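(* Let $\Omega\subseteq\mathbb{Q}_p^n$ be a nonempty, bounded, open, Jordan measurable set (i.e. $|\partial\Omega|=0$). (1) The Dirichlet operator satisfies Weyl's law: $$N_{D_{\Omega,\mathcal{D}}^{\alpha}}(\lambda)\sim|\Omega|\,p^{n[\frac{1}{\alpha}\log_p\lambda]},\qquad \lambda\to+\infty,$$ i.e. the ratio of the two sides tends to $1$. (2) Write $\Omega=\bigsqcup_{i}B_{L_i}(\boldsymbol a_i)$ as the disjoint union of its maximal balls and let $$\Gamma_i=\frac{p^\alpha-1}{1-p^{-\alpha-n}}\int_{\Omega^c}\frac{d\boldsymbol y}{\|\boldsymbol x-\boldsymbol y\|_p^{n+\alpha}},\qquad \boldsymbol x\in B_{L_i}(\boldsymbol a_i)$$ (the value does not depend on the choice of $\boldsymbol x\in B_{L_i}(\boldsymbol a_i)$). Suppose $\Gamma_{\max}:=\sup_{i}\Gamma_i<+\infty$ and define $E=\bigcup_{j=1}^{\infty}[p^{\alpha j}-\Gamma_{\max},p^{\alpha j})$. Then $$\lim_{\substack{\lambda\to+\infty\\ \lambda\notin E}}\frac{N_{D_{\Omega,\mathcal{N}}^{\alpha}}(\lambda)}{|\Omega|\,p^{n[\frac{1}{\alpha}\log_p\lambda]}}=1,\qquad \lim_{R\to\infty}\frac{|E\cap[0,R]|}{R}=0,$$ where in the last formula $|\cdot|$ is Lebesgue measure on $\mathbb{R}$. Thus the Neumann operator satisfies Weyl's law outside an exceptional set $E$ of zero Lebesgue asymptotic density.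
   Context: Fix a prime $p$, an integer $n\ge1$ and a real $\alpha>0$. On $\mathbb{Q}_p^n$ put $\|\boldsymbol x\|_p=\max_i|x_i|_p$; $d\boldsymbol x$ is the Haar measure with $|\mathbb{Z}_p^n|=1$, and $|A|$ denotes the measure of $A\subseteq\mathbb{Q}_p^n$. Balls are $B_L(\boldsymbol a)=\boldsymbol a+p^L\mathbb{Z}_p^n$, $L\in\mathbb{Z}$. $\Omega^c=\mathbb{Q}_p^n\setminus\Omega$. A maximal ball of $\Omega$ is a ball $B_L(\boldsymbol a)\subseteq\Omega$ with $B_{L-1}(\boldsymbol a)\not\subseteq\Omega$; a bounded open set is the disjoint union of its (countably many) maximal balls. $[x]$ is the integer part (floor) of $x$. Fourier transform: $\hat f(\boldsymbol\xi)=\int_{\mathbb{Q}_p^n}f(\boldsymbol x)\chi_p(\boldsymbol\xi\cdot\boldsymbol x)d\boldsymbol x$ with $\chi_p(x)=e^{2\pi i\{x\}_p}$, $\{x\}_p$ the $p$-adic fractional part, extended to $L^2$. For $s\ge0$, $H^s(\mathbb{Q}_p^n)$ is the space of $f$ with $\|f\|_{H^s}^2=\int\max\{1,\|\boldsymbol\xi\|_p\}^{2s}|\hat f(\boldsymbol\xi)|^2d\boldsymbol\xi<\infty$. $\mathcal{S}(\Omega)$ is the space of locally constant compactly supported functions on $\mathbb{Q}_p^n$ with support in $\Omega$, and $H_0^s(\Omega)$ is the closure of $\mathcal{S}(\Omega)$ in $H^s(\mathbb{Q}_p^n)$ (its elements vanish a.e. on $\Omega^c$ and are identified with functions on $\Omega$).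 Dirichlet operator: $D_{\Omega,\mathcal{D}}^{\alpha}$ is the nonnegative self-adjoint operator in $L^2(\Omega)$ associated with the closed form $\mathcal{E}_{\Omega,\mathcal{D}}(u,v)=\int_{\mathbb{Q}_p^n}\|\boldsymbol\xi\|_p^{\alpha}\hat u(\boldsymbol\xi)\overline{\hat v(\boldsymbol\xi)}d\boldsymbol\xi$ (with $u,v$ extended by zero) with domain $H_0^{\alpha/2}(\Omega)$. Neumann operator: $D_{\Omega,\mathcal{N}}^{\alpha}$ is the nonnegative self-adjoint operator in $L^2(\Omega)$ associated with the closed form $$\mathcal{E}_{\Omega,\mathcal{N}}(u,v)=\frac12\frac{p^\alpha-1}{1-p^{-\alpha-n}}\iint_{\Omega\times\Omega}\frac{(u(\boldsymbol x)-u(\boldsymbol y))\overline{(v(\boldsymbol x)-v(\boldsymbol y))}}{\|\boldsymbol x-\boldsymbol y\|_p^{\alpha+n}}d\boldsymbol xd\boldsymbol y,$$ whose domain $H^{\alpha/2}(\Omega)$ is the set of $u\in L^2(\Omega)$ for which $\mathcal{E}_{\Omega,\mathcal{N}}(u,u)<\infty$. For a self-adjoint operator $A$, $N_A(\lambda)$ is the number of eigenvalues of $A$ that are $\le\lambda$, counted with multiplicity. *)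

theory Defs
  imports "HOL-Analysis.Analysis" "Berlekamp_Zassenhaus.Finite_Field"
begin

section \<open>The field of p-adic numbers\<close>

text \<open>
  The field of p-adic numbers is constructed as the completion of the rationals with respect to
  the p-adic absolute value, following the construction of the reals in
  \<^theory>\<open>HOL.Real\<close>. The prime is the cardinality of a type of class
  \<^class>\<open>prime_card\<close>.
\<close>

definition padic_val :: "nat \<Rightarrow> rat \<Rightarrow> int" where
  "padic_val p q =
     int (multiplicity (int p) (fst (quotient_of q))) - int (multiplicity (int p) (snd (quotient_of q)))"

definition padic_abs :: "nat \<Rightarrow> rat \<Rightarrow> real" where
  "padic_abs p q = (if q = 0 then 0 else real p powi (- padic_val p q))"

definition padic_cauchy :: "nat \<Rightarrow> (nat \<Rightarrow> rat) \<Rightarrow> bool" where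
  "padic_cauchy p X \<longleftrightarrow> (\<forall>e>0. \<exists>k. \<forall>m\<ge>k. \<forall>n\<ge>k. padic_abs p (X m - X n) < e)"

definition padic_null :: "nat \<Rightarrow> (nat \<Rightarrow> rat) \<Rightarrow> bool" where
  "padic_null p X \<longleftrightarrow> (\<lambda>n. padic_abs p (X n)) \<longlonglongrightarrow> 0"

definition padic_rel :: "nat \<Rightarrow> (nat \<Rightarrow> rat) \<Rightarrow> (nat \<Rightarrow> rat) \<Rightarrow> bool" where
  "padic_rel p X Y \<longleftrightarrow> padic_cauchy p X \<and> padic_cauchy p Y \<and> padic_null p (\<lambda>n. X n - Y n)"

context
  fixes p :: nat
  assumes p: "prime p"
begin

lemma padic_prime_elem: "prime_elem (int p)"
  using p by simp

lemma padic_val_fract: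
  assumes "a \<noteq> 0" "b \<noteq> 0"
  shows "padic_val p (of_int a / of_int b) = int (multiplicity (int p) a) - int (multiplicity (int p) b)"
proof -
  obtain c d where cd: "quotient_of (of_int a / of_int b) = (c, d)" by fastforce
  have d: "d > 0" using cd quotient_of_denom_pos by blast
  have eq: "(of_int a / of_int b :: rat) = of_int c / of_int d"
    using cd quotient_of_div by blast
  then have "(of_int (a * d) :: rat) = of_int (c * b)"
    using assms d by (simp add: field_simps)
  then have *: "a * d = c * b" by (simp only: of_int_eq_iff)
  then have c: "c \<noteq> 0" using assms d by auto
  have "multiplicity (int p) (a * d) = multiplicity (int p) (c * b)" using * by simp
  then have "multiplicity (int p) a + multiplicity (int p) d = multiplicity (int p) c + multiplicity (int p) b"
    using assms c d padic_prime_elem by (simp add: prime_elem_multiplicity_mult_distrib)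
  then show ?thesis unfolding padic_val_def cd by simp
qed

lemma padic_abs_fract:
  assumes "a \<noteq> 0" "b \<noteq> 0"
  shows "padic_abs p (of_int a / of_int b) =
    real p powi (int (multiplicity (int p) b) - int (multiplicity (int p) a))"
  using assms by (simp add: padic_abs_def padic_val_fract)

lemma padic_abs_zero [simp]: "padic_abs p 0 = 0"
  by (simp add: padic_abs_def)

lemma padic_p_pos [simp]: "0 < p" "1 < p"
  using p prime_gt_0_nat prime_gt_1_nat by auto

lemma padic_abs_eq_0_iff [simp]: "padic_abs p q = 0 \<longleftrightarrow> q = 0"
  by (auto simp: padic_abs_def)

lemma padic_abs_nonneg [simp]: "0 \<le> padic_abs p q"
  by (auto simp: padic_abs_def)

lemma padic_abs_pos_iff [simp]: "0 < padic_abs p q \<longleftrightarrow> q \<noteq> 0"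
  using padic_abs_nonneg[of q] padic_abs_eq_0_iff[of q] by linarith

lemma rat_fractE:
  fixes x :: rat
  obtains a b where "b \<noteq> 0" "x = of_int a / of_int b"
proof -
  obtain a b where "quotient_of x = (a, b)" by fastforce
  then show ?thesis using that[of b a] quotient_of_div[of x a b] quotient_of_denom_pos[of x a b] by auto
qed

lemma padic_abs_mult [simp]: "padic_abs p (x * y) = padic_abs p x * padic_abs p y"
proof (cases "x = 0 \<or> y = 0")
  case False
  obtain a b where ab: "b \<noteq> 0" "x = of_int a / of_int b" by (rule rat_fractE)
  obtain c d where cd: "d \<noteq> 0" "y = of_int c / of_int d" by (rule rat_fractE)
  have nz: "a \<noteq> 0" "c \<noteq> 0" using False ab cd by auto
  have "x * y = of_int (a * c) / of_int (b * d)" using ab cd by simp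
  then show ?thesis
    unfolding ab(2) cd(2) using nz ab(1) cd(1) padic_prime_elem
    by (simp add: padic_abs_fract prime_elem_multiplicity_mult_distrib flip: of_int_mult power_int_add)
       (simp add: algebra_simps)
qed auto

lemma padic_abs_one [simp]: "padic_abs p 1 = 1"
  using padic_abs_fract[of 1 1] by simp

lemma padic_abs_inverse: "padic_abs p (inverse x) = inverse (padic_abs p x)"
proof (cases "x = 0")
  case False
  then have "padic_abs p (inverse x) * padic_abs p x = 1"
    by (simp flip: padic_abs_mult)
  then show ?thesis by (metis inverse_unique mult.commute)
qed simp

lemma padic_abs_minus [simp]: "padic_abs p (- x) = padic_abs p x"
proof -
  have "(padic_abs p (-1))\<^sup>2 = 1"
    by (simp add: power2_eq_square flip: padic_abs_mult)
  then have "padic_abs p (-1) = 1"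
    using padic_abs_nonneg[of "-1"] by (auto simp: power2_eq_1_iff)
  then show ?thesis using padic_abs_mult[of "-1" x] by simp
qed

lemma padic_abs_commute: "padic_abs p (x - y) = padic_abs p (y - x)"
  using padic_abs_minus[of "x - y"] by simp

lemma padic_abs_ultra: "padic_abs p (x + y) \<le> max (padic_abs p x) (padic_abs p y)"
proof (cases "x = 0 \<or> y = 0 \<or> x + y = 0")
  case False
  obtain a b where ab: "b \<noteq> 0" "x = of_int a / of_int b" by (rule rat_fractE)
  obtain c d where cd: "d \<noteq> 0" "y = of_int c / of_int d" by (rule rat_fractE)
  define u v w where "u = a * d" and "v = c * b" and "w = b * d"
  have x: "x = of_int u / of_int w" and y: "y = of_int v / of_int w"
    and xy: "x + y = of_int (u + v) / of_int w"
    using ab cd by (simp_all add: u_def v_def w_def field_simps)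
  have nz: "u \<noteq> 0" "v \<noteq> 0" "w \<noteq> 0" "u + v \<noteq> 0"
    using False x y xy by auto
  have nu: "\<not> is_unit (int p)" using padic_prime_elem by auto
  define k where "k = min (multiplicity (int p) u) (multiplicity (int p) v)"
  have "int p ^ k dvd u" "int p ^ k dvd v"
    by (auto simp: k_def intro!: multiplicity_dvd')
  then have "int p ^ k dvd u + v" by simp
  then have "k \<le> multiplicity (int p) (u + v)"
    using nz(4) nu by (intro multiplicity_geI) auto
  then have *: "real p powi (int (multiplicity (int p) w) - int (multiplicity (int p) (u + v)))
     \<le> real p powi (int (multiplicity (int p) w) - int k)"
    using padic_p_pos by (intro power_int_increasing) auto
  show ?thesis
    unfolding xy unfolding x y padic_abs_fract[OF nz(4,3)] padic_abs_fract[OF nz(1,3)] padic_abs_fract[OF nz(2,3)]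
    using * by (auto simp: k_def min_def max_def split: if_splits)
qed (auto simp: max_def)

lemma padic_abs_triangle: "padic_abs p (x + y) \<le> padic_abs p x + padic_abs p y"
  using padic_abs_ultra[of x y] padic_abs_nonneg[of x] padic_abs_nonneg[of y]
  by (smt (verit))

lemma padic_abs_diff_triangle: "\<bar>padic_abs p x - padic_abs p y\<bar> \<le> padic_abs p (x - y)"
  using padic_abs_triangle[of "x - y" y] padic_abs_triangle[of "y - x" x] padic_abs_commute[of x y]
  by simp

lemma padic_cauchy_const [simp]: "padic_cauchy p (\<lambda>_. c)"
  by (simp add: padic_cauchy_def)

lemma padic_null_const [simp]: "padic_null p (\<lambda>_. c) \<longleftrightarrow> c = 0"
  by (simp add: padic_null_def LIMSEQ_const_iff)

lemma padic_null_add: "padic_null p X \<Longrightarrow> padic_null p Y \<Longrightarrow> padic_null p (\<lambda>n. X n + Y n)"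
  unfolding padic_null_def
  by (rule Lim_null_comparison[where g = "\<lambda>n. padic_abs p (X n) + padic_abs p (Y n)"])
     (auto simp: padic_abs_triangle intro: tendsto_add_zero)

lemma padic_null_minus: "padic_null p X \<Longrightarrow> padic_null p (\<lambda>n. - X n)"
  by (simp add: padic_null_def)

lemma padic_null_diff: "padic_null p X \<Longrightarrow> padic_null p Y \<Longrightarrow> padic_null p (\<lambda>n. X n - Y n)"
  using padic_null_add[of X "\<lambda>n. - Y n"] padic_null_minus[of Y] by simp

lemma padic_cauchy_add: 
  assumes "padic_cauchy p X" "padic_cauchy p Y"
  shows "padic_cauchy p (\<lambda>n. X n + Y n)"
  unfolding padic_cauchy_def
proof safe
  fix e :: real assume e: "e > 0"
  obtain k where k: "\<And>m n. m \<ge> k \<Longrightarrow> n \<ge> k \<Longrightarrow> padic_abs p (X m - X n) < e"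
    using assms(1) e unfolding padic_cauchy_def by blast
  obtain l where l: "\<And>m n. m \<ge> l \<Longrightarrow> n \<ge> l \<Longrightarrow> padic_abs p (Y m - Y n) < e"
    using assms(2) e unfolding padic_cauchy_def by blast
  have "padic_abs p (X m + Y m - (X n + Y n)) < e" if "m \<ge> max k l" "n \<ge> max k l" for m n
    using padic_abs_ultra[of "X m - X n" "Y m - Y n"] k[of m n] l[of m n] that
    by (simp add: algebra_simps max_def split: if_splits)
  then show "\<exists>k. \<forall>m\<ge>k. \<forall>n\<ge>k. padic_abs p (X m + Y m - (X n + Y n)) < e" by blast
qed

lemma padic_cauchy_minus: "padic_cauchy p X \<Longrightarrow> padic_cauchy p (\<lambda>n. - X n)"
  unfolding padic_cauchy_def using padic_abs_commute by simp

lemma padic_cauchy_diff: "padic_cauchy p X \<Longrightarrow> padic_cauchy p Y \<Longrightarrow> padic_cauchy p (\<lambda>n. X n - Y n)"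
  using padic_cauchy_add[of X "\<lambda>n. - Y n"] padic_cauchy_minus[of Y] by simp

lemma padic_cauchy_convergent:
  assumes "padic_cauchy p X"
  shows "convergent (\<lambda>n. padic_abs p (X n))"
proof -
  have "Cauchy (\<lambda>n. padic_abs p (X n))"
    unfolding Cauchy_def dist_real_def
    using assms padic_abs_diff_triangle unfolding padic_cauchy_def
    by (meson le_less_trans)
  then show ?thesis by (simp add: Cauchy_convergent_iff)
qed

lemma padic_cauchy_lim:
  "padic_cauchy p X \<Longrightarrow> (\<lambda>n. padic_abs p (X n)) \<longlonglongrightarrow> lim (\<lambda>n. padic_abs p (X n))"
  using padic_cauchy_convergent convergent_LIMSEQ_iff by blast

lemma padic_cauchy_bounded:
  assumes "padic_cauchy p X"
  obtains B where "B > 0" "\<And>n. padic_abs p (X n) < B"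
proof -
  have "Bseq (\<lambda>n. padic_abs p (X n))"
    using padic_cauchy_convergent[OF assms] by (rule convergent_imp_Bseq)
  then obtain B where "B > 0" "\<And>n. norm (padic_abs p (X n)) \<le> B" by (auto elim: BseqE)
  then show ?thesis using that[of "B + 1"] by (force intro: le_less_trans)
qed

lemma padic_cauchy_mult:
  assumes X: "padic_cauchy p X" and Y: "padic_cauchy p Y"
  shows "padic_cauchy p (\<lambda>n. X n * Y n)"
  unfolding padic_cauchy_def
proof safe
  fix e :: real assume e: "e > 0"
  obtain A where A: "A > 0" "\<And>n. padic_abs p (X n) < A" using X by (rule padic_cauchy_bounded) blast
  obtain B where B: "B > 0" "\<And>n. padic_abs p (Y n) < B" using Y by (rule padic_cauchy_bounded) blast
  obtain k where k: "\<And>m n. m \<ge> k \<Longrightarrow> n \<ge> k \<Longrightarrow> padic_abs p (X m - X n) < e / B"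
    using X e B unfolding padic_cauchy_def by (meson divide_pos_pos)
  obtain l where l: "\<And>m n. m \<ge> l \<Longrightarrow> n \<ge> l \<Longrightarrow> padic_abs p (Y m - Y n) < e / A"
    using Y e A unfolding padic_cauchy_def by (meson divide_pos_pos)
  have "padic_abs p (X m * Y m - X n * Y n) < e" if "m \<ge> max k l" "n \<ge> max k l" for m n
  proof -
    have "padic_abs p (X m) * padic_abs p (Y m - Y n) < A * (e / A)"
      using A l[of m n] that by (intro mult_strict_mono) auto
    moreover have "padic_abs p (X m - X n) * padic_abs p (Y n) < e / B * B"
      using B k[of m n] that e by (intro mult_strict_mono) auto
    moreover have "X m * Y m - X n * Y n = X m * (Y m - Y n) + (X m - X n) * Y n"
      by (simp add: algebra_simps)
    ultimately show ?thesis
      using A(1) B(1) padic_abs_ultra[of "X m * (Y m - Y n)" "(X m - X n) * Y n"]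
      by (auto simp: max_def split: if_splits)
  qed
  then show "\<exists>k. \<forall>m\<ge>k. \<forall>n\<ge>k. padic_abs p (X m * Y m - X n * Y n) < e" by blast
qed

lemma padic_null_mult:
  assumes X: "padic_cauchy p X" and Y: "padic_null p Y"
  shows "padic_null p (\<lambda>n. X n * Y n)"
  using tendsto_mult[OF padic_cauchy_lim[OF X] Y[unfolded padic_null_def]]
  by (simp add: padic_null_def)

lemma padic_null_iff_lim:
  "padic_cauchy p X \<Longrightarrow> padic_null p X \<longleftrightarrow> lim (\<lambda>n. padic_abs p (X n)) = 0"
  unfolding padic_null_def using padic_cauchy_lim limI by metis

lemma padic_cauchy_not_null:
  assumes X: "padic_cauchy p X" and nz: "\<not> padic_null p X"
  obtains b k where "b > 0" "\<And>n. n \<ge> k \<Longrightarrow> b < padic_abs p (X n)"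
proof -
  let ?l = "lim (\<lambda>n. padic_abs p (X n))"
  have "0 \<le> ?l"
    using padic_cauchy_lim[OF X] by (rule LIMSEQ_le_const) auto
  then have l: "?l > 0" using nz padic_null_iff_lim[OF X] by simp
  have "eventually (\<lambda>n. ?l / 2 < padic_abs p (X n)) sequentially"
    by (rule order_tendstoD(1)[OF padic_cauchy_lim[OF X]]) (use l in simp)
  then show ?thesis using that[of "?l / 2"] l by (auto simp: eventually_sequentially)
qed

lemma padic_cauchy_inverse:
  assumes X: "padic_cauchy p X" and nz: "\<not> padic_null p X"
  shows "padic_cauchy p (\<lambda>n. inverse (X n))"
  unfolding padic_cauchy_def
proof safe
  fix e :: real assume e: "e > 0"
  obtain b k where b: "b > 0" "\<And>n. n \<ge> k \<Longrightarrow> b < padic_abs p (X n)"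
    using padic_cauchy_not_null[OF X nz] by blast
  obtain l where l: "\<And>m n. m \<ge> l \<Longrightarrow> n \<ge> l \<Longrightarrow> padic_abs p (X m - X n) < b * e * b"
    using X e b unfolding padic_cauchy_def by (meson mult_pos_pos)
  have "padic_abs p (inverse (X m) - inverse (X n)) < e" if "m \<ge> max k l" "n \<ge> max k l" for m n
  proof -
    have bm: "b < padic_abs p (X m)" and bn: "b < padic_abs p (X n)" using b(2) that by auto
    then have nz: "X m \<noteq> 0" "X n \<noteq> 0" using b(1) by auto
    have pos: "0 < padic_abs p (X m) * e" using nz e by simp
    have "b * e < padic_abs p (X m) * e" using bm e by simp
    then have "b * e * b < padic_abs p (X m) * e * padic_abs p (X n)"
      by (rule mult_strict_mono[OF _ bn pos]) (use b(1) in simp)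
    then have *: "padic_abs p (X n - X m) < padic_abs p (X m) * e * padic_abs p (X n)"
      using l[of n m] that by auto
    have "inverse (X m) - inverse (X n) = (X n - X m) * inverse (X m) * inverse (X n)"
      using nz by (simp add: field_simps)
    then have "padic_abs p (inverse (X m) - inverse (X n)) =
        padic_abs p (X n - X m) / (padic_abs p (X m) * padic_abs p (X n))"
      by (simp add: padic_abs_inverse divide_inverse)
    also have "\<dots> < e" using * nz by (simp add: field_simps)
    finally show ?thesis .
  qed
  then show "\<exists>k. \<forall>m\<ge>k. \<forall>n\<ge>k. padic_abs p (inverse (X m) - inverse (X n)) < e" by blast
qed

lemma padic_rel_null_iff:
  assumes "padic_rel p X Y"
  shows "padic_null p X \<longleftrightarrow> padic_null p Y"
proof -
  have d: "padic_null p (\<lambda>n. X n - Y n)" using assms by (simp add: padic_rel_def)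
  show ?thesis
    using padic_null_diff[OF _ d, of X] padic_null_add[OF _ d, of Y] by auto
qed

lemma padic_rel_inverse:
  assumes XY: "padic_rel p X Y" and nX: "\<not> padic_null p X"
  shows "padic_rel p (\<lambda>n. inverse (X n)) (\<lambda>n. inverse (Y n))"
proof -
  have X: "padic_cauchy p X" and Y: "padic_cauchy p Y" and d: "padic_null p (\<lambda>n. X n - Y n)"
    using XY by (auto simp: padic_rel_def)
  have nY: "\<not> padic_null p Y" using padic_rel_null_iff[OF XY] nX by simp
  obtain b k where b: "b > 0" "\<And>n. n \<ge> k \<Longrightarrow> b < padic_abs p (X n)"
    using padic_cauchy_not_null[OF X nX] by blast
  obtain c l where c: "c > 0" "\<And>n. n \<ge> l \<Longrightarrow> c < padic_abs p (Y n)"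
    using padic_cauchy_not_null[OF Y nY] by blast
  have iX: "padic_cauchy p (\<lambda>n. inverse (X n))" and iY: "padic_cauchy p (\<lambda>n. inverse (Y n))"
    using padic_cauchy_inverse X Y nX nY by auto
  have "padic_null p (\<lambda>n. (inverse (X n) * inverse (Y n)) * (X n - Y n))"
    by (intro padic_null_mult padic_cauchy_mult iX iY d)
  moreover have "eventually (\<lambda>n. padic_abs p ((inverse (X n) * inverse (Y n)) * (X n - Y n))
      = padic_abs p (inverse (X n) - inverse (Y n))) sequentially"
    unfolding eventually_sequentially
  proof (intro exI[of _ "max k l"] allI impI)
    fix n assume "max k l \<le> n"
    then have "X n \<noteq> 0" "Y n \<noteq> 0" using b c by fastforce+
    then have "(inverse (X n) * inverse (Y n)) * (X n - Y n) = - (inverse (X n) - inverse (Y n))"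
      by (simp add: field_simps)
    then show "padic_abs p ((inverse (X n) * inverse (Y n)) * (X n - Y n))
      = padic_abs p (inverse (X n) - inverse (Y n))" by (simp only: padic_abs_minus)
  qed
  ultimately have "padic_null p (\<lambda>n. inverse (X n) - inverse (Y n))"
    unfolding padic_null_def by (simp add: filterlim_cong)
  then show ?thesis using iX iY by (simp add: padic_rel_def)
qed

lemma padic_rel_refl: "padic_cauchy p X \<Longrightarrow> padic_rel p X X"
  by (simp add: padic_rel_def)

lemma part_equivp_padic_rel: "part_equivp (padic_rel p)"
proof (rule part_equivpI)
  show "\<exists>x. padic_rel p x x" using padic_rel_refl padic_cauchy_const by blast
  show "symp (padic_rel p)"
    by (auto simp: symp_def padic_rel_def padic_null_def padic_abs_commute)
  show "transp (padic_rel p)"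
  proof (rule transpI)
    fix X Y Z assume "padic_rel p X Y" "padic_rel p Y Z"
    then show "padic_rel p X Z"
      using padic_null_add[of "\<lambda>n. X n - Y n" "\<lambda>n. Y n - Z n"] by (auto simp: padic_rel_def)
  qed
qed

lemma padic_rel_mult:
  assumes "padic_rel p X X'" "padic_rel p Y Y'"
  shows "padic_rel p (\<lambda>n. X n * Y n) (\<lambda>n. X' n * Y' n)"
proof -
  have "padic_null p (\<lambda>n. X n * (Y n - Y' n) + Y' n * (X n - X' n))"
    using assms unfolding padic_rel_def by (intro padic_null_add padic_null_mult) auto
  then show ?thesis
    using assms by (auto simp: padic_rel_def padic_cauchy_mult algebra_simps)
qed

lemma padic_rel_add:
  assumes "padic_rel p X X'" "padic_rel p Y Y'"
  shows "padic_rel p (\<lambda>n. X n + Y n) (\<lambda>n. X' n + Y' n)"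
  using assms padic_null_add[of "\<lambda>n. X n - X' n" "\<lambda>n. Y n - Y' n"]
  by (auto simp: padic_rel_def padic_cauchy_add algebra_simps)

lemma padic_rel_minus:
  assumes "padic_rel p X X'"
  shows "padic_rel p (\<lambda>n. - X n) (\<lambda>n. - X' n)"
  using assms padic_null_minus[of "\<lambda>n. X n - X' n"]
  by (auto simp: padic_rel_def padic_cauchy_minus algebra_simps)

lemma padic_rel_lim:
  assumes "padic_rel p X Y"
  shows "lim (\<lambda>n. padic_abs p (X n)) = lim (\<lambda>n. padic_abs p (Y n))"
proof -
  have X: "padic_cauchy p X" and Y: "padic_cauchy p Y" and d: "padic_null p (\<lambda>n. X n - Y n)"
    using assms by (auto simp: padic_rel_def)
  have "(\<lambda>n. padic_abs p (X n) - padic_abs p (Y n)) \<longlonglongrightarrow> 0"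
    by (rule Lim_null_comparison[OF _ d[unfolded padic_null_def]])
       (simp add: padic_abs_diff_triangle)
  moreover have "(\<lambda>n. padic_abs p (X n) - padic_abs p (Y n)) \<longlonglongrightarrow>
      lim (\<lambda>n. padic_abs p (X n)) - lim (\<lambda>n. padic_abs p (Y n))"
    by (intro tendsto_diff padic_cauchy_lim X Y)
  ultimately show ?thesis using LIMSEQ_unique by fastforce
qed

end

typedef (overloaded) ('p::prime_card) padic =
  "{C. \<exists>X. padic_rel CARD('p) X X \<and> C = {Y. padic_rel CARD('p) X Y}}"
  using padic_rel_refl[OF prime_card] padic_cauchy_const[OF prime_card] by blast

definition padic_of_seq :: "(nat \<Rightarrow> rat) \<Rightarrow> 'p::prime_card padic" where
  "padic_of_seq X = Abs_padic {Y. padic_rel CARD('p) X Y}"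

definition seq_of_padic :: "'p::prime_card padic \<Rightarrow> nat \<Rightarrow> rat" where
  "seq_of_padic x = (SOME X. X \<in> Rep_padic x)"

definition cr_padic :: "(nat \<Rightarrow> rat) \<Rightarrow> 'p::prime_card padic \<Rightarrow> bool" where
  "cr_padic = (\<lambda>X x. padic_rel CARD('p) X X \<and> padic_of_seq X = x)"

lemma Quotient_padic:
  "Quotient (padic_rel CARD('p)) (padic_of_seq :: _ \<Rightarrow> 'p::prime_card padic) seq_of_padic cr_padic"
proof -
  interpret quot_type "padic_rel CARD('p)" "Abs_padic :: _ \<Rightarrow> 'p padic" Rep_padic
  proof
    show "part_equivp (padic_rel CARD('p))" by (rule part_equivp_padic_rel[OF prime_card])
    show "\<exists>x. padic_rel CARD('p) x x \<and> Rep_padic y = Collect (padic_rel CARD('p) x)"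
      for y :: "'p padic" using Rep_padic[of y] by auto
    show "Abs_padic (Rep_padic x) = x" for x :: "'p padic" by (rule Rep_padic_inverse)
    show "Rep_padic (Abs_padic c :: 'p padic) = c"
      if "\<exists>x. padic_rel CARD('p) x x \<and> c = Collect (padic_rel CARD('p) x)" for c
      using that by (intro Abs_padic_inverse) auto
    show "(Rep_padic x = Rep_padic y) = (x = y)" for x y :: "'p padic" by (rule Rep_padic_inject)
  qed
  have "abs = (padic_of_seq :: _ \<Rightarrow> 'p padic)"
    by (simp add: fun_eq_iff abs_def padic_of_seq_def)
  moreover have "rep = (seq_of_padic :: 'p padic \<Rightarrow> _)"
    by (simp add: fun_eq_iff rep_def seq_of_padic_def)
  ultimately have "Quotient3 (padic_rel CARD('p)) (padic_of_seq :: _ \<Rightarrow> 'p padic) seq_of_padic"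
    using Quotient by simp
  then show ?thesis
    by (rule Quotient3_to_Quotient) (simp add: cr_padic_def)
qed

setup_lifting Quotient_padic

instantiation padic :: (prime_card) field
begin

lift_definition zero_padic :: "'a padic" is "\<lambda>_. 0"
  by (rule padic_rel_refl[OF prime_card padic_cauchy_const[OF prime_card]])

lift_definition one_padic :: "'a padic" is "\<lambda>_. 1"
  by (rule padic_rel_refl[OF prime_card padic_cauchy_const[OF prime_card]])

lift_definition plus_padic :: "'a padic \<Rightarrow> 'a padic \<Rightarrow> 'a padic" is "\<lambda>X Y n. X n + Y n"
  by (rule padic_rel_add[OF prime_card])

lift_definition uminus_padic :: "'a padic \<Rightarrow> 'a padic" is "\<lambda>X n. - X n"
  by (rule padic_rel_minus[OF prime_card])

lift_definition times_padic :: "'a padic \<Rightarrow> 'a padic \<Rightarrow> 'a padic" is "\<lambda>X Y n. X n * Y n"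
  by (rule padic_rel_mult[OF prime_card])

lift_definition inverse_padic :: "'a padic \<Rightarrow> 'a padic"
  is "\<lambda>X. if padic_null CARD('a) X then (\<lambda>_. 0) else (\<lambda>n. inverse (X n))"
  by (auto simp: padic_rel_null_iff[OF prime_card] padic_rel_inverse[OF prime_card]
    padic_rel_refl[OF prime_card padic_cauchy_const[OF prime_card]])

definition "x - y = x + - y" for x y :: "'a padic"

definition "x div y = x * inverse y" for x y :: "'a padic"

instance
proof
  note [simp] = padic_rel_def padic_cauchy_add[OF prime_card] padic_cauchy_mult[OF prime_card]
    padic_cauchy_minus[OF prime_card] padic_null_const[OF prime_card] padic_cauchy_const[OF prime_card]
  fix a b c :: "'a padic"
  show "a + b = b + a" by transfer (simp add: ac_simps)
  show "(a + b) + c = a + (b + c)" by transfer (simp add: ac_simps)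
  show "0 + a = a" by transfer simp
  show "- a + a = 0" by transfer simp
  show "a - b = a + - b" by (rule minus_padic_def)
  show "(a * b) * c = a * (b * c)" by transfer (simp add: ac_simps)
  show "a * b = b * a" by transfer (simp add: ac_simps)
  show "1 * a = a" by transfer simp
  show "(a + b) * c = a * c + b * c" by transfer (simp add: distrib_right)
  show "(0::'a padic) \<noteq> 1" by transfer simp
  show "inverse a * a = 1" if "a \<noteq> 0"
    using that
  proof transfer
    fix X assume "padic_rel CARD('a) X X" "\<not> padic_rel CARD('a) X (\<lambda>_. 0)"
    then have X: "padic_cauchy CARD('a) X" and nz: "\<not> padic_null CARD('a) X" by auto
    obtain b k where b: "b > 0" "\<And>n. n \<ge> k \<Longrightarrow> b < padic_abs CARD('a) (X n)"
      using padic_cauchy_not_null[OF prime_card X nz] by blast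
    have "padic_null CARD('a) (\<lambda>n. inverse (X n) * X n - 1)"
      unfolding padic_null_def
    proof (rule tendsto_eventually, unfold eventually_sequentially, intro exI[of _ k] allI impI)
      fix n assume "k \<le> n"
      then have "X n \<noteq> 0" using b by (force simp: padic_abs_zero[OF prime_card])
      then show "padic_abs CARD('a) (inverse (X n) * X n - 1) = 0"
        by (simp add: padic_abs_zero[OF prime_card])
    qed
    then show "padic_rel CARD('a)
        (\<lambda>n. (if padic_null CARD('a) X then \<lambda>_. 0 else (\<lambda>n. inverse (X n))) n * X n) (\<lambda>_. 1)"
      using X nz padic_cauchy_inverse[OF prime_card X nz] by simp
  qed
  show "a div b = a * inverse b" by (rule divide_padic_def)
  show "inverse (0::'a padic) = 0" by transfer simp
qed

end

lift_definition padic_norm :: "'p::prime_card padic \<Rightarrow> real"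
  is "\<lambda>X. lim (\<lambda>n. padic_abs CARD('p) (X n))"
  by (rule padic_rel_lim[OF prime_card])

lemma padic_norm_nonneg [simp]: "0 \<le> padic_norm x"
proof transfer
  fix X assume "padic_rel CARD('a) X X"
  then have "padic_cauchy CARD('a) X" by (simp add: padic_rel_def)
  from padic_cauchy_lim[OF prime_card this] show "0 \<le> lim (\<lambda>n. padic_abs CARD('a) (X n))"
    by (rule LIMSEQ_le_const) (auto simp: padic_abs_nonneg[OF prime_card])
qed

lemma padic_norm_eq_0_iff [simp]: "padic_norm x = 0 \<longleftrightarrow> x = 0"
  by transfer (auto simp: padic_rel_def padic_null_iff_lim[OF prime_card] padic_cauchy_const[OF prime_card])

lemma padic_norm_mult: "padic_norm (x * y) = padic_norm x * padic_norm y"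
proof transfer
  fix X Y assume "padic_rel CARD('a) X X" "padic_rel CARD('a) Y Y"
  then have "padic_cauchy CARD('a) X" "padic_cauchy CARD('a) Y" by (auto simp: padic_rel_def)
  then show "lim (\<lambda>n. padic_abs CARD('a) (X n * Y n)) =
      lim (\<lambda>n. padic_abs CARD('a) (X n)) * lim (\<lambda>n. padic_abs CARD('a) (Y n))"
    unfolding padic_abs_mult[OF prime_card] by (intro limI tendsto_mult padic_cauchy_lim prime_card)
qed

lemma padic_norm_minus [simp]: "padic_norm (- x) = padic_norm x"
  by transfer (simp add: padic_abs_minus[OF prime_card])

lemma padic_norm_ultra: "padic_norm (x + y) \<le> max (padic_norm x) (padic_norm y)"
proof transfer
  fix X Y assume "padic_rel CARD('a) X X" "padic_rel CARD('a) Y Y"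
  then have X: "padic_cauchy CARD('a) X" and Y: "padic_cauchy CARD('a) Y" by (auto simp: padic_rel_def)
  show "lim (\<lambda>n. padic_abs CARD('a) (X n + Y n)) \<le>
      max (lim (\<lambda>n. padic_abs CARD('a) (X n))) (lim (\<lambda>n. padic_abs CARD('a) (Y n)))"
    by (rule LIMSEQ_le[OF padic_cauchy_lim[OF prime_card padic_cauchy_add[OF prime_card X Y]]
        tendsto_max[OF padic_cauchy_lim[OF prime_card X] padic_cauchy_lim[OF prime_card Y]]])
       (auto simp: padic_abs_ultra[OF prime_card])
qed

lemma padic_norm_triangle: "padic_norm (x + y) \<le> padic_norm x + padic_norm y"
  using padic_norm_ultra[of x y] padic_norm_nonneg[of x] padic_norm_nonneg[of y] by linarith

lemma cr_padic_of_nat: "cr_padic (\<lambda>_. of_nat n) (of_nat n :: 'p::prime_card padic)"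
proof (induction n)
  case 0
  have "cr_padic (\<lambda>_. 0) (0 :: 'p padic)"
    using zero_padic.transfer by (simp add: padic.pcr_cr_eq)
  then show ?case by simp
next
  case (Suc n)
  have "cr_padic (\<lambda>_. 1) (1 :: 'p padic)"
    using one_padic.transfer by (simp add: padic.pcr_cr_eq)
  moreover have "cr_padic (\<lambda>n. X n + Y n) (x + y)"
    if "cr_padic X x" "cr_padic Y y" for X Y and x y :: "'p padic"
    using that plus_padic.transfer unfolding padic.pcr_cr_eq rel_fun_def by blast
  ultimately have "cr_padic (\<lambda>_. 1 + of_nat n) (1 + of_nat n :: 'p padic)"
    using Suc by blast
  then show ?case by simp
qed

lemma padic_norm_of_nat: "padic_norm (of_nat n :: 'p::prime_card padic) = padic_abs CARD('p) (of_nat n)"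
proof -
  have "lim (\<lambda>n. padic_abs CARD('p) (X n)) = padic_norm x" if "cr_padic X x" for X and x :: "'p padic"
    using that padic_norm.transfer unfolding padic.pcr_cr_eq rel_fun_def by blast
  from this[OF cr_padic_of_nat] show ?thesis by simp
qed

instance padic :: (prime_card) field_char_0
proof (standard, rule injI)
  fix m n :: nat assume *: "(of_nat m :: 'a padic) = of_nat n"
  have "(of_nat (max m n - min m n) :: 'a padic) = 0"
    using * by (auto simp: max_def min_def of_nat_diff)
  then have "padic_abs CARD('a) (of_nat (max m n - min m n)) = 0"
    by (metis padic_norm_of_nat padic_norm_eq_0_iff)
  then show "m = n"
    by (simp add: padic_abs_eq_0_iff[OF prime_card] max_def min_def split: if_splits)
qed

lemma padic_norm_of_rat: "padic_norm (of_rat q :: 'p::prime_card padic) = padic_abs CARD('p) q"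
proof -
  obtain a b where q: "b \<noteq> 0" "q = of_int a / of_int b" by (rule rat_fractE[OF prime_card[where 'a='p]])
  have int: "padic_norm (of_int c :: 'p padic) = padic_abs CARD('p) (of_int c)" for c
  proof (cases c)
    case (nonneg n)
    then show ?thesis by (simp add: padic_norm_of_nat)
  next
    case (neg n)
    then have "c = - int (Suc n)" by simp
    then show ?thesis
      by (simp only: of_int_minus of_int_of_nat_eq padic_norm_minus padic_abs_minus[OF prime_card] padic_norm_of_nat)
  qed
  have "q * of_int b = of_int a" using q by simp
  then have "padic_norm (of_rat (q * of_int b) :: 'p padic) = padic_abs CARD('p) (q * of_int b)"
    by (simp only: of_rat_of_int_eq int)
  then show ?thesis
    using q(1) by (simp add: of_rat_mult padic_norm_mult padic_abs_mult[OF prime_card] int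
        padic_abs_eq_0_iff[OF prime_card])
qed

instantiation padic :: (prime_card) metric_space
begin

definition dist_padic :: "'a padic \<Rightarrow> 'a padic \<Rightarrow> real" where
  "dist_padic x y = padic_norm (x - y)"

definition uniformity_padic :: "('a padic \<times> 'a padic) filter" where
  "uniformity_padic = (INF e\<in>{0<..}. principal {(x, y). dist x y < e})"

definition open_padic :: "'a padic set \<Rightarrow> bool" where
  "open_padic U \<longleftrightarrow> (\<forall>x\<in>U. eventually (\<lambda>(x', y). x' = x \<longrightarrow> y \<in> U) uniformity)"

instance
proof
  fix x y z :: "'a padic"
  show "dist x y = 0 \<longleftrightarrow> x = y" by (simp add: dist_padic_def)
  have "x - y = (x - z) + - (y - z)" by simp
  then show "dist x y \<le> dist x z + dist y z"
    unfolding dist_padic_def using padic_norm_triangle[of "x - z" "- (y - z)"] padic_norm_minus[of "y - z"] by simp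
qed (simp_all add: uniformity_padic_def open_padic_def)

end

section \<open>The space of p-adic vectors\<close>

definition padic_vnorm :: "('p::prime_card padic) ^ 'n \<Rightarrow> real" where
  "padic_vnorm x = Max (range (\<lambda>i. padic_norm (x $ i)))"

definition padic_ball :: "('p::prime_card padic) ^ 'n \<Rightarrow> int \<Rightarrow> (('p padic) ^ 'n) set" where
  "padic_ball a L = {a + (of_nat CARD('p) powi L) *s z | z. padic_vnorm z \<le> 1}"

lemma padic_vnorm_le_iff: "padic_vnorm x \<le> r \<longleftrightarrow> (\<forall>i. padic_norm (x $ i) \<le> r)"
  by (simp add: padic_vnorm_def)

lemma padic_norm_p_powi:
  "padic_norm (of_nat CARD('p) powi L :: 'p::prime_card padic) = real CARD('p) powi (- L)"
proof -
  have p: "prime CARD('p)" by (rule prime_card)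
  have gt: "CARD('p) > 1" using p prime_gt_1_nat by blast
  have nz: "(of_nat CARD('p) :: 'p padic) \<noteq> 0" using gt by simp
  have one: "padic_norm (1 :: 'p padic) = 1"
    using padic_norm_of_nat[of 1, where 'p='p] padic_abs_one[OF p] by simp
  have "multiplicity (int CARD('p)) (int CARD('p)) = 1"
    using gt by (intro multiplicity_self) auto
  then have "padic_abs CARD('p) (of_int (int CARD('p)) / of_int 1) = real CARD('p) powi (- 1)"
    using gt by (subst padic_abs_fract[OF p]) auto
  then have "padic_norm (of_nat CARD('p) :: 'p padic) = inverse (real CARD('p))"
    by (simp add: padic_norm_of_nat power_int_minus)
  then have pow: "padic_norm (of_nat CARD('p) ^ n :: 'p padic) = inverse (real CARD('p)) ^ n" for n
    by (induction n) (auto simp: one padic_norm_mult)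
  have "padic_norm (inverse y) = inverse (padic_norm y)" if "y \<noteq> 0" for y :: "'p padic"
    using that one padic_norm_mult[of "inverse y" y] by (simp add: inverse_eq_divide eq_divide_eq)
  then show ?thesis
    using pow nz one by (simp add: power_int_def power_inverse)
qed

lemma mem_padic_ball_iff:
  fixes a x :: "('p::prime_card padic) ^ 'n"
  shows "x \<in> padic_ball a L \<longleftrightarrow> padic_vnorm (x - a) \<le> real CARD('p) powi (- L)"
proof
  let ?c = "of_nat CARD('p) powi L :: 'p padic"
  assume "x \<in> padic_ball a L"
  then obtain z where z: "x = a + ?c *s z" "padic_vnorm z \<le> 1"
    by (auto simp: padic_ball_def)
  show "padic_vnorm (x - a) \<le> real CARD('p) powi (- L)"
    unfolding padic_vnorm_le_iff
  proof
    fix i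
    have "padic_norm (z $ i) \<le> 1" using z(2) by (simp add: padic_vnorm_le_iff)
    then show "padic_norm ((x - a) $ i) \<le> real CARD('p) powi (- L)"
      using mult_left_mono[of "padic_norm (z $ i)" 1 "real CARD('p) powi (- L)"]
      by (simp add: z(1) padic_norm_mult padic_norm_p_powi)
  qed
next
  let ?c = "of_nat CARD('p) powi L :: 'p padic" and ?d = "of_nat CARD('p) powi (- L) :: 'p padic"
  have cd: "?c * ?d = 1" by (simp add: power_int_minus)
  assume *: "padic_vnorm (x - a) \<le> real CARD('p) powi (- L)"
  have "padic_vnorm (?d *s (x - a)) \<le> 1"
    unfolding padic_vnorm_le_iff
  proof
    fix i
    have "padic_norm ((x - a) $ i) \<le> real CARD('p) powi (- L)"
      using * by (simp only: padic_vnorm_le_iff)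
    then have "real CARD('p) powi L * padic_norm ((x - a) $ i) \<le> real CARD('p) powi L * real CARD('p) powi (- L)"
      by (intro mult_left_mono) auto
    also have "\<dots> = 1" by (simp add: power_int_minus)
    finally show "padic_norm ((?d *s (x - a)) $ i) \<le> 1"
      by (simp only: vector_smult_component padic_norm_mult padic_norm_p_powi minus_minus)
  qed
  moreover have "x = a + ?c *s (?d *s (x - a))"
    using cd by (simp add: vector_smult_assoc)
  ultimately show "x \<in> padic_ball a L" unfolding padic_ball_def by blast
qed

lemma padic_ball_small:
  assumes "e > 0"
  obtains L where "real CARD('p::prime_card) powi (- L) < e"
proof -
  have "real CARD('p) > 1" using prime_gt_1_nat[OF prime_card[where 'a='p]] by simp
  then obtain n where "inverse e < real CARD('p) ^ n" using real_arch_pow by blast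
  then have "inverse (real CARD('p) ^ n) < inverse (inverse e)"
    using assms by (intro less_imp_inverse_less) auto
  then have "real CARD('p) powi (- int n) < e"
    by (simp add: power_int_minus)
  then show ?thesis using that by blast
qed

text \<open>The topology and the bounded sets of the product metric are those of the maximum norm.\<close>

lemma open_padic_vec_iff:
  fixes S :: "(('p::prime_card padic) ^ 'n) set"
  shows "open S \<longleftrightarrow> (\<forall>a\<in>S. \<exists>L. padic_ball a L \<subseteq> S)"
proof safe
  fix a assume "open S" "a \<in> S"
  then obtain e where e: "e > 0" "\<And>y. dist y a < e \<Longrightarrow> y \<in> S" by (auto simp: open_dist)
  obtain L where L: "real CARD('p) powi (- L) < e / real CARD('n)"
    using padic_ball_small[of "e / real CARD('n)", where 'p='p] e(1) by auto
  have "padic_ball a L \<subseteq> S"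
  proof
    fix y assume "y \<in> padic_ball a L"
    then have "dist (y $ i) (a $ i) \<le> real CARD('p) powi (- L)" for i
      by (simp add: mem_padic_ball_iff padic_vnorm_le_iff dist_padic_def)
    then have "(\<Sum>i\<in>UNIV. dist (y $ i) (a $ i)) \<le> real CARD('n) * real CARD('p) powi (- L)"
      using sum_bounded_above[of UNIV "\<lambda>i. dist (y $ i) (a $ i)"] by simp
    then have "dist y a \<le> real CARD('n) * real CARD('p) powi (- L)"
      unfolding dist_vec_def using L2_set_le_sum[of UNIV "\<lambda>i. dist (y $ i) (a $ i)"] by simp
    also have "\<dots> < e" using L by (simp add: field_simps)
    finally show "y \<in> S" by (rule e(2))
  qed
  then show "\<exists>L. padic_ball a L \<subseteq> S" ..
next
  assume *: "\<forall>a\<in>S. \<exists>L. padic_ball a L \<subseteq> S"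
  show "open S"
    unfolding open_dist
  proof
    fix a assume "a \<in> S"
    then obtain L where L: "padic_ball a L \<subseteq> S" using * by blast
    have "y \<in> S" if "dist y a < real CARD('p) powi (- L)" for y
    proof -
      have "dist (y $ i) (a $ i) \<le> real CARD('p) powi (- L)" for i
        using dist_vec_nth_le[of y i a] that by linarith
      then have "y \<in> padic_ball a L"
        by (simp add: mem_padic_ball_iff padic_vnorm_le_iff dist_padic_def)
      then show ?thesis using L by blast
    qed
    then show "\<exists>e>0. \<forall>y. dist y a < e \<longrightarrow> y \<in> S"
      by (intro exI[of _ "real CARD('p) powi (- L)"]) auto
  qed
qed

lemma bounded_padic_vec_iff:
  fixes S :: "(('p::prime_card padic) ^ 'n) set"
  shows "bounded S \<longleftrightarrow> (\<exists>r. \<forall>x\<in>S. padic_vnorm x \<le> r)"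
proof
  assume "bounded S"
  then obtain r where r: "\<And>x. x \<in> S \<Longrightarrow> dist 0 x \<le> r" using iffD1[OF bounded_any_center[of S 0]] by blast
  have "padic_norm (x $ i) \<le> r" if "x \<in> S" for x i
    using dist_vec_nth_le[of 0 i x] r[OF that] by (simp add: dist_padic_def)
  then show "\<exists>r. \<forall>x\<in>S. padic_vnorm x \<le> r" by (auto simp: padic_vnorm_le_iff)
next
  assume "\<exists>r. \<forall>x\<in>S. padic_vnorm x \<le> r"
  then obtain r where r: "\<And>x i. x \<in> S \<Longrightarrow> padic_norm (x $ i) \<le> r"
    by (auto simp: padic_vnorm_le_iff)
  have "dist 0 x \<le> real CARD('n) * r" if "x \<in> S" for x
    using L2_set_le_sum[of UNIV "\<lambda>i. dist (0 $ i) (x $ i)"] r[OF that]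
      sum_bounded_above[of UNIV "\<lambda>i. dist (0 $ i) (x $ i)" r]
    by (simp add: dist_vec_def dist_padic_def)
  then show "bounded S" unfolding bounded_def by blast
qed

definition maximal_balls :: "(('p::prime_card padic) ^ 'n) set \<Rightarrow> (('p padic) ^ 'n) set set" where
  "maximal_balls \<Omega> =
     {padic_ball a L | a L. padic_ball a L \<subseteq> \<Omega> \<and> \<not> padic_ball a (L - 1) \<subseteq> \<Omega>}"

definition padic_haar :: "(('p::prime_card padic) ^ 'n) measure" where
  "padic_haar = (THE M. sets M = sets borel \<and>
     (\<forall>a. \<forall>A\<in>sets M. emeasure M ((+) a ` A) = emeasure M A) \<and>
     emeasure M {x. padic_vnorm x \<le> 1} = 1)"

section \<open>Fourier transform and Sobolev spaces\<close>

definition padic_frac :: "'p::prime_card padic \<Rightarrow> rat" where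
  "padic_frac x = (THE q. 0 \<le> q \<and> q < 1 \<and> (\<exists>(a::int) k. q = of_int a / of_nat CARD('p) ^ k) \<and>
     padic_norm (x - of_rat q) \<le> 1)"

definition padic_char :: "'p::prime_card padic \<Rightarrow> complex" where
  "padic_char x = exp (2 * of_real pi * \<i> * of_rat (padic_frac x))"

definition L2_norm_sq :: "'a measure \<Rightarrow> ('a \<Rightarrow> complex) \<Rightarrow> ennreal" where
  "L2_norm_sq M f = (\<integral>\<^sup>+x. ennreal ((cmod (f x))\<^sup>2) \<partial>M)"

definition L2_fun :: "'a measure \<Rightarrow> ('a \<Rightarrow> complex) set" where
  "L2_fun M = {f \<in> borel_measurable M. L2_norm_sq M f < \<infinity>}"

definition fourier_L1 ::
  "(('p::prime_card padic) ^ 'n \<Rightarrow> complex) \<Rightarrow> ('p padic) ^ 'n \<Rightarrow> complex" where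
  "fourier_L1 f \<xi> = (LINT x|padic_haar. f x * padic_char (\<Sum>i\<in>UNIV. \<xi> $ i * x $ i))"

text \<open>Extension by continuity from the intersection of L1 and L2; the value is one
  representative of a class that is determined almost everywhere.\<close>

definition fourier ::
  "(('p::prime_card padic) ^ 'n \<Rightarrow> complex) \<Rightarrow> ('p padic) ^ 'n \<Rightarrow> complex" where
  "fourier f = (SOME g. g \<in> L2_fun padic_haar \<and>
     (\<exists>\<phi>. (\<forall>k::nat. \<phi> k \<in> L2_fun padic_haar \<and> integrable padic_haar (\<phi> k)) \<and>
          (\<lambda>k. L2_norm_sq padic_haar (\<lambda>x. \<phi> k x - f x)) \<longlonglongrightarrow> 0 \<and>
          (\<lambda>k. L2_norm_sq padic_haar (\<lambda>\<xi>. fourier_L1 (\<phi> k) \<xi> - g \<xi>)) \<longlonglongrightarrow> 0))"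

definition sobolev_norm_sq :: "real \<Rightarrow> (('p::prime_card padic) ^ 'n \<Rightarrow> complex) \<Rightarrow> ennreal" where
  "sobolev_norm_sq s f =
     (\<integral>\<^sup>+\<xi>. ennreal (max 1 (padic_vnorm \<xi>) powr (2 * s) * (cmod (fourier f \<xi>))\<^sup>2) \<partial>padic_haar)"

definition sobolev :: "real \<Rightarrow> (('p::prime_card padic) ^ 'n \<Rightarrow> complex) set" where
  "sobolev s = {f \<in> L2_fun padic_haar. sobolev_norm_sq s f < \<infinity>}"

definition locally_constant :: "('a::topological_space \<Rightarrow> 'b) \<Rightarrow> bool" where
  "locally_constant f \<longleftrightarrow> (\<forall>x. \<exists>U. open U \<and> x \<in> U \<and> (\<forall>y\<in>U. f y = f x))"

definition test_functions :: "('a::topological_space) set \<Rightarrow> ('a \<Rightarrow> complex) set" where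
  "test_functions \<Omega> = {f. locally_constant f \<and> compact (closure {x. f x \<noteq> 0}) \<and>
     closure {x. f x \<noteq> 0} \<subseteq> \<Omega>}"

definition sobolev0 ::
  "real \<Rightarrow> (('p::prime_card padic) ^ 'n) set \<Rightarrow> (('p padic) ^ 'n \<Rightarrow> complex) set" where
  "sobolev0 s \<Omega> = {f \<in> sobolev s. \<exists>\<phi>. (\<forall>k::nat. \<phi> k \<in> test_functions \<Omega>) \<and>
     (\<lambda>k. sobolev_norm_sq s (\<lambda>x. \<phi> k x - f x)) \<longlonglongrightarrow> 0}"

section \<open>Operators associated with forms and their eigenvalues\<close>

text \<open>
  Elements of the Hilbert space are represented by functions, considered up to equality almost
  everywhere; an operator is represented by its graph. For a densely defined closed nonnegative
  form with domain \<open>D\<close> the following relation is the graph of the associated self-adjoint operator.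
\<close>

definition form_operator ::
  "'a measure \<Rightarrow> ('a \<Rightarrow> complex) set \<Rightarrow> (('a \<Rightarrow> complex) \<Rightarrow> ('a \<Rightarrow> complex) \<Rightarrow> complex) \<Rightarrow>
   (('a \<Rightarrow> complex) \<times> ('a \<Rightarrow> complex)) set" where
  "form_operator M D Q =
     {(u, f). u \<in> D \<and> f \<in> L2_fun M \<and> (\<forall>v\<in>D. Q u v = (LINT x|M. f x * cnj (v x)))}"

definition ae_independent :: "'a measure \<Rightarrow> ('a \<Rightarrow> complex) set \<Rightarrow> bool" where
  "ae_independent M S \<longleftrightarrow>
     (\<forall>c. (AE x in M. (\<Sum>f\<in>S. c f * f x) = 0) \<longrightarrow> (\<forall>f\<in>S. c f = (0::complex)))"

text \<open>The dimension of the span of \<open>V\<close> in the quotient by almost everywhere vanishing functions,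
  for a linear space \<open>V\<close> the dimension of its image.\<close>

definition ae_dim :: "'a measure \<Rightarrow> ('a \<Rightarrow> complex) set \<Rightarrow> enat" where
  "ae_dim M V = (SUP S\<in>{S. finite S \<and> S \<subseteq> V \<and> ae_independent M S}. enat (card S))"

definition eigenspace ::
  "(('a \<Rightarrow> complex) \<times> ('a \<Rightarrow> complex)) set \<Rightarrow> real \<Rightarrow> ('a \<Rightarrow> complex) set" where
  "eigenspace A \<mu> = {u. (u, \<lambda>x. of_real \<mu> * u x) \<in> A}"

text \<open>The count lives in \<^typ>\<open>ennreal\<close>, so that an infinite count stays distinct from finite ones.
  Values of \<open>\<mu>\<close> that are not eigenvalues contribute 0 to the following sum.\<close>

definition eigenvalue_count ::
  "'a measure \<Rightarrow> (('a \<Rightarrow> complex) \<times> ('a \<Rightarrow> complex)) set \<Rightarrow> real \<Rightarrow> ennreal" where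
  "eigenvalue_count M A t = (\<Sum>\<^sub>\<infinity>\<mu>\<in>{..t}. ennreal_of_enat (ae_dim M (eigenspace A \<mu>)))"

section \<open>The Dirichlet and Neumann operators\<close>

text \<open>Functions on \<open>\<Omega>\<close> are total functions whose values outside \<open>\<Omega>\<close> are irrelevant.\<close>

abbreviation haar_on :: "(('p::prime_card padic) ^ 'n) set \<Rightarrow> (('p padic) ^ 'n) measure" where
  "haar_on \<Omega> \<equiv> restrict_space padic_haar \<Omega>"

definition zero_extend :: "'a set \<Rightarrow> ('a \<Rightarrow> complex) \<Rightarrow> 'a \<Rightarrow> complex" where
  "zero_extend \<Omega> u x = (if x \<in> \<Omega> then u x else 0)"

definition dirichlet_form ::
  "real \<Rightarrow> (('p::prime_card padic) ^ 'n) set \<Rightarrow>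
   (('p padic) ^ 'n \<Rightarrow> complex) \<Rightarrow> (('p padic) ^ 'n \<Rightarrow> complex) \<Rightarrow> complex" where
  "dirichlet_form \<alpha> \<Omega> u v = (LINT \<xi>|padic_haar.
     of_real (padic_vnorm \<xi> powr \<alpha>) * fourier (zero_extend \<Omega> u) \<xi> * cnj (fourier (zero_extend \<Omega> v) \<xi>))"

definition dirichlet_domain ::
  "real \<Rightarrow> (('p::prime_card padic) ^ 'n) set \<Rightarrow> (('p padic) ^ 'n \<Rightarrow> complex) set" where
  "dirichlet_domain \<alpha> \<Omega> = {u. zero_extend \<Omega> u \<in> sobolev0 (\<alpha> / 2) \<Omega>}"

definition dirichlet_operator ::
  "real \<Rightarrow> (('p::prime_card padic) ^ 'n) set \<Rightarrow>
   ((('p padic) ^ 'n \<Rightarrow> complex) \<times> (('p padic) ^ 'n \<Rightarrow> complex)) set" where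
  "dirichlet_operator \<alpha> \<Omega> = form_operator (haar_on \<Omega>) (dirichlet_domain \<alpha> \<Omega>) (dirichlet_form \<alpha> \<Omega>)"

definition kernel_const :: "nat \<Rightarrow> nat \<Rightarrow> real \<Rightarrow> real" where
  "kernel_const p n \<alpha> = (real p powr \<alpha> - 1) / (1 - real p powr (- \<alpha> - real n))"

definition neumann_form ::
  "real \<Rightarrow> (('p::prime_card padic) ^ 'n) set \<Rightarrow>
   (('p padic) ^ 'n \<Rightarrow> complex) \<Rightarrow> (('p padic) ^ 'n \<Rightarrow> complex) \<Rightarrow> complex" where
  "neumann_form \<alpha> \<Omega> u v = of_real (1 / 2 * kernel_const CARD('p) CARD('n) \<alpha>) *
     (LINT (x, y)|(haar_on \<Omega> \<Otimes>\<^sub>M haar_on \<Omega>).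
        (u x - u y) * cnj (v x - v y) / of_real (padic_vnorm (x - y) powr (\<alpha> + real CARD('n))))"

definition neumann_energy ::
  "real \<Rightarrow> (('p::prime_card padic) ^ 'n) set \<Rightarrow> (('p padic) ^ 'n \<Rightarrow> complex) \<Rightarrow> ennreal" where
  "neumann_energy \<alpha> \<Omega> u = ennreal (1 / 2 * kernel_const CARD('p) CARD('n) \<alpha>) *
     (\<integral>\<^sup>+(x, y). ennreal ((cmod (u x - u y))\<^sup>2 / padic_vnorm (x - y) powr (\<alpha> + real CARD('n)))
        \<partial>(haar_on \<Omega> \<Otimes>\<^sub>M haar_on \<Omega>))"

definition neumann_domain ::
  "real \<Rightarrow> (('p::prime_card padic) ^ 'n) set \<Rightarrow> (('p padic) ^ 'n \<Rightarrow> complex) set" where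
  "neumann_domain \<alpha> \<Omega> = {u \<in> L2_fun (haar_on \<Omega>). neumann_energy \<alpha> \<Omega> u < \<infinity>}"

definition neumann_operator ::
  "real \<Rightarrow> (('p::prime_card padic) ^ 'n) set \<Rightarrow>
   ((('p padic) ^ 'n \<Rightarrow> complex) \<times> (('p padic) ^ 'n \<Rightarrow> complex)) set" where
  "neumann_operator \<alpha> \<Omega> = form_operator (haar_on \<Omega>) (neumann_domain \<alpha> \<Omega>) (neumann_form \<alpha> \<Omega>)"

section \<open>Weyl asymptotics\<close>

definition weyl_term :: "real \<Rightarrow> (('p::prime_card padic) ^ 'n) set \<Rightarrow> real \<Rightarrow> real" where
  "weyl_term \<alpha> \<Omega> t =
     measure padic_haar \<Omega> * real CARD('p) powi (int CARD('n) * \<lfloor>1 / \<alpha> * log (real CARD('p)) t\<rfloor>)"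

definition Gamma_at :: "real \<Rightarrow> (('p::prime_card padic) ^ 'n) set \<Rightarrow> ('p padic) ^ 'n \<Rightarrow> ennreal" where
  "Gamma_at \<alpha> \<Omega> x = ennreal (kernel_const CARD('p) CARD('n) \<alpha>) *
     (\<integral>\<^sup>+y\<in>- \<Omega>. ennreal (1 / padic_vnorm (x - y) powr (real CARD('n) + \<alpha>)) \<partial>padic_haar)"

text \<open>\<^term>\<open>Gamma_at \<alpha> \<Omega>\<close> is constant on every ball contained in \<open>\<Omega>\<close>, by the ultrametric
  inequality; any point may serve as representative.\<close>

definition Gamma_ball ::
  "real \<Rightarrow> (('p::prime_card padic) ^ 'n) set \<Rightarrow> (('p padic) ^ 'n) set \<Rightarrow> ennreal" where
  "Gamma_ball \<alpha> \<Omega> B = Gamma_at \<alpha> \<Omega> (SOME x. x \<in> B)"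

definition Gamma_max :: "real \<Rightarrow> (('p::prime_card padic) ^ 'n) set \<Rightarrow> ennreal" where
  "Gamma_max \<alpha> \<Omega> = (SUP B\<in>maximal_balls \<Omega>. Gamma_ball \<alpha> \<Omega> B)"

definition exceptional_set :: "real \<Rightarrow> (('p::prime_card padic) ^ 'n) set \<Rightarrow> real set" where
  "exceptional_set \<alpha> \<Omega> =
     (\<Union>j\<in>{1::nat..}. {real CARD('p) powr (\<alpha> * real j) - enn2real (Gamma_max \<alpha> \<Omega>) ..<
        real CARD('p) powr (\<alpha> * real j)})"

end

theory Submission
  imports Defs
begin

text \<open>
  Let \<open>J = \<lfloor>log\<^sub>p t / \<alpha>\<rfloor>\<close>. A function whose means over all balls of level \<open>J\<close> vanish has
  a Fourier transform that vanishes on \<open>\<parallel>\<xi>\<parallel> \<le> p\<^sup>J\<close>, so its Dirichlet form is at least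
  \<open>p\<^bsup>\<alpha>(J+1)\<^esup> > t\<close> times its squared norm; hence there are at most as many eigenvalues up to \<open>t\<close>
  as balls of level \<open>J\<close> that meet \<open>\<Omega>\<close>. For the Neumann form the same conclusion holds with the
  loss \<open>\<Gamma>\<^sub>m\<^sub>a\<^sub>x\<close>: cutting the kernel off at radius \<open>p\<^sup>-\<^sup>J\<close> only lowers the form, and then the
  mixed terms vanish because the kernel is constant on products of balls of level \<open>J\<close>.
  Conversely, a function with mean zero that is supported in a ball of level \<open>l\<close> inside \<open>\<Omega>\<close> and
  constant on its subballs of level \<open>l + 1\<close> is an eigenfunction of both operators, with eigenvalue
  at most \<open>p\<^bsup>\<alpha>(l+1)\<^esup>\<close>. Counting such wavelets at the levels between \<open>J / 2\<close> and \<open>J\<close> gives a lower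
  bound. Both bounds are asymptotic to \<open>|\<Omega>| p\<^bsup>nJ\<^esup>\<close>, since the balls of level \<open>J\<close> inside \<open>\<Omega>\<close> and
  those that meet \<open>\<Omega>\<close> exhaust the measures of \<open>\<Omega>\<close> and of its closure.
\<close>

section \<open>Completeness and residues\<close>

text \<open>Eigenvalues are counted directly from their definition, through independent families of
  eigenfunctions. More such functions below the threshold than balls would admit a nonzero
  combination with all means zero, because a homogeneous linear system with more unknowns than
  equations has a nontrivial solution. The Neumann kernel is singular, so products like
  \<open>u x * cnj (v y)\<close> need not be integrable against it; the cut-off kernel is bounded,
  and its mass over the whole space times the constant in the form is exactly p^(\<alpha>(J+1)).
  What is lost outside \<open>\<Omega>\<close> is at most \<open>Gamma_at\<close> at the point. On
  the Dirichlet side \<open>fourier\<close> is a chosen representative, determined only almost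
  everywhere. It is compared with the integral \<open>fourier_L1\<close>, for which Plancherel comes
  from an exact identity: the energy on a ball of frequencies plus half the mean square oscillation
  at the dual scale is the squared norm. Wavelets start at half the level because every ball of the
  coarsest level costs one function, and this cost is negligible once the gap between the levels
  grows.\<close>

lemma one_less_card_prime: "1 < real CARD('p::prime_card)"
  using prime_gt_1_nat[OF prime_card[where 'a='p]] by simp

lemma padic_norm_one [simp]: "padic_norm (1 :: 'p::prime_card padic) = 1"
  using padic_norm_p_powi[of 0, where 'p='p] by simp

lemma padic_norm_zero [simp]: "padic_norm 0 = 0"
  by simp

lemma power_int_le_iff: "1 < (x::real) \<Longrightarrow> x powi a \<le> x powi b \<longleftrightarrow> a \<le> b"
  using power_int_strict_increasing[of b a x] power_int_increasing[of a b x] by (cases "a \<le> b") auto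

lemma power_int_less_iff: "1 < (x::real) \<Longrightarrow> x powi a < x powi b \<longleftrightarrow> a < b"
  using power_int_le_iff[of x b a] by auto

lemma padic_norm_inverse: "padic_norm (inverse x) = inverse (padic_norm x)"
proof (cases "x = 0")
  case False
  then have "padic_norm (inverse x) * padic_norm x = 1"
    by (simp flip: padic_norm_mult)
  then show ?thesis by (metis inverse_unique mult.commute)
qed simp

lemma padic_norm_minus_commute: "padic_norm (x - y) = padic_norm (y - x)"
  using padic_norm_minus[of "x - y"] by simp

lemma padic_norm_diff_ultra: "padic_norm (x - y) \<le> max (padic_norm (x - z)) (padic_norm (z - y))"
  using padic_norm_ultra[of "x - z" "z - y"] by simp

section \<open>Rational Cauchy sequences as representatives, density of the rationals,
  completeness\<close>

lemma cr_padic_unique: "cr_padic X x \<Longrightarrow> cr_padic X y \<Longrightarrow> x = y"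
  by (simp add: cr_padic_def)

lemma cr_padic_ex:
  fixes x :: "'p::prime_card padic"
  obtains X where "cr_padic X x"
  using Quotient_abs_rep[OF Quotient_padic, of x] Quotient_rep_reflp[OF Quotient_padic, of x]
  by (auto simp: cr_padic_def)

lemma cr_padic_cauchy: "cr_padic X (x :: 'p::prime_card padic) \<Longrightarrow> padic_cauchy CARD('p) X"
  by (simp add: cr_padic_def padic_rel_def)

lemma cauchy_cr_padic: "padic_cauchy CARD('p) X \<Longrightarrow> cr_padic X (padic_of_seq X :: 'p::prime_card padic)"
  by (simp add: cr_padic_def padic_rel_refl[OF prime_card])

lemma cr_padic_uminus: "cr_padic X x \<Longrightarrow> cr_padic (\<lambda>n. - X n) (- x)"
  using uminus_padic.transfer unfolding padic.pcr_cr_eq rel_fun_def by blast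

lemma cr_padic_add: "cr_padic X x \<Longrightarrow> cr_padic Y y \<Longrightarrow> cr_padic (\<lambda>n. X n + Y n) (x + y)"
  using plus_padic.transfer unfolding padic.pcr_cr_eq rel_fun_def by blast

lemma cr_padic_mult: "cr_padic X x \<Longrightarrow> cr_padic Y y \<Longrightarrow> cr_padic (\<lambda>n. X n * Y n) (x * y)"
  using times_padic.transfer unfolding padic.pcr_cr_eq rel_fun_def by blast

lemma cr_padic_diff: "cr_padic X x \<Longrightarrow> cr_padic Y y \<Longrightarrow> cr_padic (\<lambda>n. X n - Y n) (x - y)"
  using cr_padic_add[of X x "\<lambda>n. - Y n" "- y"] cr_padic_uminus[of Y y] by simp

lemma cr_padic_norm:
  "cr_padic X (x :: 'p::prime_card padic) \<Longrightarrow> lim (\<lambda>n. padic_abs CARD('p) (X n)) = padic_norm x"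
  using padic_norm.transfer unfolding padic.pcr_cr_eq rel_fun_def by blast

lemma cr_padic_of_int: "cr_padic (\<lambda>_. of_int c) (of_int c :: 'p::prime_card padic)"
proof (cases c)
  case (nonneg n)
  then show ?thesis using cr_padic_of_nat[of n] by simp
next
  case (neg n)
  then show ?thesis using cr_padic_uminus[OF cr_padic_of_nat[of "Suc n"]] by simp
qed

text \<open>Multiplication by the denominator reduces the claim to integers, where the embedding is
  already known.\<close>

lemma cr_padic_of_rat: "cr_padic (\<lambda>_. q) (of_rat q :: 'p::prime_card padic)"
proof -
  obtain a b where q: "b \<noteq> 0" "q = of_int a / of_int b" by (rule rat_fractE[OF prime_card[where 'a='p]])
  let ?x = "padic_of_seq (\<lambda>_. q) :: 'p padic"
  have x: "cr_padic (\<lambda>_. q) ?x"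
    by (intro cauchy_cr_padic padic_cauchy_const[OF prime_card])
  have "cr_padic (\<lambda>_. q * of_int b) (?x * of_int b)"
    by (intro cr_padic_mult x cr_padic_of_int)
  moreover have "q * of_int b = of_int a" using q by simp
  ultimately have "?x * of_int b = of_int a"
    using cr_padic_of_int[of a, where 'p='p] cr_padic_unique by metis
  moreover have "of_rat q * of_int b = (of_int a :: 'p padic)"
    using q by (simp add: of_rat_divide)
  ultimately have "?x = of_rat q" using q(1) by (metis mult_right_cancel of_int_eq_0_iff)
  then show ?thesis using x by simp
qed

lemma padic_norm_diff_of_rat_le:
  assumes X: "cr_padic X (x :: 'p::prime_card padic)"
    and le: "\<And>n. n \<ge> k \<Longrightarrow> padic_abs CARD('p) (X n - q) \<le> e"
  shows "padic_norm (x - of_rat q) \<le> e"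
proof -
  have c: "cr_padic (\<lambda>n. X n - q) (x - of_rat q)"
    by (intro cr_padic_diff X cr_padic_of_rat)
  show ?thesis
    using padic_cauchy_lim[OF prime_card cr_padic_cauchy[OF c]] le
    unfolding cr_padic_norm[OF c] by (intro LIMSEQ_le_const2) auto
qed

lemma padic_rat_dense:
  fixes x :: "'p::prime_card padic"
  assumes "e > 0"
  obtains q where "padic_norm (x - of_rat q) < e"
proof -
  obtain X where X: "cr_padic X x" by (rule cr_padic_ex)
  \<comment> \<open>The passage to the limit keeps only non-strict bounds, so the tail is taken
    below half of \<open>e\<close>.\<close>
  have "e / 2 > 0" using assms by simp
  then obtain k where k: "\<And>m n. m \<ge> k \<Longrightarrow> n \<ge> k \<Longrightarrow> padic_abs CARD('p) (X m - X n) < e / 2"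
    using cr_padic_cauchy[OF X] unfolding padic_cauchy_def by blast
  have "padic_norm (x - of_rat (X k)) \<le> e / 2"
    by (rule padic_norm_diff_of_rat_le[OF X, of k]) (use k[of _ k] in force)
  then show ?thesis using that[of "X k"] assms by simp
qed

text \<open>Diagonal argument: rationals \<open>q n\<close> within 1/(n+1) of \<open>s n\<close>
  form a Cauchy sequence of rationals, and the p-adic number that this sequence represents is the
  limit.\<close>

instance padic :: (prime_card) complete_space
proof
  fix s :: "nat \<Rightarrow> 'a padic" assume s: "Cauchy s"
  have "\<exists>q. padic_norm (s n - of_rat q) < inverse (real (Suc n))" for n
    using padic_rat_dense[of "inverse (real (Suc n))" "s n"] by (metis inverse_positive_iff_positive of_nat_0_less_iff zero_less_Suc)
  then obtain q where q: "\<And>n. padic_norm (s n - of_rat (q n)) < inverse (real (Suc n))" by metis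
  have small: "\<exists>k. \<forall>n\<ge>k. padic_norm (s n - of_rat (q n)) < e" if e: "e > 0" for e
  proof -
    obtain k where k: "inverse (real (Suc k)) < e" using reals_Archimedean[OF e] by blast
    have "padic_norm (s n - of_rat (q n)) < e" if "n \<ge> k" for n
    proof -
      have "inverse (real (Suc n)) \<le> inverse (real (Suc k))" using that by simp
      then show ?thesis using q[of n] k by linarith
    qed
    then show ?thesis by blast
  qed
  have qc: "padic_cauchy CARD('a) q"
    unfolding padic_cauchy_def
  proof safe
    fix e :: real assume e: "e > 0"
    obtain k where k: "\<And>n. n \<ge> k \<Longrightarrow> padic_norm (s n - of_rat (q n)) < e" using small[OF e] by blast
    obtain l where l: "\<And>m n. m \<ge> l \<Longrightarrow> n \<ge> l \<Longrightarrow> padic_norm (s m - s n) < e"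
      using s e unfolding Cauchy_def dist_padic_def by blast
    have "padic_abs CARD('a) (q m - q n) < e" if "m \<ge> max k l" "n \<ge> max k l" for m n
    proof -
      have "padic_norm (of_rat (q m) - of_rat (q n) :: 'a padic) < e"
        using padic_norm_diff_ultra[of "of_rat (q m)" "of_rat (q n)" "s m"]
          padic_norm_diff_ultra[of "s m" "of_rat (q n)" "s n"] k[of m] k[of n] l[of m n] that
          padic_norm_minus_commute[of "s m" "of_rat (q m)"]
        by (auto simp: max_def split: if_splits)
      then show ?thesis by (metis of_rat_diff padic_norm_of_rat)
    qed
    then show "\<exists>k. \<forall>m\<ge>k. \<forall>n\<ge>k. padic_abs CARD('a) (q m - q n) < e" by blast
  qed
  define x :: "'a padic" where "x = padic_of_seq q"
  have x: "cr_padic q x" unfolding x_def by (rule cauchy_cr_padic[OF qc])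
  have "s \<longlonglongrightarrow> x"
    unfolding lim_sequentially dist_padic_def
  proof safe
    fix e :: real assume e: "e > 0"
    obtain k where k: "\<And>n. n \<ge> k \<Longrightarrow> padic_norm (s n - of_rat (q n)) < e" using small[OF e] by blast
    have "e / 2 > 0" using e by simp
    then obtain l where l: "\<And>m n. m \<ge> l \<Longrightarrow> n \<ge> l \<Longrightarrow> padic_abs CARD('a) (q m - q n) < e / 2"
      using qc unfolding padic_cauchy_def by blast
    have "padic_norm (s n - x) < e" if n: "n \<ge> max k l" for n
    proof -
      have "padic_norm (x - of_rat (q n)) \<le> e / 2"
        by (rule padic_norm_diff_of_rat_le[OF x, of l]) (use l[of _ n] n in force)
      then show ?thesis
        using padic_norm_diff_ultra[of "s n" x "of_rat (q n)"] k[of n] n e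
          padic_norm_minus_commute[of x "of_rat (q n)"]
        by (auto simp: max_def split: if_splits)
    qed
    then show "\<exists>no. \<forall>n\<ge>no. padic_norm (s n - x) < e" by blast
  qed
  then show "convergent s" by (auto simp: convergent_def)
qed

section \<open>Residues modulo powers of p and the values of the norm\<close>

lemma padic_abs_of_int_le_iff:
  assumes p: "prime p"
  shows "padic_abs p (of_int z) \<le> real p powi (- int k) \<longleftrightarrow> int p ^ k dvd z"
proof (cases "z = 0")
  case False
  have "1 < real p" using prime_gt_1_nat[OF p] by simp
  then have "padic_abs p (of_int z) \<le> real p powi (- int k) \<longleftrightarrow> k \<le> multiplicity (int p) z"
    using padic_abs_fract[OF p False, of 1] by (auto simp: power_int_le_iff)
  then show ?thesis
    using False prime_gt_1_nat[OF p] by (subst power_dvd_iff_le_multiplicity) auto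
qed (use prime_gt_0_nat[OF p] in \<open>simp add: padic_abs_def\<close>)

text \<open>A rational close to \<open>x\<close> has norm at most 1, so in lowest terms its
  denominator \<open>b\<close> is prime to p and invertible modulo p^k. Solving b c = a modulo p^k
  for its numerator \<open>a\<close> yields the residue.\<close>

lemma padic_residue_ex:
  fixes x :: "'p::prime_card padic"
  assumes x: "padic_norm x \<le> 1"
  obtains c where "c < CARD('p) ^ k" "padic_norm (x - of_nat c) \<le> real CARD('p) powi (- int k)"
proof -
  let ?p = "CARD('p)"
  have p: "prime ?p" by (rule prime_card)
  have p1: "1 < real ?p" by (rule one_less_card_prime)
  have e: "real ?p powi (- int k) > 0" and e1: "real ?p powi (- int k) \<le> 1"
    using p1 by (auto simp: power_int_minus field_simps)
  obtain q where q: "padic_norm (x - of_rat q) < real ?p powi (- int k)" using padic_rat_dense[OF e] .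
  have "padic_norm (of_rat q :: 'p padic) \<le> 1"
    using padic_norm_ultra[of x "of_rat q - x"] x q e1 padic_norm_minus_commute[of x "of_rat q"]
    by (auto simp: max_def split: if_splits)
  then have q1: "padic_abs ?p q \<le> 1" by (simp add: padic_norm_of_rat)
  obtain a b where ab: "quotient_of q = (a, b)" by fastforce
  have b: "b > 0" and cop: "coprime a b" and qab: "q = of_int a / of_int b"
    using ab quotient_of_denom_pos quotient_of_coprime quotient_of_div by blast+
  have nb: "\<not> int ?p dvd b"
  proof
    assume d: "int ?p dvd b"
    then have na: "\<not> int ?p dvd a" using cop p
      by (meson coprime_common_divisor not_prime_unit prime_nat_int_transfer)
    then have "a \<noteq> 0" by auto
    have "multiplicity (int ?p) b > 0" using d b p by (simp add: prime_multiplicity_gt_zero_iff)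
    moreover have "multiplicity (int ?p) a = 0" using na by (rule not_dvd_imp_multiplicity_0)
    ultimately have "1 < padic_abs ?p q"
      unfolding qab using padic_abs_fract[OF p \<open>a \<noteq> 0\<close>, of b] b p1 by (auto simp: one_less_power)
    then show False using q1 by simp
  qed
  then have "coprime b (int ?p ^ k)"
    using p prime_imp_coprime[of "int ?p" b] by (simp add: coprime_commute)
  then obtain c0 where c0: "[b * c0 = a] (mod int ?p ^ k)"
    by (metis cong_solve_coprime_int cong_scalar_right mult.assoc mult_1)
  define c where "c = nat (c0 mod int ?p ^ k)"
  have pk: "int ?p ^ k > 0" using p1 by simp
  have "int c = c0 mod int ?p ^ k" using pk by (simp add: c_def)
  then have "[b * int c = a] (mod int ?p ^ k)"
    using c0 unfolding cong_def by (simp add: mod_mult_right_eq)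
  then have dv: "int ?p ^ k dvd a - b * int c"
    by (metis cong_iff_dvd_diff cong_sym)
  have "padic_abs ?p (of_int b) = 1"
    using padic_abs_fract[OF p, of b 1] b nb by (simp add: not_dvd_imp_multiplicity_0)
  moreover have "(q - of_nat c) * of_int b = of_int (a - b * int c)"
    using b by (simp add: qab field_simps)
  ultimately have "padic_abs ?p (q - of_nat c) = padic_abs ?p (of_int (a - b * int c))"
    using padic_abs_mult[OF p, of "q - of_nat c" "of_int b"] by simp
  then have "padic_abs ?p (q - of_nat c) \<le> real ?p powi (- int k)"
    using dv padic_abs_of_int_le_iff[OF p, of "a - b * int c" k] by simp
  then have "padic_norm (of_rat q - of_nat c :: 'p padic) \<le> real ?p powi (- int k)"
    by (metis of_rat_diff of_rat_of_nat_eq padic_norm_of_rat)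
  then have "padic_norm (x - of_nat c) \<le> real ?p powi (- int k)"
    using padic_norm_diff_ultra[of x "of_nat c" "of_rat q"] q by (auto simp: max_def split: if_splits)
  moreover have "int c < int (?p ^ k)" using \<open>int c = _\<close> pk by simp
  then have "c < ?p ^ k" by (simp only: of_nat_less_iff)
  ultimately show ?thesis using that by blast
qed

lemma padic_residue_unique:
  assumes "c < CARD('p) ^ k" "d < CARD('p) ^ k"
    and "padic_norm (of_nat c - of_nat d :: 'p::prime_card padic) \<le> real CARD('p) powi (- int k)"
  shows "c = d"
proof -
  have "padic_abs CARD('p) (of_int (int c - int d)) \<le> real CARD('p) powi (- int k)"
    using assms(3) by (metis of_int_diff of_int_of_nat_eq of_rat_of_int_eq padic_norm_of_rat)
  then have "int CARD('p) ^ k dvd int c - int d" by (simp only: padic_abs_of_int_le_iff[OF prime_card])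
  then have "[int c = int d] (mod int (CARD('p) ^ k))" by (simp add: cong_iff_dvd_diff)
  then show ?thesis using assms(1,2) by (metis cong_int_iff cong_less_modulus_unique_nat)
qed

text \<open>By the ultrametric inequality a rational closer to \<open>x\<close> than
  \<open>padic_norm x\<close> has the same norm as \<open>x\<close>, and nonzero rationals have
  powers of p as norms.\<close>

lemma padic_norm_discrete:
  fixes x :: "'p::prime_card padic"
  assumes "x \<noteq> 0"
  obtains k where "padic_norm x = real CARD('p) powi k"
proof -
  have pos: "padic_norm x > 0" using assms by (simp add: less_le)
  then obtain q where q: "padic_norm (x - of_rat q) < padic_norm x" by (rule padic_rat_dense)
  have "padic_norm x = padic_norm (of_rat q :: 'p padic)"
    using padic_norm_ultra[of "x - of_rat q" "of_rat q"] padic_norm_ultra[of x "of_rat q - x"] q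
      padic_norm_minus_commute[of x "of_rat q"]
    by (auto simp: max_def split: if_splits)
  then show ?thesis
    using that pos padic_norm_of_rat[of q, where 'p='p] by (auto simp: padic_abs_def split: if_splits)
qed

section \<open>Balls\<close>

lemma padic_norm_nth_le: "padic_norm (x $ i) \<le> padic_vnorm x"
  using padic_vnorm_le_iff[of x "padic_vnorm x"] by simp

lemma padic_vnorm_attained: obtains i where "padic_vnorm x = padic_norm (x $ i)"
proof -
  have "padic_vnorm x \<in> range (\<lambda>i. padic_norm (x $ i))"
    unfolding padic_vnorm_def by (intro Max_in) auto
  then show ?thesis using that by blast
qed

lemma padic_vnorm_nonneg [simp]: "0 \<le> padic_vnorm x"
  using padic_norm_nonneg[of "x $ undefined"] padic_norm_nth_le[of x undefined] by linarith

lemma padic_vnorm_eq_0_iff [simp]: "padic_vnorm x = 0 \<longleftrightarrow> x = 0"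
proof -
  have "padic_vnorm x \<le> 0 \<longleftrightarrow> x = 0"
    unfolding padic_vnorm_le_iff by (auto simp: vec_eq_iff order_antisym_conv[OF padic_norm_nonneg])
  then show ?thesis using padic_vnorm_nonneg[of x] by linarith
qed

lemma padic_vnorm_minus [simp]: "padic_vnorm (- x) = padic_vnorm x"
  by (simp add: padic_vnorm_def)

lemma padic_vnorm_minus_commute: "padic_vnorm (x - y) = padic_vnorm (y - x)"
  using padic_vnorm_minus[of "x - y"] by simp

lemma padic_vnorm_ultra: "padic_vnorm (x + y) \<le> max (padic_vnorm x) (padic_vnorm y)"
  unfolding padic_vnorm_le_iff
proof
  fix i show "padic_norm ((x + y) $ i) \<le> max (padic_vnorm x) (padic_vnorm y)"
    using padic_norm_ultra[of "x $ i" "y $ i"] padic_norm_nth_le[of x i] padic_norm_nth_le[of y i]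
    by auto
qed

lemma padic_vnorm_diff_ultra: "padic_vnorm (x - y) \<le> max (padic_vnorm (x - z)) (padic_vnorm (z - y))"
  using padic_vnorm_ultra[of "x - z" "z - y"] by simp

lemma padic_vnorm_discrete:
  fixes x :: "('p::prime_card padic) ^ 'n"
  assumes "x \<noteq> 0"
  obtains k where "padic_vnorm x = real CARD('p) powi k"
proof -
  obtain i where i: "padic_vnorm x = padic_norm (x $ i)" by (rule padic_vnorm_attained)
  then have "x $ i \<noteq> 0" using assms padic_vnorm_eq_0_iff[of x] by auto
  then show ?thesis using that i by (metis padic_norm_discrete)
qed

text \<open>Norms take only powers of p and 0 as values, so a strict inequality gains a full factor
  p. This gap gives the exponent \<open>J + 1\<close> in the Dirichlet upper bound and makes the
  cut-off exact on Neumann wavelets.\<close>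

lemma padic_vnorm_le_if_less:
  fixes x :: "('p::prime_card padic) ^ 'n"
  assumes "padic_vnorm x < real CARD('p) powi k"
  shows "padic_vnorm x \<le> real CARD('p) powi (k - 1)"
proof (cases "x = 0")
  case True
  then have "padic_vnorm x = 0" by simp
  then show ?thesis by (metis of_nat_0_le_iff zero_le_power_int)
next
  case False
  then obtain l where l: "padic_vnorm x = real CARD('p) powi l" by (rule padic_vnorm_discrete)
  then have "l < k" using assms one_less_card_prime[where 'p='p] by (simp add: power_int_less_iff)
  then show ?thesis using l one_less_card_prime[where 'p='p] by (simp add: power_int_le_iff)
qed

lemma center_in_padic_ball [simp]: "a \<in> padic_ball a L"
proof -
  have "padic_vnorm (a - a) = 0" by simp
  then show ?thesis by (simp only: mem_padic_ball_iff) (simp add: zero_le_power_int)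
qed

lemma padic_ball_ne [simp]: "padic_ball a L \<noteq> {}"
  using center_in_padic_ball by blast

lemma padic_ball_sym: "x \<in> padic_ball a L \<longleftrightarrow> a \<in> padic_ball x L"
  by (simp add: mem_padic_ball_iff padic_vnorm_minus_commute)

lemma padic_ball_trans: "x \<in> padic_ball a L \<Longrightarrow> y \<in> padic_ball x L \<Longrightarrow> y \<in> padic_ball a L"
  unfolding mem_padic_ball_iff using padic_vnorm_diff_ultra[of y a x] by auto

lemma padic_ball_eqI: "x \<in> padic_ball a L \<Longrightarrow> padic_ball x L = padic_ball a L"
  using padic_ball_trans padic_ball_sym by blast

lemma padic_ball_eq_iff: "padic_ball x L = padic_ball a L \<longleftrightarrow> x \<in> padic_ball a L"
  using padic_ball_eqI center_in_padic_ball by blast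

lemma padic_ball_antimono:
  fixes a :: "('p::prime_card padic) ^ 'n"
  assumes "L \<le> M" shows "padic_ball a M \<subseteq> padic_ball a L"
proof -
  have "real CARD('p) powi (- M) \<le> real CARD('p) powi (- L)"
    using assms one_less_card_prime[where 'p='p] by (intro power_int_increasing) auto
  then show ?thesis by (auto simp: mem_padic_ball_iff)
qed

lemma padic_ball_nested:
  "L \<le> M \<Longrightarrow> padic_ball a L \<inter> padic_ball b M \<noteq> {} \<Longrightarrow> padic_ball b M \<subseteq> padic_ball a L"
proof -
  assume LM: "L \<le> M" and "padic_ball a L \<inter> padic_ball b M \<noteq> {}"
  then obtain x where x: "x \<in> padic_ball a L" "x \<in> padic_ball b M" by blast
  have "padic_ball b M = padic_ball x M" using padic_ball_eqI[OF x(2)] by simp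
  also have "\<dots> \<subseteq> padic_ball x L" by (rule padic_ball_antimono[OF LM])
  finally show ?thesis using padic_ball_eqI[OF x(1)] by simp
qed

text \<open>A ball attains its radius: the center shifted by the vector with all entries p^L has
  distance exactly p^(-L). Hence a ball as a set determines its level, without which its volume
  would not be well defined.\<close>

lemma padic_ball_level_le:
  fixes a b :: "('p::prime_card padic) ^ 'n"
  assumes "padic_ball a L \<subseteq> padic_ball b M"
  shows "M \<le> L"
proof -
  define x where "x = a + (\<chi> i. of_nat CARD('p) powi L)"
  have n: "padic_vnorm (x - a) = real CARD('p) powi (- L)"
    by (simp add: x_def padic_vnorm_def padic_norm_p_powi)
  then have "x \<in> padic_ball a L" by (simp add: mem_padic_ball_iff)
  moreover have "padic_ball b M = padic_ball a M"
    using assms center_in_padic_ball[of a L] padic_ball_eqI by blast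
  ultimately have "padic_vnorm (x - a) \<le> real CARD('p) powi (- M)"
    using assms by (auto simp: mem_padic_ball_iff)
  then show ?thesis using n one_less_card_prime[where 'p='p] by (simp add: power_int_le_iff)
qed

lemma padic_ball_level_unique: "padic_ball a L = padic_ball b M \<Longrightarrow> L = M"
  using padic_ball_level_le[of a L b M] padic_ball_level_le[of b M a L] by simp

lemma padic_ball_translate: "(+) c ` padic_ball a L = padic_ball (c + a) L"
proof -
  have "x \<in> (+) c ` padic_ball a L \<longleftrightarrow> x \<in> padic_ball (c + a) L" for x
    unfolding image_iff by (auto simp: mem_padic_ball_iff algebra_simps intro!: bexI[of _ "x - c"])
  then show ?thesis by blast
qed

text \<open>All points of one ball of level \<open>L\<close> give the same element, so this is the
  set of balls of level \<open>L\<close> that meet \<open>S\<close>. Its cardinality is the quantity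
  to which eigenvalue counts are compared.\<close>

definition balls_at :: "int \<Rightarrow> (('p::prime_card padic) ^ 'n) set \<Rightarrow> (('p padic) ^ 'n) set set" where
  "balls_at L S = (\<lambda>x. padic_ball x L) ` S"

lemma disjoint_balls_at: "disjoint (balls_at L S)"
  unfolding balls_at_def disjoint_def by (metis (no_types, lifting) disjoint_iff imageE padic_ball_eqI)

text \<open>Two points a + p^L z lie in the same ball of level L + k exactly when the coordinates of
  the z agree modulo p^k, so the subballs correspond to vectors of residues; \<open>\<phi>\<close>
  picks the representatives.\<close>

lemma balls_at_ball:
  fixes a :: "('p::prime_card padic) ^ 'n"
  shows "finite (balls_at (L + int k) (padic_ball a L))"
    and "card (balls_at (L + int k) (padic_ball a L)) = CARD('p) ^ (CARD('n) * k)"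
proof -
  let ?p = "CARD('p)"
  let ?c = "of_nat ?p powi L :: 'p padic"
  let ?D = "PiE UNIV (\<lambda>_::'n. {..<?p ^ k})"
  define \<phi> :: "('n \<Rightarrow> nat) \<Rightarrow> ('p padic) ^ 'n" where "\<phi> d = a + ?c *s (\<chi> i. of_nat (d i))" for d
  let ?\<beta> = "\<lambda>d. padic_ball (\<phi> d) (L + int k)"
  have pp: "real ?p > 0" using one_less_card_prime[where 'p='p] by simp
  have split: "real ?p powi (- (L + int k)) = real ?p powi (- L) * real ?p powi (- int k)"
    using pp by (simp add: power_int_add[symmetric] add.commute)
  have cnz: "?c \<noteq> 0" by simp
  have inj: "inj_on ?\<beta> ?D"
  proof (rule inj_onI)
    fix d e assume d: "d \<in> ?D" and e: "e \<in> ?D" and "?\<beta> d = ?\<beta> e"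
    then have *: "padic_vnorm (\<phi> d - \<phi> e) \<le> real ?p powi (- (L + int k))"
      by (simp add: padic_ball_eq_iff mem_padic_ball_iff)
    show "d = e"
    proof
      fix i
      have "padic_norm (?c * (of_nat (d i) - of_nat (e i))) \<le> real ?p powi (- (L + int k))"
        using padic_norm_nth_le[of "\<phi> d - \<phi> e" i] * by (simp add: \<phi>_def algebra_simps)
      then have "padic_norm (of_nat (d i) - of_nat (e i) :: 'p padic) \<le> real ?p powi (- int k)"
        using pp unfolding padic_norm_mult padic_norm_p_powi split by (simp only: mult_le_cancel_left) auto
      then show "d i = e i" using d e by (intro padic_residue_unique[where 'p='p]) auto
    qed
  qed
  have sub: "\<phi> d \<in> padic_ball a L" for d
  proof -
    have "padic_norm (of_nat m :: 'p padic) \<le> 1" for m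
      using padic_abs_of_int_le_iff[OF prime_card[where 'a='p], of "int m" 0] by (simp add: padic_norm_of_nat)
    then show ?thesis unfolding padic_ball_def \<phi>_def by (auto simp: padic_vnorm_le_iff)
  qed
  have "balls_at (L + int k) (padic_ball a L) = ?\<beta> ` ?D"
  proof (intro equalityI subsetI)
    fix B assume "B \<in> balls_at (L + int k) (padic_ball a L)"
    then obtain x where B: "B = padic_ball x (L + int k)" and "x \<in> padic_ball a L"
      by (auto simp: balls_at_def)
    then obtain z where z: "x = a + ?c *s z" "padic_vnorm z \<le> 1" by (auto simp: padic_ball_def)
    have "\<exists>c. c < ?p ^ k \<and> padic_norm (z $ i - of_nat c) \<le> real ?p powi (- int k)" for i
      using padic_residue_ex[of "z $ i" k] z(2) by (metis padic_vnorm_le_iff)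
    then obtain d where d: "\<And>i. d i < ?p ^ k" "\<And>i. padic_norm (z $ i - of_nat (d i)) \<le> real ?p powi (- int k)"
      by metis
    have "padic_norm ((x - \<phi> d) $ i) \<le> real ?p powi (- (L + int k))" for i
    proof -
      have "(x - \<phi> d) $ i = ?c * (z $ i - of_nat (d i))" by (simp add: z \<phi>_def algebra_simps)
      then show ?thesis using d(2)[of i] pp
        by (simp only: padic_norm_mult padic_norm_p_powi split) (simp add: mult_left_mono)
    qed
    then have "B = ?\<beta> d" unfolding B padic_ball_eq_iff mem_padic_ball_iff padic_vnorm_le_iff by blast
    then show "B \<in> ?\<beta> ` ?D" using d(1) by auto
  qed (use sub in \<open>auto simp: balls_at_def\<close>)
  moreover have "finite ?D" by (intro finite_PiE) auto
  moreover have "card ?D = (?p ^ k) ^ CARD('n)" by (subst card_PiE) auto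
  ultimately show "finite (balls_at (L + int k) (padic_ball a L))"
    "card (balls_at (L + int k) (padic_ball a L)) = ?p ^ (CARD('n) * k)"
    using card_image[OF inj] by (auto simp: power_mult[symmetric] mult.commute)
qed

section \<open>Topology of the space of p-adic vectors\<close>

text \<open>Balls around rational points form a basis. Second countability, here and for vectors,
  makes the Borel sets of a product space generated by rectangles, on which the joint measurability
  of kernels and pairings rests.\<close>

instance padic :: (prime_card) second_countable_topology
proof
  let ?B = "(\<lambda>(q, n). ball (of_rat q :: 'a padic) (inverse (real (Suc n)))) ` UNIV"
  have "topological_basis ?B"
  proof (rule topological_basisI)
    fix S :: "'a padic set" and x assume "open S" "x \<in> S"
    then obtain e where e: "e > 0" "ball x e \<subseteq> S" using open_contains_ball by blast
    then obtain n where n: "inverse (real (Suc n)) < e / 2" using reals_Archimedean[of "e / 2"] by auto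
    obtain q where q: "padic_norm (x - of_rat q) < inverse (real (Suc n))"
      by (rule padic_rat_dense[of "inverse (real (Suc n))" x]) auto
    then have xq: "dist x (of_rat q) < inverse (real (Suc n))" by (simp add: dist_padic_def)
    have "ball (of_rat q) (inverse (real (Suc n))) \<subseteq> ball x e"
    proof
      fix y :: "'a padic" assume "y \<in> ball (of_rat q) (inverse (real (Suc n)))"
      then have "dist (of_rat q) y < inverse (real (Suc n))" by simp
      then have "dist x y < e" using dist_triangle[of x y "of_rat q"] xq n by linarith
      then show "y \<in> ball x e" by simp
    qed
    then show "\<exists>B\<in>?B. x \<in> B \<and> B \<subseteq> S" using xq e by (force simp: dist_commute)
  qed auto
  then show "\<exists>B::'a padic set set. countable B \<and> open = generate_topology B"
    by (intro exI[of _ ?B]) (auto simp: topological_basis_imp_subbasis)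
qed

instance vec :: ("{metric_space, second_countable_topology}", finite) second_countable_topology
proof
  obtain A :: "'a set set" where A: "countable A" "topological_basis A"
    using ex_countable_basis by auto
  let ?B = "(\<lambda>f. {x :: 'a ^ 'b. \<forall>i. x $ i \<in> f i}) ` PiE UNIV (\<lambda>_. A)"
  have "topological_basis ?B"
  proof (rule topological_basisI)
    fix S assume "S \<in> ?B"
    then obtain f where f: "S = {x. \<forall>i. x $ i \<in> f i}" "f \<in> PiE UNIV (\<lambda>_. A)" by blast
    have "open (f i)" for i using f(2) A(2) topological_basis_open by blast
    then show "open S" unfolding f(1) open_vec_def by (auto intro!: exI[of _ f])
  next
    fix S :: "('a ^ 'b) set" and x assume "open S" "x \<in> S"
    then obtain T where T: "\<And>i. open (T i)" "\<And>i. x $ i \<in> T i"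
      and sub: "\<And>y. (\<forall>i. y $ i \<in> T i) \<Longrightarrow> y \<in> S"
      unfolding open_vec_def by metis
    have "\<exists>B. B \<in> A \<and> x $ i \<in> B \<and> B \<subseteq> T i" for i
      using topological_basisE[OF A(2) T] by metis
    then obtain f where f: "\<And>i. f i \<in> A" "\<And>i. x $ i \<in> f i" "\<And>i. f i \<subseteq> T i" by metis
    then show "\<exists>B\<in>?B. x \<in> B \<and> B \<subseteq> S"
      by (intro bexI[of _ "{x. \<forall>i. x $ i \<in> f i}"] conjI imageI) (use f sub in \<open>auto, blast\<close>)
  qed
  moreover have "countable ?B" using A(1) by (intro countable_image countable_PiE) auto
  ultimately show "\<exists>B::('a ^ 'b) set set. countable B \<and> open = generate_topology B"
    using topological_basis_imp_subbasis by blast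
qed

section \<open>Continuity of addition and multiplication\<close>

instance padic :: (prime_card) topological_ab_group_add
proof
  fix a b :: "'a padic"
  show "((\<lambda>x. fst x + snd x) \<longlongrightarrow> a + b) (nhds a \<times>\<^sub>F nhds b)"
    unfolding tendsto_iff
  proof safe
    fix e :: real assume e: "e > 0"
    have "\<forall>\<^sub>F x in nhds a \<times>\<^sub>F nhds b. dist (fst x) a < e \<and> dist (snd x) b < e"
      unfolding eventually_prod_filter
      using e by (intro exI[of _ "\<lambda>x. dist x a < e"] exI[of _ "\<lambda>x. dist x b < e"])
        (auto simp: eventually_nhds_metric)
    then show "\<forall>\<^sub>F x in nhds a \<times>\<^sub>F nhds b. dist (fst x + snd x) (a + b) < e"
    proof eventually_elim
      case (elim x)
      then show ?case
        using padic_norm_ultra[of "fst x - a" "snd x - b"]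
        by (auto simp: dist_padic_def algebra_simps)
    qed
  qed
  show "(uminus \<longlongrightarrow> - a) (nhds a)"
    unfolding tendsto_iff eventually_nhds_metric dist_padic_def
    using padic_norm_minus_commute by (metis (no_types, lifting) minus_diff_minus padic_norm_minus)
qed

instance padic :: (prime_card) topological_semigroup_mult
proof
  fix a b :: "'a padic"
  show "((\<lambda>x. fst x * snd x) \<longlongrightarrow> a * b) (nhds a \<times>\<^sub>F nhds b)"
    unfolding tendsto_iff
  proof safe
    fix e :: real assume e: "e > 0"
    \<comment> \<open>\<open>C\<close> bounds the fixed factor \<open>a\<close> and, as
      \<open>d\<close> is at most 1, also the moving factor \<open>v + b\<close>.\<close>
    define C where "C = 1 + padic_norm a + padic_norm b"
    have C: "C \<ge> 1" "padic_norm a \<le> C" "padic_norm b \<le> C" unfolding C_def by auto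
    define d where "d = min 1 (e / C)"
    have d: "d > 0" "d \<le> 1" "d * C \<le> e" using e C by (auto simp: d_def min_def field_simps)
    have "\<forall>\<^sub>F x in nhds a \<times>\<^sub>F nhds b. dist (fst x) a < d \<and> dist (snd x) b < d"
      unfolding eventually_prod_filter
      using d by (intro exI[of _ "\<lambda>x. dist x a < d"] exI[of _ "\<lambda>x. dist x b < d"])
        (auto simp: eventually_nhds_metric)
    then show "\<forall>\<^sub>F x in nhds a \<times>\<^sub>F nhds b. dist (fst x * snd x) (a * b) < e"
    proof eventually_elim
      case (elim x)
      define u v where "u = fst x - a" and "v = snd x - b"
      have uv: "padic_norm u < d" "padic_norm v < d" using elim by (auto simp: dist_padic_def u_def v_def)
      have "padic_norm (v + b) \<le> C"
        using padic_norm_ultra[of v b] uv d C by auto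
      then have "padic_norm (u * (v + b)) < e"
        using mult_less_le_imp_less[of "padic_norm u" d "padic_norm (v + b)" C] uv d C
        by (cases "padic_norm (v + b) = 0") (use e in \<open>auto simp: padic_norm_mult less_le\<close>)
      moreover have "padic_norm (a * v) < e"
        using mult_le_less_imp_less[of "padic_norm a" C "padic_norm v" d] uv d C
        by (cases "padic_norm a = 0") (use e in \<open>auto simp: padic_norm_mult less_le mult.commute\<close>)
      moreover have "fst x * snd x - a * b = u * (v + b) + a * v"
        by (simp add: u_def v_def algebra_simps)
      ultimately show ?case
        using padic_norm_ultra[of "u * (v + b)" "a * v"] by (auto simp: dist_padic_def)
    qed
  qed
qed

section \<open>Balls are open, closed and compact\<close>

lemma open_padic_ball [simp]: "open (padic_ball a L)"
  unfolding open_padic_vec_iff using padic_ball_eqI by (metis order_refl)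

lemma closed_padic_ball [simp]: "closed (padic_ball a L)"
proof -
  have "\<exists>M. padic_ball x M \<subseteq> - padic_ball a L" if "x \<in> - padic_ball a L" for x
    using that padic_ball_sym padic_ball_trans by (intro exI[of _ L]) blast
  then show ?thesis by (simp add: closed_def open_padic_vec_iff)
qed

text \<open>Total boundedness is the finite splitting into balls of any finer level. Compactness is
  what turns countable additivity of the volume of balls into finite additivity.\<close>

lemma compact_padic_ball [simp]: "compact (padic_ball a L)"
  for a :: "('p::prime_card padic) ^ 'n"
  unfolding compact_eq_totally_bounded
proof safe
  show "complete (padic_ball a L)" by (simp add: complete_eq_closed)
  fix e :: real assume e: "e > 0"
  have "open (ball (0 :: ('p padic) ^ 'n) e)" "0 \<in> ball (0 :: ('p padic) ^ 'n) e" using e by auto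
  then obtain M where M: "padic_ball (0 :: ('p padic) ^ 'n) M \<subseteq> ball 0 e"
    using open_padic_vec_iff by blast
  define k where "k = nat (max 0 (M - L))"
  have kM: "M \<le> L + int k" by (simp add: k_def)
  have sub: "padic_ball x (L + int k) \<subseteq> ball x e" for x :: "('p padic) ^ 'n"
  proof
    fix y assume "y \<in> padic_ball x (L + int k)"
    then have "y - x \<in> padic_ball 0 (L + int k)" by (simp add: mem_padic_ball_iff)
    then have "y - x \<in> ball 0 e" using M padic_ball_antimono[OF kM] by blast
    then have "dist 0 (y - x) < e" by simp
    then show "y \<in> ball x e"
      by (simp add: dist_vec_def dist_padic_def padic_norm_minus_commute)
  qed
  have "balls_at (L + int k) (padic_ball a L) \<subseteq> (\<lambda>x. padic_ball x (L + int k)) ` padic_ball a L"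
    by (simp add: balls_at_def)
  from finite_subset_image[OF balls_at_ball(1) this]
  obtain K where K: "K \<subseteq> padic_ball a L" "finite K"
    "balls_at (L + int k) (padic_ball a L) = (\<lambda>x. padic_ball x (L + int k)) ` K" by metis
  have "padic_ball a L \<subseteq> (\<Union>x\<in>K. ball x e)"
  proof
    fix x assume "x \<in> padic_ball a L"
    then have "padic_ball x (L + int k) \<in> (\<lambda>x. padic_ball x (L + int k)) ` K"
      using K(3) by (auto simp: balls_at_def)
    then obtain y where "y \<in> K" "padic_ball x (L + int k) = padic_ball y (L + int k)" by blast
    then show "x \<in> (\<Union>x\<in>K. ball x e)" using sub[of y] center_in_padic_ball by blast
  qed
  then show "\<exists>K. finite K \<and> padic_ball a L \<subseteq> (\<Union>x\<in>K. ball x e)" using K(2) by blast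
qed

text \<open>Every point of a ball is a center of it, and every ball contains a point with rational
  coordinates.\<close>

lemma countable_padic_balls: "countable {padic_ball a L | (a :: ('p::prime_card padic) ^ 'n) L. True}"
proof -
  have "padic_ball a L \<in> range (\<lambda>(q :: rat ^ 'n, L). padic_ball (\<chi> i. of_rat (q $ i)) L)"
    for a :: "('p padic) ^ 'n" and L
  proof -
    have "real CARD('p) powi (- L) > 0" using one_less_card_prime[where 'p='p] by simp
    then have "\<exists>q. padic_norm (a $ i - of_rat q) < real CARD('p) powi (- L)" for i
      using padic_rat_dense by metis
    then obtain q where q: "\<And>i. padic_norm (a $ i - of_rat (q i)) < real CARD('p) powi (- L)" by metis
    then have "a \<in> padic_ball (\<chi> i. of_rat ((\<chi> i. q i) $ i)) L"
      by (simp add: mem_padic_ball_iff padic_vnorm_le_iff less_imp_le)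
    then have "padic_ball a L = (\<lambda>(q :: rat ^ 'n, L). padic_ball (\<chi> i. of_rat (q $ i)) L) (\<chi> i. q i, L)"
      using padic_ball_eqI by auto
    then show ?thesis by blast
  qed
  then have "{padic_ball a L | (a :: ('p padic) ^ 'n) L. True}
      \<subseteq> range (\<lambda>(q :: rat ^ 'n, L). padic_ball (\<chi> i. of_rat (q $ i)) L)" by blast
  then show ?thesis by (rule countable_subset) auto
qed

lemma UN_padic_ball: "(\<Union>n::nat. padic_ball (a :: ('p::prime_card padic) ^ 'n) (- int n)) = UNIV"
proof -
  have "\<exists>n::nat. x \<in> padic_ball a (- int n)" for x
  proof -
    obtain n where "padic_vnorm (x - a) < real CARD('p) ^ n"
      using real_arch_pow[OF one_less_card_prime[where 'p='p]] by blast
    then show ?thesis by (intro exI[of _ n]) (simp add: mem_padic_ball_iff)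
  qed
  then show ?thesis by blast
qed

section \<open>Haar measure\<close>

text \<open>The value depends on the prime and the dimension but on no point, hence the type
  arguments.\<close>

definition ball_volume :: "'p::prime_card itself \<Rightarrow> 'n::finite itself \<Rightarrow> int \<Rightarrow> real" where
  "ball_volume _ _ L = real CARD('p) powi (- (int CARD('n) * L))"

lemma ball_volume_pos [simp]: "0 < ball_volume TYPE('p::prime_card) TYPE('n::finite) L"
  using one_less_card_prime[where 'p='p] by (simp add: ball_volume_def)

lemma ball_volume_nonneg [simp]: "0 \<le> ball_volume TYPE('p::prime_card) TYPE('n::finite) L"
  using ball_volume_pos less_imp_le by blast

lemma ball_volume_refine:
  "ball_volume TYPE('p::prime_card) TYPE('n::finite) L =
     real (CARD('p) ^ (CARD('n) * k)) * ball_volume TYPE('p) TYPE('n) (L + int k)"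
  using one_less_card_prime[where 'p='p]
  by (simp add: ball_volume_def algebra_simps power_int_diff flip: power_int_of_nat)

text \<open>Additivity is counting: all balls are split down to the finest level \<open>K\<close>
  that occurs, and the subballs of the pieces are exactly those of the whole.\<close>

lemma ball_volume_sum:
  fixes a :: "('p::prime_card padic) ^ 'n" and b :: "'i \<Rightarrow> ('p padic) ^ 'n"
  assumes fin: "finite F" and dis: "disjoint_family_on (\<lambda>i. padic_ball (b i) (M i)) F"
    and un: "(\<Union>i\<in>F. padic_ball (b i) (M i)) = padic_ball a L"
  shows "(\<Sum>i\<in>F. ball_volume TYPE('p) TYPE('n) (M i)) = ball_volume TYPE('p) TYPE('n) L"
proof -
  define K where "K = Max (insert L (M ` F))"
  have K: "L \<le> K" "\<And>i. i \<in> F \<Longrightarrow> M i \<le> K" using fin by (auto simp: K_def)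
  have fine: "finite (balls_at K (padic_ball c N))"
    "ball_volume TYPE('p) TYPE('n) N = real (card (balls_at K (padic_ball c N))) * ball_volume TYPE('p) TYPE('n) K"
    if "N \<le> K" for c :: "('p padic) ^ 'n" and N
  proof -
    have "K = N + int (nat (K - N))" using that by simp
    then show "finite (balls_at K (padic_ball c N))"
      "ball_volume TYPE('p) TYPE('n) N = real (card (balls_at K (padic_ball c N))) * ball_volume TYPE('p) TYPE('n) K"
      using balls_at_ball[of N "nat (K - N)" c] ball_volume_refine[where L=N and k="nat (K - N)" and 'p='p and 'n='n]
      by simp_all
  qed
  have "balls_at K (padic_ball a L) = (\<Union>i\<in>F. balls_at K (padic_ball (b i) (M i)))"
    unfolding un[symmetric] by (auto simp: balls_at_def)
  also have "card \<dots> = (\<Sum>i\<in>F. card (balls_at K (padic_ball (b i) (M i))))"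
  proof (rule card_UN_disjoint[OF fin])
    show "\<forall>i\<in>F. \<forall>j\<in>F. i \<noteq> j \<longrightarrow> balls_at K (padic_ball (b i) (M i)) \<inter> balls_at K (padic_ball (b j) (M j)) = {}"
    proof (intro ballI impI)
      fix i j assume ij: "i \<in> F" "j \<in> F" "i \<noteq> j"
      have *: "B \<subseteq> padic_ball (b i) (M i)" if "B \<in> balls_at K (padic_ball (b i) (M i))" "i \<in> F" for B i
        using that K(2) padic_ball_nested[of "M i" K "b i"] center_in_padic_ball
        unfolding balls_at_def by blast
      have "padic_ball (b i) (M i) \<inter> padic_ball (b j) (M j) = {}"
        using dis ij by (auto simp: disjoint_family_on_def)
      moreover have "B \<noteq> {}" if "B \<in> balls_at K S" for B and S :: "(('p padic) ^ 'n) set"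
        using that by (auto simp: balls_at_def)
      ultimately show "balls_at K (padic_ball (b i) (M i)) \<inter> balls_at K (padic_ball (b j) (M j)) = {}"
        using *[OF _ ij(1)] *[OF _ ij(2)] by (smt (verit, ccfv_threshold) disjoint_iff subset_empty Int_greatest)
    qed
  qed (use fine K in blast)
  finally have "real (card (balls_at K (padic_ball a L))) = (\<Sum>i\<in>F. real (card (balls_at K (padic_ball (b i) (M i)))))"
    by simp
  then show ?thesis using fine(2)[OF K(1), of a] fine(2)[OF K(2)]
    by (simp add: sum_distrib_right)
qed

text \<open>A semiring of sets must contain the empty set. The option type adds it to the balls and
  gives the indexed family over which \<open>extend_measure\<close> works.\<close>

definition ball_or_empty :: "((('p::prime_card padic) ^ 'n) \<times> int) option \<Rightarrow> (('p padic) ^ 'n) set" where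
  "ball_or_empty j = (case j of None \<Rightarrow> {} | Some (a, L) \<Rightarrow> padic_ball a L)"

lemma range_ball_or_empty:
  "range ball_or_empty = insert {} {padic_ball (a :: ('p::prime_card padic) ^ 'n) L | a L. True}"
proof -
  have "ball_or_empty j \<in> insert {} {padic_ball a L | a L. True}" for j :: "((('p padic) ^ 'n) \<times> int) option"
    by (auto simp: ball_or_empty_def split: option.splits)
  moreover have "padic_ball a L = ball_or_empty (Some (a, L))" "{} = ball_or_empty None" for a :: "('p padic) ^ 'n" and L
    by (simp_all add: ball_or_empty_def)
  ultimately show ?thesis by blast
qed

text \<open>Two balls are nested or disjoint. The difference of a ball and a smaller one inside it
  is the union of the remaining balls of the smaller level, finitely many.\<close>

lemma semiring_padic_balls: "semiring_of_sets UNIV (range (ball_or_empty :: _ \<Rightarrow> (('p::prime_card padic) ^ 'n) set))"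
proof
  let ?G = "range (ball_or_empty :: _ \<Rightarrow> (('p padic) ^ 'n) set)"
  have G: "?G = insert {} {padic_ball a L | a L. True}" by (rule range_ball_or_empty)
  show "?G \<subseteq> Pow UNIV" "{} \<in> ?G" unfolding G by auto
  have nest: "padic_ball a L \<inter> padic_ball b M = {} \<or> padic_ball a L \<subseteq> padic_ball b M \<or> padic_ball b M \<subseteq> padic_ball a L"
    for a b :: "('p padic) ^ 'n" and L M
    using padic_ball_nested[of L M a b] padic_ball_nested[of M L b a] by (cases "L \<le> M") auto
  show "S \<inter> T \<in> ?G" if "S \<in> ?G" "T \<in> ?G" for S T
  proof (cases "S = {} \<or> T = {}")
    case False
    then obtain a L b M where "S = padic_ball a L" "T = padic_ball b M" using \<open>S \<in> ?G\<close> \<open>T \<in> ?G\<close> unfolding G by blast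
    then have "S \<inter> T = {} \<or> S \<inter> T = S \<or> S \<inter> T = T" using nest[of a L b M] by blast
    then show ?thesis using that \<open>{} \<in> ?G\<close> by metis
  qed (auto simp: G)
  show "\<exists>C\<subseteq>?G. finite C \<and> disjoint C \<and> S - T = \<Union>C" if S: "S \<in> ?G" and T: "T \<in> ?G" for S T
  proof (cases "S \<inter> T = {} \<or> S \<subseteq> T")
    case True
    then consider "S - T = S" | "S - T = {}" by blast
    then show ?thesis
    proof cases
      case 1
      then show ?thesis using S by (intro exI[of _ "{S}"]) (auto simp: disjoint_def)
    next
      case 2
      then show ?thesis by (intro exI[of _ "{}"]) (auto simp: disjoint_def)
    qed
  next
    case False
    then obtain a L b M where ab: "S = padic_ball a L" "T = padic_ball b M" using S T unfolding G by blast
    with False have TS: "T \<subseteq> S" using nest[of a L b M] by blast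
    then have LM: "L \<le> M" using ab padic_ball_level_le by blast
    let ?C = "balls_at M S - {T}"
    have "finite (balls_at M S)"
      using balls_at_ball(1)[of L "nat (M - L)" a] LM by (simp add: ab)
    moreover have "disjoint ?C" using disjoint_balls_at by (rule pairwise_subset) auto
    moreover have "?C \<subseteq> ?G" unfolding G balls_at_def by blast
    moreover have "S - T = \<Union>?C"
    proof (intro equalityI subsetI)
      fix x assume x: "x \<in> S - T"
      then have "padic_ball x M \<in> balls_at M S" by (simp add: balls_at_def)
      moreover have "padic_ball x M \<noteq> T" using x center_in_padic_ball by blast
      ultimately show "x \<in> \<Union>?C" using center_in_padic_ball by blast
    next
      fix x assume "x \<in> \<Union>?C"
      then obtain y where y: "y \<in> S" "padic_ball y M \<noteq> T" "x \<in> padic_ball y M" by (auto simp: balls_at_def)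
      then have "x \<notin> T" unfolding ab(2) using padic_ball_eqI by blast
      moreover have "padic_ball y M \<subseteq> S" unfolding ab(1)
        by (rule padic_ball_nested[OF LM]) (use y ab center_in_padic_ball in blast)
      ultimately show "x \<in> S - T" using y by blast
    qed
    ultimately show ?thesis by blast
  qed
qed

lemma sigma_sets_padic_balls:
  "sigma_sets UNIV (range ball_or_empty) = sets (borel :: (('p::prime_card padic) ^ 'n) measure)"
proof -
  let ?G = "range (ball_or_empty :: _ \<Rightarrow> (('p padic) ^ 'n) set)"
  have "S \<in> sigma_sets UNIV ?G" if S: "open S" for S
  proof -
    define C where "C = {B \<in> {padic_ball a L | a L. True}. B \<subseteq> S}"
    have "countable C" unfolding C_def using countable_padic_balls by (rule countable_subset[rotated]) auto
    moreover have "B \<in> sigma_sets UNIV ?G" if "B \<in> C" for B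
      using that unfolding range_ball_or_empty C_def by (auto intro: sigma_sets.Basic)
    ultimately have "\<Union>C \<in> sigma_sets UNIV ?G" by (rule sigma_sets_UNION)
    moreover have "S = \<Union>C"
    proof (intro equalityI subsetI)
      fix x assume "x \<in> S"
      then obtain L where "padic_ball x L \<subseteq> S" using S open_padic_vec_iff by blast
      then show "x \<in> \<Union>C" using center_in_padic_ball[of x L] unfolding C_def by blast
    qed (auto simp: C_def)
    ultimately show ?thesis by simp
  qed
  moreover have "S \<in> sets borel" if "S \<in> ?G" for S
    using that unfolding range_ball_or_empty by auto
  ultimately show ?thesis
    by (auto simp: borel_def intro!: sigma_sets_eqI)
qed

text \<open>Balls and the empty set form an intersection-stable generator, and balls of finite
  measure exhaust the space. Both the translation invariance and the uniqueness of the Haar measure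
  rest on this.\<close>

lemma measure_eqI_padic_balls:
  fixes M N :: "(('p::prime_card padic) ^ 'n) measure"
  assumes "sets M = sets borel" "sets N = sets borel"
    and eq: "\<And>a L. emeasure M (padic_ball a L) = emeasure N (padic_ball a L)"
    and fin: "\<And>L. emeasure M (padic_ball 0 L) \<noteq> \<infinity>"
  shows "M = N"
proof (rule measure_eqI_generator_eq[where \<Omega> = UNIV])
  show "Int_stable (range (ball_or_empty :: _ \<Rightarrow> (('p padic) ^ 'n) set))"
    using semiring_of_sets.Int[OF semiring_padic_balls] unfolding Int_stable_def by blast
  show "emeasure M X = emeasure N X" if "X \<in> range ball_or_empty" for X
    using that eq unfolding range_ball_or_empty by auto
  show "range (\<lambda>n. padic_ball 0 (- int n)) \<subseteq> range (ball_or_empty :: _ \<Rightarrow> (('p padic) ^ 'n) set)"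
    unfolding range_ball_or_empty by auto
qed (use assms UN_padic_ball[of 0] in \<open>simp_all add: sigma_sets_padic_balls\<close>)

text \<open>Caratheodory extension of the volume. A ball is compact and the pieces of a countable
  partition are open, so only finitely many pieces are nonempty and \<open>ball_volume_sum\<close>
  suffices.\<close>

lemma haar_exists:
  obtains M :: "(('p::prime_card padic) ^ 'n) measure" where "sets M = sets borel"
    "\<And>a L. emeasure M (padic_ball a L) = ennreal (ball_volume TYPE('p) TYPE('n) L)"
proof -
  let ?G = "ball_or_empty :: _ \<Rightarrow> (('p padic) ^ 'n) set"
  define \<mu> :: "((('p padic) ^ 'n) \<times> int) option \<Rightarrow> ennreal" where
    "\<mu> j = (case j of None \<Rightarrow> 0 | Some (a, L) \<Rightarrow> ennreal (ball_volume TYPE('p) TYPE('n) L))" for j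
  define M where "M = extend_measure UNIV UNIV ?G \<mu>"
  have "emeasure M (?G i) = \<mu> i" for i
  proof (rule extend_measure_caratheodory[OF M_def UNIV_I semiring_padic_balls])
    show "\<mu> i = 0" if "?G i = {}" for i using that
      by (auto simp: \<mu>_def ball_or_empty_def split: option.splits prod.splits)
    \<comment> \<open>A ball determines its level, so the volume depends on the set alone and not on
      the index.\<close>
    show "\<mu> i = \<mu> j" if "?G i = ?G j" for i j using that padic_ball_level_unique
      by (auto simp: padic_ball_ne[symmetric] \<mu>_def ball_or_empty_def split: option.splits prod.splits)
    fix A :: "nat \<Rightarrow> ((('p padic) ^ 'n) \<times> int) option" and j
    assume dis: "disjoint_family (?G \<circ> A)" and un: "(\<Union>i. ?G (A i)) = ?G j"
    have mu0: "\<mu> (A n) = 0" if "?G (A n) = {}" for n using that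
      by (auto simp: \<mu>_def ball_or_empty_def split: option.splits prod.splits)
    show "(\<Sum>n. \<mu> (A n)) = \<mu> j"
    proof (cases j)
      case None
      then have "?G (A n) = {}" for n using un by (auto simp: ball_or_empty_def)
      then show ?thesis using mu0 None by (simp add: \<mu>_def)
    next
      case (Some aL)
      obtain a L where aL: "aL = (a, L)" by fastforce
      have j: "?G j = padic_ball a L" by (simp add: Some aL ball_or_empty_def)
      have "open (?G i)" for i by (auto simp: ball_or_empty_def split: option.splits prod.splits)
      then obtain F where F: "finite F" "padic_ball a L \<subseteq> (\<Union>n\<in>F. ?G (A n))"
        using compactE_image[OF compact_padic_ball[of a L], of UNIV "\<lambda>n. ?G (A n)"] un j by (metis order_refl)
      define F' where "F' = {n \<in> F. ?G (A n) \<noteq> {}}"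
      have "\<exists>b M. A n = Some (b, M)" if "n \<in> F'" for n
        using that by (auto simp: F'_def ball_or_empty_def split: option.splits)
      then obtain b M where bM: "\<And>n. n \<in> F' \<Longrightarrow> A n = Some (b n, M n)" by metis
      then have GA: "?G (A n) = padic_ball (b n) (M n)" if "n \<in> F'" for n using that by (simp add: ball_or_empty_def)
      have "(\<Union>n\<in>F'. ?G (A n)) = (\<Union>n\<in>F. ?G (A n))" unfolding F'_def by fast
      moreover have "(\<Union>n\<in>F. ?G (A n)) \<subseteq> padic_ball a L"
        unfolding j[symmetric] un[symmetric] by (rule UN_mono) auto
      ultimately have un': "(\<Union>n\<in>F'. ?G (A n)) = padic_ball a L" using F(2) by simp
      \<comment> \<open>A piece outside \<open>F'\<close> is disjoint from pieces that already cover
        the ball, so it is empty.\<close>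
      have "(\<Sum>n. \<mu> (A n)) = (\<Sum>n\<in>F'. \<mu> (A n))"
      proof (rule suminf_finite)
        fix n assume n: "n \<notin> F'"
        have "?G (A n) = {}"
        proof (rule ccontr)
          assume "?G (A n) \<noteq> {}"
          then obtain x where x: "x \<in> ?G (A n)" by blast
          then have "x \<in> padic_ball a L" using un j by blast
          then obtain m where m: "m \<in> F'" "x \<in> ?G (A m)" unfolding un'[symmetric] by (rule UN_E)
          then have "n \<noteq> m" using n by metis
          then have "(?G \<circ> A) n \<inter> (?G \<circ> A) m = {}" using disjoint_family_onD[OF dis UNIV_I UNIV_I] by blast
          then show False using x m(2) by auto
        qed
        then show "\<mu> (A n) = 0" by (rule mu0)
      qed (use F in \<open>simp add: F'_def\<close>)
      also have "\<dots> = ennreal (\<Sum>n\<in>F'. ball_volume TYPE('p) TYPE('n) (M n))"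
        using bM by (simp add: \<mu>_def)
      also have "(\<Sum>n\<in>F'. ball_volume TYPE('p) TYPE('n) (M n)) = ball_volume TYPE('p) TYPE('n) L"
      proof (rule ball_volume_sum)
        show "finite F'" using F by (simp add: F'_def)
        show "disjoint_family_on (\<lambda>i. padic_ball (b i) (M i)) F'"
          using dis GA[symmetric] by (simp add: disjoint_family_on_def)
        show "(\<Union>i\<in>F'. padic_ball (b i) (M i)) = padic_ball a L" using un' GA by auto
      qed
      finally show ?thesis by (simp add: \<mu>_def Some aL)
    qed
  qed simp
  from this[of "Some (a, L)" for a L] have "emeasure M (padic_ball a L) = ennreal (ball_volume TYPE('p) TYPE('n) L)" for a L
    by (simp add: ball_or_empty_def \<mu>_def)
  moreover have "sets M = sets borel"
    unfolding M_def by (subst sets_extend_measure) (auto simp: sigma_sets_padic_balls)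
  ultimately show ?thesis using that by blast
qed

section \<open>Translation invariance and uniqueness\<close>

lemma borel_translate:
  fixes a :: "('p::prime_card padic) ^ 'n"
  shows "(+) a \<in> borel_measurable borel"
proof -
  have "continuous_on UNIV ((+) a)"
    by (auto simp: continuous_on_open_vimage open_padic_vec_iff) 
       (metis (no_types, lifting) image_subset_iff_subset_vimage padic_ball_translate vimageD)
  then show ?thesis by (rule borel_measurable_continuous_onI)
qed

lemma image_translate_eq_vimage: "(+) a ` A = (+) (- a) -` A" for a :: "'a::ab_group_add"
  by (force simp: image_iff)

text \<open>Translates of a ball of level L + k tile the ball of level L, so invariance fixes all
  ratios of volumes and the unit ball fixes the scale. Balls of negative level are refined down to
  level 0.\<close>

lemma translation_invariant_ball:
  fixes M :: "(('p::prime_card padic) ^ 'n) measure"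
  assumes sets: "sets M = sets borel"
    and inv: "\<And>a A. A \<in> sets M \<Longrightarrow> emeasure M ((+) a ` A) = emeasure M A"
    and one: "emeasure M {x. padic_vnorm x \<le> 1} = 1"
  shows "emeasure M (padic_ball a L) = ennreal (ball_volume TYPE('p) TYPE('n) L)"
proof -
  have [measurable]: "padic_ball a L \<in> sets M" for a L by (simp add: sets borel_open)
  have ball_a: "emeasure M (padic_ball a L) = emeasure M (padic_ball 0 L)" for a L
    using inv[of "padic_ball 0 L" a] by (simp add: padic_ball_translate)
  have "{x :: ('p padic) ^ 'n. padic_vnorm x \<le> 1} = padic_ball 0 0" by (auto simp: mem_padic_ball_iff)
  then have one': "emeasure M (padic_ball 0 0) = 1" using one by simp
  have refine: "emeasure M (padic_ball 0 L) = of_nat (CARD('p) ^ (CARD('n) * k)) * emeasure M (padic_ball 0 (L + int k))" for L k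
  proof -
    let ?C = "balls_at (L + int k) (padic_ball (0 :: ('p padic) ^ 'n) L)"
    have sub: "B \<subseteq> padic_ball 0 L" if "B \<in> ?C" for B
      using that padic_ball_nested[of L "L + int k" 0] center_in_padic_ball unfolding balls_at_def by fastforce
    have "padic_ball (0 :: ('p padic) ^ 'n) L = \<Union>?C"
      using sub unfolding balls_at_def by (auto intro!: bexI center_in_padic_ball)
    also have "emeasure M \<dots> = (\<Sum>B\<in>?C. emeasure M B)"
    proof -
      have "disjoint_family_on (\<lambda>B. B) ?C"
        using disjoint_balls_at[of "L + int k" "padic_ball (0 :: ('p padic) ^ 'n) L"]
        by (auto simp: disjoint_family_on_def disjoint_def)
      moreover have "(\<lambda>B. B) ` ?C \<subseteq> sets M" by (auto simp: balls_at_def)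
      ultimately show ?thesis using sum_emeasure[of "\<lambda>B. B" ?C M] balls_at_ball(1)[of L k "0 :: ('p padic) ^ 'n"] by simp
    qed
    also have "\<dots> = (\<Sum>B\<in>?C. emeasure M (padic_ball 0 (L + int k)))"
      by (intro sum.cong) (auto simp: balls_at_def intro: ball_a)
    finally show ?thesis by (simp add: balls_at_ball(2))
  qed
  have v: "ennreal (ball_volume TYPE('p) TYPE('n) L) =
      of_nat (CARD('p) ^ (CARD('n) * k)) * ennreal (ball_volume TYPE('p) TYPE('n) (L + int k))" for L k
    unfolding ball_volume_refine[where L=L and k=k and 'p='p and 'n='n]
    by (subst ennreal_mult) (auto simp: ennreal_of_nat_eq_real_of_nat)
  have v0: "ennreal (ball_volume TYPE('p) TYPE('n) 0) = 1" by (simp add: ball_volume_def)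
  have "emeasure M (padic_ball 0 L) = ennreal (ball_volume TYPE('p) TYPE('n) L)"
  proof (cases "L \<ge> 0")
    case True
    let ?c = "of_nat (CARD('p) ^ (CARD('n) * nat L)) :: ennreal"
    have nz: "?c \<noteq> 0" using one_less_card_prime[where 'p='p] by simp
    have "of_nat (CARD('p) ^ (CARD('n) * nat L)) * emeasure M (padic_ball 0 L)
        = of_nat (CARD('p) ^ (CARD('n) * nat L)) * ennreal (ball_volume TYPE('p) TYPE('n) L)"
      using refine[of 0 "nat L"] v[of 0 "nat L"] one' v0 True by simp
    then show ?thesis
      using nz ennreal_mult_cancel_left[of ?c "emeasure M (padic_ball 0 L)" "ennreal (ball_volume TYPE('p) TYPE('n) L)"]
      by (metis ennreal_of_nat_neq_top)
  next
    case False
    then have "L + int (nat (- L)) = 0" by simp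
    then show ?thesis using refine[of L "nat (- L)"] v[of L "nat (- L)"] one' v0 by (simp only:)
  qed
  then show ?thesis by (simp only: ball_a[of a])
qed

text \<open>This discharges the definite description in \<open>padic_haar\<close>: the measure built
  from ball volumes has the three properties, and any measure with them has the same values on
  balls.\<close>

lemma padic_haar_properties:
  fixes a :: "('p::prime_card padic) ^ 'n" and A :: "(('p padic) ^ 'n) set"
  shows sets_padic_haar [measurable_cong]: "sets padic_haar = sets (borel :: (('p padic) ^ 'n) measure)"
    and padic_haar_translate: "A \<in> sets borel \<Longrightarrow> emeasure padic_haar ((+) a ` A) = emeasure padic_haar A"
    and emeasure_padic_ball: "emeasure padic_haar (padic_ball a L) = ennreal (ball_volume TYPE('p) TYPE('n) L)"
proof -
  let ?P = "\<lambda>M :: (('p padic) ^ 'n) measure. sets M = sets borel \<and>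
     (\<forall>a. \<forall>A\<in>sets M. emeasure M ((+) a ` A) = emeasure M A) \<and>
     emeasure M {x. padic_vnorm x \<le> 1} = 1"
  obtain M :: "(('p padic) ^ 'n) measure" where M: "sets M = sets borel"
    "\<And>a L. emeasure M (padic_ball a L) = ennreal (ball_volume TYPE('p) TYPE('n) L)"
    using haar_exists by blast
  have trans: "emeasure M ((+) a ` A) = emeasure M A" if A: "A \<in> sets M" for a A
  proof -
    have [measurable]: "(+) (- a) \<in> measurable M borel" using borel_translate[of "- a"] M(1) by (simp cong: measurable_cong_sets)
    \<comment> \<open>The translated measure agrees with \<open>M\<close> on balls, and balls
      determine the measure.\<close>
    have "M = distr M borel ((+) (- a))"
    proof (rule measure_eqI_padic_balls)
      show "emeasure M (padic_ball b L) = emeasure (distr M borel ((+) (- a))) (padic_ball b L)" for b L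
      proof -
        have "emeasure (distr M borel ((+) (- a))) (padic_ball b L) = emeasure M ((+) (- a) -` padic_ball b L \<inter> space M)"
          by (rule emeasure_distr) (auto intro: borel_open)
        also have "(+) (- a) -` padic_ball b L \<inter> space M = padic_ball (a + b) L"
          using sets_eq_imp_space_eq[OF M(1)] by (auto simp: image_iff mem_padic_ball_iff algebra_simps)
        finally show ?thesis by (simp only: M)
      qed
    qed (use M in auto)
    then have "emeasure M A = emeasure (distr M borel ((+) (- a))) A" by simp
    also have "\<dots> = emeasure M ((+) (- a) -` A \<inter> space M)"
      using A M by (intro emeasure_distr) auto
    finally show ?thesis using sets_eq_imp_space_eq[OF M(1)] by (simp add: image_translate_eq_vimage)
  qed
  have "{x :: ('p padic) ^ 'n. padic_vnorm x \<le> 1} = padic_ball 0 0" by (auto simp: mem_padic_ball_iff)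
  then have one: "emeasure M {x. padic_vnorm x \<le> 1} = 1" using M(2)[of 0 0] by (simp add: ball_volume_def)
  have PM: "?P M" using M trans one by blast
  have "N = M" if N: "?P N" for N
    by (rule measure_eqI_padic_balls) (use N M translation_invariant_ball[of N] in auto)
  then have eq: "padic_haar = M" unfolding padic_haar_def using PM by (intro the_equality) blast+
  show "sets padic_haar = sets (borel :: (('p padic) ^ 'n) measure)" using eq M by simp
  show "A \<in> sets borel \<Longrightarrow> emeasure padic_haar ((+) a ` A) = emeasure padic_haar A" using eq M trans by simp
  show "emeasure padic_haar (padic_ball a L) = ennreal (ball_volume TYPE('p) TYPE('n) L)" using eq M by simp
qed

lemma space_padic_haar [simp]: "space padic_haar = UNIV"
  using sets_eq_imp_space_eq[OF sets_padic_haar] by simp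

section \<open>Counting eigenvalues of form operators\<close>

text \<open>Gaussian elimination by induction on the equations: an unknown \<open>i0\<close> with a
  nonzero coefficient in equation \<open>b0\<close> is eliminated from the others, which leaves one
  equation and one unknown less.\<close>

lemma homogeneous_system_nontrivial:
  fixes a :: "'b \<Rightarrow> 'i \<Rightarrow> 'c::field"
  assumes "finite B" "finite I" "card B < card I"
  shows "\<exists>c. (\<exists>i\<in>I. c i \<noteq> 0) \<and> (\<forall>b\<in>B. (\<Sum>i\<in>I. c i * a b i) = 0)"
  using assms
proof (induction B arbitrary: I a rule: finite_induct)
  case empty
  then obtain i where "i \<in> I" by fastforce
  then show ?case by (intro exI[of _ "\<lambda>_. 1"]) auto
next
  case (insert b0 B)
  show ?case
  proof (cases "\<forall>i\<in>I. a b0 i = 0")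
    case True
    have "card B < card I" using insert by simp
    then obtain c where "\<exists>i\<in>I. c i \<noteq> 0" "\<forall>b\<in>B. (\<Sum>i\<in>I. c i * a b i) = 0"
      using insert.IH[of I a] insert.prems by blast
    then show ?thesis using True by (intro exI[of _ c]) auto
  next
    case False
    then obtain i0 where i0: "i0 \<in> I" "a b0 i0 \<noteq> 0" by blast
    define J where "J = I - {i0}"
    have J: "finite J" "card B < card J" "i0 \<notin> J" "I = insert i0 J"
      using insert i0 by (auto simp: J_def card_Diff_singleton)
    obtain c where c: "\<exists>i\<in>J. c i \<noteq> 0"
      "\<And>b. b \<in> B \<Longrightarrow> (\<Sum>i\<in>J. c i * (a b i - a b i0 * a b0 i / a b0 i0)) = 0"
      using insert.IH[OF J(1,2), of "\<lambda>b i. a b i - a b i0 * a b0 i / a b0 i0"] by blast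
    \<comment> \<open>The value of the eliminated unknown that solves equation
      \<open>b0\<close>.\<close>
    define c0 where "c0 = - (\<Sum>i\<in>J. c i * a b0 i) / a b0 i0"
    define d where "d = c(i0 := c0)"
    have dJ: "(\<Sum>i\<in>J. d i * h i) = (\<Sum>i\<in>J. c i * h i)" for h
      using J(3) by (intro sum.cong) (auto simp: d_def)
    have "(\<Sum>i\<in>I. d i * a b i) = c0 * a b i0 + (\<Sum>i\<in>J. c i * a b i)" for b
      using J by (simp add: dJ) (simp add: d_def)
    moreover have "c0 * a b0 i0 + (\<Sum>i\<in>J. c i * a b0 i) = 0" using i0 by (simp add: c0_def)
    moreover have "c0 * a b i0 + (\<Sum>i\<in>J. c i * a b i) = 0" if "b \<in> B" for b
    proof -
      have "(\<Sum>i\<in>J. c i * (a b i - a b i0 * a b0 i / a b0 i0))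
          = (\<Sum>i\<in>J. c i * a b i) - (\<Sum>i\<in>J. c i * a b0 i) * (a b i0 / a b0 i0)"
        by (simp add: right_diff_distrib sum_subtractf sum_distrib_right sum_distrib_left sum_divide_distrib mult_ac)
      then show ?thesis using c(2)[OF that] by (simp add: c0_def)
    qed
    moreover have "\<exists>i\<in>I. d i \<noteq> 0" using c(1) J by (auto simp: d_def)
    ultimately show ?thesis by (intro exI[of _ d]) auto
  qed
qed

section \<open>Square-integrable functions and Gram sums\<close>

lemma L2_fun_iff:
  "f \<in> L2_fun M \<longleftrightarrow> f \<in> borel_measurable M \<and> integrable M (\<lambda>x. (cmod (f x))\<^sup>2)"
  unfolding L2_fun_def L2_norm_sq_def
  by (auto simp: integrable_iff_bounded less_top[symmetric])

lemma L2_fun_measurable: "f \<in> L2_fun M \<Longrightarrow> f \<in> borel_measurable M"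
  by (simp add: L2_fun_iff)

lemma L2_norm_sq_eq_integral:
  "f \<in> L2_fun M \<Longrightarrow> L2_norm_sq M f = ennreal (LINT x|M. (cmod (f x))\<^sup>2)"
  unfolding L2_norm_sq_def by (subst nn_integral_eq_integral) (auto simp: L2_fun_iff)

lemma borel_measurable_cnj [measurable (raw)]:
  "f \<in> borel_measurable M \<Longrightarrow> (\<lambda>x. cnj (f x)) \<in> borel_measurable M"
  by (rule measurable_compose[OF _ borel_measurable_continuous_onI[OF continuous_on_cnj[OF continuous_on_id]]])

lemma L2_fun_mult_integrable:
  assumes f: "f \<in> L2_fun M" and g: "g \<in> L2_fun M"
  shows "integrable M (\<lambda>x. f x * cnj (g x))"
proof (rule Bochner_Integration.integrable_bound)
  show "integrable M (\<lambda>x. (cmod (f x))\<^sup>2 + (cmod (g x))\<^sup>2)" using f g by (auto simp: L2_fun_iff)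
  have [measurable]: "f \<in> borel_measurable M" "g \<in> borel_measurable M" using f g by (auto simp: L2_fun_iff)
  show "(\<lambda>x. f x * cnj (g x)) \<in> borel_measurable M" by measurable
  have "a * b \<le> a\<^sup>2 + b\<^sup>2" if "a \<ge> 0" "b \<ge> 0" for a b :: real
    using sum_squares_bound[of a b] that mult_nonneg_nonneg[of a b] by linarith
  then show "AE x in M. norm (f x * cnj (g x)) \<le> norm ((cmod (f x))\<^sup>2 + (cmod (g x))\<^sup>2)"
    by (auto simp: norm_mult)
qed

lemma L2_fun_cmult: "f \<in> L2_fun M \<Longrightarrow> (\<lambda>x. c * f x) \<in> L2_fun M"
  by (auto simp: L2_fun_iff norm_mult power_mult_distrib)

lemma cmod_add_squared_le: "(cmod (a + b))\<^sup>2 \<le> 2 * (cmod a)\<^sup>2 + 2 * (cmod b)\<^sup>2"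
proof -
  have "(cmod (a + b))\<^sup>2 \<le> (cmod a + cmod b)\<^sup>2" by (intro power_mono norm_triangle_ineq) auto
  also have "\<dots> \<le> 2 * (cmod a)\<^sup>2 + 2 * (cmod b)\<^sup>2"
    using sum_squares_bound[of "cmod a" "cmod b"] by (simp add: power2_sum)
  finally show ?thesis .
qed

lemma L2_fun_add:
  assumes f: "f \<in> L2_fun M" and g: "g \<in> L2_fun M"
  shows "(\<lambda>x. f x + g x) \<in> L2_fun M"
proof -
  have [measurable]: "f \<in> borel_measurable M" "g \<in> borel_measurable M" using f g by (auto simp: L2_fun_iff)
  have "integrable M (\<lambda>x. (cmod (f x + g x))\<^sup>2)"
  proof (rule Bochner_Integration.integrable_bound)
    show "integrable M (\<lambda>x. 2 * (cmod (f x))\<^sup>2 + 2 * (cmod (g x))\<^sup>2)" using f g by (auto simp: L2_fun_iff)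
    show "AE x in M. norm ((cmod (f x + g x))\<^sup>2) \<le> norm (2 * (cmod (f x))\<^sup>2 + 2 * (cmod (g x))\<^sup>2)"
      using cmod_add_squared_le by (auto simp: abs_of_nonneg)
  qed measurable
  then show ?thesis by (simp add: L2_fun_iff)
qed

lemma L2_fun_zero: "(\<lambda>_. 0) \<in> L2_fun M"
  by (simp add: L2_fun_iff)

lemma L2_fun_sum: "finite S \<Longrightarrow> (\<And>i. i \<in> S \<Longrightarrow> f i \<in> L2_fun M) \<Longrightarrow> (\<lambda>x. \<Sum>i\<in>S. f i x) \<in> L2_fun M"
  by (induction S rule: finite_induct) (auto simp: L2_fun_zero intro: L2_fun_add)

text \<open>The squared norm of a combination as a Gram sum. It serves for eigenfunctions, for
  \<open>difference_quotient\<close> and for \<open>weighted_fourier\<close>, so that both forms of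
  a combination can be read off from their values on the family.\<close>

lemma L2_norm_sum_expand:
  fixes F :: "'i \<Rightarrow> 'a \<Rightarrow> complex"
  assumes "finite S" "\<And>i. i \<in> S \<Longrightarrow> F i \<in> L2_fun M"
  shows "complex_of_real (LINT x|M. (cmod (\<Sum>i\<in>S. c i * F i x))\<^sup>2)
    = (\<Sum>i\<in>S. \<Sum>j\<in>S. c i * cnj (c j) * (LINT x|M. F i x * cnj (F j x)))"
proof -
  have int: "integrable M (\<lambda>x. c i * cnj (c j) * (F i x * cnj (F j x)))" if "i \<in> S" "j \<in> S" for i j
    using that assms L2_fun_mult_integrable by (intro integrable_mult_right) blast
  have "complex_of_real (LINT x|M. (cmod (\<Sum>i\<in>S. c i * F i x))\<^sup>2)
      = (LINT x|M. complex_of_real ((cmod (\<Sum>i\<in>S. c i * F i x))\<^sup>2))"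
    by (rule integral_complex_of_real[symmetric])
  also have "\<dots> = (LINT x|M. (\<Sum>i\<in>S. \<Sum>j\<in>S. c i * cnj (c j) * (F i x * cnj (F j x))))"
    by (intro Bochner_Integration.integral_cong refl)
      (simp only: complex_norm_square cnj_sum sum_product complex_cnj_mult mult_ac)
  also have "\<dots> = (\<Sum>i\<in>S. \<Sum>j\<in>S. (LINT x|M. c i * cnj (c j) * (F i x * cnj (F j x))))"
    using int by (subst Bochner_Integration.integral_sum; (intro sum.cong refl Bochner_Integration.integral_sum Bochner_Integration.integrable_sum)?)
  finally show ?thesis by simp
qed

section \<open>Reducing the eigenvalue count to independent families\<close>

lemma eigenvalue_count_eq_SUP:
  "eigenvalue_count M A t =
     (SUP T\<in>{T. finite T \<and> T \<subseteq> {..t}}. \<Sum>\<mu>\<in>T. ennreal_of_enat (ae_dim M (eigenspace A \<mu>)))"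
  unfolding eigenvalue_count_def by (intro nonneg_infsum_complete) auto

lemma ae_independent_empty: "ae_independent M {}"
  by (simp add: ae_independent_def)

text \<open>A uniform bound leaves only finitely many cardinalities, so the supremum is a
  maximum.\<close>

lemma ae_dim_attained:
  assumes "\<And>S. finite S \<Longrightarrow> S \<subseteq> V \<Longrightarrow> ae_independent M S \<Longrightarrow> card S \<le> K"
  obtains S where "finite S" "S \<subseteq> V" "ae_independent M S" "ae_dim M V = enat (card S)"
proof -
  let ?\<A> = "{S. finite S \<and> S \<subseteq> V \<and> ae_independent M S}"
  let ?E = "(\<lambda>S. enat (card S)) ` ?\<A>"
  have "?E \<subseteq> enat ` {..K}" using assms by auto
  then have fin: "finite ?E" by (rule finite_subset) auto
  have "{} \<in> ?\<A>" by (simp add: ae_independent_empty)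
  then have ne: "?E \<noteq> {}" by blast
  have "ae_dim M V = Max ?E" unfolding ae_dim_def Sup_enat_def using fin ne by presburger
  then have "ae_dim M V \<in> ?E" using Max_in[OF fin ne] by simp
  then show ?thesis using that by blast
qed

text \<open>The hypothesis acts twice: for singletons \<open>T\<close> it bounds every eigenspace,
  so that its dimension is attained by a finite set, and then it bounds these sets together.\<close>

lemma eigenvalue_count_leI:
  assumes "\<And>T S. finite T \<Longrightarrow> T \<subseteq> {..t} \<Longrightarrow>
    (\<And>\<mu>. \<mu> \<in> T \<Longrightarrow> finite (S \<mu>) \<and> S \<mu> \<subseteq> eigenspace A \<mu> \<and> ae_independent M (S \<mu>)) \<Longrightarrow>
    (\<Sum>\<mu>\<in>T. card (S \<mu>)) \<le> K"
  shows "eigenvalue_count M A t \<le> of_nat K"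
  unfolding eigenvalue_count_eq_SUP
proof (rule SUP_least, clarify)
  fix T :: "real set" assume T: "finite T" "T \<subseteq> {..t}"
  have "\<exists>S. finite S \<and> S \<subseteq> eigenspace A \<mu> \<and> ae_independent M S \<and>
      ae_dim M (eigenspace A \<mu>) = enat (card S)" if \<mu>: "\<mu> \<in> T" for \<mu>
  proof -
    have "card S \<le> K" if "finite S" "S \<subseteq> eigenspace A \<mu>" "ae_independent M S" for S
      using assms[of "{\<mu>}" "\<lambda>_. S"] \<mu> T that by auto
    then obtain S where "finite S" "S \<subseteq> eigenspace A \<mu>" "ae_independent M S"
      "ae_dim M (eigenspace A \<mu>) = enat (card S)"
      by (rule ae_dim_attained[of "eigenspace A \<mu>" M K])
    then show ?thesis by blast
  qed
  then obtain S where S: "\<And>\<mu>. \<mu> \<in> T \<Longrightarrow> finite (S \<mu>) \<and> S \<mu> \<subseteq> eigenspace A \<mu> \<and> ae_independent M (S \<mu>)"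
    "\<And>\<mu>. \<mu> \<in> T \<Longrightarrow> ae_dim M (eigenspace A \<mu>) = enat (card (S \<mu>))" by metis
  have "(\<Sum>\<mu>\<in>T. ennreal_of_enat (ae_dim M (eigenspace A \<mu>))) = (\<Sum>\<mu>\<in>T. of_nat (card (S \<mu>)))"
    using S(2) by (intro sum.cong) auto
  also have "\<dots> = of_nat (\<Sum>\<mu>\<in>T. card (S \<mu>))" by simp
  also have "\<dots> \<le> of_nat K" using assms[OF T S(1)] by (intro of_nat_mono)
  finally show "(\<Sum>\<mu>\<in>T. ennreal_of_enat (ae_dim M (eigenspace A \<mu>))) \<le> of_nat K" .
qed

text \<open>The index set is sorted by the eigenvalue \<open>\<mu> i\<close>, and each class is an
  independent set in one eigenspace. Independence is assumed for the indexed family, which forces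
  \<open>f\<close> to be injective.\<close>

lemma eigenvalue_count_geI:
  fixes f :: "'i \<Rightarrow> 'a \<Rightarrow> complex"
  assumes I: "finite I" and le: "\<And>i. i \<in> I \<Longrightarrow> \<mu> i \<le> t" and eig: "\<And>i. i \<in> I \<Longrightarrow> f i \<in> eigenspace A (\<mu> i)"
    and ind: "\<And>c i. (AE x in M. (\<Sum>i\<in>I. c i * f i x) = 0) \<Longrightarrow> i \<in> I \<Longrightarrow> c i = 0"
  shows "of_nat (card I) \<le> eigenvalue_count M A t"
proof -
  have inj: "inj_on f I"
  proof (rule inj_onI, rule ccontr)
    fix i j assume ij: "i \<in> I" "j \<in> I" "f i = f j" "i \<noteq> j"
    \<comment> \<open>The coefficients 1 at \<open>i\<close> and -1 at \<open>j\<close> would be a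
      nontrivial relation if both indices had the same function.\<close>
    define c :: "'i \<Rightarrow> complex" where "c k = (if k = i then 1 else 0) - (if k = j then 1 else 0)" for k
    have "(\<Sum>k\<in>I. c k * f k x) = f i x - f j x" for x
      using I ij by (simp add: c_def left_diff_distrib sum_subtractf if_distrib[of "\<lambda>y. y * _"] cong: if_cong)
    then have "(\<Sum>k\<in>I. c k * f k x) = 0" for x using ij by simp
    then have "c i = 0" using ij by (intro ind[of c i]) auto
    then show False using ij by (simp add: c_def)
  qed
  let ?S = "\<lambda>\<nu>. f ` {i \<in> I. \<mu> i = \<nu>}"
  have dim: "of_nat (card {i \<in> I. \<mu> i = \<nu>}) \<le> ennreal_of_enat (ae_dim M (eigenspace A \<nu>))" for \<nu>
  proof -
    have "ae_independent M (?S \<nu>)"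
      unfolding ae_independent_def
    proof (intro allI impI ballI)
      fix c g assume ae: "AE x in M. (\<Sum>f\<in>?S \<nu>. c f * f x) = 0" and g: "g \<in> ?S \<nu>"
      define d where "d i = (if \<mu> i = \<nu> then c (f i) else 0)" for i
      have "(\<Sum>f\<in>?S \<nu>. c f * f x) = (\<Sum>i\<in>I. d i * f i x)" for x
      proof -
        have "(\<Sum>f\<in>?S \<nu>. c f * f x) = (\<Sum>i | i \<in> I \<and> \<mu> i = \<nu>. c (f i) * f i x)"
          using inj by (subst sum.reindex) (auto simp: inj_on_def)
        also have "\<dots> = (\<Sum>i\<in>I. d i * f i x)"
          using I by (intro sum.mono_neutral_cong_left) (auto simp: d_def)
        finally show ?thesis .
      qed
      then have d0: "d i = 0" if "i \<in> I" for i using ind[of d i] ae that by simp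
      obtain i where "i \<in> I" "\<mu> i = \<nu>" "g = f i" using g by blast
      then show "c g = 0" using d0[of i] by (simp add: d_def)
    qed
    then have "enat (card (?S \<nu>)) \<le> ae_dim M (eigenspace A \<nu>)"
      unfolding ae_dim_def using I eig by (intro SUP_upper) auto
    then have "ennreal_of_enat (enat (card (?S \<nu>))) \<le> ennreal_of_enat (ae_dim M (eigenspace A \<nu>))"
      by (simp only: ennreal_of_enat_le_iff)
    moreover have "card (?S \<nu>) = card {i \<in> I. \<mu> i = \<nu>}"
      using inj by (intro card_image) (auto simp: inj_on_def)
    ultimately show ?thesis by simp
  qed
  have "card I = (\<Sum>\<nu>\<in>\<mu> ` I. card {i \<in> I. \<mu> i = \<nu>})"
    using I sum.image_gen[of I "\<lambda>_. 1::nat" \<mu>] by simp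
  then have "of_nat (card I) = (\<Sum>\<nu>\<in>\<mu> ` I. of_nat (card {i \<in> I. \<mu> i = \<nu>}) :: ennreal)" by simp
  also have "\<dots> \<le> (\<Sum>\<nu>\<in>\<mu> ` I. ennreal_of_enat (ae_dim M (eigenspace A \<nu>)))"
    by (intro sum_mono dim)
  also have "\<dots> \<le> eigenvalue_count M A t"
    unfolding eigenvalue_count_eq_SUP using I le by (intro SUP_upper) auto
  finally show ?thesis .
qed

text \<open>If finitely many linear conditions force the form above a level \<open>\<kappa> > t\<close>, then a larger
  independent family of eigenfunctions with eigenvalues at most \<open>t\<close> would have a nontrivial
  combination that satisfies all conditions, although its form is at most \<open>t\<close> times its norm.\<close>

lemma eigenvalue_count_form_operator_le:
  fixes Q :: "('a \<Rightarrow> complex) \<Rightarrow> ('a \<Rightarrow> complex) \<Rightarrow> complex" and l :: "'b \<Rightarrow> ('a \<Rightarrow> complex) \<Rightarrow> complex"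
  assumes D: "D \<subseteq> L2_fun M"
    and herm: "\<And>u v. u \<in> D \<Longrightarrow> v \<in> D \<Longrightarrow> Q v u = cnj (Q u v)"
    and B: "finite B" and t: "t < \<kappa>"
    and coercive: "\<And>S c. finite S \<Longrightarrow> S \<subseteq> D \<Longrightarrow> (\<And>b. b \<in> B \<Longrightarrow> (\<Sum>f\<in>S. c f * l b f) = 0) \<Longrightarrow>
      \<kappa> * (LINT x|M. (cmod (\<Sum>f\<in>S. c f * f x))\<^sup>2) \<le> Re (\<Sum>f\<in>S. \<Sum>g\<in>S. c f * cnj (c g) * Q f g)"
  shows "eigenvalue_count M (form_operator M D Q) t \<le> of_nat (card B)"
proof (rule eigenvalue_count_leI, rule ccontr)
  fix T S
  assume T: "finite T" "T \<subseteq> {..t}" and S: "\<And>\<mu>. \<mu> \<in> T \<Longrightarrow> finite (S \<mu>) \<and>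
    S \<mu> \<subseteq> eigenspace (form_operator M D Q) \<mu> \<and> ae_independent M (S \<mu>)"
    and gt: "\<not> (\<Sum>\<mu>\<in>T. card (S \<mu>)) \<le> card B"
  define ip where "ip f g = (LINT x|M. f x * cnj (g x))" for f g :: "'a \<Rightarrow> complex"
  have ip_cnj: "ip g f = cnj (ip f g)" for f g
    using integral_bounded_linear'[OF bounded_linear_cnj bounded_linear_cnj, of M "\<lambda>x. f x * cnj (g x)"]
    by (simp add: ip_def mult.commute)
  have SD: "f \<in> D" if "\<mu> \<in> T" "f \<in> S \<mu>" for f \<mu>
    using S[OF that(1)] that(2) by (auto simp: eigenspace_def form_operator_def)
  have Q: "Q f g = of_real \<mu> * ip f g" if "\<mu> \<in> T" "f \<in> S \<mu>" "g \<in> D" for f g \<mu>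
  proof -
    have "Q f g = (LINT x|M. of_real \<mu> * f x * cnj (g x))"
      using S[OF that(1)] that(2,3) by (auto simp: eigenspace_def form_operator_def)
    then show ?thesis by (simp add: ip_def mult.assoc)
  qed
  \<comment> \<open>Hermitian symmetry gives \<mu> <f, g> = \<nu> <f, g> with real \<mu> and
    \<nu>.\<close>
  have orth: "ip f g = 0" if "\<mu> \<in> T" "\<nu> \<in> T" "\<mu> \<noteq> \<nu>" "f \<in> S \<mu>" "g \<in> S \<nu>" for f g \<mu> \<nu>
  proof -
    have "of_real \<nu> * cnj (ip f g) = cnj (of_real \<mu> * ip f g)"
      using Q[OF that(2,5) SD[OF that(1,4)]] Q[OF that(1,4) SD[OF that(2,5)]]
        herm[OF SD[OF that(1,4)] SD[OF that(2,5)]] ip_cnj by metis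
    then show ?thesis using that(3) by simp
  qed
  \<comment> \<open>A common element would be orthogonal to itself, hence zero almost everywhere,
    against independence. Thus the cardinalities add up in the union \<open>U\<close>.\<close>
  have disj: "S \<mu> \<inter> S \<nu> = {}" if mn: "\<mu> \<in> T" "\<nu> \<in> T" "\<mu> \<noteq> \<nu>" for \<mu> \<nu>
  proof (rule ccontr)
    assume "S \<mu> \<inter> S \<nu> \<noteq> {}"
    then obtain f where f: "f \<in> S \<mu>" "f \<in> S \<nu>" by blast
    have fL2: "f \<in> L2_fun M" using SD[OF mn(1) f(1)] D by blast
    have "ip f f = of_real (LINT x|M. (cmod (f x))\<^sup>2)"
      unfolding ip_def integral_complex_of_real[symmetric] complex_norm_square by simp
    then have "(LINT x|M. (cmod (f x))\<^sup>2) = 0" using orth[OF mn f] by simp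
    then have "AE x in M. (cmod (f x))\<^sup>2 = 0"
      using fL2 by (subst (asm) integral_nonneg_eq_0_iff_AE) (auto simp: L2_fun_iff)
    then have "AE x in M. (\<Sum>g\<in>S \<mu>. (if g = f then 1 else 0) * g x) = 0"
      using f S[OF mn(1)] by (auto simp: if_distrib[of "\<lambda>y. y * _"] cong: if_cong)
    moreover have "\<forall>f\<in>S \<mu>. d f = 0" if "AE x in M. (\<Sum>g\<in>S \<mu>. d g * g x) = 0" for d
      using S[OF mn(1)] that unfolding ae_independent_def by blast
    ultimately show False using f(1) by fastforce
  qed
  define U where "U = (\<Union>\<mu>\<in>T. S \<mu>)"
  have U: "finite U" using T S by (auto simp: U_def)
  have sumU: "(\<Sum>f\<in>U. h f) = (\<Sum>\<mu>\<in>T. \<Sum>f\<in>S \<mu>. h f)" for h :: "('a \<Rightarrow> complex) \<Rightarrow> complex"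
    unfolding U_def using T S disj by (intro sum.UNION_disjoint) auto
  have "card U = (\<Sum>\<mu>\<in>T. card (S \<mu>))"
    unfolding U_def using T S disj by (intro card_UN_disjoint) auto
  then have "card B < card U" using gt by simp
  then obtain c where c: "\<exists>f\<in>U. c f \<noteq> 0" "\<And>b. b \<in> B \<Longrightarrow> (\<Sum>f\<in>U. c f * l b f) = 0"
    using homogeneous_system_nontrivial[OF B U, of l] by blast
  have UD: "U \<subseteq> D" using SD by (auto simp: U_def)
  define n where "n \<mu> = (LINT x|M. (cmod (\<Sum>f\<in>S \<mu>. c f * f x))\<^sup>2)" for \<mu>
  have n: "complex_of_real (n \<mu>) = (\<Sum>f\<in>S \<mu>. \<Sum>g\<in>S \<mu>. c f * cnj (c g) * ip f g)" if "\<mu> \<in> T" for \<mu>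
    unfolding n_def ip_def using S[OF that] SD[OF that] D by (intro L2_norm_sum_expand[where F = "\<lambda>f. f"]) auto
  \<comment> \<open>Orthogonality makes the Gram matrix block diagonal, one block for each
    eigenvalue.\<close>
  have inner: "(\<Sum>g\<in>U. c f * cnj (c g) * ip f g) = (\<Sum>g\<in>S \<mu>. c f * cnj (c g) * ip f g)"
    if "\<mu> \<in> T" "f \<in> S \<mu>" for \<mu> f
    using that U orth by (intro sum.mono_neutral_right) (fastforce simp: U_def)+
  have "complex_of_real (LINT x|M. (cmod (\<Sum>f\<in>U. c f * f x))\<^sup>2) = (\<Sum>f\<in>U. \<Sum>g\<in>U. c f * cnj (c g) * ip f g)"
    unfolding ip_def using U UD D by (intro L2_norm_sum_expand[where F = "\<lambda>f. f"]) auto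
  also have "\<dots> = (\<Sum>\<mu>\<in>T. complex_of_real (n \<mu>))"
    unfolding sumU by (intro sum.cong refl) (simp add: n sumU[symmetric] inner)
  also have "\<dots> = complex_of_real (\<Sum>\<mu>\<in>T. n \<mu>)" by simp
  finally have norm: "(LINT x|M. (cmod (\<Sum>f\<in>U. c f * f x))\<^sup>2) = (\<Sum>\<mu>\<in>T. n \<mu>)"
    by (simp only: of_real_eq_iff)
  have "(\<Sum>f\<in>U. \<Sum>g\<in>U. c f * cnj (c g) * Q f g) = (\<Sum>\<mu>\<in>T. \<Sum>f\<in>S \<mu>. \<Sum>g\<in>U. c f * cnj (c g) * Q f g)"
    by (rule sumU)
  also have "\<dots> = (\<Sum>\<mu>\<in>T. \<Sum>f\<in>S \<mu>. \<Sum>g\<in>U. of_real \<mu> * (c f * cnj (c g) * ip f g))"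
    using UD by (intro sum.cong refl) (auto simp: Q)
  also have "\<dots> = (\<Sum>\<mu>\<in>T. complex_of_real (\<mu> * n \<mu>))"
    by (intro sum.cong refl) (simp add: n inner sum_distrib_left[symmetric])
  finally have form: "Re (\<Sum>f\<in>U. \<Sum>g\<in>U. c f * cnj (c g) * Q f g) = (\<Sum>\<mu>\<in>T. \<mu> * n \<mu>)" by simp
  have n0: "n \<mu> \<ge> 0" for \<mu> unfolding n_def by simp
  have "\<kappa> * (\<Sum>\<mu>\<in>T. n \<mu>) \<le> (\<Sum>\<mu>\<in>T. \<mu> * n \<mu>)"
    using coercive[OF U UD c(2)] unfolding norm form by blast
  also have "\<dots> \<le> (\<Sum>\<mu>\<in>T. t * n \<mu>)" using T n0 by (intro sum_mono mult_right_mono) auto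
  finally have "\<kappa> * (\<Sum>\<mu>\<in>T. n \<mu>) \<le> t * (\<Sum>\<mu>\<in>T. n \<mu>)" by (simp add: sum_distrib_left)
  \<comment> \<open>As \<open>\<kappa>\<close> exceeds \<open>t\<close>, every component of the
    combination has norm zero; the component with a nonzero coefficient then contradicts
    independence inside its eigenspace.\<close>
  then have "(\<kappa> - t) * (\<Sum>\<mu>\<in>T. n \<mu>) \<le> 0" by (simp add: left_diff_distrib)
  then have "(\<Sum>\<mu>\<in>T. n \<mu>) = 0"
    using t sum_nonneg[of T n] n0 by (simp add: mult_le_0_iff)
  then have nz: "n \<mu> = 0" if "\<mu> \<in> T" for \<mu> using that T n0 sum_nonneg_eq_0_iff[of T n] by auto
  obtain f where "f \<in> U" and cf: "c f \<noteq> 0" using c(1) by blast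
  then obtain \<mu> where \<mu>: "\<mu> \<in> T" "f \<in> S \<mu>" by (auto simp: U_def)
  have "(\<lambda>x. \<Sum>f\<in>S \<mu>. c f * f x) \<in> L2_fun M"
    using S[OF \<mu>(1)] SD[OF \<mu>(1)] D by (intro L2_fun_sum L2_fun_cmult) auto
  then have "AE x in M. (cmod (\<Sum>f\<in>S \<mu>. c f * f x))\<^sup>2 = 0"
    using nz[OF \<mu>(1)] unfolding n_def by (subst (asm) integral_nonneg_eq_0_iff_AE) (auto simp: L2_fun_iff)
  then have "AE x in M. (\<Sum>f\<in>S \<mu>. c f * f x) = 0" by simp
  then show False using S[OF \<mu>(1)] \<mu>(2) cf unfolding ae_independent_def by blast
qed

section \<open>Bounded sets and counting of balls\<close>

lemma sigma_finite_padic_haar: "sigma_finite_measure (padic_haar :: (('p::prime_card padic) ^ 'n) measure)"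
proof
  show "\<exists>A::(('p padic) ^ 'n) set set. countable A \<and> A \<subseteq> sets padic_haar \<and> \<Union>A = space padic_haar \<and>
      (\<forall>a\<in>A. emeasure padic_haar a \<noteq> \<infinity>)"
    by (intro exI[of _ "range (\<lambda>n::nat. padic_ball 0 (- int n))"])
       (auto simp: UN_padic_ball emeasure_padic_ball sets_padic_haar borel_open)
qed

lemma padic_ball_in_sets [measurable, simp]: "padic_ball a L \<in> sets borel"
  by (simp add: borel_open)

text \<open>The level has the form \<open>L - int k\<close> so that \<open>balls_at_ball\<close>
  counts the subballs of the given level \<open>L\<close>.\<close>

lemma bounded_subset_padic_ball:
  fixes S :: "(('p::prime_card padic) ^ 'n) set"
  assumes "bounded S"
  obtains k :: nat where "S \<subseteq> padic_ball 0 (L - int k)"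
proof -
  obtain r where r: "\<And>x. x \<in> S \<Longrightarrow> padic_vnorm x \<le> r" using assms bounded_padic_vec_iff by blast
  have pos: "real CARD('p) powi (- L) > 0" using one_less_card_prime[where 'p='p] by simp
  obtain k where k: "r / real CARD('p) powi (- L) < real CARD('p) ^ k"
    using real_arch_pow[OF one_less_card_prime[where 'p='p]] by blast
  have "real CARD('p) powi (- (L - int k)) = real CARD('p) ^ k * real CARD('p) powi (- L)"
    using one_less_card_prime[where 'p='p] by (simp add: power_int_diff power_int_minus field_simps)
  then have "r \<le> real CARD('p) powi (- (L - int k))" using k pos by (simp add: divide_less_eq)
  then have "S \<subseteq> padic_ball 0 (L - int k)" using order_trans[OF r] by (auto simp: mem_padic_ball_iff)
  then show ?thesis by (rule that)
qed

lemma finite_balls_at: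
  assumes "bounded (S :: (('p::prime_card padic) ^ 'n) set)"
  shows "finite (balls_at L S)"
proof -
  obtain k :: nat where "S \<subseteq> padic_ball 0 (L - int k)" using bounded_subset_padic_ball[OF assms] .
  then have "balls_at L S \<subseteq> balls_at ((L - int k) + int k) (padic_ball 0 (L - int k))"
    by (auto simp: balls_at_def)
  then show ?thesis using balls_at_ball(1) finite_subset by blast
qed

lemma emeasure_Union_balls_at:
  fixes S :: "(('p::prime_card padic) ^ 'n) set"
  assumes "bounded S"
  shows "emeasure padic_haar (\<Union>(balls_at L S)) = ennreal (real (card (balls_at L S)) * ball_volume TYPE('p) TYPE('n) L)"
proof -
  let ?C = "balls_at L S"
  have "disjoint_family_on (\<lambda>B. B) ?C"
    using disjoint_balls_at[of L S] by (auto simp: disjoint_family_on_def disjoint_def)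
  moreover have "(\<lambda>B. B) ` ?C \<subseteq> sets padic_haar" by (auto simp: balls_at_def sets_padic_haar)
  ultimately have "emeasure padic_haar (\<Union>?C) = (\<Sum>B\<in>?C. emeasure padic_haar B)"
    using sum_emeasure[of "\<lambda>B. B" ?C padic_haar] finite_balls_at[OF assms] by simp
  also have "\<dots> = (\<Sum>B\<in>?C. ennreal (ball_volume TYPE('p) TYPE('n) L))"
    by (intro sum.cong) (auto simp: balls_at_def emeasure_padic_ball)
  finally show ?thesis by (simp add: ennreal_mult ennreal_of_nat_eq_real_of_nat)
qed

section \<open>Measurability and ultrametric geometry of the distance\<close>

lemma padic_vnorm_triangle: "padic_vnorm (x + y) \<le> padic_vnorm x + padic_vnorm y"
  using padic_vnorm_ultra[of x y] padic_vnorm_nonneg[of x] padic_vnorm_nonneg[of y] by linarith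

lemma padic_vnorm_abs_diff_le: "\<bar>padic_vnorm x - padic_vnorm y\<bar> \<le> padic_vnorm (x - y)"
  using padic_vnorm_triangle[of "x - y" y] padic_vnorm_triangle[of "y - x" x] padic_vnorm_minus_commute[of x y]
  by simp

lemma padic_vnorm_diff_le_dist: "padic_vnorm (x - y) \<le> dist x y"
  unfolding padic_vnorm_le_iff using dist_vec_nth_le[of x _ y] by (simp add: dist_padic_def)

lemma continuous_on_padic_vnorm_diff:
  "continuous_on UNIV (\<lambda>z :: (('p::prime_card padic) ^ 'n) \<times> (('p padic) ^ 'n). padic_vnorm (fst z - snd z))"
  unfolding continuous_on_iff
proof (intro ballI allI impI)
  fix z :: "(('p padic) ^ 'n) \<times> (('p padic) ^ 'n)" and e :: real assume e: "e > 0"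
  have "dist (padic_vnorm (fst w - snd w)) (padic_vnorm (fst z - snd z)) < e" if "dist w z < e" for w
  proof -
    have "dist (padic_vnorm (fst w - snd w)) (padic_vnorm (fst z - snd z))
        \<le> padic_vnorm ((fst w - fst z) + - (snd w - snd z))"
      using padic_vnorm_abs_diff_le[of "fst w - snd w" "fst z - snd z"] by (simp add: dist_real_def algebra_simps)
    also have "\<dots> \<le> max (padic_vnorm (fst w - fst z)) (padic_vnorm (snd w - snd z))"
      using padic_vnorm_ultra[of "fst w - fst z" "- (snd w - snd z)"] unfolding padic_vnorm_minus .
    also have "\<dots> \<le> dist w z"
      using padic_vnorm_diff_le_dist[of "fst w" "fst z"] padic_vnorm_diff_le_dist[of "snd w" "snd z"]
        dist_fst_le[of w z] dist_snd_le[of w z] by simp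
    finally show ?thesis using that by simp
  qed
  then show "\<exists>d>0. \<forall>w\<in>UNIV. dist w z < d \<longrightarrow>
      dist (padic_vnorm (fst w - snd w)) (padic_vnorm (fst z - snd z)) < e" using e by blast
qed

lemma borel_measurable_padic_vnorm_diff [measurable (raw)]:
  fixes f g :: "'a \<Rightarrow> ('p::prime_card padic) ^ 'n"
  assumes [measurable]: "f \<in> borel_measurable N" "g \<in> borel_measurable N"
  shows "(\<lambda>x. padic_vnorm (f x - g x)) \<in> borel_measurable N"
proof -
  have "(\<lambda>x. (f x, g x)) \<in> measurable N borel" by (simp add: borel_prod[symmetric])
  from measurable_compose[OF this borel_measurable_continuous_onI[OF continuous_on_padic_vnorm_diff]]
  show ?thesis by simp
qed

text \<open>Isosceles triangle principle: \<open>x - y\<close> is strictly shorter than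
  \<open>x - z\<close>, so the two remaining sides agree.\<close>

lemma padic_vnorm_eq_outside_ball:
  assumes "y \<in> padic_ball x L" "z \<notin> padic_ball x L"
  shows "padic_vnorm (x - z) = padic_vnorm (y - z)"
proof -
  have "padic_vnorm (x - y) < padic_vnorm (x - z)"
    using assms padic_vnorm_minus_commute[of x y] padic_vnorm_minus_commute[of x z] by (simp add: mem_padic_ball_iff)
  then show ?thesis
    using padic_vnorm_diff_ultra[of x z y] padic_vnorm_diff_ultra[of y z x] padic_vnorm_minus_commute[of x y]
    by (auto simp: max_def split: if_splits)
qed

section \<open>Truncated Riesz kernels\<close>

text \<open>The kernel is cut off at the radius of a ball of level \<open>J\<close>, which makes it bounded and
  constant on products of such balls.\<close>

definition trunc_kernel :: "real \<Rightarrow> int \<Rightarrow> ('p::prime_card padic) ^ 'n \<Rightarrow> real" where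
  "trunc_kernel s J z = 1 / max (padic_vnorm z) (real CARD('p) powi (- J)) powr s"

lemma trunc_kernel_nonneg [simp]: "0 \<le> trunc_kernel s J z"
  by (simp add: trunc_kernel_def)

lemma powi_pos_prime [simp]: "0 < real CARD('p::prime_card) powi k"
  using one_less_card_prime[where 'p='p] by simp

lemma trunc_radius_pos: "0 < max (padic_vnorm (z :: ('p::prime_card padic) ^ 'n)) (real CARD('p) powi k)"
  using powi_pos_prime[where 'p='p and k=k] by linarith

lemma trunc_kernel_le:
  assumes "s \<ge> 0"
  shows "trunc_kernel s J (z :: ('p::prime_card padic) ^ 'n) \<le> 1 / (real CARD('p) powi (- J)) powr s"
  unfolding trunc_kernel_def using assms powi_pos_prime[where 'p='p and k="- J"] trunc_radius_pos[of z "- J"]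
  by (intro divide_left_mono powr_mono2 mult_pos_pos) (auto simp: less_imp_le)

lemma trunc_kernel_le_kernel:
  assumes "s \<ge> 0" "z \<noteq> 0"
  shows "trunc_kernel s J (z :: ('p::prime_card padic) ^ 'n) \<le> 1 / padic_vnorm z powr s"
proof -
  have "padic_vnorm z > 0" using assms padic_vnorm_nonneg[of z] padic_vnorm_eq_0_iff[of z] by linarith
  then show ?thesis unfolding trunc_kernel_def using assms
    by (intro divide_left_mono powr_mono2 mult_pos_pos) (auto simp: less_max_iff_disj)
qed

lemma trunc_kernel_eq_kernel:
  "real CARD('p) powi (- J) \<le> padic_vnorm z \<Longrightarrow>
    trunc_kernel s J (z :: ('p::prime_card padic) ^ 'n) = 1 / padic_vnorm z powr s"
  by (simp add: trunc_kernel_def max_def)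

lemma trunc_kernel_commute: "trunc_kernel s J (x - y) = trunc_kernel s J (y - x)"
  by (simp add: trunc_kernel_def padic_vnorm_minus_commute)

text \<open>For \<open>z\<close> in the ball both distances are at most the cut-off radius; for
  \<open>z\<close> outside, both distances coincide.\<close>

lemma trunc_kernel_const:
  fixes x y :: "('p::prime_card padic) ^ 'n"
  assumes y: "y \<in> padic_ball x J"
  shows "trunc_kernel s J (x - z) = trunc_kernel s J (y - z)"
proof (cases "z \<in> padic_ball x J")
  case True
  then have "z \<in> padic_ball y J" using y padic_ball_eqI by blast
  then have "padic_vnorm (x - z) \<le> real CARD('p) powi (- J)" "padic_vnorm (y - z) \<le> real CARD('p) powi (- J)"
    using True by (auto simp: mem_padic_ball_iff padic_vnorm_minus_commute)
  then show ?thesis by (simp add: trunc_kernel_def max_def)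
qed (simp add: trunc_kernel_def padic_vnorm_eq_outside_ball[OF y])

lemma borel_measurable_trunc_kernel [measurable (raw)]:
  fixes f g :: "'a \<Rightarrow> ('p::prime_card padic) ^ 'n"
  assumes [measurable]: "f \<in> borel_measurable N" "g \<in> borel_measurable N"
  shows "(\<lambda>x. trunc_kernel s J (f x - g x)) \<in> borel_measurable N"
  unfolding trunc_kernel_def by measurable

text \<open>The kernel is a geometric superposition of indicators of balls around the origin.\<close>

lemma trunc_kernel_series:
  fixes z :: "('p::prime_card padic) ^ 'n"
  assumes s: "s > 0"
  defines "r \<equiv> real CARD('p) powr (- s)"
  shows "ennreal (trunc_kernel s J z) =
    (\<Sum>i. ennreal (real CARD('p) powr (s * J) * r ^ i * (1 - r)) * indicator (padic_ball 0 (J - int i)) z)"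
proof -
  let ?P = "real CARD('p)"
  have P: "?P > 1" by (rule one_less_card_prime)
  have r: "0 < r" "r < 1" using P s by (auto simp: r_def powr_less_one)
  \<comment> \<open>\<open>j\<close> is the index of the first ball that contains \<open>z\<close>;
    it is 0 when the cut-off is active.\<close>
  obtain j :: nat where j: "max (padic_vnorm z) (?P powi (- J)) = ?P powi (int j - J)"
    "\<And>i::nat. z \<in> padic_ball 0 (J - int i) \<longleftrightarrow> j \<le> i"
  proof (cases "padic_vnorm z \<le> ?P powi (- J)")
    case True
    have "z \<in> padic_ball 0 (J - int i)" for i :: nat
      using True power_int_le_iff[OF P, of "- J" "int i - J"] by (simp add: mem_padic_ball_iff)
    then show ?thesis using that[of 0] True by (simp add: max_def)
  next
    case False
    then have "padic_vnorm z \<noteq> 0" by (metis less_imp_le powi_pos_prime)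
    then have "z \<noteq> 0" by simp
    then obtain k where k: "padic_vnorm z = ?P powi k" by (rule padic_vnorm_discrete)
    then have "- J < k" using False power_int_le_iff[OF P, of k "- J"] by simp
    then have jk: "int (nat (k + J)) - J = k" by simp
    have "z \<in> padic_ball 0 (J - int i) \<longleftrightarrow> nat (k + J) \<le> i" for i
      using power_int_le_iff[OF P, of k "int i - J"] by (auto simp: mem_padic_ball_iff k)
    then show ?thesis using that[of "nat (k + J)"] False k jk by (simp add: max_def)
  qed
  \<comment> \<open>The weight \<open>c i\<close> is the drop of the kernel from radius p^(i-J) to
    radius p^(i+1-J), so the weights from \<open>j\<close> on telescope to the kernel at radius
    p^(j-J).\<close>
  define c where "c i = ?P powr (s * J) * r ^ i * (1 - r)" for i
  have c0: "c i \<ge> 0" for i using r by (simp add: c_def)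
  have "(\<lambda>i. r ^ (i + j)) sums (r ^ j * (1 / (1 - r)))"
    using sums_mult[OF geometric_sums[of r], of "r ^ j"] r by (simp add: power_add mult.commute)
  from sums_mult[OF this, of "?P powr (s * J) * (1 - r)"]
  have "(\<lambda>i. c (i + j)) sums (?P powr (s * J) * r ^ j)"
    using r by (simp add: c_def mult_ac)
  moreover have "r ^ j = ?P powr (- s * j)" using P by (simp add: r_def powr_power mult.commute)
  moreover have "?P powr (s * J) * ?P powr (- s * j) = 1 / (?P powi (int j - J)) powr s"
    using P by (simp add: powr_real_of_int'[symmetric] powr_powr powr_add[symmetric] powr_minus_divide[symmetric] algebra_simps)
  ultimately have sums: "(\<lambda>i. c (i + j)) sums trunc_kernel s J z"
    by (simp add: trunc_kernel_def j(1))
  have "(\<lambda>i. if j \<le> i then c i else 0) sums trunc_kernel s J z"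
    using sums by (subst sums_iff_shift'[of _ j, symmetric]) (simp add: sum.neutral)
  then have "(\<lambda>i. ennreal (if j \<le> i then c i else 0)) sums ennreal (trunc_kernel s J z)"
    using c0 by (subst sums_ennreal) auto
  moreover have "ennreal (if j \<le> i then c i else 0) = ennreal (c i) * indicator (padic_ball 0 (J - int i)) z" for i
    by (simp add: j(2) indicator_def)
  ultimately show ?thesis by (simp add: sums_iff c_def)
qed

text \<open>The series is integrated term by term. The volume p^(n(i-J)) of the i-th ball turns the
  ratio p^(-\<alpha>-n) of the weights into p^(-\<alpha>), again a geometric series.\<close>

lemma trunc_kernel_integral:
  fixes x :: "('p::prime_card padic) ^ 'n"
  assumes a: "\<alpha> > 0"
  defines "P \<equiv> real CARD('p)" and "s \<equiv> \<alpha> + real CARD('n)"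
  shows "(\<integral>\<^sup>+y. ennreal (trunc_kernel s J (x - y)) \<partial>padic_haar) =
    ennreal (P powr (\<alpha> * real_of_int J) * (1 - P powr (- s)) / (1 - P powr (- \<alpha>)))"
proof -
  have P: "P > 1" unfolding P_def by (rule one_less_card_prime)
  have s: "s > 0" using a by (simp add: s_def add_pos_nonneg)
  define r where "r = P powr (- s)"
  have r: "0 < r" "r < 1" using P s by (auto simp: r_def powr_less_one)
  define c where "c i = P powr (s * J) * r ^ i * (1 - r)" for i :: nat
  have c0: "c i \<ge> 0" for i using r by (simp add: c_def)
  have ball: "x - y \<in> padic_ball 0 L \<longleftrightarrow> y \<in> padic_ball x L" for y L
    by (simp add: mem_padic_ball_iff padic_vnorm_minus_commute)
  have q: "0 < P powr (- \<alpha>)" "P powr (- \<alpha>) < 1" using P a by (auto simp: powr_less_one)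
  have "(\<integral>\<^sup>+y. ennreal (trunc_kernel s J (x - y)) \<partial>padic_haar)
      = (\<integral>\<^sup>+y. (\<Sum>i. ennreal (c i) * indicator (padic_ball x (J - int i)) y) \<partial>padic_haar)"
    unfolding trunc_kernel_series[OF s] c_def r_def P_def by (simp add: indicator_def ball)
  also have "\<dots> = (\<Sum>i. ennreal (c i) * emeasure padic_haar (padic_ball x (J - int i)))"
    by (subst nn_integral_suminf) (auto simp: nn_integral_cmult_indicator sets_padic_haar)
  also have "\<dots> = (\<Sum>i. ennreal (P powr (\<alpha> * real_of_int J) * (1 - r) * (P powr (- \<alpha>)) ^ i))"
  proof (intro suminf_cong)
    fix i
    have "c i * ball_volume TYPE('p) TYPE('n) (J - int i) = P powr (\<alpha> * real_of_int J) * (1 - r) * (P powr (- \<alpha>)) ^ i"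
    proof -
      have "ball_volume TYPE('p) TYPE('n) (J - int i) = P powr (- (real CARD('n) * (J - int i)))"
        unfolding ball_volume_def P_def[symmetric] using P by (subst powr_real_of_int'[symmetric]) auto
      moreover have "r ^ i = P powr (- s * i)" using P by (simp add: r_def powr_power mult.commute)
      moreover have "(P powr (- \<alpha>)) ^ i = P powr (- \<alpha> * i)" using P by (simp add: powr_power mult.commute)
      moreover have "P powr (s * J) * P powr (- s * i) * P powr (- (real CARD('n) * (J - int i)))
          = P powr (\<alpha> * real_of_int J) * P powr (- \<alpha> * i)"
        unfolding powr_add[symmetric] by (simp add: s_def algebra_simps)
      ultimately show ?thesis by (simp add: c_def mult_ac)
    qed
    then show "ennreal (c i) * emeasure padic_haar (padic_ball x (J - int i))
        = ennreal (P powr (\<alpha> * real_of_int J) * (1 - r) * (P powr (- \<alpha>)) ^ i)"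
      using c0 by (simp add: emeasure_padic_ball ennreal_mult[symmetric])
  qed
  also have "\<dots> = ennreal (P powr (\<alpha> * real_of_int J) * (1 - r) * (1 / (1 - P powr (- \<alpha>))))"
  proof (rule sums_unique[symmetric])
    have "(\<lambda>i. P powr (\<alpha> * real_of_int J) * (1 - r) * (P powr (- \<alpha>)) ^ i)
        sums (P powr (\<alpha> * real_of_int J) * (1 - r) * (1 / (1 - P powr (- \<alpha>))))"
      using q by (intro sums_mult geometric_sums) auto
    then show "(\<lambda>i. ennreal (P powr (\<alpha> * real_of_int J) * (1 - r) * (P powr (- \<alpha>)) ^ i))
        sums ennreal (P powr (\<alpha> * real_of_int J) * (1 - r) * (1 / (1 - P powr (- \<alpha>))))"
      using q r by (subst sums_ennreal) auto
  qed
  finally show ?thesis by (simp add: r_def)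
qed

lemma kernel_const_pos:
  assumes "\<alpha> > 0" shows "kernel_const CARD('p::prime_card) n \<alpha> > 0"
proof -
  have P: "real CARD('p) > 1" by (rule one_less_card_prime)
  have "real CARD('p) powr \<alpha> > 1" using assms P by simp
  moreover have "real CARD('p) powr (- \<alpha> - real n) < 1" using assms P by (intro powr_less_one) auto
  ultimately show ?thesis by (simp add: kernel_const_def)
qed

text \<open>The meaning of the constant in the Neumann form: it normalises the mass of the kernel
  cut off at level \<open>J\<close> to the Fourier symbol on the sphere of radius p^(J+1).\<close>

lemma kernel_const_times_integral:
  fixes \<alpha> :: real and J :: int
  assumes a: "\<alpha> > 0" and P: "real p > 1"
  shows "kernel_const p n \<alpha> *
      (real p powr (\<alpha> * real_of_int J) * (1 - real p powr (- (\<alpha> + real n))) / (1 - real p powr (- \<alpha>)))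
    = real p powr (\<alpha> * (real_of_int J + 1))"
proof -
  have "real p powr (- \<alpha>) < 1" "real p powr (- (\<alpha> + real n)) < 1" using a P by (auto intro!: powr_less_one)
  then have q: "1 - real p powr (- \<alpha>) \<noteq> 0" "1 - real p powr (- (\<alpha> + real n)) \<noteq> 0" by simp_all
  have e: "- \<alpha> - real n = - (\<alpha> + real n)" by simp
  have 1: "real p powr \<alpha> - 1 = real p powr \<alpha> * (1 - real p powr (- \<alpha>))"
    using P by (simp add: right_diff_distrib powr_add[symmetric])
  have 2: "real p powr (\<alpha> * (real_of_int J + 1)) = real p powr (\<alpha> * real_of_int J) * real p powr \<alpha>"
    by (simp add: powr_add[symmetric] algebra_simps)
  have "x * b / c * (d * c / b) = d * x" if "b \<noteq> 0" "c \<noteq> 0" for b c d x :: real using that by simp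
  from this[OF q] show ?thesis unfolding kernel_const_def e 1 2 .
qed

section \<open>The Neumann form\<close>

locale bounded_region =
  fixes \<Omega> :: "(('p::prime_card padic) ^ 'n) set" and \<alpha> :: real
  assumes bounded: "bounded \<Omega>" and open_region: "open \<Omega>" and alpha: "\<alpha> > 0"
begin

abbreviation "M \<equiv> haar_on \<Omega>"

lemma P: "real CARD('p) > 1" by (rule one_less_card_prime)

lemma s: "(\<alpha> + real CARD('n)) > 0" using alpha by (simp add: add_pos_nonneg)

lemma sets_Omega [measurable, simp]: "\<Omega> \<in> sets borel" "\<Omega> \<in> sets padic_haar"
  using open_region by (auto simp: sets_padic_haar)

lemma emeasure_Omega_finite: "emeasure padic_haar \<Omega> < \<infinity>"
proof -
  obtain k :: nat where "\<Omega> \<subseteq> padic_ball 0 (0 - int k)" using bounded_subset_padic_ball[OF bounded] .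
  then have "emeasure padic_haar \<Omega> \<le> emeasure padic_haar (padic_ball (0 :: ('p padic) ^ 'n) (0 - int k))"
    by (intro emeasure_mono) (auto simp: sets_padic_haar)
  then show ?thesis by (simp add: emeasure_padic_ball le_less_trans)
qed

lemma space_M [simp]: "space M = \<Omega>"
  by simp

sublocale M: finite_measure M
  using emeasure_Omega_finite by (intro finite_measure_restrict_space finite_measureI) (auto simp: emeasure_restrict_space)

sublocale MM: pair_sigma_finite M M ..

lemma ident_measurable [measurable]: "(\<lambda>x. x) \<in> borel_measurable M"
  by (intro measurable_restrict_space1 measurable_ident_sets sets_padic_haar)

lemma borel_measurable_M: "f \<in> borel_measurable borel \<Longrightarrow> f \<in> borel_measurable M"
  by (rule measurable_compose[OF ident_measurable])

lemma L2_fun_integrable: "u \<in> L2_fun M \<Longrightarrow> integrable M u"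
proof -
  assume u: "u \<in> L2_fun M"
  have "(\<lambda>_. 1) \<in> L2_fun M" by (simp add: L2_fun_iff)
  from L2_fun_mult_integrable[OF u this] show ?thesis by simp
qed

lemma integrable_indicator_times:
  fixes u :: "_ \<Rightarrow> complex"
  assumes B: "B \<in> sets borel" and u: "integrable M u"
  shows "integrable M (\<lambda>x. indicator B x * u x)"
proof (rule Bochner_Integration.integrable_bound[OF u])
  show "(\<lambda>x. indicator B x * u x) \<in> borel_measurable M"
    by (intro borel_measurable_times borel_measurable_M borel_measurable_indicator B borel_measurable_integrable u)
  show "AE x in M. norm (indicator B x * u x) \<le> norm (u x)"
    by (rule AE_I2) (simp add: indicator_def)
qed

text \<open>The linear conditions of the counting argument, one for each ball of level
  \<open>J\<close> that meets \<open>\<Omega>\<close>. A ball may stick out of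
  \<open>\<Omega>\<close>; only its part inside is integrated.\<close>

definition zero_means :: "int \<Rightarrow> (('p padic) ^ 'n \<Rightarrow> complex) \<Rightarrow> bool" where
  "zero_means J u \<longleftrightarrow> (\<forall>B\<in>balls_at J \<Omega>. (LINT x|M. indicator B x * u x) = 0)"

text \<open>On \<open>\<Omega>\<close> the function \<open>h\<close> is a finite combination of
  indicators of balls of level \<open>J\<close>. It is applied to truncated kernels and to
  characters of small frequency.\<close>

lemma zero_means_integral:
  assumes u: "integrable M u" and z: "zero_means J u"
    and h: "\<And>x y. x \<in> \<Omega> \<Longrightarrow> y \<in> padic_ball x J \<Longrightarrow> h x = h y"
  shows "(LINT x|M. h x * u x) = 0"
proof -
  let ?C = "balls_at J \<Omega>"
  define c where "c B = h (SOME x. x \<in> B \<inter> \<Omega>)" for B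
  have c: "h x = c B" if "B \<in> ?C" "x \<in> B" "x \<in> \<Omega>" for x B
  proof -
    have "(SOME x. x \<in> B \<inter> \<Omega>) \<in> B \<inter> \<Omega>" by (rule someI[of _ x]) (use that in auto)
    moreover have "B = padic_ball x J" using that padic_ball_eqI by (auto simp: balls_at_def)
    ultimately show ?thesis unfolding c_def using h[OF that(3)] by auto
  qed
  have fin: "finite ?C" by (rule finite_balls_at[OF bounded])
  have int: "integrable M (\<lambda>x. c B * (indicator B x * u x))" if "B \<in> ?C" for B
    using that u by (intro integrable_mult_right integrable_indicator_times) (auto simp: balls_at_def)
  have eq: "h x * u x = (\<Sum>B\<in>?C. c B * (indicator B x * u x))" if x: "x \<in> \<Omega>" for x
  proof -
    have Bx: "padic_ball x J \<in> ?C" using x by (simp add: balls_at_def)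
    have "(\<Sum>B\<in>?C. c B * (indicator B x * u x)) = (\<Sum>B\<in>{padic_ball x J}. c B * (indicator B x * u x))"
      using fin Bx padic_ball_eqI by (intro sum.mono_neutral_right) (auto simp: indicator_def balls_at_def)
    also have "\<dots> = h x * u x" using c[OF Bx _ x] by simp
    finally show ?thesis by simp
  qed
  have "(LINT x|M. h x * u x) = (LINT x|M. (\<Sum>B\<in>?C. c B * (indicator B x * u x)))"
    using eq by (intro Bochner_Integration.integral_cong) auto
  also have "\<dots> = (\<Sum>B\<in>?C. LINT x|M. c B * (indicator B x * u x))"
    using int by (rule Bochner_Integration.integral_sum)
  also have "\<dots> = 0" using z by (simp add: zero_means_def)
  finally show ?thesis .
qed

text \<open>On functions with zero means the truncated form acts as multiplication by this mass, up
  to constants.\<close>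

definition kernel_mass :: "int \<Rightarrow> ('p padic) ^ 'n \<Rightarrow> real" where
  "kernel_mass J x = (LINT y|M. trunc_kernel (\<alpha> + real CARD('n)) J (x - y))"

lemma trunc_kernel_norm_le: "norm (complex_of_real (trunc_kernel (\<alpha> + real CARD('n)) J z)) \<le> 1 / (real CARD('p) powi (- J)) powr (\<alpha> + real CARD('n))"
  for z :: "('p padic) ^ 'n"
  using trunc_kernel_le[of "\<alpha> + real CARD('n)" J z] s trunc_kernel_nonneg[of "\<alpha> + real CARD('n)" J z] by (simp del: trunc_kernel_nonneg)

lemma integrable_trunc_kernel: "integrable M (\<lambda>y. trunc_kernel (\<alpha> + real CARD('n)) J (x - y))"
  using trunc_kernel_le[of "\<alpha> + real CARD('n)" J] s by (intro M.integrable_const_bound[of _ "1 / (real CARD('p) powi (- J)) powr (\<alpha> + real CARD('n))"]) auto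

lemma kernel_mass_nonneg [simp]: "0 \<le> kernel_mass J x"
  by (simp add: kernel_mass_def)

lemma kernel_mass_measurable [measurable]: "kernel_mass J \<in> borel_measurable M"
  unfolding kernel_mass_def by measurable

lemma kernel_mass_ennreal: "ennreal (kernel_mass J x) = (\<integral>\<^sup>+y. ennreal (trunc_kernel (\<alpha> + real CARD('n)) J (x - y)) \<partial>M)"
  unfolding kernel_mass_def by (subst nn_integral_eq_integral[OF integrable_trunc_kernel]) auto

lemma kernel_mass_restrict:
  "ennreal (kernel_mass J x) = (\<integral>\<^sup>+y\<in>\<Omega>. ennreal (trunc_kernel (\<alpha> + real CARD('n)) J (x - y)) \<partial>padic_haar)"
  unfolding kernel_mass_ennreal by (subst nn_integral_restrict_space) auto

lemma kernel_mass_const: "y \<in> padic_ball x J \<Longrightarrow> kernel_mass J x = kernel_mass J y"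
  unfolding kernel_mass_def using trunc_kernel_const by metis

lemma full_kernel_integral:
  "ennreal (kernel_const CARD('p) CARD('n) \<alpha>) * (\<integral>\<^sup>+y. ennreal (trunc_kernel (\<alpha> + real CARD('n)) J (x - y)) \<partial>padic_haar) = ennreal (real CARD('p) powr (\<alpha> * (real_of_int J + 1)))"
  for x :: "('p padic) ^ 'n"
proof -
  have "real CARD('p) powr (- (\<alpha> + real CARD('n))) < 1" "real CARD('p) powr (- \<alpha>) < 1" using P alpha s by (auto intro!: powr_less_one)
  then have "0 \<le> real CARD('p) powr (\<alpha> * real_of_int J) * (1 - real CARD('p) powr (- (\<alpha> + real CARD('n)))) / (1 - real CARD('p) powr (- \<alpha>))"
    by simp
  moreover have "0 \<le> kernel_const CARD('p) CARD('n) \<alpha>" using kernel_const_pos[OF alpha] by (rule less_imp_le)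
  ultimately show ?thesis
    unfolding trunc_kernel_integral[OF alpha] kernel_const_times_integral[OF alpha P, where n = "CARD('n)", symmetric]
    by (intro ennreal_mult[symmetric])
qed

text \<open>The mass inside \<open>\<Omega>\<close> is at most the mass over the whole space, which
  is known exactly. This bounds the Neumann eigenvalues of wavelets from above.\<close>

lemma kernel_mass_upper: "(kernel_const CARD('p) CARD('n) \<alpha>) * kernel_mass J x \<le> real CARD('p) powr (\<alpha> * (real_of_int J + 1))"
proof -
  have "ennreal ((kernel_const CARD('p) CARD('n) \<alpha>) * kernel_mass J x) = ennreal (kernel_const CARD('p) CARD('n) \<alpha>) * ennreal (kernel_mass J x)"
    using kernel_const_pos[OF alpha, where 'p='p] by (intro ennreal_mult) (auto simp: less_imp_le)
  also have "\<dots> \<le> ennreal (kernel_const CARD('p) CARD('n) \<alpha>) * (\<integral>\<^sup>+y. ennreal (trunc_kernel (\<alpha> + real CARD('n)) J (x - y)) \<partial>padic_haar)"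
    unfolding kernel_mass_restrict by (intro mult_left_mono nn_integral_mono) (auto simp: indicator_def)
  finally show ?thesis by (simp add: full_kernel_integral)
qed

text \<open>The mass over the whole space splits into the parts inside and outside
  \<open>\<Omega>\<close>. Outside, the cut-off kernel is dominated by the full one, whose
  normalised integral is \<open>Gamma_at\<close>.\<close>

lemma kernel_mass_lower:
  assumes x: "x \<in> \<Omega>" and fin: "Gamma_at \<alpha> \<Omega> x < \<infinity>"
  shows "real CARD('p) powr (\<alpha> * (real_of_int J + 1)) - enn2real (Gamma_at \<alpha> \<Omega> x) \<le> (kernel_const CARD('p) CARD('n) \<alpha>) * kernel_mass J x"
proof -
  have [measurable]: "(\<lambda>x. x) \<in> borel_measurable (padic_haar :: (('p padic) ^ 'n) measure)"
    by (intro measurable_ident_sets sets_padic_haar)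
  have C: "(kernel_const CARD('p) CARD('n) \<alpha>) > 0" by (rule kernel_const_pos[OF alpha])
  have "(\<integral>\<^sup>+y. ennreal (trunc_kernel (\<alpha> + real CARD('n)) J (x - y)) \<partial>padic_haar)
      = (\<integral>\<^sup>+y. ennreal (trunc_kernel (\<alpha> + real CARD('n)) J (x - y)) * indicator \<Omega> y + ennreal (trunc_kernel (\<alpha> + real CARD('n)) J (x - y)) * indicator (- \<Omega>) y \<partial>padic_haar)"
    by (intro nn_integral_cong) (auto simp: indicator_def)
  also have "\<dots> = ennreal (kernel_mass J x) + (\<integral>\<^sup>+y\<in>- \<Omega>. ennreal (trunc_kernel (\<alpha> + real CARD('n)) J (x - y)) \<partial>padic_haar)"
    unfolding kernel_mass_restrict by (rule nn_integral_add) measurable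
  also have "\<dots> \<le> ennreal (kernel_mass J x) + (\<integral>\<^sup>+y\<in>- \<Omega>. ennreal (1 / padic_vnorm (x - y) powr (real CARD('n) + \<alpha>)) \<partial>padic_haar)"
  proof (intro add_left_mono nn_integral_mono)
    fix y
    have "trunc_kernel (\<alpha> + real CARD('n)) J (x - y) \<le> 1 / padic_vnorm (x - y) powr (real CARD('n) + \<alpha>)" if "y \<notin> \<Omega>"
      using trunc_kernel_le_kernel[of "\<alpha> + real CARD('n)" "x - y" J] s x that by (auto simp: add.commute)
    then show "ennreal (trunc_kernel (\<alpha> + real CARD('n)) J (x - y)) * indicator (- \<Omega>) y
        \<le> ennreal (1 / padic_vnorm (x - y) powr (real CARD('n) + \<alpha>)) * indicator (- \<Omega>) y"
      by (cases "y \<in> \<Omega>") (auto intro!: ennreal_leI)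
  qed
  finally have "ennreal (kernel_const CARD('p) CARD('n) \<alpha>) * (\<integral>\<^sup>+y. ennreal (trunc_kernel (\<alpha> + real CARD('n)) J (x - y)) \<partial>padic_haar)
      \<le> ennreal (kernel_const CARD('p) CARD('n) \<alpha>) * ennreal (kernel_mass J x) + Gamma_at \<alpha> \<Omega> x"
    unfolding Gamma_at_def distrib_left[symmetric] by (rule mult_left_mono) simp
  also have "\<dots> = ennreal ((kernel_const CARD('p) CARD('n) \<alpha>) * kernel_mass J x + enn2real (Gamma_at \<alpha> \<Omega> x))"
    using C fin by (simp add: ennreal_mult[symmetric] less_imp_le)
  finally have "real CARD('p) powr (\<alpha> * (real_of_int J + 1)) \<le> (kernel_const CARD('p) CARD('n) \<alpha>) * kernel_mass J x + enn2real (Gamma_at \<alpha> \<Omega> x)"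
    unfolding full_kernel_integral using C by (subst (asm) ennreal_le_iff) (auto simp: less_imp_le)
  then show ?thesis by simp
qed

section \<open>The truncated form as a multiplication operator\<close>

lemma L2_fun_fst: "u \<in> L2_fun M \<Longrightarrow> (\<lambda>z. u (fst z)) \<in> L2_fun (M \<Otimes>\<^sub>M M)"
proof -
  assume u: "u \<in> L2_fun M"
  then have [measurable]: "u \<in> borel_measurable M" by (rule L2_fun_measurable)
  have "L2_norm_sq (M \<Otimes>\<^sub>M M) (\<lambda>z. u (fst z)) = (\<integral>\<^sup>+x. \<integral>\<^sup>+y. ennreal ((cmod (u x))\<^sup>2) \<partial>M \<partial>M)"
    unfolding L2_norm_sq_def by (subst M.nn_integral_fst[symmetric]) auto
  also have "\<dots> = L2_norm_sq M u * emeasure M \<Omega>"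
    unfolding L2_norm_sq_def by (simp add: nn_integral_multc)
  also have "\<dots> < \<infinity>"
    using u M.emeasure_finite[of \<Omega>] by (simp add: L2_fun_def ennreal_mult_less_top less_top[symmetric] ennreal_mult_eq_top_iff)
  finally show ?thesis by (simp add: L2_fun_def)
qed

lemma L2_fun_snd: "u \<in> L2_fun M \<Longrightarrow> (\<lambda>z. u (snd z)) \<in> L2_fun (M \<Otimes>\<^sub>M M)"
proof -
  assume u: "u \<in> L2_fun M"
  then have [measurable]: "u \<in> borel_measurable M" by (rule L2_fun_measurable)
  have "L2_norm_sq (M \<Otimes>\<^sub>M M) (\<lambda>z. u (snd z)) = (\<integral>\<^sup>+x. \<integral>\<^sup>+y. ennreal ((cmod (u y))\<^sup>2) \<partial>M \<partial>M)"
    unfolding L2_norm_sq_def by (subst M.nn_integral_fst[symmetric]) auto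
  also have "\<dots> = L2_norm_sq M u * emeasure M \<Omega>"
    unfolding L2_norm_sq_def by simp
  also have "\<dots> < \<infinity>"
    using u M.emeasure_finite[of \<Omega>] by (simp add: L2_fun_def ennreal_mult_less_top less_top[symmetric] ennreal_mult_eq_top_iff)
  finally show ?thesis by (simp add: L2_fun_def)
qed

text \<open>The mixed terms vanish because the kernel is constant on products of balls of level \<open>J\<close>.\<close>

lemma truncated_form:
  assumes u: "u \<in> L2_fun M" and v: "v \<in> L2_fun M" and z: "zero_means J u"
  defines "F \<equiv> \<lambda>z. (u (fst z) - u (snd z)) * cnj (v (fst z) - v (snd z)) * complex_of_real (trunc_kernel (\<alpha> + real CARD('n)) J (fst z - snd z))"
  shows "integrable (M \<Otimes>\<^sub>M M) F"
    and "integral\<^sup>L (M \<Otimes>\<^sub>M M) F = 2 * (LINT x|M. u x * cnj (v x) * complex_of_real (kernel_mass J x))"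
proof -
  let ?K = "\<lambda>z. complex_of_real (trunc_kernel (\<alpha> + real CARD('n)) J (fst z - snd z))"
  have [measurable]: "u \<in> borel_measurable M" "v \<in> borel_measurable M" using u v by (auto dest: L2_fun_measurable)
  note L2 = L2_fun_fst[OF u] L2_fun_snd[OF u] L2_fun_fst[OF v] L2_fun_snd[OF v]
  \<comment> \<open>The truncated kernel is bounded, so the four products in the expansion of the
    form can be integrated separately.\<close>
  have int: "integrable (M \<Otimes>\<^sub>M M) (\<lambda>z. f z * cnj (g z) * ?K z)"
    if "f \<in> L2_fun (M \<Otimes>\<^sub>M M)" "g \<in> L2_fun (M \<Otimes>\<^sub>M M)" for f g
  proof -
    have [measurable]: "f \<in> borel_measurable (M \<Otimes>\<^sub>M M)" "g \<in> borel_measurable (M \<Otimes>\<^sub>M M)"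
      using that by (auto dest: L2_fun_measurable)
    show ?thesis
    proof (rule Bochner_Integration.integrable_bound)
      show "integrable (M \<Otimes>\<^sub>M M) (\<lambda>z. complex_of_real (1 / (real CARD('p) powi (- J)) powr (\<alpha> + real CARD('n))) * (f z * cnj (g z)))"
        using L2_fun_mult_integrable[OF that] by (rule integrable_mult_right)
      show "AE z in M \<Otimes>\<^sub>M M. norm (f z * cnj (g z) * ?K z)
          \<le> norm (complex_of_real (1 / (real CARD('p) powi (- J)) powr (\<alpha> + real CARD('n))) * (f z * cnj (g z)))"
      proof (rule AE_I2)
        fix z
        show "norm (f z * cnj (g z) * ?K z) \<le> norm (complex_of_real (1 / (real CARD('p) powi (- J)) powr (\<alpha> + real CARD('n))) * (f z * cnj (g z)))"
          using mult_left_mono[OF trunc_kernel_norm_le[of J "fst z - snd z"], of "norm (f z * cnj (g z))"]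
          by (simp add: norm_mult norm_divide mult_ac)
      qed
    qed measurable
  qed
  let ?A1 = "\<lambda>z. u (fst z) * cnj (v (fst z)) * ?K z" and ?A2 = "\<lambda>z. u (snd z) * cnj (v (snd z)) * ?K z"
  let ?A3 = "\<lambda>z. u (fst z) * cnj (v (snd z)) * ?K z" and ?A4 = "\<lambda>z. u (snd z) * cnj (v (fst z)) * ?K z"
  have F: "F = (\<lambda>z. ?A1 z + ?A2 z - ?A3 z - ?A4 z)" by (auto simp: F_def algebra_simps)
  have i: "integrable (M \<Otimes>\<^sub>M M) ?A1" "integrable (M \<Otimes>\<^sub>M M) ?A2" "integrable (M \<Otimes>\<^sub>M M) ?A3" "integrable (M \<Otimes>\<^sub>M M) ?A4"
    by (intro int L2)+
  show "integrable (M \<Otimes>\<^sub>M M) F" unfolding F using i by simp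
  have mass: "(LINT x|M. trunc_kernel (\<alpha> + real CARD('n)) J (x - y)) = kernel_mass J y" for y
    by (simp add: kernel_mass_def trunc_kernel_commute[of _ _ _ y])
  have "integral\<^sup>L (M \<Otimes>\<^sub>M M) ?A1 = (LINT x|M. LINT y|M. ?A1 (x, y))" by (rule MM.integral_fst'[OF i(1), symmetric])
  also have "\<dots> = (LINT x|M. u x * cnj (v x) * complex_of_real (kernel_mass J x))" by (simp add: kernel_mass_def)
  finally have 1: "integral\<^sup>L (M \<Otimes>\<^sub>M M) ?A1 = (LINT x|M. u x * cnj (v x) * complex_of_real (kernel_mass J x))" .
  have snd: "integral\<^sup>L (M \<Otimes>\<^sub>M M) f = (LINT y|M. LINT x|M. f (x, y))" if "integrable (M \<Otimes>\<^sub>M M) f" for f :: "_ \<Rightarrow> complex"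
    using MM.integral_snd[of "\<lambda>x y. f (x, y)"] that by simp
  have "integral\<^sup>L (M \<Otimes>\<^sub>M M) ?A2 = (LINT y|M. LINT x|M. ?A2 (x, y))" by (rule snd[OF i(2)])
  also have "\<dots> = (LINT x|M. u x * cnj (v x) * complex_of_real (kernel_mass J x))" by (simp add: mass)
  finally have 2: "integral\<^sup>L (M \<Otimes>\<^sub>M M) ?A2 = (LINT x|M. u x * cnj (v x) * complex_of_real (kernel_mass J x))" .
  \<comment> \<open>Only \<open>u\<close> has zero means, so in both mixed terms the variable of
    \<open>u\<close> is integrated first.\<close>
  have zero: "(LINT x|M. complex_of_real (trunc_kernel (\<alpha> + real CARD('n)) J (x - y)) * u x) = 0" for y
    by (intro zero_means_integral[OF L2_fun_integrable[OF u] z] arg_cong[of _ _ complex_of_real] trunc_kernel_const)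
  have "integral\<^sup>L (M \<Otimes>\<^sub>M M) ?A3 = (LINT y|M. LINT x|M. ?A3 (x, y))" by (rule snd[OF i(3)])
  also have "\<dots> = (LINT y|M. LINT x|M. cnj (v y) * (complex_of_real (trunc_kernel (\<alpha> + real CARD('n)) J (x - y)) * u x))"
    by (simp add: mult_ac)
  finally have 3: "integral\<^sup>L (M \<Otimes>\<^sub>M M) ?A3 = 0" by (simp add: zero)
  have "integral\<^sup>L (M \<Otimes>\<^sub>M M) ?A4 = (LINT x|M. LINT y|M. ?A4 (x, y))" by (rule MM.integral_fst'[OF i(4), symmetric])
  also have "\<dots> = (LINT x|M. LINT y|M. cnj (v x) * (complex_of_real (trunc_kernel (\<alpha> + real CARD('n)) J (y - x)) * u y))"
    by (simp add: mult_ac trunc_kernel_commute[of "\<alpha> + real CARD('n)" J _ "_"])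
  finally have 4: "integral\<^sup>L (M \<Otimes>\<^sub>M M) ?A4 = 0" by (simp add: zero)
  show "integral\<^sup>L (M \<Otimes>\<^sub>M M) F = 2 * (LINT x|M. u x * cnj (v x) * complex_of_real (kernel_mass J x))"
    unfolding F using i 1 2 3 4 by simp
qed

text \<open>The root of the kernel is put on each factor, so that the energy is the squared norm of
  a function that depends linearly on \<open>u\<close>. On the diagonal the numerator
  vanishes.\<close>

definition difference_quotient :: "(('p padic) ^ 'n \<Rightarrow> complex) \<Rightarrow> (('p padic) ^ 'n) \<times> (('p padic) ^ 'n) \<Rightarrow> complex" where
  "difference_quotient u z = (u (fst z) - u (snd z)) * of_real (1 / padic_vnorm (fst z - snd z) powr ((\<alpha> + real CARD('n)) / 2))"

lemma difference_quotient_mult: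
  "difference_quotient u z * cnj (difference_quotient v z) =
    (u (fst z) - u (snd z)) * cnj (v (fst z) - v (snd z)) / of_real (padic_vnorm (fst z - snd z) powr (\<alpha> + real CARD('n)))"
proof -
  have "padic_vnorm (fst z - snd z) powr (\<alpha> + real CARD('n)) = padic_vnorm (fst z - snd z) powr ((\<alpha> + real CARD('n)) / 2) * padic_vnorm (fst z - snd z) powr ((\<alpha> + real CARD('n)) / 2)"
    by (simp add: powr_add[symmetric])
  then show ?thesis by (simp add: difference_quotient_def field_simps)
qed

lemma cmod_difference_quotient:
  "(cmod (difference_quotient u z))\<^sup>2 = (cmod (u (fst z) - u (snd z)))\<^sup>2 / padic_vnorm (fst z - snd z) powr (\<alpha> + real CARD('n))"
proof -
  have "complex_of_real ((cmod (difference_quotient u z))\<^sup>2) =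
      complex_of_real ((cmod (u (fst z) - u (snd z)))\<^sup>2 / padic_vnorm (fst z - snd z) powr (\<alpha> + real CARD('n)))"
    by (simp only: of_real_divide complex_norm_square difference_quotient_mult)
  then show ?thesis by (simp only: of_real_eq_iff)
qed

lemma neumann_form_eq:
  "neumann_form \<alpha> \<Omega> u v =
    of_real (1 / 2 * (kernel_const CARD('p) CARD('n) \<alpha>)) * (LINT z|(M \<Otimes>\<^sub>M M). difference_quotient u z * cnj (difference_quotient v z))"
  unfolding neumann_form_def difference_quotient_mult by (simp add: case_prod_beta')

lemma neumann_domain_iff:
  "u \<in> neumann_domain \<alpha> \<Omega> \<longleftrightarrow> u \<in> L2_fun M \<and> difference_quotient u \<in> L2_fun (M \<Otimes>\<^sub>M M)"
proof (cases "u \<in> L2_fun M")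
  case True
  then have [measurable]: "u \<in> borel_measurable M" by (rule L2_fun_measurable)
  have m: "difference_quotient u \<in> borel_measurable (M \<Otimes>\<^sub>M M)"
    unfolding difference_quotient_def by measurable
  have "neumann_energy \<alpha> \<Omega> u = ennreal (1 / 2 * (kernel_const CARD('p) CARD('n) \<alpha>)) * L2_norm_sq (M \<Otimes>\<^sub>M M) (difference_quotient u)"
    unfolding neumann_energy_def L2_norm_sq_def cmod_difference_quotient by (simp add: case_prod_beta')
  moreover have "(kernel_const CARD('p) CARD('n) \<alpha>) > 0" by (rule kernel_const_pos[OF alpha])
  ultimately have "neumann_energy \<alpha> \<Omega> u < \<infinity> \<longleftrightarrow> L2_norm_sq (M \<Otimes>\<^sub>M M) (difference_quotient u) < \<infinity>"
    by (auto simp: ennreal_mult_less_top ennreal_eq_0_iff)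
  then show ?thesis using True m by (simp add: neumann_domain_def L2_fun_def)
qed (simp add: neumann_domain_def)

section \<open>Maximal balls and the supremum of the \<Gamma>\<close>

lemma Gamma_at_const:
  assumes "B \<in> maximal_balls \<Omega>" "x \<in> B" "y \<in> B"
  shows "Gamma_at \<alpha> \<Omega> x = Gamma_at \<alpha> \<Omega> y"
proof -
  obtain a L where B: "B = padic_ball a L" "B \<subseteq> \<Omega>" using assms by (auto simp: maximal_balls_def)
  have eq: "padic_vnorm (x - z) = padic_vnorm (y - z)" if "z \<notin> \<Omega>" for z
    using assms B that padic_ball_eqI by (intro padic_vnorm_eq_outside_ball[of y x L]) blast+
  have "ennreal (1 / padic_vnorm (x - z) powr (real CARD('n) + \<alpha>)) * indicator (- \<Omega>) z
      = ennreal (1 / padic_vnorm (y - z) powr (real CARD('n) + \<alpha>)) * indicator (- \<Omega>) z" for z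
    using eq[of z] by (cases "z \<in> \<Omega>") simp_all
  then show ?thesis unfolding Gamma_at_def by simp
qed

text \<open>Balls around \<open>x\<close> inside \<open>\<Omega>\<close> cannot grow indefinitely,
  since \<open>\<Omega>\<close> lies in one ball and inclusion orders the levels. The largest
  enlargement is maximal.\<close>

lemma maximal_ball_ex:
  assumes x: "x \<in> \<Omega>"
  obtains B where "B \<in> maximal_balls \<Omega>" "x \<in> B"
proof -
  obtain L0 where L0: "padic_ball x L0 \<subseteq> \<Omega>" using open_region x open_padic_vec_iff by blast
  obtain k :: nat where k: "\<Omega> \<subseteq> padic_ball 0 (L0 - int k)" using bounded_subset_padic_ball[OF bounded] .
  define j where "j = (GREATEST j. padic_ball x (L0 - int j) \<subseteq> \<Omega>)"
  have bd: "j \<le> k" if "padic_ball x (L0 - int j) \<subseteq> \<Omega>" for j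
    using padic_ball_level_le[of x "L0 - int j" 0 "L0 - int k"] that k by auto
  have j: "padic_ball x (L0 - int j) \<subseteq> \<Omega>"
    unfolding j_def by (rule GreatestI_nat[of _ 0 k]) (use L0 bd in auto)
  have "\<not> padic_ball x (L0 - int j - 1) \<subseteq> \<Omega>"
  proof
    assume "padic_ball x (L0 - int j - 1) \<subseteq> \<Omega>"
    then have "padic_ball x (L0 - int (Suc j)) \<subseteq> \<Omega>" by (simp add: algebra_simps)
    then have "Suc j \<le> j" unfolding j_def using bd by (intro Greatest_le_nat[of _ _ k])
    then show False by simp
  qed
  then have "padic_ball x (L0 - int j) \<in> maximal_balls \<Omega>" using j by (auto simp: maximal_balls_def)
  then show ?thesis using that by simp
qed

lemma Gamma_at_le_Gamma_max:
  assumes "x \<in> \<Omega>" shows "Gamma_at \<alpha> \<Omega> x \<le> Gamma_max \<alpha> \<Omega>"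
proof -
  obtain B where B: "B \<in> maximal_balls \<Omega>" "x \<in> B" using maximal_ball_ex[OF assms] .
  then have "(SOME x. x \<in> B) \<in> B" by (intro someI)
  then have "Gamma_at \<alpha> \<Omega> x = Gamma_ball \<alpha> \<Omega> B"
    unfolding Gamma_ball_def using Gamma_at_const[OF B] by blast
  then show ?thesis unfolding Gamma_max_def using B(1) by (simp add: SUP_upper)
qed

section \<open>Coercivity and the upper bound for the Neumann count\<close>

lemma zero_means_sum:
  assumes S: "finite S" "S \<subseteq> L2_fun M"
    and z: "\<And>B. B \<in> balls_at J \<Omega> \<Longrightarrow> (\<Sum>f\<in>S. c f * (LINT x|M. indicator B x * f x)) = 0"
  shows "zero_means J (\<lambda>x. \<Sum>f\<in>S. c f * f x)"
  unfolding zero_means_def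
proof
  fix B assume B: "B \<in> balls_at J \<Omega>"
  then have "B \<in> sets borel" by (auto simp: balls_at_def)
  then have int: "integrable M (\<lambda>x. c f * (indicator B x * f x))" if "f \<in> S" for f
    using that S L2_fun_integrable by (intro integrable_mult_right integrable_indicator_times) auto
  have "(LINT x|M. indicator B x * (\<Sum>f\<in>S. c f * f x)) = (LINT x|M. (\<Sum>f\<in>S. c f * (indicator B x * f x)))"
    by (simp add: sum_distrib_left mult_ac)
  also have "\<dots> = (\<Sum>f\<in>S. LINT x|M. c f * (indicator B x * f x))"
    using int by (rule Bochner_Integration.integral_sum)
  also have "\<dots> = (\<Sum>f\<in>S. c f * (LINT x|M. indicator B x * f x))"
    by (intro sum.cong refl integral_mult_right_zero)
  finally show "(LINT x|M. indicator B x * (\<Sum>f\<in>S. c f * f x)) = 0" unfolding z[OF B] .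
qed

lemma kernel_mass_le: "kernel_mass J x \<le> real CARD('p) powr (\<alpha> * (real_of_int J + 1)) / (kernel_const CARD('p) CARD('n) \<alpha>)"
  using kernel_mass_upper[of J x] kernel_const_pos[OF alpha, where 'p='p and n="CARD('n)"]
  by (simp add: field_simps)

text \<open>The full energy dominates the truncated one, which by \<open>truncated_form\<close> is
  the integral of \<open>kernel_mass\<close> against the square of \<open>u\<close>. The mass is
  then bounded below by \<open>kernel_mass_lower\<close>, uniformly in the point because every
  \<open>Gamma_at\<close> is at most \<open>Gamma_max\<close>.\<close>

lemma neumann_coercive:
  assumes u: "u \<in> neumann_domain \<alpha> \<Omega>" and z: "zero_means J u" and fin: "Gamma_max \<alpha> \<Omega> < \<infinity>"
  shows "(real CARD('p) powr (\<alpha> * (real_of_int J + 1)) - enn2real (Gamma_max \<alpha> \<Omega>)) * (LINT x|M. (cmod (u x))\<^sup>2)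
    \<le> 1 / 2 * (kernel_const CARD('p) CARD('n) \<alpha>) * (LINT z|(M \<Otimes>\<^sub>M M). (cmod (difference_quotient u z))\<^sup>2)"
proof -
  let ?k = "real CARD('p) powr (\<alpha> * (real_of_int J + 1)) - enn2real (Gamma_max \<alpha> \<Omega>)"
  have C: "(kernel_const CARD('p) CARD('n) \<alpha>) > 0" by (rule kernel_const_pos[OF alpha])
  have uL2: "u \<in> L2_fun M" and dq: "difference_quotient u \<in> L2_fun (M \<Otimes>\<^sub>M M)"
    using u by (auto simp: neumann_domain_iff)
  have [measurable]: "u \<in> borel_measurable M" using uL2 by (rule L2_fun_measurable)
  have sq: "integrable M (\<lambda>x. (cmod (u x))\<^sup>2)" using uL2 by (simp add: L2_fun_iff)
  define F where "F z = (cmod (u (fst z) - u (snd z)))\<^sup>2 * trunc_kernel (\<alpha> + real CARD('n)) J (fst z - snd z)" for z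
  note tf = truncated_form[OF uL2 uL2 z]
  have F: "(\<lambda>z. (u (fst z) - u (snd z)) * cnj (u (fst z) - u (snd z)) * complex_of_real (trunc_kernel (\<alpha> + real CARD('n)) J (fst z - snd z)))
      = (\<lambda>z. complex_of_real (F z))"
    unfolding F_def by (auto simp: complex_norm_square[symmetric] fun_eq_iff simp del: complex_cnj_diff)
  have F_int: "integrable (M \<Otimes>\<^sub>M M) F" using tf(1) unfolding F by (simp add: complex_of_real_integrable_eq)
  have "complex_of_real (integral\<^sup>L (M \<Otimes>\<^sub>M M) F) = 2 * (LINT x|M. u x * cnj (u x) * complex_of_real (kernel_mass J x))"
    using tf(2) unfolding F by (simp add: integral_complex_of_real)
  also have "\<dots> = 2 * (LINT x|M. complex_of_real ((cmod (u x))\<^sup>2 * kernel_mass J x))"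
    by (simp only: complex_norm_square[symmetric] of_real_mult)
  also have "\<dots> = complex_of_real (2 * (LINT x|M. (cmod (u x))\<^sup>2 * kernel_mass J x))"
    unfolding integral_complex_of_real by simp
  finally have F_eq: "integral\<^sup>L (M \<Otimes>\<^sub>M M) F = 2 * (LINT x|M. (cmod (u x))\<^sup>2 * kernel_mass J x)"
    by (simp only: of_real_eq_iff)
  have km_int: "integrable M (\<lambda>x. (cmod (u x))\<^sup>2 * kernel_mass J x)"
  proof (rule Bochner_Integration.integrable_bound)
    show "integrable M (\<lambda>x. (real CARD('p) powr (\<alpha> * (real_of_int J + 1)) / (kernel_const CARD('p) CARD('n) \<alpha>)) * (cmod (u x))\<^sup>2)" using sq by simp
    show "AE x in M. norm ((cmod (u x))\<^sup>2 * kernel_mass J x) \<le> norm ((real CARD('p) powr (\<alpha> * (real_of_int J + 1)) / (kernel_const CARD('p) CARD('n) \<alpha>)) * (cmod (u x))\<^sup>2)"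
    proof (rule AE_I2)
      fix x
      have "(cmod (u x))\<^sup>2 * kernel_mass J x \<le> (cmod (u x))\<^sup>2 * (real CARD('p) powr (\<alpha> * (real_of_int J + 1)) / (kernel_const CARD('p) CARD('n) \<alpha>))"
        by (intro mult_left_mono kernel_mass_le) auto
      then show "norm ((cmod (u x))\<^sup>2 * kernel_mass J x) \<le> norm ((real CARD('p) powr (\<alpha> * (real_of_int J + 1)) / (kernel_const CARD('p) CARD('n) \<alpha>)) * (cmod (u x))\<^sup>2)"
        using C by (simp add: mult.commute)
    qed
  qed measurable
  have "?k * (LINT x|M. (cmod (u x))\<^sup>2) = (LINT x|M. ?k * (cmod (u x))\<^sup>2)" by simp
  also have "\<dots> \<le> (LINT x|M. (kernel_const CARD('p) CARD('n) \<alpha>) * ((cmod (u x))\<^sup>2 * kernel_mass J x))"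
  proof (rule integral_mono)
    fix x assume "x \<in> space M"
    then have x: "x \<in> \<Omega>" by simp
    have le: "Gamma_at \<alpha> \<Omega> x \<le> Gamma_max \<alpha> \<Omega>" by (rule Gamma_at_le_Gamma_max[OF x])
    then have "enn2real (Gamma_at \<alpha> \<Omega> x) \<le> enn2real (Gamma_max \<alpha> \<Omega>)" using fin by (intro enn2real_mono) auto
    moreover have "Gamma_at \<alpha> \<Omega> x < \<infinity>" using le fin by (rule le_less_trans)
    ultimately have "?k \<le> (kernel_const CARD('p) CARD('n) \<alpha>) * kernel_mass J x" using kernel_mass_lower[OF x, of J] by linarith
    then have "?k * (cmod (u x))\<^sup>2 \<le> (kernel_const CARD('p) CARD('n) \<alpha>) * kernel_mass J x * (cmod (u x))\<^sup>2" by (intro mult_right_mono) auto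
    then show "?k * (cmod (u x))\<^sup>2 \<le> (kernel_const CARD('p) CARD('n) \<alpha>) * ((cmod (u x))\<^sup>2 * kernel_mass J x)" by (simp add: mult_ac)
  qed (use sq km_int in auto)
  also have "\<dots> = 1 / 2 * (kernel_const CARD('p) CARD('n) \<alpha>) * integral\<^sup>L (M \<Otimes>\<^sub>M M) F" by (simp add: F_eq)
  also have "\<dots> \<le> 1 / 2 * (kernel_const CARD('p) CARD('n) \<alpha>) * (LINT z|(M \<Otimes>\<^sub>M M). (cmod (difference_quotient u z))\<^sup>2)"
  proof (intro mult_left_mono integral_mono F_int)
    show "integrable (M \<Otimes>\<^sub>M M) (\<lambda>z. (cmod (difference_quotient u z))\<^sup>2)" using dq by (simp add: L2_fun_iff)
    fix z
    show "F z \<le> (cmod (difference_quotient u z))\<^sup>2"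
    \<comment> \<open>On the diagonal both sides vanish; off it the cut-off only lowers the
      kernel.\<close>
    proof (cases "fst z = snd z")
      case False
      then have "(cmod (u (fst z) - u (snd z)))\<^sup>2 * trunc_kernel (\<alpha> + real CARD('n)) J (fst z - snd z)
          \<le> (cmod (u (fst z) - u (snd z)))\<^sup>2 * (1 / padic_vnorm (fst z - snd z) powr (\<alpha> + real CARD('n)))"
        using s by (intro mult_left_mono trunc_kernel_le_kernel) auto
      then show ?thesis by (simp add: F_def cmod_difference_quotient)
    qed (simp add: F_def)
  qed (use C in auto)
  finally show ?thesis .
qed

text \<open>The general counting bound with the ball means as linear conditions and the constant of
  \<open>neumann_coercive\<close> as threshold.\<close>

lemma neumann_count_le:
  assumes fin: "Gamma_max \<alpha> \<Omega> < \<infinity>" and t: "t < real CARD('p) powr (\<alpha> * (real_of_int J + 1)) - enn2real (Gamma_max \<alpha> \<Omega>)"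
  shows "eigenvalue_count M (neumann_operator \<alpha> \<Omega>) t \<le> of_nat (card (balls_at J \<Omega>))"
  unfolding neumann_operator_def
proof (rule eigenvalue_count_form_operator_le[OF _ _ finite_balls_at[OF bounded] t,
      where l = "\<lambda>B f. LINT x|M. indicator B x * f x"])
  show "neumann_domain \<alpha> \<Omega> \<subseteq> L2_fun M" by (auto simp: neumann_domain_iff)
  show "neumann_form \<alpha> \<Omega> v u = cnj (neumann_form \<alpha> \<Omega> u v)" for u v
    unfolding neumann_form_eq
    using integral_bounded_linear'[OF bounded_linear_cnj bounded_linear_cnj, of "M \<Otimes>\<^sub>M M" "\<lambda>z. difference_quotient u z * cnj (difference_quotient v z)"]
    by (simp add: mult.commute)
  fix S c assume S: "finite S" "S \<subseteq> neumann_domain \<alpha> \<Omega>"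
    and z: "\<And>B. B \<in> balls_at J \<Omega> \<Longrightarrow> (\<Sum>f\<in>S. c f * (LINT x|M. indicator B x * f x)) = 0"
  define u where "u x = (\<Sum>f\<in>S. c f * f x)" for x
  have SL2: "S \<subseteq> L2_fun M" and SG: "\<And>f. f \<in> S \<Longrightarrow> difference_quotient f \<in> L2_fun (M \<Otimes>\<^sub>M M)"
    using S by (auto simp: neumann_domain_iff)
  \<comment> \<open>Linearity of the quotient turns the energy of the combination into a Gram sum of
    form values.\<close>
  have dq: "difference_quotient u z = (\<Sum>f\<in>S. c f * difference_quotient f z)" for z
    by (simp add: difference_quotient_def u_def sum_subtractf[symmetric] sum_distrib_right sum_divide_distrib algebra_simps)
  have "u \<in> L2_fun M" unfolding u_def using S SL2 by (intro L2_fun_sum L2_fun_cmult) auto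
  moreover have "difference_quotient u \<in> L2_fun (M \<Otimes>\<^sub>M M)"
    unfolding dq[abs_def] using S SG by (intro L2_fun_sum L2_fun_cmult) auto
  ultimately have "u \<in> neumann_domain \<alpha> \<Omega>" by (simp add: neumann_domain_iff)
  moreover have "zero_means J u" unfolding u_def using S(1) SL2 z by (rule zero_means_sum)
  ultimately have le: "(real CARD('p) powr (\<alpha> * (real_of_int J + 1)) - enn2real (Gamma_max \<alpha> \<Omega>)) * (LINT x|M. (cmod (u x))\<^sup>2)
    \<le> 1 / 2 * (kernel_const CARD('p) CARD('n) \<alpha>) * (LINT z|(M \<Otimes>\<^sub>M M). (cmod (difference_quotient u z))\<^sup>2)" using fin by (rule neumann_coercive)
  have "complex_of_real (1 / 2 * (kernel_const CARD('p) CARD('n) \<alpha>) * (LINT z|(M \<Otimes>\<^sub>M M). (cmod (difference_quotient u z))\<^sup>2))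
      = of_real (1 / 2 * (kernel_const CARD('p) CARD('n) \<alpha>)) * (\<Sum>f\<in>S. \<Sum>g\<in>S. c f * cnj (c g) *
          (LINT z|(M \<Otimes>\<^sub>M M). difference_quotient f z * cnj (difference_quotient g z)))"
    unfolding dq using L2_norm_sum_expand[OF S(1), of difference_quotient "M \<Otimes>\<^sub>M M" c] SG by simp
  also have "\<dots> = (\<Sum>f\<in>S. \<Sum>g\<in>S. c f * cnj (c g) * neumann_form \<alpha> \<Omega> f g)"
    unfolding neumann_form_eq sum_distrib_left by (simp add: mult_ac)
  finally have "Re (\<Sum>f\<in>S. \<Sum>g\<in>S. c f * cnj (c g) * neumann_form \<alpha> \<Omega> f g)
      = 1 / 2 * (kernel_const CARD('p) CARD('n) \<alpha>) * (LINT z|(M \<Otimes>\<^sub>M M). (cmod (difference_quotient u z))\<^sup>2)" by (metis Re_complex_of_real)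
  then show "(real CARD('p) powr (\<alpha> * (real_of_int J + 1)) - enn2real (Gamma_max \<alpha> \<Omega>)) * (LINT x|M. (cmod (\<Sum>f\<in>S. c f * f x))\<^sup>2)
      \<le> Re (\<Sum>f\<in>S. \<Sum>g\<in>S. c f * cnj (c g) * neumann_form \<alpha> \<Omega> f g)"
    using le by (simp add: u_def)
qed

text \<open>\<open>\<psi>\<close> is constant at distances below p^(-l), so cutting the kernel off
  there changes nothing in the form. By \<open>truncated_form\<close> it becomes multiplication by
  \<open>kernel_mass l\<close>, which is constant on the supporting ball.\<close>

lemma neumann_eigenfunction:
  assumes m: "\<psi> \<in> borel_measurable borel" and bd: "\<And>x. cmod (\<psi> x) \<le> K"
    and B: "padic_ball b l \<subseteq> \<Omega>" and supp: "\<And>x. x \<notin> padic_ball b l \<Longrightarrow> \<psi> x = 0"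
    and const: "\<And>x y. y \<in> padic_ball x (l + 1) \<Longrightarrow> \<psi> x = \<psi> y" and z: "zero_means l \<psi>"
  shows "\<psi> \<in> eigenspace (neumann_operator \<alpha> \<Omega>) ((kernel_const CARD('p) CARD('n) \<alpha>) * kernel_mass l b)"
proof -
  have [measurable]: "\<psi> \<in> borel_measurable M" using m by (rule borel_measurable_M)
  have K: "K \<ge> 0" using bd[of 0] norm_ge_zero order_trans by blast
  have L2: "\<psi> \<in> L2_fun M"
    unfolding L2_fun_iff by (auto intro!: M.integrable_const_bound[of _ "K\<^sup>2"] AE_I2 power_mono bd)
  \<comment> \<open>A distance below p^(-l) is at most p^(-l-1) by discreteness, and there the
    difference is zero.\<close>
  have far: "(\<psi> (fst z) - \<psi> (snd z)) * of_real (trunc_kernel (\<alpha> + real CARD('n)) l (fst z - snd z))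
      = (\<psi> (fst z) - \<psi> (snd z)) / of_real (padic_vnorm (fst z - snd z) powr (\<alpha> + real CARD('n)))" for z
  proof (cases "real CARD('p) powi (- l) \<le> padic_vnorm (fst z - snd z)")
    case False
    then have "padic_vnorm (fst z - snd z) \<le> real CARD('p) powi (- l - 1)" using padic_vnorm_le_if_less[of "fst z - snd z" "- l"] by simp
    moreover have "- (l + 1) = - l - 1" by simp
    ultimately have "fst z \<in> padic_ball (snd z) (l + 1)" by (simp only: mem_padic_ball_iff)
    then show ?thesis using const[of "fst z" "snd z"] by simp
  qed (simp add: trunc_kernel_eq_kernel)
  have sq_le: "(cmod (difference_quotient \<psi> z))\<^sup>2 \<le> (2 * K)\<^sup>2 * (1 / (real CARD('p) powi (- l)) powr (\<alpha> + real CARD('n)))" for z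
  proof -
    have "(cmod (difference_quotient \<psi> z))\<^sup>2
        = cmod (\<psi> (fst z) - \<psi> (snd z)) * cmod ((\<psi> (fst z) - \<psi> (snd z)) / of_real (padic_vnorm (fst z - snd z) powr (\<alpha> + real CARD('n))))"
      unfolding cmod_difference_quotient by (simp add: norm_divide power2_eq_square)
    also have "\<dots> = (cmod (\<psi> (fst z) - \<psi> (snd z)))\<^sup>2 * trunc_kernel (\<alpha> + real CARD('n)) l (fst z - snd z)"
      unfolding far[symmetric] by (simp add: norm_mult power2_eq_square)
    also have "\<dots> \<le> (2 * K)\<^sup>2 * (1 / (real CARD('p) powi (- l)) powr (\<alpha> + real CARD('n)))"
    proof (rule mult_mono)
      have "cmod (\<psi> (fst z) - \<psi> (snd z)) \<le> 2 * K"
        using norm_triangle_ineq4[of "\<psi> (fst z)" "\<psi> (snd z)"] bd[of "fst z"] bd[of "snd z"] by simp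
      then show "(cmod (\<psi> (fst z) - \<psi> (snd z)))\<^sup>2 \<le> (2 * K)\<^sup>2" by (intro power_mono) auto
    qed (use s in \<open>auto intro!: trunc_kernel_le\<close>)
    finally show ?thesis .
  qed
  have [measurable]: "difference_quotient \<psi> \<in> borel_measurable (M \<Otimes>\<^sub>M M)"
    unfolding difference_quotient_def by measurable
  have "finite_measure (M \<Otimes>\<^sub>M M)" by (rule finite_measure_pair_measure) unfold_locales
  then have dq: "difference_quotient \<psi> \<in> L2_fun (M \<Otimes>\<^sub>M M)"
    unfolding L2_fun_iff using sq_le
    by (auto intro!: finite_measure.integrable_const_bound[where B = "(2 * K)\<^sup>2 * (1 / (real CARD('p) powi (- l)) powr (\<alpha> + real CARD('n)))"])
  have "neumann_form \<alpha> \<Omega> \<psi> v = (LINT x|M. of_real ((kernel_const CARD('p) CARD('n) \<alpha>) * kernel_mass l b) * \<psi> x * cnj (v x))"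
    if v: "v \<in> neumann_domain \<alpha> \<Omega>" for v
  proof -
    have vL2: "v \<in> L2_fun M" using v by (simp add: neumann_domain_iff)
    have "difference_quotient \<psi> z * cnj (difference_quotient v z)
        = (\<psi> (fst z) - \<psi> (snd z)) * cnj (v (fst z) - v (snd z)) * complex_of_real (trunc_kernel (\<alpha> + real CARD('n)) l (fst z - snd z))" for z
    proof -
      have "difference_quotient \<psi> z * cnj (difference_quotient v z)
          = ((\<psi> (fst z) - \<psi> (snd z)) * complex_of_real (trunc_kernel (\<alpha> + real CARD('n)) l (fst z - snd z)))
            * cnj (v (fst z) - v (snd z))"
        unfolding difference_quotient_mult far by simp
      then show ?thesis by (simp only: mult_ac)
    qed
    then have "neumann_form \<alpha> \<Omega> \<psi> v = of_real (1 / 2 * (kernel_const CARD('p) CARD('n) \<alpha>)) * (2 * (LINT x|M. \<psi> x * cnj (v x) * complex_of_real (kernel_mass l x)))"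
      unfolding neumann_form_eq using truncated_form(2)[OF L2 vL2 z] by simp
    also have "(LINT x|M. \<psi> x * cnj (v x) * complex_of_real (kernel_mass l x)) = (LINT x|M. complex_of_real (kernel_mass l b) * (\<psi> x * cnj (v x)))"
    proof (intro Bochner_Integration.integral_cong refl)
      fix x show "\<psi> x * cnj (v x) * complex_of_real (kernel_mass l x) = complex_of_real (kernel_mass l b) * (\<psi> x * cnj (v x))"
        using supp[of x] kernel_mass_const[of x b l] by (cases "x \<in> padic_ball b l") auto
    qed
    finally show ?thesis by (simp add: mult.assoc)
  qed
  moreover have "\<psi> \<in> neumann_domain \<alpha> \<Omega>" using L2 dq by (simp add: neumann_domain_iff)
  ultimately show ?thesis
    using L2_fun_cmult[OF L2] by (simp add: eigenspace_def neumann_operator_def form_operator_def)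
qed

end

section \<open>Wavelets\<close>

lemma emeasure_haar_on: "A \<in> sets borel \<Longrightarrow> A \<subseteq> \<Omega> \<Longrightarrow> \<Omega> \<in> sets borel \<Longrightarrow>
    emeasure (haar_on \<Omega>) A = emeasure padic_haar A"
  by (subst emeasure_restrict_space) (auto simp: sets_padic_haar)

lemma ball_volume_neq_0 [simp]: "ball_volume TYPE('p::prime_card) TYPE('n::finite) L \<noteq> 0"
  using ball_volume_pos less_irrefl by metis

context bounded_region
begin

lemma measure_M: "A \<in> sets borel \<Longrightarrow> A \<subseteq> \<Omega> \<Longrightarrow> measure M A = measure padic_haar A"
  by (simp add: measure_def emeasure_haar_on)

text \<open>The hypotheses shared by the Neumann and the Dirichlet eigenfunction computations. They
  do not force \<open>\<psi>\<close> to be nonzero; that is part of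
  \<open>wavelet_independent\<close>.\<close>

definition wavelet :: "int \<Rightarrow> ('p padic) ^ 'n \<Rightarrow> (('p padic) ^ 'n \<Rightarrow> complex) \<Rightarrow> bool" where
  "wavelet l b \<psi> \<longleftrightarrow> \<psi> \<in> borel_measurable borel \<and> (\<forall>x. cmod (\<psi> x) \<le> 1) \<and> padic_ball b l \<subseteq> \<Omega> \<and>
     (\<forall>x. x \<notin> padic_ball b l \<longrightarrow> \<psi> x = 0) \<and> (\<forall>x. \<forall>y\<in>padic_ball x (l + 1). \<psi> x = \<psi> y) \<and> zero_means l \<psi>"

text \<open>The union of the balls of level \<open>m\<close> that lie in \<open>\<Omega>\<close>.
  Wavelets of level at least \<open>m\<close> are placed here, so their supporting balls stay inside
  \<open>\<Omega>\<close>.\<close>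

definition inner_region :: "int \<Rightarrow> (('p padic) ^ 'n) set" where
  "inner_region m = {x. padic_ball x m \<subseteq> \<Omega>}"

lemma inner_region_subset: "inner_region m \<subseteq> \<Omega>"
  using center_in_padic_ball by (auto simp: inner_region_def)

lemma bounded_inner_region: "bounded (inner_region m)"
  using bounded inner_region_subset by (rule bounded_subset)

lemma ball_subset_inner_region:
  assumes "x \<in> inner_region m" "m \<le> l" shows "padic_ball x l \<subseteq> inner_region m"
proof
  fix y assume "y \<in> padic_ball x l"
  then have "y \<in> padic_ball x m" using padic_ball_antimono[OF assms(2)] by blast
  then have "padic_ball y m = padic_ball x m" by (rule padic_ball_eqI)
  then show "y \<in> inner_region m" using assms by (simp add: inner_region_def)
qed

lemma Union_balls_at_inner: "m \<le> l \<Longrightarrow> \<Union>(balls_at l (inner_region m)) = inner_region m"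
proof (intro equalityI subsetI)
  fix x assume "m \<le> l" "x \<in> \<Union>(balls_at l (inner_region m))"
  then obtain y where "y \<in> inner_region m" "x \<in> padic_ball y l" by (auto simp: balls_at_def)
  then show "x \<in> inner_region m" using ball_subset_inner_region[OF _ \<open>m \<le> l\<close>] by (meson subsetD)
next
  fix x assume "x \<in> inner_region m"
  then have "padic_ball x l \<in> balls_at l (inner_region m)" by (simp add: balls_at_def)
  then show "x \<in> \<Union>(balls_at l (inner_region m))" using center_in_padic_ball by (rule UnionI)
qed

lemma sets_inner_region [measurable, simp]: "inner_region m \<in> sets borel"
proof -
  have "open (inner_region m)"
    unfolding open_padic_vec_iff using ball_subset_inner_region[OF _ order_refl] by (intro ballI exI)
  then show ?thesis by simp
qed

lemma measure_inner_region:
  assumes "m \<le> l"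
  shows "measure padic_haar (inner_region m) = card (balls_at l (inner_region m)) * ball_volume TYPE('p) TYPE('n) l"
  using emeasure_Union_balls_at[OF bounded_inner_region, of l m] unfolding Union_balls_at_inner[OF assms]
  by (simp add: measure_def)

text \<open>The choice of a point is harmless, as every point of a ball is a center of it. In
  \<open>first_child\<close> the choice matters, but it depends only on the ball as a set, which
  suffices for a distinguished subball.\<close>

definition parent :: "int \<Rightarrow> (('p padic) ^ 'n) set \<Rightarrow> (('p padic) ^ 'n) set" where
  "parent l B = padic_ball (SOME x. x \<in> B) l"

definition first_child :: "int \<Rightarrow> (('p padic) ^ 'n) set \<Rightarrow> (('p padic) ^ 'n) set" where
  "first_child l B = padic_ball (SOME x. x \<in> B) (l + 1)"

lemma some_in_ball: "(SOME x. x \<in> padic_ball a L) \<in> padic_ball a L"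
  by (rule someI[of _ a]) simp

lemma parent_eq: "x \<in> padic_ball a (l + 1) \<Longrightarrow> parent l (padic_ball a (l + 1)) = padic_ball x l"
  unfolding parent_def using some_in_ball[of a "l + 1"] padic_ball_antimono[of l "l + 1"]
  by (metis in_mono padic_ball_eqI zle_add1_eq_le zless_add1_eq)

lemma first_child_subset: "first_child l (padic_ball a l) \<subseteq> padic_ball a l"
  unfolding first_child_def using some_in_ball[of a l] padic_ball_antimono[of l "l + 1"]
  by (metis padic_ball_eqI zle_add1_eq_le zless_add1_eq)

lemma parent_first_child: "parent l (first_child l (padic_ball a l)) = padic_ball a l"
proof -
  have "parent l (first_child l (padic_ball a l)) = padic_ball (SOME x. x \<in> padic_ball a l) l"
    unfolding first_child_def by (rule parent_eq) simp
  then show ?thesis using padic_ball_eqI[OF some_in_ball] by simp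
qed

text \<open>Every ball inside the region has a distinguished subball of the next level; the wavelets
  are attached to the remaining subballs.\<close>

definition wavelet_index :: "int \<Rightarrow> int \<Rightarrow> (int \<times> (('p padic) ^ 'n) set) set" where
  "wavelet_index m J = (SIGMA l:{m..<J}. {B \<in> balls_at (l + 1) (inner_region m). B \<noteq> first_child l (parent l B)})"

text \<open>The indicator of a subball minus its mean over the parent, which consists of p^n
  subballs of equal volume.\<close>

definition wavelet_fun :: "int \<times> (('p padic) ^ 'n) set \<Rightarrow> ('p padic) ^ 'n \<Rightarrow> complex" where
  "wavelet_fun i x = indicator (snd i) x - indicator (parent (fst i) (snd i)) x / of_nat (CARD('p) ^ CARD('n))"

lemma finite_wavelet_index: "finite (wavelet_index m J)"
  unfolding wavelet_index_def using finite_balls_at[OF bounded_inner_region] by (intro finite_SigmaI) auto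

text \<open>Exactly one subball of each ball of level \<open>l\<close> is discarded, namely its
  first child, and \<open>parent\<close> inverts this assignment.\<close>

lemma card_wavelet_level:
  assumes "m \<le> l"
  shows "int (card {B \<in> balls_at (l + 1) (inner_region m). B \<noteq> first_child l (parent l B)})
    = int (card (balls_at (l + 1) (inner_region m))) - int (card (balls_at l (inner_region m)))"
proof -
  let ?I = "inner_region m"
  let ?E = "{B \<in> balls_at (l + 1) ?I. B = first_child l (parent l B)}"
  have fin: "finite (balls_at (l + 1) ?I)" by (rule finite_balls_at[OF bounded_inner_region])
  have "?E = first_child l ` balls_at l ?I"
  proof (intro equalityI subsetI)
    fix B assume "B \<in> ?E"
    then obtain x where x: "x \<in> ?I" "B = padic_ball x (l + 1)" "B = first_child l (parent l B)" by (auto simp: balls_at_def)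
    then have "parent l B = padic_ball x l" by (simp add: parent_eq)
    then show "B \<in> first_child l ` balls_at l ?I" using x by (auto simp: balls_at_def)
  next
    fix B assume "B \<in> first_child l ` balls_at l ?I"
    then obtain x where x: "x \<in> ?I" "B = first_child l (padic_ball x l)" by (auto simp: balls_at_def)
    have "(SOME y. y \<in> padic_ball x l) \<in> ?I" using some_in_ball ball_subset_inner_region[OF x(1) assms] by blast
    then have "B \<in> balls_at (l + 1) ?I" by (auto simp: x(2) first_child_def balls_at_def)
    then show "B \<in> ?E" using x by (simp add: parent_first_child)
  qed
  moreover have "inj_on (first_child l) (balls_at l ?I)"
    by (rule inj_on_inverseI[of _ "parent l"]) (auto simp: balls_at_def parent_first_child)
  ultimately have "card ?E = card (balls_at l ?I)" by (simp add: card_image)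
  moreover have "card (balls_at (l + 1) ?I) = card ?E + card {B \<in> balls_at (l + 1) ?I. B \<noteq> first_child l (parent l B)}"
    using fin by (subst card_Un_disjoint[symmetric]) (auto intro!: arg_cong[of _ _ card])
  ultimately show ?thesis by simp
qed

text \<open>The counts of the single levels telescope, so only the balls of the coarsest level are
  lost.\<close>

lemma card_wavelet_index:
  assumes "m \<le> J"
  shows "int (card (wavelet_index m J)) = int (card (balls_at J (inner_region m))) - int (card (balls_at m (inner_region m)))"
proof -
  let ?b = "\<lambda>l. int (card (balls_at l (inner_region m)))"
  have "int (card (wavelet_index m J)) = (\<Sum>l\<in>{m..<J}. ?b (l + 1) - ?b l)"
    unfolding wavelet_index_def using finite_balls_at[OF bounded_inner_region]
    by (subst card_SigmaI) (auto simp: card_wavelet_level)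
  also have "\<dots> = ?b J - ?b m"
    using assms
  proof (induction J rule: int_ge_induct)
    case (step J)
    then have "{m..<J + 1} = insert J {m..<J}" by auto
    then show ?case using step by simp
  qed simp
  finally show ?thesis .
qed

lemma wavelet_wavelet_fun:
  assumes i: "(l, B) \<in> wavelet_index m J"
  obtains b where "wavelet l b (wavelet_fun (l, B))"
proof -
  from i obtain b where b: "b \<in> inner_region m" "B = padic_ball b (l + 1)" and ml: "m \<le> l"
    by (auto simp: wavelet_index_def balls_at_def)
  have par: "parent l B = padic_ball b l" unfolding b by (rule parent_eq) simp
  have sub: "padic_ball b l \<subseteq> \<Omega>" using ball_subset_inner_region[OF b(1) ml] inner_region_subset by blast
  have BS: "B \<subseteq> padic_ball b l" unfolding b by (rule padic_ball_antimono) simp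
  let ?q = "of_nat (CARD('p) ^ CARD('n)) :: complex"
  have f: "wavelet_fun (l, B) x = indicator B x - indicator (padic_ball b l) x / ?q" for x
    by (simp add: wavelet_fun_def par)
  have q: "real (CARD('p) ^ CARD('n)) \<ge> 1" using P by (simp add: one_le_power)
  have m: "wavelet_fun (l, B) \<in> borel_measurable borel"
  proof -
    have "wavelet_fun (l, B) = (\<lambda>x. indicator B x - indicator (padic_ball b l) x / ?q)" using f by blast
    then show ?thesis unfolding b by simp
  qed
  have bd: "cmod (wavelet_fun (l, B) x) \<le> 1" for x
  proof -
    have "wavelet_fun (l, B) x = complex_of_real (indicator B x - indicator (padic_ball b l) x / real (CARD('p) ^ CARD('n)))"
      by (simp add: f indicator_def)
    moreover have "\<bar>indicator B x - indicator (padic_ball b l) x / real (CARD('p) ^ CARD('n))\<bar> \<le> (1::real)"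
    proof -
      define w where "w = 1 / real (CARD('p) ^ CARD('n))"
      have "0 \<le> w" "w \<le> 1" using q by (auto simp: w_def)
      moreover have "indicator B x - indicator (padic_ball b l) x / real (CARD('p) ^ CARD('n))
          = indicator B x - w * indicator (padic_ball b l) x" by (simp add: w_def)
      ultimately show ?thesis using BS by (auto simp: indicator_def)
    qed
    ultimately show ?thesis by (simp only: norm_of_real)
  qed
  have const: "wavelet_fun (l, B) x = wavelet_fun (l, B) y" if "y \<in> padic_ball x (l + 1)" for x y
  proof -
    have "x \<in> padic_ball a k \<longleftrightarrow> y \<in> padic_ball a k" if "k \<le> l + 1" for a k
    proof -
      have "y \<in> padic_ball x k" using \<open>y \<in> padic_ball x (l + 1)\<close> padic_ball_antimono[OF that] by blast
      then show ?thesis using padic_ball_trans padic_ball_sym by blast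
    qed
    then show ?thesis unfolding f unfolding b by (simp add: indicator_def)
  qed
  have int: "(LINT x|M. indicator A x :: complex) = of_real (measure padic_haar A)" if "A \<in> sets borel" "A \<subseteq> \<Omega>" for A
  proof -
    have "(LINT x|M. indicator A x :: complex) = (LINT x|M. complex_of_real (indicator A x))"
      by (intro Bochner_Integration.integral_cong) (auto simp: indicator_def)
    also have "\<dots> = of_real (measure M (A \<inter> space M))"
      unfolding integral_complex_of_real by simp
    also have "A \<inter> space M = A" using that by auto
    finally show ?thesis using that by (simp add: measure_M)
  qed
  have zm: "zero_means l (wavelet_fun (l, B))"
    unfolding zero_means_def
  proof
    fix A assume "A \<in> balls_at l \<Omega>"
    then obtain a where A: "A = padic_ball a l" by (auto simp: balls_at_def)
    show "(LINT x|M. indicator A x * wavelet_fun (l, B) x) = 0"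
    proof (cases "A = padic_ball b l")
      case True
      have "indicator A x * wavelet_fun (l, B) x = indicator B x - indicator (padic_ball b l) x / ?q" for x
        using BS by (auto simp: True f indicator_def)
      then have "(LINT x|M. indicator A x * wavelet_fun (l, B) x) = (LINT x|M. indicator B x - indicator (padic_ball b l) x / ?q)" by simp
      also have "\<dots> = (LINT x|M. indicator B x) - (LINT x|M. indicator (padic_ball b l) x / ?q)"
      proof (rule Bochner_Integration.integral_diff)
        have "integrable M (\<lambda>x. indicator A x * (1::complex))" if "A \<in> sets borel" for A
          by (rule integrable_indicator_times[OF that]) simp
        then have *: "integrable M (indicator (padic_ball c k) :: _ \<Rightarrow> complex)" for c k by simp
        show "integrable M (indicator B :: _ \<Rightarrow> complex)" unfolding b by (rule *)
        show "integrable M (\<lambda>x. indicator (padic_ball b l) x / ?q)" using * by simp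
      qed
      also have "\<dots> = of_real (measure padic_haar B) - of_real (measure padic_haar (padic_ball b l)) / ?q"
        using int[of B] int[of "padic_ball b l"] sub BS b by auto
      \<comment> \<open>The parent has p^n times the volume of \<open>B\<close>.\<close>
      also have "\<dots> = 0"
        using P ball_volume_refine[where L = l and k = 1 and 'p='p and 'n='n]
        by (simp add: b measure_def emeasure_padic_ball)
      finally show ?thesis .
    next
      case False
      then have "A \<inter> padic_ball b l = {}" unfolding A using padic_ball_eqI by blast
      then have "indicator A x * wavelet_fun (l, B) x = 0" for x using BS by (auto simp: f indicator_def)
      then show ?thesis by (simp only: Bochner_Integration.integral_zero)
    qed
  qed
  have "wavelet l b (wavelet_fun (l, B))"
    unfolding wavelet_def using m bd sub const zm BS by (auto simp: f indicator_def)
  then show ?thesis by (rule that)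
qed

text \<open>Balls have positive measure, so a relation that holds almost everywhere can be evaluated
  at suitable points of prescribed balls.\<close>

lemma AE_ex_in_ball:
  assumes "AE x in M. Q x" "padic_ball a L \<subseteq> \<Omega>"
  obtains x where "x \<in> padic_ball a L" "Q x"
proof (rule ccontr)
  assume "\<not> thesis"
  then have "AE x in M. x \<notin> padic_ball a L" using assms(1) that by (auto elim!: eventually_mono)
  moreover have "{x \<in> space M. \<not> x \<notin> padic_ball a L} = padic_ball a L" using assms(2) by auto
  moreover have "padic_ball a L \<in> sets M" using assms(2) by (auto simp: sets_restrict_space_iff sets_padic_haar)
  ultimately have "emeasure M (padic_ball a L) = 0" by (simp add: AE_iff_measurable[OF _ refl])
  moreover have "emeasure M (padic_ball a L) = ennreal (ball_volume TYPE('p) TYPE('n) L)"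
    using assms(2) by (simp add: emeasure_haar_on emeasure_padic_ball)
  ultimately have "ball_volume TYPE('p) TYPE('n) L \<le> 0" by (simp add: ennreal_eq_0_iff)
  then show False using ball_volume_pos[where L = L and 'p='p and 'n='n] by linarith
qed

text \<open>On a ball of the finest level and its distinguished sibling all other wavelets take the
  same value.\<close>

lemma wavelet_independent:
  assumes ae: "AE x in M. (\<Sum>i\<in>wavelet_index m J. c i * wavelet_fun i x) = 0" and i: "i \<in> wavelet_index m J"
  shows "c i = 0"
proof (rule ccontr)
  assume "c i \<noteq> 0"
  let ?I = "wavelet_index m J"
  \<comment> \<open>The finest level \<open>l\<close> that carries a nonzero coefficient; all finer
    wavelets drop out of the relation.\<close>
  let ?L = "fst ` {i \<in> ?I. c i \<noteq> 0}"
  have "fst i \<in> ?L" using i \<open>c i \<noteq> 0\<close> by (intro imageI CollectI conjI)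
  then have L: "finite ?L" "?L \<noteq> {}" using finite_wavelet_index[of m J] by auto
  then have "Max ?L \<in> ?L" by (rule Max_in)
  then obtain i0 where i0: "i0 \<in> ?I" "c i0 \<noteq> 0" "Max ?L = fst i0" by blast
  obtain l B where "i0 = (l, B)" by fastforce
  then have lB: "(l, B) \<in> ?I" "c (l, B) \<noteq> 0" "l = Max ?L" using i0 by auto
  have top: "c (l', B') = 0" if "(l', B') \<in> ?I" "l' > l" for l' B'
  proof (rule ccontr)
    assume "c (l', B') \<noteq> 0"
    then have "fst (l', B') \<in> ?L" using that(1) by (intro imageI CollectI conjI)
    then have "l' \<le> Max ?L" using L(1) by (intro Max_ge) simp_all
    then show False using lB(3) that(2) by linarith
  qed
  from lB(1) obtain b where b: "b \<in> inner_region m" "B = padic_ball b (l + 1)" and ml: "m \<le> l"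
    and nfc: "B \<noteq> first_child l (parent l B)"
    by (auto simp: wavelet_index_def balls_at_def)
  have par: "parent l B = padic_ball b l" unfolding b by (rule parent_eq) simp
  have sub: "padic_ball b l \<subseteq> \<Omega>" using ball_subset_inner_region[OF b(1) ml] inner_region_subset by blast
  have BS: "B \<subseteq> padic_ball b l" unfolding b by (rule padic_ball_antimono) simp
  define S where "S x = (\<Sum>i\<in>?I. c i * wavelet_fun i x)" for x
  obtain x where x: "x \<in> B" "S x = 0"
  proof -
    have "padic_ball b (l + 1) \<subseteq> \<Omega>" using order_trans[OF BS sub] by (simp only: b)
    from AE_ex_in_ball[OF ae this] show ?thesis using that by (auto simp: S_def b)
  qed
  have fc: "first_child l (parent l B) \<subseteq> padic_ball b l" unfolding par by (rule first_child_subset)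
  obtain y where y: "y \<in> first_child l (parent l B)" "S y = 0"
  proof -
    have "padic_ball (SOME x. x \<in> parent l B) (l + 1) \<subseteq> \<Omega>"
      using order_trans[OF fc sub] by (simp only: first_child_def)
    from AE_ex_in_ball[OF ae this] show ?thesis using that by (auto simp: S_def first_child_def)
  qed
  have xl: "x \<in> padic_ball b l" and yl: "y \<in> padic_ball b l" using x y BS fc by blast+
  have same: "indicator (padic_ball a k) x = (indicator (padic_ball a k) y :: complex)" if "k \<le> l" for a k
  proof -
    have "y \<in> padic_ball x l" using xl yl padic_ball_eqI by blast
    then have "y \<in> padic_ball x k" using padic_ball_antimono[OF that] by blast
    then have "x \<in> padic_ball a k \<longleftrightarrow> y \<in> padic_ball a k" using padic_ball_trans padic_ball_sym by blast
    then show ?thesis by (simp add: indicator_def)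
  qed
  \<comment> \<open>Subtracting the relations at \<open>x\<close> and at \<open>y\<close> isolates
    the coefficient of \<open>(l, B)\<close>.\<close>
  have diff: "c i * wavelet_fun i x - c i * wavelet_fun i y = (if i = (l, B) then c (l, B) else 0)" if iI: "i \<in> ?I" for i
  proof -
    obtain l' B' where i: "i = (l', B')" by fastforce
    from iI obtain a where a: "B' = padic_ball a (l' + 1)" and nfc': "B' \<noteq> first_child l' (parent l' B')"
      unfolding i by (auto simp: wavelet_index_def balls_at_def)
    consider "l' > l" | "l' < l" | "l' = l" by linarith
    then show ?thesis
    proof cases
      case 1
      then show ?thesis using top[of l' B'] iI by (simp add: i)
    next
      case 2
      then have "wavelet_fun i x = wavelet_fun i y"
        using same[of "l' + 1"] same[of l'] by (simp add: wavelet_fun_def i a parent_def)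
      then show ?thesis using 2 by (simp add: i)
    next
      case 3
      have "wavelet_fun i x - wavelet_fun i y = indicator B' x - indicator B' y"
        using same[of l] by (simp add: wavelet_fun_def i 3 parent_def)
      also have "\<dots> = (if B' = B then 1 else 0)"
      proof -
        have "x \<in> B' \<longleftrightarrow> B' = B" using x(1) unfolding a b 3 using padic_ball_eqI by metis
        \<comment> \<open>Otherwise \<open>B'\<close> would be the distinguished subball, which the
          index set excludes.\<close>
        moreover have "y \<notin> B'"
        proof
          assume "y \<in> B'"
          then have "parent l B' = padic_ball y l" unfolding a 3 by (rule parent_eq)
          then have pp: "parent l B' = parent l B" unfolding par using padic_ball_eqI[OF yl] by simp
          have "B' = padic_ball y (l + 1)" using \<open>y \<in> B'\<close> padic_ball_eqI unfolding a 3 by blast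
          also have "\<dots> = first_child l (parent l B)"
            using y(1) padic_ball_eqI unfolding first_child_def by blast
          finally show False using nfc' pp 3 by simp
        qed
        ultimately show ?thesis by (simp add: indicator_def)
      qed
      finally show ?thesis by (simp add: i 3 right_diff_distrib[symmetric])
    qed
  qed
  have "S x - S y = (\<Sum>i\<in>?I. if i = (l, B) then c (l, B) else 0)"
    unfolding S_def sum_subtractf[symmetric] by (intro sum.cong refl diff)
  also have "\<dots> = c (l, B)" using finite_wavelet_index lB(1) by simp
  finally show False using x(2) y(2) lB(2) by simp
qed

text \<open>The left side is the number of wavelets of levels from \<open>m\<close> below
  \<open>J\<close>: dividing the measure of \<open>inner_region m\<close> by the volume of a ball
  gives the number of balls of that level.\<close>

lemma eigenvalue_count_ge_wavelets:
  assumes mJ: "m \<le> J"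
    and eig: "\<And>l b \<psi>. l < J \<Longrightarrow> wavelet l b \<psi> \<Longrightarrow> \<exists>\<mu>\<le>t. \<psi> \<in> eigenspace A \<mu>"
  shows "ennreal (measure padic_haar (inner_region m) *
      (1 / ball_volume TYPE('p) TYPE('n) J - 1 / ball_volume TYPE('p) TYPE('n) m)) \<le> eigenvalue_count M A t"
proof -
  let ?I = "wavelet_index m J"
  have "\<exists>\<mu>. \<mu> \<le> t \<and> wavelet_fun i \<in> eigenspace A \<mu>" if i: "i \<in> ?I" for i
  proof -
    obtain l B where lB: "i = (l, B)" by fastforce
    then obtain b where "wavelet l b (wavelet_fun i)" using wavelet_wavelet_fun i by blast
    moreover have "l < J" using i lB by (simp add: wavelet_index_def)
    ultimately show ?thesis using eig by blast
  qed
  then obtain \<mu> where \<mu>: "\<And>i. i \<in> ?I \<Longrightarrow> \<mu> i \<le> t \<and> wavelet_fun i \<in> eigenspace A (\<mu> i)" by metis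
  have "of_nat (card ?I) \<le> eigenvalue_count M A t"
    using \<mu> wavelet_independent by (intro eigenvalue_count_geI[OF finite_wavelet_index, of m J \<mu> t wavelet_fun]) blast+
  moreover have "real (card ?I) = measure padic_haar (inner_region m) *
      (1 / ball_volume TYPE('p) TYPE('n) J - 1 / ball_volume TYPE('p) TYPE('n) m)"
  proof -
    have pos: "ball_volume TYPE('p) TYPE('n) J > 0" "ball_volume TYPE('p) TYPE('n) m > 0" by simp_all
    have "measure padic_haar (inner_region m) * (1 / ball_volume TYPE('p) TYPE('n) J) = card (balls_at J (inner_region m))"
      unfolding measure_inner_region[OF mJ] using pos by simp
    moreover have "measure padic_haar (inner_region m) * (1 / ball_volume TYPE('p) TYPE('n) m) = card (balls_at m (inner_region m))"
      unfolding measure_inner_region[OF order_refl[of m]] using pos by simp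
    moreover have "real (card ?I) = real_of_int (int (card (balls_at J (inner_region m))) - int (card (balls_at m (inner_region m))))"
      using card_wavelet_index[OF mJ] by (metis of_int_of_nat_eq)
    ultimately show ?thesis by (simp add: right_diff_distrib)
  qed
  ultimately show ?thesis by (simp add: ennreal_of_nat_eq_real_of_nat)
qed

lemma neumann_count_ge:
  assumes "m \<le> J" and t: "real CARD('p) powr (\<alpha> * real_of_int J) \<le> t"
  shows "ennreal (measure padic_haar (inner_region m) *
      (1 / ball_volume TYPE('p) TYPE('n) J - 1 / ball_volume TYPE('p) TYPE('n) m))
    \<le> eigenvalue_count M (neumann_operator \<alpha> \<Omega>) t"
proof (rule eigenvalue_count_ge_wavelets[OF assms(1)])
  fix l b \<psi> assume l: "l < J" and w: "wavelet l b \<psi>"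
  have "\<psi> \<in> eigenspace (neumann_operator \<alpha> \<Omega>) (kernel_const CARD('p) CARD('n) \<alpha> * kernel_mass l b)"
    using w unfolding wavelet_def by (intro neumann_eigenfunction[of _ 1]) auto
  moreover have "kernel_const CARD('p) CARD('n) \<alpha> * kernel_mass l b \<le> real CARD('p) powr (\<alpha> * (real_of_int l + 1))"
    by (rule kernel_mass_upper)
  moreover have "real CARD('p) powr (\<alpha> * (real_of_int l + 1)) \<le> real CARD('p) powr (\<alpha> * real_of_int J)"
    using l P alpha by (intro powr_mono mult_left_mono) auto
  ultimately show "\<exists>\<mu>\<le>t. \<psi> \<in> eigenspace (neumann_operator \<alpha> \<Omega>) \<mu>" using t by (meson order_trans)
qed

section \<open>Asymptotics of the counting bounds\<close>

text \<open>Continuity from below: as \<open>\<Omega>\<close> is open, each of its points is the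
  center of some ball in \<open>\<Omega>\<close>.\<close>

lemma inner_region_limit: "(\<lambda>k::nat. measure padic_haar (inner_region (int k))) \<longlonglongrightarrow> measure padic_haar \<Omega>"
proof -
  have "(\<lambda>k::nat. measure M (inner_region (int k))) \<longlonglongrightarrow> measure M (\<Union>k::nat. inner_region (int k))"
  proof (rule M.finite_Lim_measure_incseq)
    show "range (\<lambda>k::nat. inner_region (int k)) \<subseteq> sets M"
      using inner_region_subset by (auto simp: sets_restrict_space_iff sets_padic_haar)
    show "incseq (\<lambda>k::nat. inner_region (int k))"
      unfolding incseq_def inner_region_def
    proof (intro allI impI Collect_mono)
      fix j k :: nat and x :: "('p padic) ^ 'n"
      assume "j \<le> k"
      then have "padic_ball x (int k) \<subseteq> padic_ball x (int j)" by (intro padic_ball_antimono) simp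
      then show "padic_ball x (int k) \<subseteq> \<Omega>" if "padic_ball x (int j) \<subseteq> \<Omega>" using that by blast
    qed
  qed
  moreover have "(\<Union>k::nat. inner_region (int k)) = \<Omega>"
  proof
    show "\<Omega> \<subseteq> (\<Union>k::nat. inner_region (int k))"
    proof
      fix x assume "x \<in> \<Omega>"
      then obtain L where "padic_ball x L \<subseteq> \<Omega>" using open_region open_padic_vec_iff by blast
      moreover have "padic_ball x (int (nat L)) \<subseteq> padic_ball x L" by (rule padic_ball_antimono) simp
      ultimately show "x \<in> (\<Union>k::nat. inner_region (int k))" unfolding inner_region_def by blast
    qed
  qed (use inner_region_subset in blast)
  ultimately show ?thesis using inner_region_subset by (simp add: measure_M)
qed

text \<open>Continuity from above: a point that meets the neighbourhoods of every level lies in the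
  closure. The null boundary enters here, to replace the measure of the closure by that of
  \<open>\<Omega>\<close>.\<close>

lemma outer_region_limit:
  assumes null: "emeasure padic_haar (frontier \<Omega>) = 0"
  shows "(\<lambda>k::nat. measure padic_haar (\<Union>(balls_at (int k) \<Omega>))) \<longlonglongrightarrow> measure padic_haar \<Omega>"
proof -
  let ?U = "\<lambda>k::nat. \<Union>(balls_at (int k) \<Omega>)"
  have opn: "open (?U k)" for k by (auto simp: balls_at_def)
  have fin: "emeasure padic_haar (?U k) \<noteq> \<infinity>" for k by (simp add: emeasure_Union_balls_at[OF bounded])
  have "(\<lambda>k. emeasure padic_haar (?U k)) \<longlonglongrightarrow> emeasure padic_haar (\<Inter>k. ?U k)"
  proof (rule Lim_emeasure_decseq)
    show "decseq ?U" unfolding decseq_def balls_at_def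
      by (intro allI impI UN_mono order_refl padic_ball_antimono) simp
  qed (use opn fin in \<open>auto simp: sets_padic_haar\<close>)
  moreover have "emeasure padic_haar (\<Inter>k. ?U k) = emeasure padic_haar \<Omega>"
  proof (rule antisym)
    have "(\<Inter>k. ?U k) \<subseteq> closure \<Omega>"
    proof
      fix x assume x: "x \<in> (\<Inter>k. ?U k)"
      show "x \<in> closure \<Omega>"
        unfolding closure_iff_nhds_not_empty
      proof (intro allI impI)
        fix A S assume "S \<subseteq> A" "open S" "x \<in> S"
        then obtain L where "padic_ball x L \<subseteq> S" unfolding open_padic_vec_iff by blast
        then have L: "padic_ball x L \<subseteq> A" using \<open>S \<subseteq> A\<close> by blast
        have "x \<in> \<Union>(balls_at (int (nat L)) \<Omega>)" using x by (rule INT_D) simp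
        then obtain y where y: "y \<in> \<Omega>" "x \<in> padic_ball y (int (nat L))" by (auto simp: balls_at_def)
        then have "y \<in> padic_ball x (int (nat L))" by (simp only: padic_ball_sym[of y])
        moreover have "padic_ball x (int (nat L)) \<subseteq> padic_ball x L" by (rule padic_ball_antimono) simp
        ultimately show "\<Omega> \<inter> A \<noteq> {}" using y L by blast
      qed
    qed
    also have "closure \<Omega> = \<Omega> \<union> frontier \<Omega>" by (rule closure_Un_frontier)
    finally have "emeasure padic_haar (\<Inter>k. ?U k) \<le> emeasure padic_haar (\<Omega> \<union> frontier \<Omega>)"
      by (intro emeasure_mono) (auto simp: sets_padic_haar intro!: sets.Un borel_closed)
    also have "\<dots> \<le> emeasure padic_haar \<Omega> + emeasure padic_haar (frontier \<Omega>)"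
      by (intro emeasure_subadditive) (auto simp: sets_padic_haar intro!: borel_closed)
    finally show "emeasure padic_haar (\<Inter>k. ?U k) \<le> emeasure padic_haar \<Omega>" using null by simp
    show "emeasure padic_haar \<Omega> \<le> emeasure padic_haar (\<Inter>k. ?U k)"
    proof (rule emeasure_mono)
      show "\<Omega> \<subseteq> (\<Inter>k. ?U k)" unfolding balls_at_def using center_in_padic_ball by blast
      show "(\<Inter>k. ?U k) \<in> sets padic_haar"
        unfolding sets_padic_haar using opn by (intro sets.countable_INT) auto
    qed
  qed
  ultimately have "(\<lambda>k. emeasure padic_haar (?U k)) \<longlonglongrightarrow> emeasure padic_haar \<Omega>" by simp
  moreover have "emeasure padic_haar \<Omega> = ennreal (measure padic_haar \<Omega>)"
    using emeasure_Omega_finite by (simp add: emeasure_eq_ennreal_measure)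
  moreover have "emeasure padic_haar (?U k) = ennreal (measure padic_haar (?U k))" for k
    using fin[of k] by (simp add: emeasure_eq_ennreal_measure)
  ultimately show ?thesis by (simp add: tendsto_ennreal_iff)
qed

lemma measure_Omega_pos:
  assumes "\<Omega> \<noteq> {}" shows "0 < measure padic_haar \<Omega>"
proof -
  obtain x where "x \<in> \<Omega>" using assms by blast
  then obtain L where "padic_ball x L \<subseteq> \<Omega>" using open_region open_padic_vec_iff by blast
  then have "emeasure padic_haar (padic_ball x L) \<le> emeasure padic_haar \<Omega>" by (intro emeasure_mono) auto
  then have "0 < emeasure padic_haar \<Omega>" by (auto simp: emeasure_padic_ball less_le_trans ennreal_less_zero_iff intro: less_le_trans[rotated])
  then show ?thesis using emeasure_Omega_finite by (simp add: emeasure_eq_ennreal_measure)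
qed

section \<open>The level that belongs to a spectral parameter\<close>

lemma scale_bounds:
  fixes t :: real
  assumes t: "t > 0"
  defines "J \<equiv> \<lfloor>1 / \<alpha> * log (real CARD('p)) t\<rfloor>"
  shows "real CARD('p) powr (\<alpha> * real_of_int J) \<le> t" "t < real CARD('p) powr (\<alpha> * (real_of_int J + 1))"
proof -
  have "real_of_int J \<le> 1 / \<alpha> * log (real CARD('p)) t" unfolding J_def by linarith
  then have "\<alpha> * real_of_int J \<le> log (real CARD('p)) t" using alpha by (simp add: field_simps)
  then show "real CARD('p) powr (\<alpha> * real_of_int J) \<le> t" using P t by (simp add: le_log_iff)
  have "1 / \<alpha> * log (real CARD('p)) t < real_of_int J + 1" unfolding J_def by linarith
  then have "log (real CARD('p)) t < \<alpha> * (real_of_int J + 1)" using alpha by (simp add: field_simps)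
  then show "t < real CARD('p) powr (\<alpha> * (real_of_int J + 1))" using P t by (simp add: log_less_iff)
qed

lemma scale_at_top: "filterlim (\<lambda>t. nat \<lfloor>1 / \<alpha> * log (real CARD('p)) t\<rfloor>) sequentially at_top"
  unfolding filterlim_at_top
proof
  fix Z :: nat
  show "eventually (\<lambda>t. Z \<le> nat \<lfloor>1 / \<alpha> * log (real CARD('p)) t\<rfloor>) at_top"
    unfolding eventually_at_top_linorder
  proof (intro exI allI impI)
    fix t assume t: "real CARD('p) powr (\<alpha> * real Z) \<le> t"
    have "0 < real CARD('p) powr (\<alpha> * real Z)" using P by simp
    then have "0 < t" using t by linarith
    then have "\<alpha> * real Z \<le> log (real CARD('p)) t" using P t by (simp add: le_log_iff)
    then have "real Z \<le> 1 / \<alpha> * log (real CARD('p)) t" using alpha by (simp add: field_simps)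
    then have "int Z \<le> \<lfloor>1 / \<alpha> * log (real CARD('p)) t\<rfloor>" by (simp add: le_floor_iff)
    then show "Z \<le> nat \<lfloor>1 / \<alpha> * log (real CARD('p)) t\<rfloor>" by simp
  qed
qed

text \<open>Squeezing between the two counting bounds, with the coarse level \<open>m\<close> taken as half of the
  fine level \<open>J\<close>.\<close>

lemma weyl_law_from_bounds:
  fixes F :: "real filter" and N :: "real \<Rightarrow> ennreal"
  assumes ne: "\<Omega> \<noteq> {}" and null: "emeasure padic_haar (frontier \<Omega>) = 0" and F: "F \<le> at_top"
    and lower: "\<And>t m J. m \<le> J \<Longrightarrow> real CARD('p) powr (\<alpha> * real_of_int J) \<le> t \<Longrightarrow>
      ennreal (measure padic_haar (inner_region m) *
        (1 / ball_volume TYPE('p) TYPE('n) J - 1 / ball_volume TYPE('p) TYPE('n) m)) \<le> N t"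
    and upper: "eventually (\<lambda>t. N t \<le> of_nat (card (balls_at \<lfloor>1 / \<alpha> * log (real CARD('p)) t\<rfloor> \<Omega>))) F"
  shows "((\<lambda>t. N t / ennreal (weyl_term \<alpha> \<Omega> t)) \<longlongrightarrow> 1) F"
proof -
  let ?J = "\<lambda>t. \<lfloor>1 / \<alpha> * log (real CARD('p)) t\<rfloor>"
  let ?v = "ball_volume TYPE('p) TYPE('n)"
  let ?\<mu> = "measure padic_haar"
  have \<mu>: "0 < ?\<mu> \<Omega>" by (rule measure_Omega_pos[OF ne])
  define up where "up k = ?\<mu> (\<Union>(balls_at (int k) \<Omega>)) / ?\<mu> \<Omega>" for k :: nat
  \<comment> \<open>With m = k div 2 the quotient of the ball volumes at levels k and m is
    p^(-n(k-m)), which is at most p^(-(k-m)). Both m and k - m tend to infinity with k.\<close>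
  define lo where "lo k = ?\<mu> (inner_region (int (k div 2))) / ?\<mu> \<Omega> * (1 - (1 / real CARD('p)) ^ (k - k div 2))" for k :: nat
  have up: "up \<longlonglongrightarrow> 1"
    using tendsto_divide[OF outer_region_limit[OF null] tendsto_const[of "?\<mu> \<Omega>"]] \<mu> unfolding up_def by simp
  have half: "filterlim (\<lambda>k::nat. k div 2) sequentially sequentially"
    unfolding filterlim_at_top
  proof
    fix Z :: nat
    show "eventually (\<lambda>k. Z \<le> k div 2) sequentially"
      unfolding eventually_sequentially by (rule exI[of _ "2 * Z"]) auto
  qed
  have half': "filterlim (\<lambda>k::nat. k - k div 2) sequentially sequentially"
    by (rule filterlim_at_top_mono[OF half]) (auto intro!: always_eventually)
  have "(\<lambda>k. (1 / real CARD('p)) ^ (k - k div 2)) \<longlonglongrightarrow> 0"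
    using P by (intro filterlim_compose[OF LIMSEQ_power_zero half']) auto
  then have "lo \<longlonglongrightarrow> ?\<mu> \<Omega> / ?\<mu> \<Omega> * (1 - 0)"
    unfolding lo_def using \<mu> by (intro tendsto_intros filterlim_compose[OF inner_region_limit half]) auto
  then have lo: "lo \<longlonglongrightarrow> 1" using \<mu> by simp
  have J: "filterlim (\<lambda>t. nat (?J t)) sequentially F"
    using scale_at_top F by (rule filterlim_mono[OF _ order_refl])
  have lim: "((\<lambda>t. ennreal (f (nat (?J t)))) \<longlongrightarrow> 1) F" if "f \<longlonglongrightarrow> 1" for f :: "nat \<Rightarrow> real"
    using tendsto_ennrealI[OF filterlim_compose[OF that J]] by simp
  have ev: "eventually (\<lambda>t. t \<ge> 1) F" using F eventually_ge_at_top[of "1::real"] by (rule filter_leD)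
  have weyl: "weyl_term \<alpha> \<Omega> t = ?\<mu> \<Omega> / ?v (?J t)" for t
    unfolding weyl_term_def ball_volume_def by (simp add: power_int_minus divide_inverse)
  have div: "ennreal a / ennreal (weyl_term \<alpha> \<Omega> t) = ennreal (a * ?v (?J t) / ?\<mu> \<Omega>)" if "a \<ge> 0" for a t
    unfolding weyl using that \<mu> by (subst divide_ennreal) auto
  show ?thesis
  proof (rule tendsto_sandwich[OF _ _ lim[OF lo] lim[OF up]])
    show "eventually (\<lambda>t. ennreal (lo (nat (?J t))) \<le> N t / ennreal (weyl_term \<alpha> \<Omega> t)) F"
      using ev
    proof eventually_elim
      case (elim t)
      then have "0 \<le> log (real CARD('p)) t" using P by simp
      \<comment> \<open>For \<open>t\<close> at least 1 the level is nonnegative, so converting it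
        to a natural number loses nothing.\<close>
      then have J0: "0 \<le> ?J t" using alpha by simp
      define k where "k = nat (?J t)"
      have k: "int k = ?J t" using J0 by (simp add: k_def)
      define m where "m = int (k div 2)"
      have mJ: "m \<le> ?J t" and mk: "m + int (k - k div 2) = ?J t" unfolding m_def k[symmetric] by simp_all
      have "1 - ?v (?J t) / ?v m \<ge> 1 - (1 / real CARD('p)) ^ (k - k div 2)"
      proof -
        have "?v m = real (CARD('p) ^ (CARD('n) * (k - k div 2))) * ?v (?J t)"
          using ball_volume_refine[where L = m and k = "k - k div 2" and 'p='p and 'n='n] unfolding mk .
        then have "?v (?J t) / ?v m = 1 / real (CARD('p) ^ (CARD('n) * (k - k div 2)))"
          using ball_volume_pos[where L = "?J t" and 'p='p and 'n='n] by (simp del: ball_volume_pos)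
        also have "\<dots> \<le> 1 / real (CARD('p) ^ (k - k div 2))"
          using P by (intro divide_left_mono) (auto intro!: power_increasing)
        finally show ?thesis by (simp add: power_one_over)
      qed
      then have "?\<mu> (inner_region m) / ?\<mu> \<Omega> * (1 - (1 / real CARD('p)) ^ (k - k div 2))
          \<le> ?\<mu> (inner_region m) / ?\<mu> \<Omega> * (1 - ?v (?J t) / ?v m)" by (intro mult_left_mono) auto
      then have "lo k \<le> ?\<mu> (inner_region m) / ?\<mu> \<Omega> * (1 - ?v (?J t) / ?v m)" by (simp only: lo_def m_def)
      also have "\<dots> = (?\<mu> (inner_region m) * (1 / ?v (?J t) - 1 / ?v m)) * ?v (?J t) / ?\<mu> \<Omega>"
      proof -
        have "a / d * (1 - v / w) = a * (1 / v - 1 / w) * v / d" if "v \<noteq> 0" for a d v w :: real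
        proof -
          have "(1 / v - 1 / w) * v = 1 - v / w" using that by (simp add: left_diff_distrib)
          then show ?thesis by (simp add: mult.assoc)
        qed
        then show ?thesis using ball_volume_neq_0 by blast
      qed
      finally have "ennreal (lo k) \<le> ennreal (\<dots>)" by (rule ennreal_leI)
      also have "\<dots> = ennreal (?\<mu> (inner_region m) * (1 / ?v (?J t) - 1 / ?v m)) / ennreal (weyl_term \<alpha> \<Omega> t)"
      proof (rule div[symmetric])
        have "?v (?J t) \<le> ?v m"
          unfolding ball_volume_def using mJ P by (intro power_int_increasing) auto
        then have "1 / ?v m \<le> 1 / ?v (?J t)" by (intro divide_left_mono) auto
        then show "0 \<le> ?\<mu> (inner_region m) * (1 / ?v (?J t) - 1 / ?v m)" by (intro mult_nonneg_nonneg) auto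
      qed
      also have "\<dots> \<le> N t / ennreal (weyl_term \<alpha> \<Omega> t)"
        using elim by (intro divide_right_mono_ennreal lower[OF mJ] scale_bounds) auto
      finally show ?case by (simp only: k_def)
    qed
    show "eventually (\<lambda>t. N t / ennreal (weyl_term \<alpha> \<Omega> t) \<le> ennreal (up (nat (?J t)))) F"
      using upper ev
    proof eventually_elim
      case (elim t)
      then have "0 \<le> log (real CARD('p)) t" using P by simp
      then have J0: "0 \<le> ?J t" using alpha by simp
      have "N t / ennreal (weyl_term \<alpha> \<Omega> t) \<le> of_nat (card (balls_at (?J t) \<Omega>)) / ennreal (weyl_term \<alpha> \<Omega> t)"
        using elim by (intro divide_right_mono_ennreal)
      also have "\<dots> = ennreal (card (balls_at (?J t) \<Omega>) * ?v (?J t) / ?\<mu> \<Omega>)"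
        by (simp add: ennreal_of_nat_eq_real_of_nat div)
      also have "card (balls_at (?J t) \<Omega>) * ?v (?J t) / ?\<mu> \<Omega> = up (nat (?J t))"
        using emeasure_Union_balls_at[OF bounded, of "?J t"] J0 by (simp add: up_def measure_def)
      finally show ?case .
    qed
  qed
qed

end

section \<open>Additive characters\<close>

text \<open>The ring Z[1/p]. Unlike fractional parts, its elements need not lie in [0, 1) and can
  therefore be added freely.\<close>

definition p_fraction :: "nat \<Rightarrow> rat \<Rightarrow> bool" where
  "p_fraction p q \<longleftrightarrow> (\<exists>(a::int) k. q = of_int a / of_nat p ^ k)"

lemma p_fraction_of_int: "p_fraction p (of_int a)"
  unfolding p_fraction_def by (rule exI[of _ a], rule exI[of _ 0]) simp

lemma p_fraction_add:
  assumes "p > 0" "p_fraction p q" "p_fraction p r" shows "p_fraction p (q + r)"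
proof -
  obtain a k b l where q: "q = of_int a / of_nat p ^ k" and r: "r = of_int b / of_nat p ^ l"
    using assms by (auto simp: p_fraction_def)
  have "q + r = of_int (a * int p ^ l + b * int p ^ k) / of_nat p ^ (k + l)"
    using assms(1) by (simp add: q r field_simps power_add)
  then show ?thesis unfolding p_fraction_def by blast
qed

lemma p_fraction_minus: "p_fraction p q \<Longrightarrow> p_fraction p (- q)"
  unfolding p_fraction_def by (metis minus_divide_left of_int_minus)

text \<open>The intersection of Z[1/p] with the p-adic integers is Z: the norm bound makes the power
  of p in the denominator divide the numerator.\<close>

lemma p_fraction_integral:
  assumes "p_fraction CARD('p::prime_card) q" "padic_norm (of_rat q :: 'p padic) \<le> 1"
  obtains a where "q = of_int a"
proof -
  obtain a k where q: "q = of_int a / of_nat CARD('p) ^ k" using assms(1) by (auto simp: p_fraction_def)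
  have pp: "real CARD('p) > 0" using one_less_card_prime[where 'p='p] by simp
  have nz: "(of_nat CARD('p) :: rat) ^ k \<noteq> 0" by simp
  have "padic_norm (of_rat (of_nat CARD('p) ^ k) :: 'p padic) = real CARD('p) powi (- int k)"
    using padic_norm_p_powi[of "int k", where 'p='p] by (simp add: of_rat_power)
  moreover have "of_int a = q * of_nat CARD('p) ^ k" using q nz by simp
  then have "padic_norm (of_rat (of_int a) :: 'p padic)
      = padic_norm (of_rat q :: 'p padic) * padic_norm (of_rat (of_nat CARD('p) ^ k) :: 'p padic)"
    by (simp only: of_rat_mult padic_norm_mult)
  ultimately have "padic_norm (of_rat (of_int a) :: 'p padic) \<le> 1 * real CARD('p) powi (- int k)"
    using assms(2) pp by (simp only:) (intro mult_right_mono, auto)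
  then have "int CARD('p) ^ k dvd a"
    using padic_abs_of_int_le_iff[OF prime_card[where 'a='p], of a k] by (simp only: padic_norm_of_rat) simp
  then obtain c where "a = int CARD('p) ^ k * c" by (elim dvdE)
  then have "q = of_int c" using nz by (simp add: q)
  then show ?thesis by (rule that)
qed

text \<open>Multiply by a power p^k that brings \<open>x\<close> into the unit ball, take the
  residue modulo p^k, and divide by p^k again.\<close>

lemma padic_frac_ex:
  fixes x :: "'p::prime_card padic"
  obtains q where "0 \<le> q" "q < 1" "p_fraction CARD('p) q" "padic_norm (x - of_rat q) \<le> 1"
proof -
  let ?p = "of_nat CARD('p) :: 'p padic"
  have P: "real CARD('p) > 1" by (rule one_less_card_prime)
  obtain k where k: "padic_norm x < real CARD('p) ^ k" using real_arch_pow[OF P] by blast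
  have nk: "padic_norm (?p ^ k) = real CARD('p) powi (- int k)"
    using padic_norm_p_powi[of "int k", where 'p='p] by simp
  have c1: "real CARD('p) powi (- int k) * real CARD('p) ^ k = 1" using P by (simp add: power_int_minus)
  have "padic_norm (?p ^ k * x) \<le> real CARD('p) powi (- int k) * real CARD('p) ^ k"
    unfolding padic_norm_mult nk using k by (intro mult_left_mono) auto
  then have "padic_norm (?p ^ k * x) \<le> 1" using c1 by simp
  then obtain c where c: "c < CARD('p) ^ k" "padic_norm (?p ^ k * x - of_nat c) \<le> real CARD('p) powi (- int k)"
    by (rule padic_residue_ex)
  define q :: rat where "q = of_nat c / of_nat CARD('p) ^ k"
  have q1: "0 \<le> q" "q < 1" using c(1) by (auto simp: q_def divide_less_eq simp flip: of_nat_power)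
  have "p_fraction CARD('p) q" unfolding p_fraction_def q_def by (rule exI[of _ "int c"]) auto
  moreover have "padic_norm (x - of_rat q) \<le> 1"
  proof -
    have "?p ^ k * (x - of_rat q) = ?p ^ k * x - of_nat c"
      by (simp add: q_def of_rat_divide of_rat_power right_diff_distrib)
    then have "real CARD('p) powi (- int k) * padic_norm (x - of_rat q) \<le> real CARD('p) powi (- int k) * 1"
      using c(2) nk by (metis mult.right_neutral padic_norm_mult)
    then show ?thesis by (subst (asm) mult_le_cancel_left_pos) auto
  qed
  ultimately show ?thesis using that q1 by blast
qed

lemma exp_two_pi_of_rat_add_int:
  "exp (2 * of_real pi * \<i> * of_rat (q + of_int a)) = exp (2 * of_real pi * \<i> * of_rat q)"
proof -
  have "2 * of_real pi * \<i> * of_rat (q + of_int a) = 2 * of_real pi * \<i> * of_rat q + (of_int (2 * a) * pi) * \<i>"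
    by (simp add: of_rat_add algebra_simps)
  then show ?thesis unfolding exp_eq by blast
qed

text \<open>Any two elements of Z[1/p] within distance 1 of \<open>x\<close> differ by an integer,
  which the exponential ignores. So the character may be computed from any of them; with values in
  [0, 1) the integer is 0, which also justifies the definite description.\<close>

lemma padic_char_eq:
  fixes x :: "'p::prime_card padic"
  assumes q: "p_fraction CARD('p) q" "padic_norm (x - of_rat q) \<le> 1"
  shows "padic_char x = exp (2 * of_real pi * \<i> * of_rat q)"
proof -
  let ?R = "\<lambda>q. 0 \<le> q \<and> q < 1 \<and> (\<exists>(a::int) k. q = of_int a / of_nat CARD('p) ^ k) \<and> padic_norm (x - of_rat q) \<le> 1"
  have int: "\<exists>a. r = q + of_int a" if "p_fraction CARD('p) q" "p_fraction CARD('p) r"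
    "padic_norm (x - of_rat q) \<le> 1" "padic_norm (x - of_rat r) \<le> 1" for q r
  proof -
    have "p_fraction CARD('p) (r + - q)"
      using that prime_gt_0_nat[OF prime_card[where 'a='p]] by (intro p_fraction_add p_fraction_minus)
    moreover have "padic_norm (of_rat (r + - q) :: 'p padic) \<le> 1"
      using padic_norm_diff_ultra[of "of_rat r" "of_rat q" x] that padic_norm_minus_commute[of x "of_rat r"]
      by (auto simp: of_rat_diff)
    ultimately obtain a where "r + - q = of_int a" by (rule p_fraction_integral)
    then show ?thesis by (intro exI[of _ a]) (simp add: algebra_simps)
  qed
  have "\<exists>!q. ?R q"
  proof (rule ex_ex1I)
    show "\<exists>q. ?R q" using padic_frac_ex[of x] unfolding p_fraction_def by metis
    fix q r assume "?R q" "?R r"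
    then obtain a where "r = q + of_int a" using int[of q r] unfolding p_fraction_def by blast
    moreover have "0 \<le> q" "q < 1" "0 \<le> r" "r < 1" using \<open>?R q\<close> \<open>?R r\<close> by blast+
    then have "\<bar>r - q\<bar> < 1" by linarith
    ultimately have "\<bar>of_int a :: rat\<bar> < 1" by simp
    then have "a = 0" by linarith
    then show "q = r" using \<open>r = q + of_int a\<close> by simp
  qed
  then have "?R (padic_frac x)" unfolding padic_frac_def by (rule theI')
  then obtain a where "padic_frac x = q + of_int a" using int[OF q(1) _ q(2)] unfolding p_fraction_def by blast
  then show ?thesis unfolding padic_char_def by (simp only: exp_two_pi_of_rat_add_int)
qed

lemma padic_char_add: "padic_char (x + y) = padic_char x * padic_char y"
  for x :: "'p::prime_card padic"
proof -
  obtain q where q: "p_fraction CARD('p) q" "padic_norm (x - of_rat q) \<le> 1" by (rule padic_frac_ex)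
  obtain r where r: "p_fraction CARD('p) r" "padic_norm (y - of_rat r) \<le> 1" by (rule padic_frac_ex)
  have "p_fraction CARD('p) (q + r)" using q r prime_gt_0_nat[OF prime_card[where 'a='p]] by (intro p_fraction_add)
  moreover have "padic_norm (x + y - of_rat (q + r)) \<le> 1"
    using padic_norm_ultra[of "x - of_rat q" "y - of_rat r"] q r by (auto simp: of_rat_add algebra_simps)
  ultimately have "padic_char (x + y) = exp (2 * of_real pi * \<i> * of_rat (q + r))" by (rule padic_char_eq)
  then show ?thesis unfolding padic_char_eq[OF q] padic_char_eq[OF r]
    by (simp add: exp_add[symmetric] of_rat_add algebra_simps)
qed

lemma padic_char_eq_1: "padic_norm x \<le> 1 \<Longrightarrow> padic_char x = 1"
  using padic_char_eq[of 0 x] p_fraction_of_int[of _ 0] by simp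

lemma of_rat_complex_eq: "(of_rat q :: complex) = of_real (of_rat q)"
  by (cases q) (simp add: of_rat_rat)

lemma cmod_padic_char [simp]: "cmod (padic_char x) = 1"
  unfolding padic_char_def of_rat_complex_eq by simp

lemma padic_char_minus: "padic_char (- x) = cnj (padic_char x)"
proof -
  have "padic_char x * padic_char (- x) = padic_char x * cnj (padic_char x)"
    using padic_char_add[of x "- x"] padic_char_eq_1[of "x - x"] complex_norm_square[of "padic_char x"] by simp
  then show ?thesis by (metis cmod_padic_char mult_left_cancel norm_zero zero_neq_one)
qed

text \<open>The character is nontrivial just outside the unit ball; all vanishing results for
  Fourier transforms by translation go back to this.\<close>

lemma padic_char_inverse_p: "padic_char (inverse (of_nat CARD('p)) :: 'p::prime_card padic) \<noteq> 1"
proof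
  have P: "real CARD('p) > 1" by (rule one_less_card_prime)
  let ?q = "1 / of_nat CARD('p) :: rat"
  have "p_fraction CARD('p) ?q" unfolding p_fraction_def by (rule exI[of _ 1], rule exI[of _ 1]) simp
  moreover have "padic_norm (inverse (of_nat CARD('p)) - of_rat ?q :: 'p padic) \<le> 1"
    by (simp add: of_rat_divide inverse_eq_divide)
  ultimately have c: "padic_char (inverse (of_nat CARD('p)) :: 'p padic) = exp (2 * of_real pi * \<i> * of_rat ?q)"
    by (rule padic_char_eq)
  assume "padic_char (inverse (of_nat CARD('p)) :: 'p padic) = 1"
  then have "exp (2 * of_real pi * \<i> * of_rat ?q) = 1" using c by simp
  then obtain n :: int where "Im (2 * of_real pi * \<i> * of_rat ?q) = of_int (2 * n) * pi"
    unfolding exp_eq_1 by blast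
  then have "2 * pi * (1 / real CARD('p)) = 2 * pi * of_int n"
    by (simp add: of_rat_divide of_rat_complex_eq mult_ac)
  then have "1 / real CARD('p) = of_int n" by (subst (asm) mult_left_cancel) auto
  then have "1 = real_of_int (n * int CARD('p))" using P by (simp add: field_simps)
  then have "n * int CARD('p) = 1" by linarith
  then have "int CARD('p) dvd 1" by (metis dvd_triv_right)
  then show False using P by simp
qed

section \<open>The pairing of frequencies and points\<close>

definition pairing :: "('p::prime_card padic) ^ 'n \<Rightarrow> ('p padic) ^ 'n \<Rightarrow> complex" where
  "pairing \<xi> x = padic_char (\<Sum>i\<in>UNIV. \<xi> $ i * x $ i)"

lemma pairing_commute: "pairing \<xi> x = pairing x \<xi>"
  by (simp add: pairing_def mult.commute)

lemma pairing_add: "pairing \<xi> (x + y) = pairing \<xi> x * pairing \<xi> y"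
  by (simp add: pairing_def distrib_left sum.distrib padic_char_add)

lemma cmod_pairing [simp]: "cmod (pairing \<xi> x) = 1"
  by (simp add: pairing_def)

lemma pairing_minus: "pairing \<xi> (- x) = cnj (pairing \<xi> x)"
  by (simp add: pairing_def sum_negf padic_char_minus)

lemma pairing_diff: "pairing \<xi> (x - y) = pairing \<xi> x * cnj (pairing \<xi> y)"
  using pairing_add[of \<xi> x "- y"] by (simp add: pairing_minus)

lemma pairing_diff_left: "pairing (\<xi> - \<eta>) x = pairing \<xi> x * cnj (pairing \<eta> x)"
  using pairing_diff[of x \<xi> \<eta>] by (simp only: pairing_commute[of x])

lemma padic_norm_sum_le:
  assumes "finite I" "0 \<le> r" "\<And>i. i \<in> I \<Longrightarrow> padic_norm (f i) \<le> r"
  shows "padic_norm (\<Sum>i\<in>I. f i) \<le> r"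
  using assms by (induction I rule: finite_induct) (auto intro: order_trans[OF padic_norm_ultra])

lemma pairing_eq_1:
  assumes "padic_vnorm \<xi> * padic_vnorm x \<le> 1"
  shows "pairing \<xi> x = 1"
  unfolding pairing_def
proof (intro padic_char_eq_1 padic_norm_sum_le)
  fix i
  have "padic_norm (\<xi> $ i * x $ i) \<le> padic_vnorm \<xi> * padic_vnorm x"
    unfolding padic_norm_mult by (intro mult_mono padic_norm_nth_le) auto
  then show "padic_norm (\<xi> $ i * x $ i) \<le> 1" using assms by simp
qed auto

lemma pairing_eq_1_balls:
  fixes \<xi> x :: "('p::prime_card padic) ^ 'n"
  assumes "\<xi> \<in> padic_ball 0 (- k)" "x \<in> padic_ball 0 k"
  shows "pairing \<xi> x = 1"
proof (rule pairing_eq_1)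
  have "padic_vnorm \<xi> * padic_vnorm x \<le> real CARD('p) powi k * real CARD('p) powi (- k)"
    using assms by (intro mult_mono) (auto simp: mem_padic_ball_iff less_imp_le)
  also have "\<dots> = 1" by (simp add: power_int_minus)
  finally show "padic_vnorm \<xi> * padic_vnorm x \<le> 1" .
qed

lemma pairing_nontrivial:
  fixes \<xi> :: "('p::prime_card padic) ^ 'n"
  assumes "real CARD('p) powi k < padic_vnorm \<xi>"
  obtains h where "h \<in> padic_ball 0 k" "pairing \<xi> h \<noteq> 1"
proof -
  have P: "real CARD('p) > 1" by (rule one_less_card_prime)
  have "0 < padic_vnorm \<xi>" using assms powi_pos_prime[where 'p='p and k=k] by linarith
  then have "\<xi> \<noteq> 0" using less_irrefl padic_vnorm_eq_0_iff by metis
  then obtain j where j: "padic_vnorm \<xi> = real CARD('p) powi j" by (rule padic_vnorm_discrete)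
  then have kj: "k + 1 \<le> j" using assms power_int_less_iff[OF P, of k j] by simp
  obtain i where i: "padic_vnorm \<xi> = padic_norm (\<xi> $ i)" by (rule padic_vnorm_attained)
  then have nz: "\<xi> $ i \<noteq> 0" using \<open>0 < padic_vnorm \<xi>\<close> by auto
  \<comment> \<open>At the coordinate where the norm p^j of \<open>\<xi>\<close> is attained,
    \<open>c\<close> makes the product with \<open>\<xi>\<close> equal to 1/p. Its norm is p^(1-j),
    at most p^(-k) because k + 1 is at most j.\<close>
  define c where "c = inverse (of_nat CARD('p)) * inverse (\<xi> $ i)"
  define h :: "('p padic) ^ 'n" where "h = (\<chi> l. if l = i then c else 0)"
  have "padic_norm c = real CARD('p) powi 1 * real CARD('p) powi (- j)"
    using padic_norm_p_powi[of "-1", where 'p='p] i j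
    by (simp add: c_def padic_norm_mult padic_norm_inverse power_int_minus)
  also have "\<dots> = real CARD('p) powi (1 - j)" using P by (simp add: power_int_diff power_int_minus divide_inverse)
  also have "\<dots> \<le> real CARD('p) powi (- k)" using kj by (simp add: power_int_le_iff[OF P])
  finally have "h \<in> padic_ball 0 k"
    by (auto simp: mem_padic_ball_iff padic_vnorm_le_iff h_def less_imp_le)
  moreover have "(\<Sum>l\<in>UNIV. \<xi> $ l * h $ l) = inverse (of_nat CARD('p))"
  proof -
    have "(\<Sum>l\<in>UNIV. \<xi> $ l * h $ l) = (\<Sum>l\<in>UNIV. if l = i then \<xi> $ i * c else 0)"
      by (intro sum.cong) (auto simp: h_def)
    then show ?thesis using nz by (simp add: c_def)
  qed
  then have "pairing \<xi> h \<noteq> 1" by (simp add: pairing_def padic_char_inverse_p)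
  ultimately show ?thesis by (rule that)
qed

text \<open>The character is trivial on the unit ball and hence constant at distances below 1, so 1
  serves as the distance for every tolerance.\<close>

lemma continuous_on_padic_char: "continuous_on UNIV (padic_char :: 'p::prime_card padic \<Rightarrow> complex)"
  unfolding continuous_on_iff
proof (intro ballI allI impI exI[of _ 1] conjI)
  fix x y :: "'p padic" and e :: real assume e: "0 < e" "dist y x < 1"
  then have "padic_norm (y - x) \<le> 1" by (simp add: dist_padic_def)
  then have "padic_char y = padic_char x" using padic_char_add[of "y - x" x] by (simp add: padic_char_eq_1)
  then show "dist (padic_char y) (padic_char x) < e" using e by simp
qed simp

lemma continuous_on_pairing:
  "continuous_on UNIV (\<lambda>z :: (('p::prime_card padic) ^ 'n) \<times> (('p padic) ^ 'n). pairing (fst z) (snd z))"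
proof -
  have "continuous_on UNIV (\<lambda>z :: (('p padic) ^ 'n) \<times> (('p padic) ^ 'n). \<Sum>i\<in>UNIV. fst z $ i * snd z $ i)"
    by (intro continuous_on_sum continuous_on_mult' continuous_on_component continuous_on_fst continuous_on_snd continuous_on_id)
  from continuous_on_compose2[OF continuous_on_padic_char this] show ?thesis
    unfolding pairing_def by simp
qed

lemma borel_measurable_pairing [measurable (raw)]:
  fixes f g :: "'a \<Rightarrow> ('p::prime_card padic) ^ 'n"
  assumes [measurable]: "f \<in> borel_measurable N" "g \<in> borel_measurable N"
  shows "(\<lambda>x. pairing (f x) (g x)) \<in> borel_measurable N"
proof -
  have "(\<lambda>x. (f x, g x)) \<in> measurable N borel" by (simp add: borel_prod[symmetric])
  from measurable_compose[OF this borel_measurable_continuous_onI[OF continuous_on_pairing]]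
  show ?thesis by simp
qed

section \<open>The Fourier transform of integrable functions\<close>

abbreviation haar :: "(('p::prime_card padic) ^ 'n) measure" where "haar \<equiv> padic_haar"

lemma haar_ident_measurable [measurable]: "(\<lambda>x. x) \<in> borel_measurable haar"
  by (intro measurable_ident_sets sets_padic_haar)

interpretation haar: sigma_finite_measure haar
  by (rule sigma_finite_padic_haar)

interpretation haar2: pair_sigma_finite haar haar ..

lemma distr_haar_translate: "distr haar haar ((+) a) = (haar :: (('p::prime_card padic) ^ 'n) measure)"
proof (rule measure_eqI)
  fix A assume "A \<in> sets (distr haar haar ((+) a))"
  then have A: "A \<in> sets (borel :: (('p padic) ^ 'n) measure)" by (simp add: sets_padic_haar)
  have m: "(+) a \<in> measurable haar (haar :: (('p padic) ^ 'n) measure)"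
    by (subst measurable_cong_sets[OF sets_padic_haar sets_padic_haar]) (rule borel_translate)
  have "emeasure (distr haar haar ((+) a)) A = emeasure haar ((+) a -` A \<inter> space haar)"
    using A by (intro emeasure_distr[OF m]) (simp add: sets_padic_haar)
  also have "(+) a -` A \<inter> space haar = (+) (- a) ` A"
    using image_translate_eq_vimage[of "- a" A] by simp
  finally show "emeasure (distr haar haar ((+) a)) A = emeasure haar A"
    using padic_haar_translate[OF A, of "- a"] by simp
qed simp

lemma integral_haar_translate:
  fixes f :: "('p::prime_card padic) ^ 'n \<Rightarrow> complex"
  assumes f: "f \<in> borel_measurable haar"
  shows "(LINT x|haar. f (a + x)) = (LINT x|haar. f x)"
proof -
  have m: "(+) a \<in> measurable haar (haar :: (('p padic) ^ 'n) measure)"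
    by (subst measurable_cong_sets[OF sets_padic_haar sets_padic_haar]) (rule borel_translate)
  have "(LINT x|haar. f x) = (LINT x|distr haar haar ((+) a). f x)" by (simp add: distr_haar_translate)
  also have "\<dots> = (LINT x|haar. f (a + x))" by (rule integral_distr[OF m f])
  finally show ?thesis by simp
qed

lemma fourier_L1_pairing: "fourier_L1 f \<xi> = (LINT x|haar. f x * pairing \<xi> x)"
  by (simp add: fourier_L1_def pairing_def)

lemma integrable_mult_pairing:
  assumes "integrable haar f" shows "integrable haar (\<lambda>x. f x * pairing \<xi> x)"
proof (rule Bochner_Integration.integrable_bound[OF assms])
  have [measurable]: "f \<in> borel_measurable haar" using assms by (rule borel_measurable_integrable)
  show "(\<lambda>x. f x * pairing \<xi> x) \<in> borel_measurable haar" by measurable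
qed (simp add: norm_mult)

lemma cmod_fourier_L1_le:
  assumes "integrable haar f" shows "cmod (fourier_L1 f \<xi>) \<le> (LINT x|haar. cmod (f x))"
  unfolding fourier_L1_pairing
  using integral_norm_bound[of haar "\<lambda>x. f x * pairing \<xi> x"] by (simp add: norm_mult)

lemma fourier_L1_measurable [measurable (raw)]:
  assumes "integrable haar f" shows "fourier_L1 f \<in> borel_measurable haar"
proof -
  have [measurable]: "f \<in> borel_measurable haar" using assms by (rule borel_measurable_integrable)
  have "(\<lambda>\<xi>. LINT x|haar. f x * pairing \<xi> x) \<in> borel_measurable haar" by measurable
  then show ?thesis by (simp add: fourier_L1_pairing[abs_def])
qed

lemma fourier_L1_diff:
  "integrable haar f \<Longrightarrow> integrable haar g \<Longrightarrow> fourier_L1 (\<lambda>x. f x - g x) \<xi> = fourier_L1 f \<xi> - fourier_L1 g \<xi>"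
  by (simp add: fourier_L1_pairing left_diff_distrib integrable_mult_pairing)

lemma fourier_L1_sum:
  assumes "finite S" "\<And>i. i \<in> S \<Longrightarrow> integrable haar (f i)"
  shows "fourier_L1 (\<lambda>x. \<Sum>i\<in>S. c i * f i x) \<xi> = (\<Sum>i\<in>S. c i * fourier_L1 (f i) \<xi>)"
proof -
  have "fourier_L1 (\<lambda>x. \<Sum>i\<in>S. c i * f i x) \<xi> = (LINT x|haar. (\<Sum>i\<in>S. c i * (f i x * pairing \<xi> x)))"
    unfolding fourier_L1_pairing
    by (intro Bochner_Integration.integral_cong refl) (simp add: sum_distrib_right mult.assoc)
  also have "\<dots> = (\<Sum>i\<in>S. LINT x|haar. c i * (f i x * pairing \<xi> x))"
    using assms by (intro Bochner_Integration.integral_sum integrable_mult_right integrable_mult_pairing)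
  finally show ?thesis by (simp add: fourier_L1_pairing)
qed

text \<open>Translating by an \<open>h\<close> with \<open>pairing \<xi> h \<noteq> 1\<close> multiplies the integral by a factor
  different from 1.\<close>

lemma fourier_L1_eq_0:
  fixes f :: "('p::prime_card padic) ^ 'n \<Rightarrow> complex"
  assumes f: "integrable haar f" and inv: "\<And>x h. h \<in> padic_ball 0 k \<Longrightarrow> f (h + x) = f x"
    and \<xi>: "real CARD('p) powi k < padic_vnorm \<xi>"
  shows "fourier_L1 f \<xi> = 0"
proof -
  obtain h where h: "h \<in> padic_ball 0 k" "pairing \<xi> h \<noteq> 1" using pairing_nontrivial[OF \<xi>] .
  have "fourier_L1 f \<xi> = (LINT x|haar. f (h + x) * pairing \<xi> (h + x))"
    unfolding fourier_L1_pairing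
    by (rule integral_haar_translate[symmetric]) (rule borel_measurable_integrable[OF integrable_mult_pairing[OF f]])
  also have "\<dots> = (LINT x|haar. pairing \<xi> h * (f x * pairing \<xi> x))"
    using inv[OF h(1)] by (simp add: pairing_add mult_ac)
  also have "\<dots> = pairing \<xi> h * fourier_L1 f \<xi>" by (simp add: fourier_L1_pairing)
  finally have "(1 - pairing \<xi> h) * fourier_L1 f \<xi> = 0" by (simp add: left_diff_distrib)
  then show ?thesis using h(2) by simp
qed

lemma integrable_indicator_ball: "integrable haar (indicator (padic_ball a L) :: _ \<Rightarrow> complex)"
proof -
  have "integrable haar (\<lambda>x. complex_of_real (indicator (padic_ball a L) x))"
    by (intro integrable_of_real integrable_real_indicator) (auto simp: sets_padic_haar emeasure_padic_ball)
  moreover have "(\<lambda>x. complex_of_real (indicator (padic_ball a L) x)) = indicator (padic_ball a L)"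
    by (auto simp: indicator_def)
  ultimately show ?thesis by simp
qed

text \<open>The approximate identity of ball averages: the density of the uniform distribution on
  the ball of level \<open>m\<close>. It is at the same time the transform of the indicator of the
  dual ball.\<close>

definition ball_average_kernel :: "int \<Rightarrow> ('p::prime_card padic) ^ 'n \<Rightarrow> real" where
  "ball_average_kernel m z = indicator (padic_ball 0 m) z / ball_volume TYPE('p) TYPE('n) m"

lemma ball_average_kernel_nonneg [simp]: "0 \<le> ball_average_kernel m z"
  by (simp add: ball_average_kernel_def)

lemma ball_average_kernel_minus: "ball_average_kernel m (x - y) = ball_average_kernel m (y - x)"
  by (simp add: ball_average_kernel_def indicator_def mem_padic_ball_iff padic_vnorm_minus_commute)

lemma borel_measurable_ball_average_kernel [measurable (raw)]:
  fixes f g :: "'a \<Rightarrow> ('p::prime_card padic) ^ 'n"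
  assumes [measurable]: "f \<in> borel_measurable N" "g \<in> borel_measurable N"
  shows "(\<lambda>x. ball_average_kernel m (f x - g x)) \<in> borel_measurable N"
proof -
  let ?h = "\<lambda>r. indicator {..real CARD('p) powi (- m)} r / ball_volume TYPE('p) TYPE('n) m"
  have "?h \<in> borel_measurable borel" by (intro borel_measurable_divide borel_measurable_indicator) auto
  from measurable_compose[OF borel_measurable_padic_vnorm_diff[OF assms] this]
  show ?thesis by (simp only: ball_average_kernel_def indicator_def mem_padic_ball_iff diff_0_right atMost_iff)
qed

lemma nn_integral_ball_average_kernel: "(\<integral>\<^sup>+y. ennreal (ball_average_kernel m (y - x)) \<partial>haar) = 1"
  for x :: "('p::prime_card padic) ^ 'n"
proof -
  let ?v = "ball_volume TYPE('p) TYPE('n) m"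
  have "(\<integral>\<^sup>+y. ennreal (ball_average_kernel m (y - x)) \<partial>haar) = (\<integral>\<^sup>+y. ennreal (1 / ?v) * indicator (padic_ball x m) y \<partial>haar)"
    by (intro nn_integral_cong) (auto simp: ball_average_kernel_def indicator_def mem_padic_ball_iff)
  also have "\<dots> = ennreal (1 / ?v) * ennreal ?v"
    by (subst nn_integral_cmult_indicator) (auto simp: sets_padic_haar emeasure_padic_ball)
  finally show ?thesis by (simp add: ennreal_mult[symmetric])
qed

text \<open>On the dual ball the pairing is trivial and the integral is the volume at level -m, the
  reciprocal of that at level m. Elsewhere the indicator is invariant under a translation on which
  the pairing is nontrivial.\<close>

lemma fourier_L1_indicator_ball:
  "fourier_L1 (indicator (padic_ball 0 (- m))) z = complex_of_real (ball_average_kernel m z)"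
  for z :: "('p::prime_card padic) ^ 'n"
proof (cases "z \<in> padic_ball 0 m")
  case True
  have eq: "indicator (padic_ball 0 (- m)) x * pairing z x = (indicator (padic_ball 0 (- m)) x :: complex)" for x
    using pairing_eq_1_balls[of x m z] True by (auto simp: indicator_def pairing_commute)
  have "fourier_L1 (indicator (padic_ball 0 (- m))) z = (LINT x|haar. (indicator (padic_ball (0 :: ('p padic) ^ 'n) (- m)) x :: complex))"
    by (simp only: fourier_L1_pairing eq)
  also have "\<dots> = (LINT x|haar. complex_of_real (indicator (padic_ball (0 :: ('p padic) ^ 'n) (- m)) x))"
    by (intro Bochner_Integration.integral_cong) (auto simp: indicator_def)
  also have "\<dots> = complex_of_real (measure haar (padic_ball (0 :: ('p padic) ^ 'n) (- m)))"
    unfolding integral_complex_of_real by simp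
  also have "measure haar (padic_ball (0 :: ('p padic) ^ 'n) (- m)) = 1 / ball_volume TYPE('p) TYPE('n) m"
    by (simp add: measure_def emeasure_padic_ball) (simp add: ball_volume_def power_int_minus field_simps)
  finally show ?thesis using True by (simp add: ball_average_kernel_def)
next
  case False
  have "fourier_L1 (indicator (padic_ball 0 (- m))) z = 0"
  proof (rule fourier_L1_eq_0[OF integrable_indicator_ball])
    show "real CARD('p) powi (- m) < padic_vnorm z" using False by (simp add: mem_padic_ball_iff)
    fix x h :: "('p padic) ^ 'n" assume "h \<in> padic_ball 0 (- m)"
    then have "h + x \<in> padic_ball x (- m)" by (simp add: mem_padic_ball_iff)
    then have "h + x \<in> padic_ball 0 (- m) \<longleftrightarrow> x \<in> padic_ball 0 (- m)"
      using padic_ball_trans padic_ball_sym by blast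
    then show "indicator (padic_ball 0 (- m)) (h + x) = (indicator (padic_ball 0 (- m)) x :: complex)" by (simp add: indicator_def)
  qed
  then show ?thesis using False by (simp add: ball_average_kernel_def)
qed

lemma integrable_tensor:
  fixes f g :: "('p::prime_card padic) ^ 'n \<Rightarrow> complex"
  assumes f: "integrable haar f" and g: "integrable haar g"
  shows "integrable (haar \<Otimes>\<^sub>M haar) (\<lambda>z. f (fst z) * g (snd z))"
proof (rule haar2.Fubini_integrable)
  have [measurable]: "f \<in> borel_measurable haar" "g \<in> borel_measurable haar"
    using f g by (auto intro: borel_measurable_integrable)
  show "(\<lambda>z. f (fst z) * g (snd z)) \<in> borel_measurable (haar \<Otimes>\<^sub>M haar)" by measurable
qed (use f g in \<open>auto simp: norm_mult\<close>)

text \<open>Fubini and the symmetry of the pairing move the transform from one factor to the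
  other.\<close>

lemma multiplication_formula:
  fixes f b :: "('p::prime_card padic) ^ 'n \<Rightarrow> complex"
  assumes f: "integrable haar f" and b: "integrable haar b"
  shows "(LINT \<xi>|haar. b \<xi> * fourier_L1 f \<xi>) = (LINT x|haar. f x * fourier_L1 b x)"
proof -
  let ?F = "\<lambda>x \<xi>. f x * b \<xi> * pairing \<xi> x"
  have [measurable]: "f \<in> borel_measurable haar" "b \<in> borel_measurable haar"
    using f b by (auto intro: borel_measurable_integrable)
  have int: "integrable (haar \<Otimes>\<^sub>M haar) (case_prod ?F)"
    by (rule Bochner_Integration.integrable_bound[OF integrable_tensor[OF f b]])
      (auto simp: norm_mult case_prod_beta')
  have "(LINT \<xi>|haar. b \<xi> * fourier_L1 f \<xi>) = (LINT \<xi>|haar. LINT x|haar. ?F x \<xi>)"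
  proof (intro Bochner_Integration.integral_cong refl)
    fix \<xi>
    have "(LINT x|haar. ?F x \<xi>) = (LINT x|haar. b \<xi> * (f x * pairing \<xi> x))" by (simp add: mult_ac)
    then show "b \<xi> * fourier_L1 f \<xi> = (LINT x|haar. ?F x \<xi>)" by (simp add: fourier_L1_pairing)
  qed
  also have "\<dots> = (LINT x|haar. LINT \<xi>|haar. ?F x \<xi>)" by (rule haar2.Fubini_integral[OF int])
  also have "\<dots> = (LINT x|haar. f x * fourier_L1 b x)"
    by (simp add: fourier_L1_pairing mult.assoc pairing_commute)
  finally show ?thesis .
qed

text \<open>The multiplication formula is used twice: it moves the transform from \<open>f\<close>
  to the function \<open>b\<close>, which is cut off and hence integrable, and then identifies the
  transform of \<open>b\<close> with the ball averages of the conjugate of \<open>g\<close>.\<close>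

lemma truncated_parseval:
  fixes f g :: "('p::prime_card padic) ^ 'n \<Rightarrow> complex"
  assumes f: "integrable haar f" and g: "integrable haar g"
  shows "(LINT \<xi>|haar. indicator (padic_ball 0 (- m)) \<xi> * (fourier_L1 f \<xi> * cnj (fourier_L1 g \<xi>)))
    = (LINT x|haar. f x * (LINT y|haar. cnj (g y) * complex_of_real (ball_average_kernel m (y - x))))"
proof -
  let ?u = "\<lambda>\<xi>. indicator (padic_ball 0 (- m)) \<xi> :: complex"
  have [measurable]: "f \<in> borel_measurable haar" "g \<in> borel_measurable haar" "?u \<in> borel_measurable haar"
    using f g integrable_indicator_ball by (auto intro: borel_measurable_integrable)
  have [measurable]: "fourier_L1 g \<in> borel_measurable haar" by (rule fourier_L1_measurable[OF g])
  define b where "b \<xi> = ?u \<xi> * cnj (fourier_L1 g \<xi>)" for \<xi>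
  have b: "integrable haar b"
  proof (rule Bochner_Integration.integrable_bound)
    show "integrable haar (\<lambda>\<xi>. complex_of_real (LINT x|haar. cmod (g x)) * ?u \<xi>)"
      by (intro integrable_mult_right integrable_indicator_ball)
    show "b \<in> borel_measurable haar" unfolding b_def[abs_def] by measurable
    show "AE \<xi> in haar. norm (b \<xi>) \<le> norm (complex_of_real (LINT x|haar. cmod (g x)) * ?u \<xi>)"
      using cmod_fourier_L1_le[OF g] by (auto simp: b_def norm_mult indicator_def)
  qed
  have "fourier_L1 b x = (LINT y|haar. cnj (g y) * complex_of_real (ball_average_kernel m (y - x)))" for x
  proof -
    \<comment> \<open>A modulated indicator of a frequency ball; modulation translates its
      transform, the averaging kernel, to \<open>x\<close>.\<close>
    define c where "c \<xi> = ?u \<xi> * cnj (pairing \<xi> x)" for \<xi>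
    have c: "integrable haar c"
      by (rule Bochner_Integration.integrable_bound[OF integrable_indicator_ball])
        (auto simp: c_def[abs_def] norm_mult)
    have Fc: "fourier_L1 c y = complex_of_real (ball_average_kernel m (y - x))" for y
    proof -
      have "fourier_L1 c y = fourier_L1 ?u (y - x)"
        unfolding fourier_L1_pairing c_def
      proof (intro Bochner_Integration.integral_cong refl)
        fix \<xi>
        show "?u \<xi> * cnj (pairing \<xi> x) * pairing y \<xi> = ?u \<xi> * pairing (y - x) \<xi>"
          by (simp add: pairing_diff_left pairing_commute[of \<xi> x])
      qed
      then show ?thesis by (simp add: fourier_L1_indicator_ball)
    qed
    have "fourier_L1 b x = cnj (LINT \<xi>|haar. c \<xi> * fourier_L1 g \<xi>)"
      unfolding fourier_L1_pairing[of b] Bochner_Integration.integral_cnj[symmetric]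
    proof (intro Bochner_Integration.integral_cong refl)
      fix \<xi>
      show "b \<xi> * pairing x \<xi> = cnj (c \<xi> * fourier_L1 g \<xi>)"
        by (simp add: b_def c_def indicator_def pairing_commute[of x \<xi>])
    qed
    also have "\<dots> = cnj (LINT y|haar. g y * complex_of_real (ball_average_kernel m (y - x)))"
      by (simp only: multiplication_formula[OF g c] Fc)
    also have "\<dots> = (LINT y|haar. cnj (g y) * complex_of_real (ball_average_kernel m (y - x)))"
      unfolding Bochner_Integration.integral_cnj[symmetric] by simp
    finally show ?thesis .
  qed
  then have Fb: "fourier_L1 b = (\<lambda>x. LINT y|haar. cnj (g y) * complex_of_real (ball_average_kernel m (y - x)))" by blast
  have "(LINT \<xi>|haar. ?u \<xi> * (fourier_L1 f \<xi> * cnj (fourier_L1 g \<xi>))) = (LINT \<xi>|haar. b \<xi> * fourier_L1 f \<xi>)"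
    by (intro Bochner_Integration.integral_cong refl) (simp add: b_def)
  then show ?thesis using multiplication_formula[OF f b] unfolding Fb by (rule trans)
qed

section \<open>Plancherel's theorem\<close>

text \<open>The mean square oscillation of \<open>f\<close> at distances up to p^(-m). It is twice
  the error in Plancherel's identity when the frequencies are cut off at radius p^m.\<close>

definition averaging_defect :: "int \<Rightarrow> (('p::prime_card padic) ^ 'n \<Rightarrow> complex) \<Rightarrow> ennreal" where
  "averaging_defect m f = (\<integral>\<^sup>+z. ennreal ((cmod (f (fst z) - f (snd z)))\<^sup>2 * ball_average_kernel m (snd z - fst z)) \<partial>(haar \<Otimes>\<^sub>M haar))"

lemma nn_integral_average_fst:
  fixes f :: "('p::prime_card padic) ^ 'n \<Rightarrow> complex"
  assumes [measurable]: "f \<in> borel_measurable haar"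
  shows "(\<integral>\<^sup>+z. ennreal ((cmod (f (fst z)))\<^sup>2 * ball_average_kernel m (snd z - fst z)) \<partial>(haar \<Otimes>\<^sub>M haar)) = L2_norm_sq haar f"
proof -
  have "(\<integral>\<^sup>+z. ennreal ((cmod (f (fst z)))\<^sup>2 * ball_average_kernel m (snd z - fst z)) \<partial>(haar \<Otimes>\<^sub>M haar))
      = (\<integral>\<^sup>+x. \<integral>\<^sup>+y. ennreal ((cmod (f x))\<^sup>2) * ennreal (ball_average_kernel m (y - x)) \<partial>haar \<partial>haar)"
    by (subst haar.nn_integral_fst[symmetric]) (auto simp: ennreal_mult)
  also have "\<dots> = (\<integral>\<^sup>+x. ennreal ((cmod (f x))\<^sup>2) \<partial>haar)"
    by (intro nn_integral_cong) (simp add: nn_integral_cmult nn_integral_ball_average_kernel)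
  finally show ?thesis by (simp add: L2_norm_sq_def)
qed

lemma nn_integral_average_snd:
  fixes f :: "('p::prime_card padic) ^ 'n \<Rightarrow> complex"
  assumes [measurable]: "f \<in> borel_measurable haar"
  shows "(\<integral>\<^sup>+z. ennreal ((cmod (f (snd z)))\<^sup>2 * ball_average_kernel m (snd z - fst z)) \<partial>(haar \<Otimes>\<^sub>M haar)) = L2_norm_sq haar f"
proof -
  have "(\<integral>\<^sup>+z. ennreal ((cmod (f (snd z)))\<^sup>2 * ball_average_kernel m (snd z - fst z)) \<partial>(haar \<Otimes>\<^sub>M haar))
      = (\<integral>\<^sup>+y. \<integral>\<^sup>+x. ennreal ((cmod (f y))\<^sup>2) * ennreal (ball_average_kernel m (y - x)) \<partial>haar \<partial>haar)"
    by (subst haar2.nn_integral_snd[symmetric]) (auto simp: ennreal_mult)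
  also have "\<dots> = (\<integral>\<^sup>+y. ennreal ((cmod (f y))\<^sup>2) \<partial>haar)"
  proof (intro nn_integral_cong)
    fix y :: "('p padic) ^ 'n"
    have "(\<integral>\<^sup>+x. ennreal (ball_average_kernel m (y - x)) \<partial>haar) = 1"
      using nn_integral_ball_average_kernel[of m y] by (simp only: ball_average_kernel_minus[of m y])
    then show "(\<integral>\<^sup>+x. ennreal ((cmod (f y))\<^sup>2) * ennreal (ball_average_kernel m (y - x)) \<partial>haar) = ennreal ((cmod (f y))\<^sup>2)"
      by (simp add: nn_integral_cmult)
  qed
  finally show ?thesis by (simp add: L2_norm_sq_def)
qed

text \<open>The square of a difference is at most twice the sum of the squares, and the kernel has
  mass 1 in either variable; this gives 2 + 2.\<close>

lemma averaging_defect_le: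
  fixes f :: "('p::prime_card padic) ^ 'n \<Rightarrow> complex"
  assumes [measurable]: "f \<in> borel_measurable haar"
  shows "averaging_defect m f \<le> 4 * L2_norm_sq haar f"
proof -
  let ?k = "\<lambda>z :: (('p padic) ^ 'n) \<times> (('p padic) ^ 'n). ball_average_kernel m (snd z - fst z)"
  have "averaging_defect m f \<le> (\<integral>\<^sup>+z. 2 * ennreal ((cmod (f (fst z)))\<^sup>2 * ?k z) + 2 * ennreal ((cmod (f (snd z)))\<^sup>2 * ?k z) \<partial>(haar \<Otimes>\<^sub>M haar))"
    unfolding averaging_defect_def
  proof (intro nn_integral_mono)
    fix z :: "(('p padic) ^ 'n) \<times> (('p padic) ^ 'n)"
    have "(cmod (f (fst z) - f (snd z)))\<^sup>2 * ?k z \<le> (2 * (cmod (f (fst z)))\<^sup>2 + 2 * (cmod (f (snd z)))\<^sup>2) * ?k z"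
      using cmod_add_squared_le[of "f (fst z)" "- f (snd z)"] by (intro mult_right_mono) auto
    also have "\<dots> = 2 * ((cmod (f (fst z)))\<^sup>2 * ?k z) + 2 * ((cmod (f (snd z)))\<^sup>2 * ?k z)" by (simp add: algebra_simps)
    finally have "ennreal ((cmod (f (fst z) - f (snd z)))\<^sup>2 * ?k z) \<le> ennreal (2 * ((cmod (f (fst z)))\<^sup>2 * ?k z) + 2 * ((cmod (f (snd z)))\<^sup>2 * ?k z))"
      by (rule ennreal_leI)
    then show "ennreal ((cmod (f (fst z) - f (snd z)))\<^sup>2 * ?k z) \<le> 2 * ennreal ((cmod (f (fst z)))\<^sup>2 * ?k z) + 2 * ennreal ((cmod (f (snd z)))\<^sup>2 * ?k z)"
      by (simp add: ennreal_plus ennreal_mult'')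
  qed
  also have "\<dots> = 2 * L2_norm_sq haar f + 2 * L2_norm_sq haar f"
    by (subst nn_integral_add) (auto simp: nn_integral_cmult nn_integral_average_fst nn_integral_average_snd)
  also have "\<dots> = 4 * L2_norm_sq haar f" by (simp add: distrib_right[symmetric])
  finally show ?thesis .
qed

lemma averaging_defect_add_le:
  fixes f g :: "('p::prime_card padic) ^ 'n \<Rightarrow> complex"
  assumes [measurable]: "f \<in> borel_measurable haar" "g \<in> borel_measurable haar"
  shows "averaging_defect m (\<lambda>x. f x + g x) \<le> 2 * averaging_defect m f + 2 * averaging_defect m g"
proof -
  let ?k = "\<lambda>z :: (('p padic) ^ 'n) \<times> (('p padic) ^ 'n). ball_average_kernel m (snd z - fst z)"
  let ?D = "\<lambda>f z. (cmod (f (fst z) - f (snd z)))\<^sup>2 * ?k z"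
  have "averaging_defect m (\<lambda>x. f x + g x) \<le> (\<integral>\<^sup>+z. 2 * ennreal (?D f z) + 2 * ennreal (?D g z) \<partial>(haar \<Otimes>\<^sub>M haar))"
    unfolding averaging_defect_def
  proof (intro nn_integral_mono)
    fix z :: "(('p padic) ^ 'n) \<times> (('p padic) ^ 'n)"
    have "(cmod ((f (fst z) + g (fst z)) - (f (snd z) + g (snd z))))\<^sup>2 * ?k z
        \<le> (2 * (cmod (f (fst z) - f (snd z)))\<^sup>2 + 2 * (cmod (g (fst z) - g (snd z)))\<^sup>2) * ?k z"
      using cmod_add_squared_le[of "f (fst z) - f (snd z)" "g (fst z) - g (snd z)"]
      by (intro mult_right_mono) (auto simp: algebra_simps)
    also have "\<dots> = 2 * ?D f z + 2 * ?D g z" by (simp add: algebra_simps)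
    finally have "ennreal ((cmod ((f (fst z) + g (fst z)) - (f (snd z) + g (snd z))))\<^sup>2 * ?k z) \<le> ennreal (2 * ?D f z + 2 * ?D g z)"
      by (rule ennreal_leI)
    then show "ennreal ((cmod ((f (fst z) + g (fst z)) - (f (snd z) + g (snd z))))\<^sup>2 * ?k z) \<le> 2 * ennreal (?D f z) + 2 * ennreal (?D g z)"
      by (simp add: ennreal_plus ennreal_mult'')
  qed
  also have "\<dots> = 2 * averaging_defect m f + 2 * averaging_defect m g"
    unfolding averaging_defect_def by (subst nn_integral_add) (auto simp: nn_integral_cmult)
  finally show ?thesis .
qed

lemma averaging_defect_cmult:
  fixes f :: "('p::prime_card padic) ^ 'n \<Rightarrow> complex"
  assumes [measurable]: "f \<in> borel_measurable haar"
  shows "averaging_defect m (\<lambda>x. c * f x) = ennreal ((cmod c)\<^sup>2) * averaging_defect m f"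
proof -
  have "(cmod (c * f x - c * f y))\<^sup>2 = (cmod c)\<^sup>2 * (cmod (f x - f y))\<^sup>2" for x y
    unfolding right_diff_distrib[symmetric] norm_mult power_mult_distrib ..
  then show ?thesis
    unfolding averaging_defect_def
    by (subst nn_integral_cmult[symmetric]) (auto simp: ennreal_mult[symmetric] mult.assoc)
qed

lemma averaging_defect_eq_0:
  fixes f :: "('p::prime_card padic) ^ 'n \<Rightarrow> complex"
  assumes "\<And>x y. y \<in> padic_ball x m \<Longrightarrow> f x = f y"
  shows "averaging_defect m f = 0"
proof -
  have eq: "(cmod (f (fst z) - f (snd z)))\<^sup>2 * ball_average_kernel m (snd z - fst z) = 0" for z
    using assms[of "snd z" "fst z"] by (auto simp: ball_average_kernel_def indicator_def mem_padic_ball_iff)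
  show ?thesis by (simp only: averaging_defect_def eq ennreal_0 nn_integral_const mult_zero_left)
qed

definition truncated_energy :: "int \<Rightarrow> (('p::prime_card padic) ^ 'n \<Rightarrow> complex) \<Rightarrow> real" where
  "truncated_energy m f = (LINT \<xi>|haar. indicator (padic_ball 0 (- m)) \<xi> * (cmod (fourier_L1 f \<xi>))\<^sup>2)"

lemma truncated_energy_nonneg: "0 \<le> truncated_energy m f"
  unfolding truncated_energy_def by (intro integral_nonneg_AE) (auto simp: indicator_def)

lemma truncated_energy_ennreal:
  fixes f :: "('p::prime_card padic) ^ 'n \<Rightarrow> complex"
  assumes f: "integrable haar f"
  shows "ennreal (truncated_energy m f) = (\<integral>\<^sup>+\<xi>. indicator (padic_ball 0 (- m)) \<xi> * ennreal ((cmod (fourier_L1 f \<xi>))\<^sup>2) \<partial>haar)"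
proof -
  have [measurable]: "fourier_L1 f \<in> borel_measurable haar" by (rule fourier_L1_measurable[OF f])
  let ?K = "(LINT x|haar. cmod (f x))\<^sup>2"
  have ind: "integrable haar (indicator (padic_ball (0 :: ('p padic) ^ 'n) (- m)) :: _ \<Rightarrow> real)"
    by (intro integrable_real_indicator) (auto simp: sets_padic_haar emeasure_padic_ball)
  have "integrable haar (\<lambda>\<xi>. indicator (padic_ball 0 (- m)) \<xi> * (cmod (fourier_L1 f \<xi>))\<^sup>2)"
  proof (rule Bochner_Integration.integrable_bound)
    show "integrable haar (\<lambda>\<xi>. ?K * indicator (padic_ball (0 :: ('p padic) ^ 'n) (- m)) \<xi>)"
      by (intro integrable_mult_right ind)
    show "(\<lambda>\<xi>. indicator (padic_ball 0 (- m)) \<xi> * (cmod (fourier_L1 f \<xi>))\<^sup>2) \<in> borel_measurable haar"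
      by (intro borel_measurable_times borel_measurable_integrable[OF ind]) measurable
    show "AE \<xi> in haar. norm (indicator (padic_ball 0 (- m)) \<xi> * (cmod (fourier_L1 f \<xi>))\<^sup>2)
        \<le> norm (?K * indicator (padic_ball 0 (- m)) \<xi>)"
      using cmod_fourier_L1_le[OF f] by (auto simp: indicator_def intro!: power_mono)
  qed
  then show ?thesis
    unfolding truncated_energy_def
    by (subst nn_integral_eq_integral[symmetric]) (auto simp: indicator_def intro!: nn_integral_cong)
qed

text \<open>Expand the square in the defect: each pure square integrates to the squared norm because
  the kernel has mass 1, and the mixed term is the truncated energy by
  \<open>truncated_parseval\<close>. The identity is stated as a sum to avoid subtraction in
  \<open>ennreal\<close>.\<close>

lemma truncated_plancherel:
  fixes f :: "('p::prime_card padic) ^ 'n \<Rightarrow> complex"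
  assumes f1: "integrable haar f" and f2: "f \<in> L2_fun haar"
  shows "2 * ennreal (truncated_energy m f) + averaging_defect m f = 2 * L2_norm_sq haar f"
proof -
  have [measurable]: "f \<in> borel_measurable haar" using f2 by (rule L2_fun_measurable)
  let ?HH = "haar \<Otimes>\<^sub>M haar :: ((('p padic) ^ 'n) \<times> (('p padic) ^ 'n)) measure"
  let ?k = "\<lambda>z :: (('p padic) ^ 'n) \<times> (('p padic) ^ 'n). ball_average_kernel m (snd z - fst z)"
  let ?A = "\<lambda>z. (cmod (f (fst z)))\<^sup>2 * ?k z" and ?B = "\<lambda>z. (cmod (f (snd z)))\<^sup>2 * ?k z"
  let ?C = "\<lambda>z. f (fst z) * cnj (f (snd z)) * complex_of_real (?k z)"
  define n where "n = (LINT x|haar. (cmod (f x))\<^sup>2)"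
  have n: "L2_norm_sq haar f = ennreal n" unfolding n_def by (rule L2_norm_sq_eq_integral[OF f2])
  have n0: "n \<ge> 0" unfolding n_def by simp
  have A: "has_bochner_integral ?HH ?A n"
    using nn_integral_average_fst[of f m] n n0 by (intro has_bochner_integral_nn_integral) auto
  have B: "has_bochner_integral ?HH ?B n"
    using nn_integral_average_snd[of f m] n n0 by (intro has_bochner_integral_nn_integral) auto
  have C: "integrable ?HH ?C"
  proof (rule Bochner_Integration.integrable_bound)
    show "integrable ?HH (\<lambda>z. ?A z + ?B z)"
      using A B by (auto intro: integrable.intros)
    show "AE z in ?HH. norm (?C z) \<le> norm (?A z + ?B z)"
    proof (rule AE_I2)
      fix z
      have "cmod (f (fst z)) * cmod (f (snd z)) \<le> (cmod (f (fst z)))\<^sup>2 + (cmod (f (snd z)))\<^sup>2"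
        using sum_squares_bound[of "cmod (f (fst z))" "cmod (f (snd z))"]
          mult_nonneg_nonneg[OF norm_ge_zero norm_ge_zero, of "f (fst z)" "f (snd z)"] by linarith
      then have "cmod (f (fst z)) * cmod (f (snd z)) * ?k z \<le> ((cmod (f (fst z)))\<^sup>2 + (cmod (f (snd z)))\<^sup>2) * ?k z"
        by (intro mult_right_mono) auto
      then show "norm (?C z) \<le> norm (?A z + ?B z)" by (simp add: norm_mult distrib_right)
    qed
  qed measurable
  have "integral\<^sup>L ?HH ?C = (LINT x|haar. LINT y|haar. ?C (x, y))" by (rule haar2.integral_fst'[OF C, symmetric])
  also have "\<dots> = (LINT x|haar. f x * (LINT y|haar. cnj (f y) * complex_of_real (ball_average_kernel m (y - x))))"
    by (simp add: mult.assoc)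
  also have "\<dots> = (LINT \<xi>|haar. indicator (padic_ball 0 (- m)) \<xi> * (fourier_L1 f \<xi> * cnj (fourier_L1 f \<xi>)))"
    by (rule truncated_parseval[OF f1 f1, symmetric])
  also have "\<dots> = (LINT \<xi>|haar. complex_of_real (indicator (padic_ball 0 (- m)) \<xi> * (cmod (fourier_L1 f \<xi>))\<^sup>2))"
    by (intro Bochner_Integration.integral_cong refl) (simp add: indicator_def complex_norm_square[symmetric])
  also have "\<dots> = complex_of_real (truncated_energy m f)"
    unfolding integral_complex_of_real truncated_energy_def ..
  finally have C': "integral\<^sup>L ?HH ?C = complex_of_real (truncated_energy m f)" .
  have Re: "has_bochner_integral ?HH (\<lambda>z. Re (?C z)) (truncated_energy m f)"
  proof -
    have "has_bochner_integral ?HH ?C (complex_of_real (truncated_energy m f))"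
      using C C' by (simp only: has_bochner_integral_iff)
    from has_bochner_integral_bounded_linear[OF bounded_linear_Re this] show ?thesis
      by (simp only: Re_complex_of_real)
  qed
  have "has_bochner_integral ?HH (\<lambda>z. ?A z + ?B z - 2 * Re (?C z)) (n + n - 2 * truncated_energy m f)"
    by (intro has_bochner_integral_diff has_bochner_integral_add has_bochner_integral_mult_right A B Re)
  moreover have "?A z + ?B z - 2 * Re (?C z) = (cmod (f (fst z) - f (snd z)))\<^sup>2 * ?k z" for z
  proof -
    have "(cmod a)\<^sup>2 + (cmod b)\<^sup>2 - 2 * Re (a * cnj b) = (cmod (a - b))\<^sup>2" for a b
      by (simp only: cmod_power2) (simp add: power2_eq_square algebra_simps)
    from arg_cong[OF this, of "\<lambda>w. w * ?k z" "f (fst z)" "f (snd z)"] show ?thesis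
      by (simp add: algebra_simps)
  qed
  ultimately have D: "has_bochner_integral ?HH (\<lambda>z. (cmod (f (fst z) - f (snd z)))\<^sup>2 * ?k z) (n + n - 2 * truncated_energy m f)"
    by simp
  then have "averaging_defect m f = ennreal (n + n - 2 * truncated_energy m f)"
    unfolding averaging_defect_def by (subst nn_integral_eq_integral) (auto simp: has_bochner_integral_iff)
  moreover have "0 \<le> n + n - 2 * truncated_energy m f"
    unfolding has_bochner_integral_integral_eq[OF D, symmetric] by (intro integral_nonneg_AE AE_I2) simp
  moreover have "2 * ennreal x = ennreal (2 * x)" if "x \<ge> 0" for x using that by (simp add: ennreal_mult)
  ultimately show ?thesis
    using truncated_energy_nonneg[of m f] n0 by (simp only: n) (subst ennreal_plus[symmetric], auto)
qed

text \<open>Monotone convergence along the balls of radius p^m, which exhaust the frequency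
  space.\<close>

lemma truncated_energy_limit:
  fixes f :: "('p::prime_card padic) ^ 'n \<Rightarrow> complex"
  assumes f: "integrable haar f"
  shows "(\<lambda>m::nat. ennreal (truncated_energy (int m) f)) \<longlonglongrightarrow> L2_norm_sq haar (fourier_L1 f)"
  unfolding truncated_energy_ennreal[OF f] L2_norm_sq_def
proof (rule nn_integral_LIMSEQ)
  have [measurable]: "fourier_L1 f \<in> borel_measurable haar" by (rule fourier_L1_measurable[OF f])
  show "incseq (\<lambda>m::nat. \<lambda>\<xi>. indicator (padic_ball 0 (- int m)) \<xi> * ennreal ((cmod (fourier_L1 f \<xi>))\<^sup>2))"
  proof (rule incseq_SucI, rule le_funI)
    fix m :: nat and \<xi> :: "('p padic) ^ 'n"
    have "padic_ball (0 :: ('p padic) ^ 'n) (- int m) \<subseteq> padic_ball 0 (- int (Suc m))" by (rule padic_ball_antimono) simp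
    then show "indicator (padic_ball 0 (- int m)) \<xi> * ennreal ((cmod (fourier_L1 f \<xi>))\<^sup>2)
        \<le> indicator (padic_ball 0 (- int (Suc m))) \<xi> * ennreal ((cmod (fourier_L1 f \<xi>))\<^sup>2)"
      by (intro mult_right_mono) (auto simp: indicator_def)
  qed
  have "indicator (padic_ball (0 :: ('p padic) ^ 'n) (- int m)) \<in> borel_measurable haar" for m
    by (intro borel_measurable_indicator) (simp add: sets_padic_haar)
  then show "(\<lambda>\<xi>. indicator (padic_ball 0 (- int m)) \<xi> * ennreal ((cmod (fourier_L1 f \<xi>))\<^sup>2)) \<in> borel_measurable haar" for m
    by measurable
  fix \<xi> :: "('p padic) ^ 'n"
  obtain m0 :: nat where m0: "\<xi> \<in> padic_ball 0 (- int m0)" using UN_padic_ball[of "0 :: ('p padic) ^ 'n"] by blast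
  show "(\<lambda>m::nat. indicator (padic_ball 0 (- int m)) \<xi> * ennreal ((cmod (fourier_L1 f \<xi>))\<^sup>2)) \<longlonglongrightarrow> ennreal ((cmod (fourier_L1 f \<xi>))\<^sup>2)"
  proof (rule tendsto_eventually, unfold eventually_sequentially, intro exI allI impI)
    fix m assume "m0 \<le> m"
    then have "padic_ball (0 :: ('p padic) ^ 'n) (- int m0) \<subseteq> padic_ball 0 (- int m)" by (intro padic_ball_antimono) simp
    then show "indicator (padic_ball 0 (- int m)) \<xi> * ennreal ((cmod (fourier_L1 f \<xi>))\<^sup>2) = ennreal ((cmod (fourier_L1 f \<xi>))\<^sup>2)"
      using m0 by (auto simp: indicator_def)
  qed
qed

text \<open>The defect is nonnegative. This contraction property is all that the comparison of
  \<open>fourier\<close> with \<open>fourier_L1\<close> uses.\<close>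

lemma L2_norm_fourier_L1_le:
  assumes f1: "integrable haar f" and f2: "f \<in> L2_fun haar"
  shows "L2_norm_sq haar (fourier_L1 f) \<le> L2_norm_sq haar f"
proof (rule LIMSEQ_le_const2[OF truncated_energy_limit[OF f1]], intro exI allI impI)
  fix m :: nat
  have "2 * ennreal (truncated_energy (int m) f) \<le> 2 * L2_norm_sq haar f"
    using truncated_plancherel[OF f1 f2, of "int m"] by (metis le_iff_add)
  then show "ennreal (truncated_energy (int m) f) \<le> L2_norm_sq haar f"
    by (simp add: ennreal_mult_le_mult_iff)
qed

lemma L2_fun_fourier_L1:
  assumes "integrable haar f" "f \<in> L2_fun haar"
  shows "fourier_L1 f \<in> L2_fun haar"
  using L2_norm_fourier_L1_le[OF assms] assms(2) fourier_L1_measurable[OF assms(1)]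
  by (auto simp: L2_fun_def)

section \<open>Identifying the extended transform with the integral\<close>

lemma L2_norm_sq_add_le:
  assumes [measurable]: "f \<in> borel_measurable M" "g \<in> borel_measurable M"
  shows "L2_norm_sq M (\<lambda>x. f x + g x) \<le> 2 * L2_norm_sq M f + 2 * L2_norm_sq M g"
proof -
  have "L2_norm_sq M (\<lambda>x. f x + g x) \<le> (\<integral>\<^sup>+x. 2 * ennreal ((cmod (f x))\<^sup>2) + 2 * ennreal ((cmod (g x))\<^sup>2) \<partial>M)"
    unfolding L2_norm_sq_def
  proof (intro nn_integral_mono)
    fix x
    have "ennreal ((cmod (f x + g x))\<^sup>2) \<le> ennreal (2 * (cmod (f x))\<^sup>2 + 2 * (cmod (g x))\<^sup>2)"
      by (intro ennreal_leI cmod_add_squared_le)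
    then show "ennreal ((cmod (f x + g x))\<^sup>2) \<le> 2 * ennreal ((cmod (f x))\<^sup>2) + 2 * ennreal ((cmod (g x))\<^sup>2)"
      by (simp add: ennreal_plus ennreal_mult'')
  qed
  also have "\<dots> = 2 * L2_norm_sq M f + 2 * L2_norm_sq M g"
    unfolding L2_norm_sq_def by (subst nn_integral_add) (auto simp: nn_integral_cmult)
  finally show ?thesis .
qed

lemma L2_norm_sq_eq_0_AE:
  "f \<in> borel_measurable M \<Longrightarrow> L2_norm_sq M f = 0 \<longleftrightarrow> (AE x in M. f x = 0)"
  unfolding L2_norm_sq_def by (subst nn_integral_0_iff_AE) (auto simp: ennreal_eq_0_iff)

lemma L2_norm_sq_minus_commute: "L2_norm_sq M (\<lambda>x. f x - g x) = L2_norm_sq M (\<lambda>x. g x - f x)"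
  by (simp add: L2_norm_sq_def norm_minus_commute)

text \<open>The constant sequence \<open>f\<close> shows that the choice in \<open>fourier\<close>
  is not vacuous. For whatever approximating sequence the choice comes with, the contraction
  property forces its limit to agree with \<open>fourier_L1 f\<close> almost everywhere.\<close>

lemma fourier_eq_fourier_L1:
  fixes f :: "('p::prime_card padic) ^ 'n \<Rightarrow> complex"
  assumes f1: "integrable haar f" and f2: "f \<in> L2_fun haar"
  shows "fourier f \<in> L2_fun haar" "AE \<xi> in haar. fourier f \<xi> = fourier_L1 f \<xi>"
proof -
  let ?R = "\<lambda>g. g \<in> L2_fun haar \<and> (\<exists>\<phi>. (\<forall>k::nat. \<phi> k \<in> L2_fun haar \<and> integrable haar (\<phi> k)) \<and>
      (\<lambda>k. L2_norm_sq haar (\<lambda>x. \<phi> k x - f x)) \<longlonglongrightarrow> 0 \<and>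
      (\<lambda>k. L2_norm_sq haar (\<lambda>\<xi>. fourier_L1 (\<phi> k) \<xi> - g \<xi>)) \<longlonglongrightarrow> 0)"
  have z: "L2_norm_sq haar (\<lambda>x. h x - h x) = 0" for h :: "('p padic) ^ 'n \<Rightarrow> complex" by (simp add: L2_norm_sq_def)
  have "?R (fourier_L1 f)"
    using f1 f2 L2_fun_fourier_L1[OF f1 f2] by (intro conjI exI[of _ "\<lambda>_. f"]) (simp_all only: z, auto)
  then have R: "?R (fourier f)" unfolding fourier_def by (rule someI[where P = ?R])
  then show g: "fourier f \<in> L2_fun haar" by blast
  obtain \<phi> where \<phi>: "\<And>k::nat. \<phi> k \<in> L2_fun haar" "\<And>k. integrable haar (\<phi> k)"
    "(\<lambda>k. L2_norm_sq haar (\<lambda>x. \<phi> k x - f x)) \<longlonglongrightarrow> 0"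
    "(\<lambda>k. L2_norm_sq haar (\<lambda>\<xi>. fourier_L1 (\<phi> k) \<xi> - fourier f \<xi>)) \<longlonglongrightarrow> 0" using R by blast
  have [measurable]: "fourier f \<in> borel_measurable haar" "fourier_L1 f \<in> borel_measurable haar"
    "fourier_L1 (\<phi> k) \<in> borel_measurable haar" for k
    using g fourier_L1_measurable[OF f1] fourier_L1_measurable[OF \<phi>(2)] by (auto dest: L2_fun_measurable)
  have le: "L2_norm_sq haar (\<lambda>\<xi>. fourier f \<xi> - fourier_L1 f \<xi>)
      \<le> 2 * L2_norm_sq haar (\<lambda>\<xi>. fourier_L1 (\<phi> k) \<xi> - fourier f \<xi>) + 2 * L2_norm_sq haar (\<lambda>x. \<phi> k x - f x)" for k
  proof -
    have "L2_norm_sq haar (\<lambda>\<xi>. fourier f \<xi> - fourier_L1 f \<xi>)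
        = L2_norm_sq haar (\<lambda>\<xi>. (fourier f \<xi> - fourier_L1 (\<phi> k) \<xi>) + (fourier_L1 (\<phi> k) \<xi> - fourier_L1 f \<xi>))"
      by simp
    also have "\<dots> \<le> 2 * L2_norm_sq haar (\<lambda>\<xi>. fourier f \<xi> - fourier_L1 (\<phi> k) \<xi>)
        + 2 * L2_norm_sq haar (\<lambda>\<xi>. fourier_L1 (\<phi> k) \<xi> - fourier_L1 f \<xi>)"
      by (rule L2_norm_sq_add_le) measurable
    also have "L2_norm_sq haar (\<lambda>\<xi>. fourier_L1 (\<phi> k) \<xi> - fourier_L1 f \<xi>) = L2_norm_sq haar (fourier_L1 (\<lambda>x. \<phi> k x - f x))"
      by (intro arg_cong[of _ _ "L2_norm_sq haar"] ext fourier_L1_diff[symmetric] \<phi>(2) f1)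
    also have "\<dots> \<le> L2_norm_sq haar (\<lambda>x. \<phi> k x - f x)"
    proof (rule L2_norm_fourier_L1_le)
      show "integrable haar (\<lambda>x. \<phi> k x - f x)" using \<phi>(2) f1 by simp
      show "(\<lambda>x. \<phi> k x - f x) \<in> L2_fun haar"
        using L2_fun_add[OF \<phi>(1) L2_fun_cmult[OF f2, of "-1"]] by simp
    qed
    finally show ?thesis unfolding L2_norm_sq_minus_commute[of haar "fourier f"] by (simp add: mult_left_mono add_left_mono)
  qed
  have "(\<lambda>k. 2 * L2_norm_sq haar (\<lambda>\<xi>. fourier_L1 (\<phi> k) \<xi> - fourier f \<xi>) + 2 * L2_norm_sq haar (\<lambda>x. \<phi> k x - f x)) \<longlonglongrightarrow> 2 * 0 + 2 * 0"
    by (intro tendsto_add ennreal_tendsto_cmult \<phi>) auto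
  then have "L2_norm_sq haar (\<lambda>\<xi>. fourier f \<xi> - fourier_L1 f \<xi>) \<le> 2 * 0 + 2 * 0"
    by (rule LIMSEQ_le_const) (use le in blast)
  then have "L2_norm_sq haar (\<lambda>\<xi>. fourier f \<xi> - fourier_L1 f \<xi>) = 0" by simp
  then have "AE \<xi> in haar. fourier f \<xi> - fourier_L1 f \<xi> = 0" by (subst (asm) L2_norm_sq_eq_0_AE) auto
  then show "AE \<xi> in haar. fourier f \<xi> = fourier_L1 f \<xi>" by simp
qed

text \<open>The averaging defect tends to 0 for indicators of balls, and this passes to complements,
  disjoint unions, linear combinations and limits in the mean.\<close>

definition averaging_regular :: "(('p::prime_card padic) ^ 'n \<Rightarrow> complex) \<Rightarrow> bool" where
  "averaging_regular f \<longleftrightarrow> f \<in> borel_measurable haar \<and> (\<lambda>m::nat. averaging_defect (int m) f) \<longlonglongrightarrow> 0"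

lemma averaging_regular_add:
  assumes "averaging_regular f" "averaging_regular g"
  shows "averaging_regular (\<lambda>x. f x + g x)"
proof -
  have m [measurable]: "f \<in> borel_measurable haar" "g \<in> borel_measurable haar" using assms by (auto simp: averaging_regular_def)
  have "(\<lambda>m::nat. 2 * averaging_defect (int m) f + 2 * averaging_defect (int m) g) \<longlonglongrightarrow> 2 * 0 + 2 * 0"
    using assms by (intro tendsto_add ennreal_tendsto_cmult) (auto simp: averaging_regular_def)
  then have "(\<lambda>m::nat. 2 * averaging_defect (int m) f + 2 * averaging_defect (int m) g) \<longlonglongrightarrow> 0" by simp
  then have "(\<lambda>m::nat. averaging_defect (int m) (\<lambda>x. f x + g x)) \<longlonglongrightarrow> 0"
    by (rule tendsto_sandwich[OF _ _ tendsto_const, rotated 2])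
      (use averaging_defect_add_le[OF m] in \<open>auto intro!: always_eventually\<close>)
  then show ?thesis by (simp add: averaging_regular_def)
qed

lemma averaging_regular_cmult:
  assumes "averaging_regular f" shows "averaging_regular (\<lambda>x. c * f x)"
proof -
  have m [measurable]: "f \<in> borel_measurable haar" using assms by (auto simp: averaging_regular_def)
  have "(\<lambda>m::nat. ennreal ((cmod c)\<^sup>2) * averaging_defect (int m) f) \<longlonglongrightarrow> ennreal ((cmod c)\<^sup>2) * 0"
    using assms by (intro ennreal_tendsto_cmult) (auto simp: averaging_regular_def)
  then show ?thesis by (simp add: averaging_regular_def averaging_defect_cmult)
qed

lemma averaging_regular_zero: "averaging_regular (\<lambda>_. 0)"
  by (simp add: averaging_regular_def averaging_defect_def)

lemma averaging_regular_sum: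
  "finite S \<Longrightarrow> (\<And>i. i \<in> S \<Longrightarrow> averaging_regular (f i)) \<Longrightarrow> averaging_regular (\<lambda>x. \<Sum>i\<in>S. f i x)"
  by (induction S rule: finite_induct) (auto simp: averaging_regular_zero intro: averaging_regular_add)

lemma averaging_regular_limit:
  fixes f :: "('p::prime_card padic) ^ 'n \<Rightarrow> complex"
  assumes f [measurable]: "f \<in> borel_measurable haar" and g: "\<And>i::nat. averaging_regular (g i)"
    and lim: "(\<lambda>i. L2_norm_sq haar (\<lambda>x. f x - g i x)) \<longlonglongrightarrow> 0"
  shows "averaging_regular f"
  unfolding averaging_regular_def
proof (intro conjI f order_tendstoI)
  fix e :: ennreal assume e: "0 < e"
  have [measurable]: "g i \<in> borel_measurable haar" for i using g by (simp add: averaging_regular_def)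
  \<comment> \<open>The 8 is 2 times 4: a factor 2 from splitting \<open>f\<close> into two summands
    and a factor 4 from \<open>averaging_defect_le\<close>.\<close>
  have "(\<lambda>i. 8 * L2_norm_sq haar (\<lambda>x. f x - g i x)) \<longlonglongrightarrow> 8 * 0" by (intro ennreal_tendsto_cmult lim) simp
  then obtain i where i: "8 * L2_norm_sq haar (\<lambda>x. f x - g i x) < e"
    using e order_tendstoD(2)[of _ 0 sequentially e] eventually_happens' by (metis (mono_tags, lifting) mult_zero_right sequentially_bot)
  have "(\<lambda>m::nat. 8 * L2_norm_sq haar (\<lambda>x. f x - g i x) + 2 * averaging_defect (int m) (g i))
      \<longlonglongrightarrow> 8 * L2_norm_sq haar (\<lambda>x. f x - g i x) + 2 * 0"
    using g by (intro tendsto_add tendsto_const ennreal_tendsto_cmult) (auto simp: averaging_regular_def)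
  then have "eventually (\<lambda>m::nat. 8 * L2_norm_sq haar (\<lambda>x. f x - g i x) + 2 * averaging_defect (int m) (g i) < e) sequentially"
    by (rule order_tendstoD(2)) (use i in simp)
  then show "eventually (\<lambda>m::nat. averaging_defect (int m) f < e) sequentially"
  proof eventually_elim
    case (elim m)
    have "averaging_defect (int m) f = averaging_defect (int m) (\<lambda>x. (f x - g i x) + g i x)" by simp
    also have "\<dots> \<le> 2 * averaging_defect (int m) (\<lambda>x. f x - g i x) + 2 * averaging_defect (int m) (g i)"
      by (rule averaging_defect_add_le) measurable
    also have "\<dots> \<le> 2 * (4 * L2_norm_sq haar (\<lambda>x. f x - g i x)) + 2 * averaging_defect (int m) (g i)"
      by (intro add_right_mono mult_left_mono averaging_defect_le) measurable
    also have "2 * (4 * L2_norm_sq haar (\<lambda>x. f x - g i x)) = 8 * L2_norm_sq haar (\<lambda>x. f x - g i x)"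
      by (simp add: mult.assoc[symmetric])
    finally show ?case using elim by simp
  qed
qed simp

lemma averaging_regular_indicator_ball: "averaging_regular (indicator (padic_ball (a :: ('p::prime_card padic) ^ 'n) L))"
proof -
  \<comment> \<open>Points within p^(-m) of each other lie on the same side of the ball once
    \<open>m\<close> is at least its level, so the defect is eventually exactly 0.\<close>
  have "averaging_defect (int m) (indicator (padic_ball a L) :: _ \<Rightarrow> complex) = 0" if "nat L \<le> m" for m :: nat
  proof (rule averaging_defect_eq_0)
    fix x y :: "('p padic) ^ 'n" assume "y \<in> padic_ball x (int m)"
    moreover have "padic_ball x (int m) \<subseteq> padic_ball x L" using that by (intro padic_ball_antimono) simp
    ultimately have "y \<in> padic_ball x L" by blast
    then have "x \<in> padic_ball a L \<longleftrightarrow> y \<in> padic_ball a L" using padic_ball_trans padic_ball_sym by blast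
    then show "indicator (padic_ball a L) x = (indicator (padic_ball a L) y :: complex)" by (simp add: indicator_def)
  qed
  then have "(\<lambda>m::nat. averaging_defect (int m) (indicator (padic_ball a L) :: _ \<Rightarrow> complex)) \<longlonglongrightarrow> 0"
    by (intro tendsto_eventually) (auto simp: eventually_sequentially)
  then show ?thesis
    using borel_measurable_integrable[OF integrable_indicator_ball] by (simp add: averaging_regular_def)
qed

lemma L2_norm_sq_indicator:
  "A \<in> sets M \<Longrightarrow> L2_norm_sq M (indicator A) = emeasure M A"
proof -
  assume A: "A \<in> sets M"
  have "L2_norm_sq M (indicator A) = (\<integral>\<^sup>+x. indicator A x \<partial>M)"
    unfolding L2_norm_sq_def by (intro nn_integral_cong) (auto simp: indicator_def)
  then show ?thesis using A by simp
qed

text \<open>Induction over the sigma algebra from the intersection-stable family of balls.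
  Intersecting with a fixed ball keeps measures finite, so that in a disjoint union the remainder
  after finitely many pieces tends to 0 in measure.\<close>

lemma averaging_regular_indicator:
  fixes A :: "(('p::prime_card padic) ^ 'n) set"
  assumes "A \<in> sets borel"
  shows "averaging_regular (indicator (A \<inter> padic_ball 0 L))"
proof -
  let ?B = "padic_ball (0 :: ('p padic) ^ 'n) L"
  have Int_stable: "Int_stable (range (ball_or_empty :: _ \<Rightarrow> (('p padic) ^ 'n) set))"
    using semiring_of_sets.Int[OF semiring_padic_balls] unfolding Int_stable_def by blast
  have Pow: "range (ball_or_empty :: _ \<Rightarrow> (('p padic) ^ 'n) set) \<subseteq> Pow UNIV" by simp
  have "A \<in> sigma_sets UNIV (range ball_or_empty)" using assms by (simp add: sigma_sets_padic_balls)
  from Int_stable Pow this show ?thesis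
  proof (induction A rule: sigma_sets_induct_disjoint)
    case (basic A)
    have "?B \<in> range (ball_or_empty :: _ \<Rightarrow> (('p padic) ^ 'n) set)" unfolding range_ball_or_empty by blast
    then have "A \<inter> ?B \<in> range (ball_or_empty :: _ \<Rightarrow> (('p padic) ^ 'n) set)"
      using basic semiring_of_sets.Int[OF semiring_padic_balls] by blast
    then consider "A \<inter> ?B = {}" | a K where "A \<inter> ?B = padic_ball a K" unfolding range_ball_or_empty by blast
    then show ?case
    proof cases
      case 1
      then have "(indicator (A \<inter> ?B) :: _ \<Rightarrow> complex) = (\<lambda>_. 0)" by (simp add: fun_eq_iff)
      then show ?thesis using averaging_regular_zero by simp
    next
      case 2
      then show ?thesis using averaging_regular_indicator_ball by simp
    qed
  next
    case empty
    have "(indicator ({} \<inter> ?B) :: _ \<Rightarrow> complex) = (\<lambda>_. 0)" by (simp add: fun_eq_iff)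
    then show ?case using averaging_regular_zero by simp
  next
    case (compl A)
    have "(indicator ((UNIV - A) \<inter> ?B) :: _ \<Rightarrow> complex) = (\<lambda>x. indicator ?B x + (-1) * indicator (A \<inter> ?B) x)"
      by (auto simp: indicator_def fun_eq_iff)
    then show ?case using averaging_regular_add[OF averaging_regular_indicator_ball averaging_regular_cmult[OF compl(2)]] by metis
  next
    case (union A)
    have A: "A i \<in> sets borel" for i using union(2) sigma_sets_padic_balls by blast
    let ?U = "\<lambda>k::nat. \<Union>i<k. A i"
    let ?g = "\<lambda>k::nat. \<lambda>x. \<Sum>i<k. (indicator (A i \<inter> ?B) x :: complex)"
    have g: "(\<Sum>i<k. (indicator (A i \<inter> ?B) x :: complex)) = indicator (?U k \<inter> ?B) x" for k x
    proof -
      have "indicator (\<Union>i<k. A i \<inter> ?B) x = ?g k x"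
        using union(1) by (intro indicator_UN_disjoint) (auto simp: disjoint_family_on_def)
      moreover have "(\<Union>i<k. A i \<inter> ?B) = ?U k \<inter> ?B" by blast
      ultimately show ?thesis by simp
    qed
    show ?case
    proof (rule averaging_regular_limit[where g = ?g])
      show "indicator ((\<Union>i. A i) \<inter> ?B) \<in> borel_measurable haar"
        using A by (intro borel_measurable_indicator) (auto simp: sets_padic_haar)
      show "averaging_regular (?g k)" for k using union(3) by (intro averaging_regular_sum) auto
      let ?D = "\<lambda>k::nat. ((\<Union>i. A i) - ?U k) \<inter> ?B"
      have D: "?D k \<in> sets haar" for k using A by (auto simp: sets_padic_haar)
      have "L2_norm_sq haar (\<lambda>x. indicator ((\<Union>i. A i) \<inter> ?B) x - ?g k x) = emeasure haar (?D k)" for k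
      proof -
        have "(\<lambda>x. indicator ((\<Union>i. A i) \<inter> ?B) x - ?g k x) = indicator (?D k)"
          unfolding g by (auto simp: indicator_def fun_eq_iff)
        then show ?thesis using L2_norm_sq_indicator[OF D] by simp
      qed
      moreover have "(\<lambda>k. emeasure haar (?D k)) \<longlonglongrightarrow> emeasure haar (\<Inter>k. ?D k)"
      proof (rule Lim_emeasure_decseq)
        show "range ?D \<subseteq> sets haar" using D by blast
        show "decseq ?D" unfolding decseq_def by (auto intro: less_le_trans)
        fix k
        have "emeasure haar (?D k) \<le> emeasure haar ?B" by (intro emeasure_mono) (auto simp: sets_padic_haar)
        then show "emeasure haar (?D k) \<noteq> \<infinity>" by (auto simp: emeasure_padic_ball top_unique)
      qed
      moreover have "(\<Inter>k. ?D k) = {}" by (auto; metis lessI)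
      ultimately show "(\<lambda>k. L2_norm_sq haar (\<lambda>x. indicator ((\<Union>i. A i) \<inter> ?B) x - ?g k x)) \<longlonglongrightarrow> 0" by simp
    qed
  qed
qed

text \<open>Simple functions dominated by \<open>f\<close> have their level sets covered by
  \<open>averaging_regular_indicator\<close>, since they vanish outside the same ball, and they
  converge to \<open>f\<close> in the mean.\<close>

lemma averaging_regular_L2:
  fixes f :: "('p::prime_card padic) ^ 'n \<Rightarrow> complex"
  assumes f2: "f \<in> L2_fun haar" and supp: "\<And>x. x \<notin> padic_ball 0 L \<Longrightarrow> f x = 0"
  shows "averaging_regular f"
proof -
  let ?B = "padic_ball (0 :: ('p padic) ^ 'n) L"
  have f [measurable]: "f \<in> borel_measurable haar" using f2 by (rule L2_fun_measurable)
  obtain F where F: "\<And>i::nat. simple_function haar (F i)" "\<And>x. (\<lambda>i. F i x) \<longlonglongrightarrow> f x"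
    "\<And>i x. dist (F i x) 0 \<le> 2 * dist (f x) 0"
    using borel_measurable_implies_sequence_metric[OF f, of 0] by auto
  have Fm [measurable]: "F i \<in> borel_measurable haar" for i using F(1) by (rule borel_measurable_simple_function)
  have F0: "F i x = 0" if "x \<notin> ?B" for i x using F(3)[of i x] supp[OF that] by simp
  show ?thesis
  proof (rule averaging_regular_limit[OF f])
    show "averaging_regular (F i)" for i
    proof -
      have fin: "finite (range (F i))" using F(1)[of i] by (simp add: simple_function_def)
      have "F i = (\<lambda>x. \<Sum>y\<in>range (F i). y * indicator ((F i -` {y}) \<inter> ?B) x)"
      proof
        fix x
        show "F i x = (\<Sum>y\<in>range (F i). y * indicator ((F i -` {y}) \<inter> ?B) x)"
        proof (cases "x \<in> ?B")
          case True
          then have "(\<Sum>y\<in>range (F i). y * indicator ((F i -` {y}) \<inter> ?B) x) = (\<Sum>y\<in>range (F i). if y = F i x then y else 0)"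
            by (intro sum.cong) (auto simp: indicator_def)
          then show ?thesis using fin by simp
        qed (simp add: F0)
      qed
      moreover have "averaging_regular (\<lambda>x. \<Sum>y\<in>range (F i). y * indicator ((F i -` {y}) \<inter> ?B) x)"
      proof (intro averaging_regular_sum fin averaging_regular_cmult averaging_regular_indicator)
        fix y
        show "F i -` {y} \<in> sets borel" using measurable_sets[OF Fm[of i], of "{y}"] by (simp add: sets_padic_haar)
      qed
      ultimately show ?thesis by metis
    qed
    have "(\<lambda>i. \<integral>\<^sup>+x. ennreal ((cmod (f x - F i x))\<^sup>2) \<partial>haar) \<longlonglongrightarrow> (\<integral>\<^sup>+x. 0 \<partial>(haar :: (('p padic) ^ 'n) measure))"
    \<comment> \<open>The approximation satisfies |F i| \<le> 2 |f|, hence |f - F i| \<le> 3 |f|,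
      with square 9 |f|^2.\<close>
    proof (rule nn_integral_dominated_convergence[where w = "\<lambda>x. 9 * ennreal ((cmod (f x))\<^sup>2)"])
      show "AE x in haar. ennreal ((cmod (f x - F i x))\<^sup>2) \<le> 9 * ennreal ((cmod (f x))\<^sup>2)" for i
      proof (rule AE_I2)
        fix x
        have "cmod (f x - F i x) \<le> 3 * cmod (f x)"
          using norm_triangle_ineq4[of "f x" "F i x"] F(3)[of i x] by simp
        then have "(cmod (f x - F i x))\<^sup>2 \<le> (3 * cmod (f x))\<^sup>2" by (intro power_mono) auto
        then have "ennreal ((cmod (f x - F i x))\<^sup>2) \<le> ennreal (9 * (cmod (f x))\<^sup>2)" by (intro ennreal_leI) (simp add: power_mult_distrib)
        then show "ennreal ((cmod (f x - F i x))\<^sup>2) \<le> 9 * ennreal ((cmod (f x))\<^sup>2)" by (simp add: ennreal_mult'')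
      qed
      have "(\<integral>\<^sup>+x. 9 * ennreal ((cmod (f x))\<^sup>2) \<partial>haar) = 9 * L2_norm_sq haar f"
        unfolding L2_norm_sq_def by (rule nn_integral_cmult) measurable
      then show "(\<integral>\<^sup>+x. 9 * ennreal ((cmod (f x))\<^sup>2) \<partial>haar) < \<infinity>"
        using f2 by (simp add: L2_fun_def ennreal_mult_less_top)
      show "AE x in haar. (\<lambda>i. ennreal ((cmod (f x - F i x))\<^sup>2)) \<longlonglongrightarrow> 0"
      proof (rule AE_I2)
        fix x
        have "(\<lambda>i. ennreal ((cmod (f x - F i x))\<^sup>2)) \<longlonglongrightarrow> ennreal ((cmod (f x - f x))\<^sup>2)"
          by (intro tendsto_ennrealI tendsto_intros F(2))
        then show "(\<lambda>i. ennreal ((cmod (f x - F i x))\<^sup>2)) \<longlonglongrightarrow> 0" by simp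
      qed
    qed measurable
    then show "(\<lambda>i. L2_norm_sq haar (\<lambda>x. f x - F i x)) \<longlonglongrightarrow> 0" by (simp add: L2_norm_sq_def)
  qed
qed

text \<open>Let \<open>m\<close> tend to infinity in \<open>truncated_plancherel\<close>: the energy
  converges to that of the full transform and the defect to 0.\<close>

theorem plancherel_bounded_support:
  fixes f :: "('p::prime_card padic) ^ 'n \<Rightarrow> complex"
  assumes f1: "integrable haar f" and f2: "f \<in> L2_fun haar" and supp: "\<And>x. x \<notin> padic_ball 0 L \<Longrightarrow> f x = 0"
  shows "L2_norm_sq haar (fourier_L1 f) = L2_norm_sq haar f"
proof -
  have "(\<lambda>m::nat. averaging_defect (int m) f) \<longlonglongrightarrow> 0"
    using averaging_regular_L2[OF f2 supp] by (simp add: averaging_regular_def)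
  then have "(\<lambda>m::nat. 2 * ennreal (truncated_energy (int m) f) + averaging_defect (int m) f)
      \<longlonglongrightarrow> 2 * L2_norm_sq haar (fourier_L1 f) + 0"
    by (intro tendsto_add ennreal_tendsto_cmult truncated_energy_limit[OF f1]) auto
  then have "(\<lambda>m::nat. 2 * L2_norm_sq haar f) \<longlonglongrightarrow> 2 * L2_norm_sq haar (fourier_L1 f)"
    unfolding truncated_plancherel[OF f1 f2] by simp
  then have "2 * L2_norm_sq haar f = 2 * L2_norm_sq haar (fourier_L1 f)" by (simp add: LIMSEQ_const_iff)
  then show ?thesis by (simp add: ennreal_mult_cancel_left)
qed

section \<open>The Dirichlet form\<close>

context bounded_region
begin

lemma zero_extend_scaleR: "zero_extend \<Omega> u x = indicator \<Omega> x *\<^sub>R u x"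
  by (simp add: zero_extend_def)

lemma zero_extend_L2_fun_iff: "zero_extend \<Omega> u \<in> L2_fun haar \<longleftrightarrow> u \<in> L2_fun M"
proof -
  have "zero_extend \<Omega> u \<in> borel_measurable haar \<longleftrightarrow> u \<in> borel_measurable M"
    unfolding zero_extend_scaleR[abs_def] by (subst borel_measurable_restrict_space_iff) auto
  moreover have "L2_norm_sq M u = L2_norm_sq haar (zero_extend \<Omega> u)"
    unfolding L2_norm_sq_def
    by (subst nn_integral_restrict_space) (auto intro!: nn_integral_cong simp: zero_extend_def indicator_def)
  ultimately show ?thesis by (simp add: L2_fun_def)
qed

lemma L2_norm_sq_zero_extend: "L2_norm_sq haar (zero_extend \<Omega> u) = L2_norm_sq M u"
  unfolding L2_norm_sq_def
  by (subst nn_integral_restrict_space) (auto intro!: nn_integral_cong simp: zero_extend_def indicator_def)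

lemma integrable_zero_extend: "u \<in> L2_fun M \<Longrightarrow> integrable haar (zero_extend \<Omega> u)"
  using L2_fun_integrable[of u] unfolding zero_extend_scaleR[abs_def] by (subst (asm) integrable_restrict_space) auto

lemma integral_zero_extend: "(LINT x|haar. zero_extend \<Omega> u x * h x) = (LINT x|M. u x * h x)"
  by (subst integral_restrict_space) (auto intro!: Bochner_Integration.integral_cong simp: zero_extend_def indicator_def)

lemma zero_extend_support:
  "\<exists>L. \<forall>u x. x \<notin> padic_ball 0 L \<longrightarrow> zero_extend \<Omega> u x = 0"
proof -
  obtain k :: nat where "\<Omega> \<subseteq> padic_ball 0 (0 - int k)" using bounded_subset_padic_ball[OF bounded] .
  then show ?thesis by (intro exI[of _ "0 - int k"]) (auto simp: zero_extend_def)
qed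

lemma fourier_zero_extend:
  assumes "u \<in> L2_fun M"
  shows "fourier (zero_extend \<Omega> u) \<in> L2_fun haar"
    "AE \<xi> in haar. fourier (zero_extend \<Omega> u) \<xi> = fourier_L1 (zero_extend \<Omega> u) \<xi>"
  using fourier_eq_fourier_L1[OF integrable_zero_extend[OF assms]] assms by (auto simp: zero_extend_L2_fun_iff)

text \<open>For a frequency in the ball dual to level \<open>J\<close>, the pairing is constant in
  \<open>x\<close> on balls of level \<open>J\<close>, so \<open>zero_means_integral\<close>
  applies.\<close>

lemma fourier_L1_zero_means:
  assumes u: "u \<in> L2_fun M" and z: "zero_means J u" and \<xi>: "\<xi> \<in> padic_ball 0 (- J)"
  shows "fourier_L1 (zero_extend \<Omega> u) \<xi> = 0"
proof -
  have "fourier_L1 (zero_extend \<Omega> u) \<xi> = (LINT x|M. pairing \<xi> x * u x)"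
    unfolding fourier_L1_pairing integral_zero_extend by (simp add: mult.commute)
  also have "\<dots> = 0"
  proof (rule zero_means_integral[OF L2_fun_integrable[OF u] z])
    fix x y :: "('p padic) ^ 'n" assume "y \<in> padic_ball x J"
    then have "y - x \<in> padic_ball 0 J" by (simp add: mem_padic_ball_iff)
    then have "pairing \<xi> (y - x) = 1" by (rule pairing_eq_1_balls[OF \<xi>])
    then show "pairing \<xi> x = pairing \<xi> y" using pairing_add[of \<xi> "y - x" x] by simp
  qed
  finally show ?thesis .
qed

lemma padic_vnorm_measurable [measurable]: "padic_vnorm \<in> borel_measurable (haar :: (('p padic) ^ 'n) measure)"
proof -
  have "(\<lambda>\<xi> :: ('p padic) ^ 'n. padic_vnorm (\<xi> - 0)) \<in> borel_measurable haar"
    by (rule borel_measurable_padic_vnorm_diff[OF haar_ident_measurable]) simp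
  then show ?thesis by simp
qed

text \<open>Counterpart of \<open>difference_quotient\<close>: with half of the weight on each
  factor, the form is the inner product of these functions.\<close>

definition weighted_fourier :: "(('p padic) ^ 'n \<Rightarrow> complex) \<Rightarrow> ('p padic) ^ 'n \<Rightarrow> complex" where
  "weighted_fourier u \<xi> = of_real (padic_vnorm \<xi> powr (\<alpha> / 2)) * fourier (zero_extend \<Omega> u) \<xi>"

lemma powr_half_mult_self: "r powr (\<alpha> / 2) * r powr (\<alpha> / 2) = r powr \<alpha>" for r :: real
  by (simp add: powr_add[symmetric])

lemma dirichlet_form_eq:
  "dirichlet_form \<alpha> \<Omega> u v = (LINT \<xi>|haar. weighted_fourier u \<xi> * cnj (weighted_fourier v \<xi>))"
  unfolding dirichlet_form_def weighted_fourier_def powr_half_mult_self[symmetric] by (simp add: mult_ac)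

lemma cmod_weighted_fourier:
  "(cmod (weighted_fourier u \<xi>))\<^sup>2 = padic_vnorm \<xi> powr \<alpha> * (cmod (fourier (zero_extend \<Omega> u) \<xi>))\<^sup>2"
  unfolding weighted_fourier_def norm_mult power_mult_distrib powr_half_mult_self[symmetric]
  by (simp add: power2_eq_square)

text \<open>The weight of the form is dominated by the Sobolev weight of order \<alpha>/2.\<close>

lemma dirichlet_domainD:
  assumes "u \<in> dirichlet_domain \<alpha> \<Omega>"
  shows "u \<in> L2_fun M" "weighted_fourier u \<in> L2_fun haar"
proof -
  have ze: "zero_extend \<Omega> u \<in> L2_fun haar" and fin: "sobolev_norm_sq (\<alpha> / 2) (zero_extend \<Omega> u) < \<infinity>"
    using assms by (auto simp: dirichlet_domain_def sobolev0_def sobolev_def)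
  show u: "u \<in> L2_fun M" using ze by (simp only: zero_extend_L2_fun_iff)
  have [measurable]: "fourier (zero_extend \<Omega> u) \<in> borel_measurable haar"
    using fourier_zero_extend(1)[OF u] by (rule L2_fun_measurable)
  have "L2_norm_sq haar (weighted_fourier u) \<le> sobolev_norm_sq (\<alpha> / 2) (zero_extend \<Omega> u)"
    unfolding L2_norm_sq_def sobolev_norm_sq_def cmod_weighted_fourier
    using alpha by (intro nn_integral_mono ennreal_leI mult_right_mono) (auto intro!: powr_mono2)
  then have "L2_norm_sq haar (weighted_fourier u) < \<infinity>" using fin by (rule le_less_trans)
  moreover have "weighted_fourier u \<in> borel_measurable haar" unfolding weighted_fourier_def[abs_def] by measurable
  ultimately show "weighted_fourier u \<in> L2_fun haar" by (simp add: L2_fun_def)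
qed

text \<open>Zero means remove all frequencies of norm up to p^J. The remaining ones carry a symbol
  of at least p^(\<alpha>(J+1)), and Plancherel converts their energy back into the norm of the
  combination.\<close>

lemma dirichlet_count_le:
  assumes t: "t < real CARD('p) powr (\<alpha> * (real_of_int J + 1))"
  shows "eigenvalue_count M (dirichlet_operator \<alpha> \<Omega>) t \<le> of_nat (card (balls_at J \<Omega>))"
  unfolding dirichlet_operator_def
proof (rule eigenvalue_count_form_operator_le[OF _ _ finite_balls_at[OF bounded] t,
      where l = "\<lambda>B f. LINT x|M. indicator B x * f x"])
  show "dirichlet_domain \<alpha> \<Omega> \<subseteq> L2_fun M" using dirichlet_domainD(1) by blast
  show "dirichlet_form \<alpha> \<Omega> v u = cnj (dirichlet_form \<alpha> \<Omega> u v)" for u v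
    unfolding dirichlet_form_eq Bochner_Integration.integral_cnj[symmetric] by (simp add: mult.commute)
  let ?\<kappa> = "real CARD('p) powr (\<alpha> * (real_of_int J + 1))"
  fix S c assume S: "finite S" "S \<subseteq> dirichlet_domain \<alpha> \<Omega>"
    and z: "\<And>B. B \<in> balls_at J \<Omega> \<Longrightarrow> (\<Sum>f\<in>S. c f * (LINT x|M. indicator B x * f x)) = 0"
  have SL2: "f \<in> L2_fun M" "weighted_fourier f \<in> L2_fun haar" if "f \<in> S" for f
    using S(2) that dirichlet_domainD by blast+
  define u where "u x = (\<Sum>f\<in>S. c f * f x)" for x
  have uL2: "u \<in> L2_fun M" unfolding u_def[abs_def] using S SL2 by (intro L2_fun_sum L2_fun_cmult) auto
  have zm: "zero_means J u" unfolding u_def[abs_def] using S(1) SL2 z by (intro zero_means_sum) auto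
  have zeL2: "zero_extend \<Omega> u \<in> L2_fun haar" using uL2 by (simp add: zero_extend_L2_fun_iff)
  have ze1: "integrable haar (zero_extend \<Omega> u)" by (rule integrable_zero_extend[OF uL2])
  have ze_sum: "zero_extend \<Omega> u = (\<lambda>x. \<Sum>f\<in>S. c f * zero_extend \<Omega> f x)"
    by (auto simp: zero_extend_def u_def)
  define W where "W \<xi> = (\<Sum>f\<in>S. c f * weighted_fourier f \<xi>)" for \<xi>
  let ?F = "fourier_L1 (zero_extend \<Omega> u)"
  have FL2: "?F \<in> L2_fun haar" by (rule L2_fun_fourier_L1[OF ze1 zeL2])
  have WL2: "W \<in> L2_fun haar" unfolding W_def[abs_def] using S(1) SL2 by (intro L2_fun_sum L2_fun_cmult) auto
  \<comment> \<open>The chosen representatives \<open>fourier\<close> are linear only up to null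
    sets. Discarding finitely many of these identifies \<open>W\<close> with the weighted integral
    transform of \<open>u\<close>.\<close>
  have "AE \<xi> in haar. \<forall>f\<in>S. fourier (zero_extend \<Omega> f) \<xi> = fourier_L1 (zero_extend \<Omega> f) \<xi>"
    using S(1) SL2 fourier_zero_extend(2) by (intro AE_finite_allI) auto
  then have W: "AE \<xi> in haar. W \<xi> = of_real (padic_vnorm \<xi> powr (\<alpha> / 2)) * ?F \<xi>"
  proof eventually_elim
    case (elim \<xi>)
    have "?F \<xi> = (\<Sum>f\<in>S. c f * fourier_L1 (zero_extend \<Omega> f) \<xi>)"
      unfolding ze_sum using S(1) SL2 integrable_zero_extend by (intro fourier_L1_sum) auto
    then show ?case using elim by (simp add: W_def weighted_fourier_def sum_distrib_left mult_ac)
  qed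
  have "ennreal (LINT x|M. (cmod (u x))\<^sup>2) = ennreal (LINT \<xi>|haar. (cmod (?F \<xi>))\<^sup>2)"
  proof -
    obtain L where L: "\<And>u x. x \<notin> padic_ball 0 L \<Longrightarrow> zero_extend \<Omega> u x = 0" using zero_extend_support by blast
    have "L2_norm_sq haar ?F = L2_norm_sq M u"
      using plancherel_bounded_support[OF ze1 zeL2 L] by (simp only: L2_norm_sq_zero_extend)
    then show ?thesis by (simp only: L2_norm_sq_eq_integral[OF FL2] L2_norm_sq_eq_integral[OF uL2])
  qed
  then have norm: "(LINT x|M. (cmod (u x))\<^sup>2) = (LINT \<xi>|haar. (cmod (?F \<xi>))\<^sup>2)"
    by (subst (asm) ennreal_inj) auto
  have "?\<kappa> * (LINT x|M. (cmod (u x))\<^sup>2) = (LINT \<xi>|haar. ?\<kappa> * (cmod (?F \<xi>))\<^sup>2)"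
    unfolding norm by simp
  also have "\<dots> \<le> (LINT \<xi>|haar. (cmod (W \<xi>))\<^sup>2)"
  proof (rule integral_mono_AE)
    show "integrable haar (\<lambda>\<xi>. ?\<kappa> * (cmod (?F \<xi>))\<^sup>2)" using FL2 by (simp add: L2_fun_iff)
    show "integrable haar (\<lambda>\<xi>. (cmod (W \<xi>))\<^sup>2)" using WL2 by (simp add: L2_fun_iff)
    show "AE \<xi> in haar. ?\<kappa> * (cmod (?F \<xi>))\<^sup>2 \<le> (cmod (W \<xi>))\<^sup>2"
      using W
    proof eventually_elim
      case (elim \<xi>)
      have W2: "(cmod (W \<xi>))\<^sup>2 = padic_vnorm \<xi> powr \<alpha> * (cmod (?F \<xi>))\<^sup>2"
        unfolding elim norm_mult power_mult_distrib powr_half_mult_self[symmetric] by (simp add: power2_eq_square)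
      show ?case
      proof (cases "\<xi> \<in> padic_ball 0 (- J)")
        case True
        then show ?thesis using fourier_L1_zero_means[OF uL2 zm] by simp
      next
        case False
        \<comment> \<open>Beyond radius p^J the next possible norm is p^(J+1).\<close>
        then have "real CARD('p) powi J < padic_vnorm \<xi>" by (simp add: mem_padic_ball_iff)
        then have "real CARD('p) powi (J + 1) \<le> padic_vnorm \<xi>"
          using padic_vnorm_le_if_less[of \<xi> "J + 1"] by force
        then have "(real CARD('p) powi (J + 1)) powr \<alpha> \<le> padic_vnorm \<xi> powr \<alpha>"
          using alpha by (intro powr_mono2) auto
        moreover have "(real CARD('p) powi (J + 1)) powr \<alpha> = ?\<kappa>"
          using P by (simp add: powr_real_of_int'[symmetric] powr_powr mult.commute)
        ultimately show ?thesis unfolding W2 by (intro mult_right_mono) auto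
      qed
    qed
  qed
  also have "(LINT \<xi>|haar. (cmod (W \<xi>))\<^sup>2) = Re (\<Sum>f\<in>S. \<Sum>g\<in>S. c f * cnj (c g) * dirichlet_form \<alpha> \<Omega> f g)"
    unfolding dirichlet_form_eq W_def
    using arg_cong[where f = Re, OF L2_norm_sum_expand[where F = weighted_fourier and c = c, OF S(1) SL2(2)]] by (simp only: Re_complex_of_real)
  finally show "?\<kappa> * (LINT x|M. (cmod (\<Sum>f\<in>S. c f * f x))\<^sup>2)
      \<le> Re (\<Sum>f\<in>S. \<Sum>g\<in>S. c f * cnj (c g) * dirichlet_form \<alpha> \<Omega> f g)" by (simp only: u_def)
qed

text \<open>\<open>fourier\<close> of the zero function is a choice and vanishes only almost
  everywhere. The fact is used for a constant approximating sequence in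
  \<open>sobolev0\<close>.\<close>

lemma sobolev_norm_sq_zero: "sobolev_norm_sq r (\<lambda>_ :: ('p padic) ^ 'n. 0) = 0"
proof -
  have "AE \<xi> in haar. fourier (\<lambda>_ :: ('p padic) ^ 'n. 0) \<xi> = fourier_L1 (\<lambda>_. 0) \<xi>"
    by (rule fourier_eq_fourier_L1(2)) (auto simp: L2_fun_zero)
  moreover have "fourier_L1 (\<lambda>_ :: ('p padic) ^ 'n. 0) \<xi> = 0" for \<xi> by (simp add: fourier_L1_pairing)
  ultimately have "AE \<xi> in haar. ennreal (max 1 (padic_vnorm \<xi>) powr (2 * r) * (cmod (fourier (\<lambda>_ :: ('p padic) ^ 'n. 0) \<xi>))\<^sup>2) = 0"
    by (auto elim: eventually_mono)
  then have "sobolev_norm_sq r (\<lambda>_ :: ('p padic) ^ 'n. 0) = (\<integral>\<^sup>+\<xi>. 0 \<partial>(haar :: (('p padic) ^ 'n) measure))"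
    unfolding sobolev_norm_sq_def by (rule nn_integral_cong_AE)
  then show ?thesis by simp
qed

section \<open>Wavelets as Dirichlet eigenfunctions\<close>

lemma wavelet_zero_extend: "wavelet l b \<psi> \<Longrightarrow> zero_extend \<Omega> \<psi> = \<psi>"
  by (auto simp: wavelet_def zero_extend_def fun_eq_iff)

lemma wavelet_L2_fun: "wavelet l b \<psi> \<Longrightarrow> \<psi> \<in> L2_fun M"
  unfolding L2_fun_iff wavelet_def
  by (auto intro!: borel_measurable_M M.integrable_const_bound[of _ 1] AE_I2 power_le_one)

text \<open>Constancy on balls of level l + 1 removes all frequencies above p^(l+1), and zero means
  at level l remove those up to p^l. Only one sphere is left between them.\<close>

lemma wavelet_fourier_support:
  assumes w: "wavelet l b \<psi>" and nz: "fourier_L1 \<psi> \<xi> \<noteq> 0"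
  shows "padic_vnorm \<xi> = real CARD('p) powi (l + 1)"
proof (rule antisym)
  show "padic_vnorm \<xi> \<le> real CARD('p) powi (l + 1)"
  proof (rule ccontr)
    assume "\<not> padic_vnorm \<xi> \<le> real CARD('p) powi (l + 1)"
    moreover have "\<psi> (h + x) = \<psi> x" if "h \<in> padic_ball 0 (l + 1)" for h x
    proof -
      have "h + x \<in> padic_ball x (l + 1)" using that by (simp add: mem_padic_ball_iff)
      then show ?thesis using w unfolding wavelet_def by metis
    qed
    moreover have "integrable haar \<psi>"
      using integrable_zero_extend[OF wavelet_L2_fun[OF w]] by (simp only: wavelet_zero_extend[OF w])
    ultimately have "fourier_L1 \<psi> \<xi> = 0" by (intro fourier_L1_eq_0[of \<psi> "l + 1"]) auto
    then show False using nz by simp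
  qed
  show "real CARD('p) powi (l + 1) \<le> padic_vnorm \<xi>"
  proof (rule ccontr)
    assume "\<not> real CARD('p) powi (l + 1) \<le> padic_vnorm \<xi>"
    then have "padic_vnorm \<xi> \<le> real CARD('p) powi l" using padic_vnorm_le_if_less[of \<xi> "l + 1"] by simp
    then have "\<xi> \<in> padic_ball 0 (- l)" by (simp add: mem_padic_ball_iff)
    then have "fourier_L1 (zero_extend \<Omega> \<psi>) \<xi> = 0"
      using w by (intro fourier_L1_zero_means[OF wavelet_L2_fun[OF w]]) (auto simp: wavelet_def)
    then show False using nz by (simp add: wavelet_zero_extend[OF w])
  qed
qed

text \<open>A wavelet is itself a test function in \<open>\<Omega>\<close>, so the constant sequence
  approximates it. Its Sobolev norm is finite because the weight is constant on the sphere that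
  carries its transform.\<close>

lemma wavelet_dirichlet_domain:
  assumes w: "wavelet l b \<psi>" shows "\<psi> \<in> dirichlet_domain \<alpha> \<Omega>"
proof -
  note ze = wavelet_zero_extend[OF w]
  have L2: "\<psi> \<in> L2_fun haar" using wavelet_L2_fun[OF w] unfolding zero_extend_L2_fun_iff[symmetric] ze .
  have int: "integrable haar \<psi>" using integrable_zero_extend[OF wavelet_L2_fun[OF w]] by (simp only: ze)
  have "fourier \<psi> \<in> L2_fun haar" and ae: "AE \<xi> in haar. fourier \<psi> \<xi> = fourier_L1 \<psi> \<xi>"
    using fourier_eq_fourier_L1[OF int L2] by auto
  let ?K = "max 1 (real CARD('p) powi (l + 1)) powr \<alpha>"
  have [measurable]: "fourier_L1 \<psi> \<in> borel_measurable haar" by (rule fourier_L1_measurable[OF int])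
  have "sobolev_norm_sq (\<alpha> / 2) \<psi> \<le> (\<integral>\<^sup>+\<xi>. ennreal ?K * ennreal ((cmod (fourier_L1 \<psi> \<xi>))\<^sup>2) \<partial>haar)"
    unfolding sobolev_norm_sq_def
  proof (rule nn_integral_mono_AE)
    show "AE \<xi> in haar. ennreal (max 1 (padic_vnorm \<xi>) powr (2 * (\<alpha> / 2)) * (cmod (fourier \<psi> \<xi>))\<^sup>2)
        \<le> ennreal ?K * ennreal ((cmod (fourier_L1 \<psi> \<xi>))\<^sup>2)"
      using ae
    proof eventually_elim
      case (elim \<xi>)
      show ?case
      proof (cases "fourier_L1 \<psi> \<xi> = 0")
        case False
        then show ?thesis using wavelet_fourier_support[OF w False] elim by (simp add: ennreal_mult[symmetric])
      qed (simp add: elim)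
    qed
  qed
  also have "\<dots> = ennreal ?K * L2_norm_sq haar (fourier_L1 \<psi>)"
    unfolding L2_norm_sq_def by (rule nn_integral_cmult) measurable
  also have "\<dots> < \<infinity>"
    using L2_fun_fourier_L1[OF int L2] by (simp add: L2_fun_def ennreal_mult_less_top)
  finally have "\<psi> \<in> sobolev (\<alpha> / 2)" using L2 by (simp add: sobolev_def)
  moreover have "\<psi> \<in> test_functions \<Omega>"
  proof -
    have "locally_constant \<psi>"
      unfolding locally_constant_def
    proof
      fix x
      have "\<forall>y\<in>padic_ball x (l + 1). \<psi> y = \<psi> x" using w unfolding wavelet_def by metis
      then show "\<exists>U. open U \<and> x \<in> U \<and> (\<forall>y\<in>U. \<psi> y = \<psi> x)"
        by (intro exI[of _ "padic_ball x (l + 1)"] conjI open_padic_ball center_in_padic_ball)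
    qed
    moreover have cl: "closure {x. \<psi> x \<noteq> 0} \<subseteq> padic_ball b l"
      using w by (intro closure_minimal) (auto simp: wavelet_def)
    moreover have "compact (closure {x. \<psi> x \<noteq> 0})"
      using compact_Int_closed[OF compact_padic_ball[of b l] closed_closure[of "{x. \<psi> x \<noteq> 0}"]] cl
      by (simp add: Int_absorb1)
    moreover have "padic_ball b l \<subseteq> \<Omega>" using w by (simp add: wavelet_def)
    ultimately show ?thesis by (auto simp: test_functions_def)
  qed
  ultimately have "\<psi> \<in> sobolev0 (\<alpha> / 2) \<Omega>"
    unfolding sobolev0_def by (auto intro!: exI[of _ "\<lambda>_. \<psi>"] simp: sobolev_norm_sq_zero)
  then show ?thesis by (simp add: dirichlet_domain_def ze)
qed

lemma integral_ball_average_kernel: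
  "(LINT y|haar. complex_of_real (ball_average_kernel m (y - x))) = 1" for x :: "('p padic) ^ 'n"
proof -
  have [measurable]: "(\<lambda>y. ball_average_kernel m (y - x)) \<in> borel_measurable haar"
    by (intro borel_measurable_ball_average_kernel haar_ident_measurable) simp
  have "(LINT y|haar. ball_average_kernel m (y - x)) = 1"
    by (subst integral_eq_nn_integral) (auto simp: nn_integral_ball_average_kernel)
  then show ?thesis by (simp add: integral_complex_of_real)
qed

text \<open>On the sphere that carries the transform of \<open>\<psi>\<close> the symbol is
  constant. The remaining inner product of transforms is evaluated by
  \<open>truncated_parseval\<close> at level l + 1, whose frequency ball contains this
  sphere.\<close>

lemma dirichlet_eigenfunction:
  assumes w: "wavelet l b \<psi>"
  shows "\<psi> \<in> eigenspace (dirichlet_operator \<alpha> \<Omega>) (real CARD('p) powr (\<alpha> * (real_of_int l + 1)))"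
proof -
  let ?\<mu> = "real CARD('p) powr (\<alpha> * (real_of_int l + 1))"
  note ze = wavelet_zero_extend[OF w] and L2M = wavelet_L2_fun[OF w]
  have int: "integrable haar \<psi>" using integrable_zero_extend[OF L2M] by (simp only: ze)
  have "dirichlet_form \<alpha> \<Omega> \<psi> v = (LINT x|M. of_real ?\<mu> * \<psi> x * cnj (v x))" if v: "v \<in> dirichlet_domain \<alpha> \<Omega>" for v
  proof -
    let ?v = "zero_extend \<Omega> v"
    let ?u = "\<lambda>\<xi>. indicator (padic_ball 0 (- (l + 1))) \<xi> :: complex"
    have vL2: "v \<in> L2_fun M" by (rule dirichlet_domainD(1)[OF v])
    have vint: "integrable haar ?v" by (rule integrable_zero_extend[OF vL2])
    have [measurable]: "fourier_L1 \<psi> \<in> borel_measurable haar" "fourier_L1 ?v \<in> borel_measurable haar"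
      "?u \<in> borel_measurable haar"
      using fourier_L1_measurable[OF int] fourier_L1_measurable[OF vint] borel_measurable_integrable[OF integrable_indicator_ball]
      by auto
    have ae: "AE \<xi> in haar. fourier \<psi> \<xi> = fourier_L1 \<psi> \<xi>" "AE \<xi> in haar. fourier ?v \<xi> = fourier_L1 ?v \<xi>"
      using fourier_zero_extend(2)[OF L2M] fourier_zero_extend(2)[OF vL2] by (simp_all only: ze)
    have [measurable]: "fourier \<psi> \<in> borel_measurable haar" "fourier ?v \<in> borel_measurable haar"
      using fourier_zero_extend(1)[OF L2M] fourier_zero_extend(1)[OF vL2] by (auto simp: ze dest: L2_fun_measurable)
    have "dirichlet_form \<alpha> \<Omega> \<psi> v
        = (LINT \<xi>|haar. of_real ?\<mu> * cnj (?u \<xi> * (fourier_L1 ?v \<xi> * cnj (fourier_L1 \<psi> \<xi>))))"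
      unfolding dirichlet_form_def ze
    proof (rule integral_cong_AE)
      show "AE \<xi> in haar. of_real (padic_vnorm \<xi> powr \<alpha>) * fourier \<psi> \<xi> * cnj (fourier ?v \<xi>)
          = of_real ?\<mu> * cnj (?u \<xi> * (fourier_L1 ?v \<xi> * cnj (fourier_L1 \<psi> \<xi>)))"
        using ae
      proof eventually_elim
        case (elim \<xi>)
        show ?case
        proof (cases "fourier_L1 \<psi> \<xi> = 0")
          case False
          then have n: "padic_vnorm \<xi> = real CARD('p) powi (l + 1)" by (rule wavelet_fourier_support[OF w])
          then have "?u \<xi> = 1"
            by (simp only: indicator_def mem_padic_ball_iff diff_0_right minus_minus order_refl if_True of_bool_eq)
          moreover have "padic_vnorm \<xi> powr \<alpha> = ?\<mu>"
            unfolding n using P by (simp add: powr_real_of_int'[symmetric] powr_powr mult.commute)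
          ultimately show ?thesis using elim by (simp add: mult_ac)
        qed (simp add: elim)
      qed
    qed measurable
    also have "\<dots> = of_real ?\<mu> * cnj (LINT \<xi>|haar. ?u \<xi> * (fourier_L1 ?v \<xi> * cnj (fourier_L1 \<psi> \<xi>)))"
      unfolding Bochner_Integration.integral_cnj[symmetric] by (rule integral_mult_right_zero)
    also have "(LINT \<xi>|haar. ?u \<xi> * (fourier_L1 ?v \<xi> * cnj (fourier_L1 \<psi> \<xi>)))
        = (LINT x|haar. ?v x * (LINT y|haar. cnj (\<psi> y) * complex_of_real (ball_average_kernel (l + 1) (y - x))))"
      by (rule truncated_parseval[OF vint int])
    \<comment> \<open>\<open>\<psi>\<close> is constant on balls of level l + 1, so averaging at
      that level reproduces it and the truncated identity is exact.\<close>
    also have "\<dots> = (LINT x|haar. ?v x * cnj (\<psi> x))"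
    proof (intro Bochner_Integration.integral_cong refl arg_cong2[where f = "(*)"])
      fix x :: "('p padic) ^ 'n"
      have "cnj (\<psi> y) * complex_of_real (ball_average_kernel (l + 1) (y - x))
          = cnj (\<psi> x) * complex_of_real (ball_average_kernel (l + 1) (y - x))" for y
      proof (cases "y \<in> padic_ball x (l + 1)")
        case True
        then have "\<psi> x = \<psi> y" using w unfolding wavelet_def by blast
        then show ?thesis by simp
      next
        case False
        then have "ball_average_kernel (l + 1) (y - x) = 0" by (simp add: ball_average_kernel_def mem_padic_ball_iff)
        then show ?thesis by simp
      qed
      then have "(LINT y|haar. cnj (\<psi> y) * complex_of_real (ball_average_kernel (l + 1) (y - x)))
          = (LINT y|haar. cnj (\<psi> x) * complex_of_real (ball_average_kernel (l + 1) (y - x)))" by (simp only:)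
      also have "\<dots> = cnj (\<psi> x) * (LINT y|haar. complex_of_real (ball_average_kernel (l + 1) (y - x)))"
        by (rule integral_mult_right_zero)
      finally show "(LINT y|haar. cnj (\<psi> y) * complex_of_real (ball_average_kernel (l + 1) (y - x))) = cnj (\<psi> x)"
        by (simp only: integral_ball_average_kernel mult_1_right)
    qed
    also have "\<dots> = (LINT x|M. v x * cnj (\<psi> x))" by (rule integral_zero_extend)
    also have "of_real ?\<mu> * cnj (LINT x|M. v x * cnj (\<psi> x)) = of_real ?\<mu> * (LINT x|M. \<psi> x * cnj (v x))"
      unfolding Bochner_Integration.integral_cnj[symmetric] by (simp add: mult.commute)
    also have "\<dots> = (LINT x|M. of_real ?\<mu> * \<psi> x * cnj (v x))"
      unfolding mult.assoc by (rule integral_mult_right_zero[symmetric])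
    finally show ?thesis .
  qed
  then show ?thesis
    using L2_fun_cmult[OF L2M] wavelet_dirichlet_domain[OF w]
    by (simp add: eigenspace_def dirichlet_operator_def form_operator_def)
qed

lemma dirichlet_count_ge:
  assumes "m \<le> J" and t: "real CARD('p) powr (\<alpha> * real_of_int J) \<le> t"
  shows "ennreal (measure padic_haar (inner_region m) *
      (1 / ball_volume TYPE('p) TYPE('n) J - 1 / ball_volume TYPE('p) TYPE('n) m))
    \<le> eigenvalue_count M (dirichlet_operator \<alpha> \<Omega>) t"
proof (rule eigenvalue_count_ge_wavelets[OF assms(1)])
  fix l b \<psi> assume l: "l < J" and w: "wavelet l b \<psi>"
  have "real CARD('p) powr (\<alpha> * (real_of_int l + 1)) \<le> real CARD('p) powr (\<alpha> * real_of_int J)"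
    using l P alpha by (intro powr_mono mult_left_mono) auto
  then show "\<exists>\<mu>\<le>t. \<psi> \<in> eigenspace (dirichlet_operator \<alpha> \<Omega>) \<mu>"
    using t dirichlet_eigenfunction[OF w] by (meson order_trans)
qed

section \<open>The exceptional set\<close>

text \<open>An interval that meets [0, R] has its right end p^(\<alpha>j) at most R + g. So only
  logarithmically many intervals occur, each of length g.\<close>

lemma exceptional_set_density:
  "((\<lambda>R. measure lborel (exceptional_set \<alpha> \<Omega> \<inter> {0..R}) / R) \<longlongrightarrow> 0) at_top"
proof -
  define g where "g = enn2real (Gamma_max \<alpha> \<Omega>)"
  have g: "g \<ge> 0" by (simp add: g_def)
  let ?P = "real CARD('p)"
  let ?I = "\<lambda>j::nat. {?P powr (\<alpha> * real j) - g ..< ?P powr (\<alpha> * real j)}"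
  have E: "exceptional_set \<alpha> \<Omega> = (\<Union>j\<in>{1..}. ?I j)" by (simp add: exceptional_set_def g_def)
  have bound: "measure lborel (exceptional_set \<alpha> \<Omega> \<inter> {0..R}) \<le> g * (log ?P (R + g) / \<alpha>)" if R: "R \<ge> 1" for R
  proof -
    define n where "n = nat \<lfloor>log ?P (R + g) / \<alpha>\<rfloor>"
    have l0: "0 \<le> log ?P (R + g) / \<alpha>" using P R g alpha by simp
    have "exceptional_set \<alpha> \<Omega> \<inter> {0..R} \<subseteq> (\<Union>j\<in>{1..n}. ?I j)"
    proof
      fix x assume "x \<in> exceptional_set \<alpha> \<Omega> \<inter> {0..R}"
      then obtain j :: nat where j: "1 \<le> j" "x \<in> ?I j" "x \<le> R" unfolding E by auto
      then have "?P powr (\<alpha> * real j) \<le> R + g" by simp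
      then have "\<alpha> * real j \<le> log ?P (R + g)" using P R g by (simp add: le_log_iff)
      then have "real j \<le> log ?P (R + g) / \<alpha>" using alpha by (simp add: field_simps)
      then have "j \<le> n" unfolding n_def by (simp add: le_nat_floor)
      then show "x \<in> (\<Union>j\<in>{1..n}. ?I j)" using j by auto
    qed
    then have "measure lborel (exceptional_set \<alpha> \<Omega> \<inter> {0..R}) \<le> measure lborel (\<Union>j\<in>{1..n}. ?I j)"
    proof (intro measure_mono_fmeasurable fmeasurable.finite_UN)
      show "exceptional_set \<alpha> \<Omega> \<inter> {0..R} \<in> sets lborel" unfolding E by auto
      show "?I j \<in> fmeasurable lborel" for j using g by (intro fmeasurableI) auto
    qed auto
    also have "\<dots> \<le> (\<Sum>j\<in>{1..n}. measure lborel (?I j))" by (intro measure_UNION_le) auto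
    also have "\<dots> = real n * g" using g by simp
    also have "\<dots> \<le> (log ?P (R + g) / \<alpha>) * g"
      using l0 g unfolding n_def by (intro mult_right_mono) auto
    finally show ?thesis by (simp add: mult.commute)
  qed
  have lim: "((\<lambda>x::real. ln x / x) \<longlongrightarrow> 0) at_top" by (rule ln_x_over_x_tendsto_0)
  have shift: "filterlim (\<lambda>R::real. g + R) at_top at_top"
    by (rule filterlim_tendsto_add_at_top[OF tendsto_const filterlim_ident])
  \<comment> \<open>The factor 2 pays for replacing 1/R by 2/(g + R), which is valid once R is at
    least g.\<close>
  have "((\<lambda>R. 2 * g / (\<alpha> * ln ?P) * (ln (g + R) / (g + R))) \<longlongrightarrow> 2 * g / (\<alpha> * ln ?P) * 0) at_top"
    by (intro tendsto_mult tendsto_const filterlim_compose[OF lim shift])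
  then have lim0: "((\<lambda>R. 2 * g / (\<alpha> * ln ?P) * (ln (g + R) / (g + R))) \<longlongrightarrow> 0) at_top" by simp
  show ?thesis
  proof (rule tendsto_sandwich[OF _ _ tendsto_const lim0])
    show "eventually (\<lambda>R. 0 \<le> measure lborel (exceptional_set \<alpha> \<Omega> \<inter> {0..R}) / R) at_top"
      using eventually_ge_at_top[of 0] by eventually_elim simp
    show "eventually (\<lambda>R. measure lborel (exceptional_set \<alpha> \<Omega> \<inter> {0..R}) / R
        \<le> 2 * g / (\<alpha> * ln ?P) * (ln (g + R) / (g + R))) at_top"
      using eventually_ge_at_top[of "max 1 g"]
    proof eventually_elim
      case (elim R)
      then have R: "R \<ge> 1" "g \<le> R" by auto
      have lnP: "ln ?P > 0" using P by simp
      have ln0: "ln (g + R) \<ge> 0" using R g by simp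
      have "measure lborel (exceptional_set \<alpha> \<Omega> \<inter> {0..R}) / R \<le> g * (log ?P (R + g) / \<alpha>) / R"
        using bound[OF R(1)] R by (intro divide_right_mono) auto
      also have "\<dots> = g / (\<alpha> * ln ?P) * ln (g + R) * (1 / R)"
        by (simp add: log_def add.commute)
      also have "\<dots> \<le> g / (\<alpha> * ln ?P) * ln (g + R) * (2 / (g + R))"
      proof (rule mult_left_mono)
        show "1 / R \<le> 2 / (g + R)" using R g by (simp add: field_simps)
        show "0 \<le> g / (\<alpha> * ln ?P) * ln (g + R)" using g alpha lnP ln0 by simp
      qed
      finally show ?case by (simp add: mult_ac)
    qed
  qed
qed

end

theorem theorem1p1:
  fixes \<Omega> :: "(('p::prime_card padic) ^ 'n) set" and \<alpha> :: real
  assumes "\<alpha> > 0"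
    and "\<Omega> \<noteq> {}" and "bounded \<Omega>" and "open \<Omega>"
    and "emeasure padic_haar (frontier \<Omega>) = 0"
  shows "((\<lambda>t. eigenvalue_count (haar_on \<Omega>) (dirichlet_operator \<alpha> \<Omega>) t / ennreal (weyl_term \<alpha> \<Omega> t))
            \<longlongrightarrow> 1) at_top \<and>
         (\<forall>B\<in>maximal_balls \<Omega>. \<forall>x\<in>B. \<forall>y\<in>B. Gamma_at \<alpha> \<Omega> x = Gamma_at \<alpha> \<Omega> y) \<and>
         (Gamma_max \<alpha> \<Omega> < \<infinity> \<longrightarrow>
            ((\<lambda>t. eigenvalue_count (haar_on \<Omega>) (neumann_operator \<alpha> \<Omega>) t / ennreal (weyl_term \<alpha> \<Omega> t))
               \<longlongrightarrow> 1) (inf at_top (principal (- exceptional_set \<alpha> \<Omega>))) \<and>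
            ((\<lambda>R. measure lborel (exceptional_set \<alpha> \<Omega> \<inter> {0..R}) / R) \<longlongrightarrow> 0) at_top)"
proof -
  interpret bounded_region \<Omega> \<alpha> by unfold_locales (use assms in auto)
  let ?P = "real CARD('p)"
  let ?J = "\<lambda>t. \<lfloor>1 / \<alpha> * log ?P t\<rfloor>"
  have dirichlet: "((\<lambda>t. eigenvalue_count (haar_on \<Omega>) (dirichlet_operator \<alpha> \<Omega>) t / ennreal (weyl_term \<alpha> \<Omega> t))
      \<longlongrightarrow> 1) at_top"
  proof (rule weyl_law_from_bounds[OF assms(2,5) order_refl dirichlet_count_ge])
    show "eventually (\<lambda>t. eigenvalue_count (haar_on \<Omega>) (dirichlet_operator \<alpha> \<Omega>) t
        \<le> of_nat (card (balls_at (?J t) \<Omega>))) at_top"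
      using eventually_gt_at_top[of "0::real"]
      by eventually_elim (intro dirichlet_count_le scale_bounds(2))
  qed
  have neumann: "((\<lambda>t. eigenvalue_count (haar_on \<Omega>) (neumann_operator \<alpha> \<Omega>) t / ennreal (weyl_term \<alpha> \<Omega> t))
      \<longlongrightarrow> 1) (inf at_top (principal (- exceptional_set \<alpha> \<Omega>)))" if fin: "Gamma_max \<alpha> \<Omega> < \<infinity>"
  \<comment> \<open>The lower bound holds for every \<open>t\<close>; only the upper bound uses the
    restriction of the filter to the complement of
    \<open>exceptional_set \<alpha> \<Omega>\<close>.\<close>
  proof (rule weyl_law_from_bounds[OF assms(2,5) inf_le1 neumann_count_ge])
    show "eventually (\<lambda>t. eigenvalue_count (haar_on \<Omega>) (neumann_operator \<alpha> \<Omega>) t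
        \<le> of_nat (card (balls_at (?J t) \<Omega>))) (inf at_top (principal (- exceptional_set \<alpha> \<Omega>)))"
      unfolding eventually_inf_principal
      using eventually_ge_at_top[of "1::real"]
    proof (eventually_elim, intro impI)
      case (elim t)
      assume t: "t \<in> - exceptional_set \<alpha> \<Omega>"
      have "0 \<le> log ?P t" using elim P by simp
      then have "0 \<le> ?J t" using alpha by simp
      \<comment> \<open>For \<open>t\<close> at least 1 the number J + 1 is an index of the
        exceptional intervals. Since \<open>t\<close> is below the right end of that interval but
        outside of it, \<open>t\<close> lies below its left end, which is the threshold of
        \<open>neumann_count_le\<close>.\<close>
      then have "real_of_int (?J t) + 1 = real (nat (?J t + 1))" "nat (?J t + 1) \<ge> 1" by linarith+
      then obtain j :: nat where j: "real_of_int (?J t) + 1 = real j" "j \<ge> 1" by blast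
      have "t < ?P powr (\<alpha> * (real_of_int (?J t) + 1))" using elim by (intro scale_bounds(2)) simp
      moreover have "\<not> (?P powr (\<alpha> * real j) - enn2real (Gamma_max \<alpha> \<Omega>) \<le> t \<and> t < ?P powr (\<alpha> * real j))"
        using t j(2) by (auto simp: exceptional_set_def)
      ultimately have "t < ?P powr (\<alpha> * (real_of_int (?J t) + 1)) - enn2real (Gamma_max \<alpha> \<Omega>)"
        unfolding j(1) by linarith
      then show "eigenvalue_count (haar_on \<Omega>) (neumann_operator \<alpha> \<Omega>) t \<le> of_nat (card (balls_at (?J t) \<Omega>))"
        by (rule neumann_count_le[OF fin])
    qed
  qed
  show ?thesis using dirichlet neumann Gamma_at_const exceptional_set_density by blast
qed

end
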